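(* Let $N\in\{2,3\}$ and $\omega\in D(\varepsilon)$. Suppose that $\varepsilon_+(\cdot,\omega)=\varepsilon_{p,+}(\cdot,\omega)+\varepsilon_{as,+}(\cdot,\omega)$, where $\varepsilon_{p,+}(\cdot,\omega)$ is $a$-periodic (for some $a>0$) and $\varepsilon_{as,+}(\cdot,\omega)\in L^1(\mathbb R_+)$. a) Let $k_0\in\mathbb R^{N-1}$ be such that the equation $$-w''+(|k_0|^2-\omega^2\varepsilon_{p,+}(\cdot,\omega))w=0$$ is in the case of stability. Then $\omega\in\sigma_{\mathrm{Weyl}}(\mathcal L)$. b) Let $k_0\in\mathbb R^{N-1}$ be such that the equation $$-\Big(\frac{\varepsilon_{p,+}(\cdot,\omega)}{|k_0|^2-\omega^2\varepsilon_{p,+}(\cdot,\omega)}v'\Big)'+\varepsilon_{p,+}(\cdot,\omega)v=0$$ is in the case of stability. Moreover, suppose that $(\varepsilon_{as,+})'(\cdot,\omega)\in L^1(\mathbb R_+)$ and $\operatorname{dist}(\omega^2\varepsilon_{p,+}(\mathbb R_+,\omega),\{0,|k_0|^2\})>0$. Then $\omega\in\sigma_{\mathrm{Weyl}}(\mathcal L)$. Analogous statements hold if the corresponding assumptions are satisfied by $\varepsilon_-$, i.e. with $\varepsilon_-(\cdot,\omega)=\varepsilon_{p,-}(\cdot,\omega)+\varepsilon_{as,-}(\cdot,\omega)$ on $\mathbb R_-$ and $\mathbb R_+,\varepsilon_{p,+},\varepsilon_{as,+}$ replaced by $\mathbb R_-,\varepsilon_{p,-},\varepsilon_{as,-}$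 in all hypotheses.
   Context: Setting. Let $N\in\{2,3\}$, $\mathbb R_+=(0,\infty)$, $\mathbb R_-=(-\infty,0)$. The permittivity is $\varepsilon(x_1,\omega)=\varepsilon_\pm(x_1,\omega)$ for $\pm x_1>0$, where $\varepsilon_\pm(\cdot,\omega)$ are complex-valued functions on $\mathbb R_\pm$ depending in an arbitrary way on a complex parameter $\omega$. $D(\varepsilon):=\{\omega\in\mathbb C:\varepsilon_+(\cdot,\omega)\in W^{3,\infty}(\mathbb R_+),\ \varepsilon_-(\cdot,\omega)\in W^{3,\infty}(\mathbb R_-)\}$ is assumed non-empty. A prime denotes $\partial_{x_1}$. Stability. For $-(Py')'+Qy=0$ with coefficients of period $a>0$ (extended periodically to $\mathbb R$), let $\Phi$ solve $\Phi'=\begin{pmatrix}0&1/P\\Q&0\end{pmatrix}\Phi$, $\Phi(0)=I$, and $D=\operatorname{Tr}\Phi(a)$. The equation is in the case of stability if $D\in(-2,2)$, or if $D\in\{-2,2\}$ and the (only) eigenvalue of $\Phi(a)$ has geometric multiplicity 2 (i.e. $\Phi(a)=\pm I$); in this case all solutions are bounded on $\mathbb R$. Pencil. $\nabla=(\partial_{x_1},\partial_{x_2},\partial_{x_3})^\top$ if $N=3$, $\nabla=(\partial_{x_1},\partial_{x_2},0)^\top$ if $N=2$. For $\omega\in D(\varepsilon)$, $\mathcal D_\omega:=\{E\in L^2(\mathbb R^N)^3:\nabla\times E,\ \nabla\times\nabla\times E\in L^2(\mathbb R^N)^3,\ \nabla\cdot(\varepsilon(\cdot,\omega)E)=0\}$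 (distributionally; $\varepsilon(\cdot,\omega)$ acts as a function of $x_1$; functions are $\mathbb C^3$-valued), $\mathcal R:=\{f\in L^2(\mathbb R^N)^3:\nabla\cdot f=0\}$, $L(\omega):\mathcal D_\omega\to\mathcal R$, $L(\omega)E:=\nabla\times\nabla\times E-\omega^2\varepsilon(x_1,\omega)E$, $\mathcal L:=(L(\omega))_{\omega\in D(\varepsilon)}$. $\sigma_{\mathrm{Weyl}}(\mathcal L)$ is the set of $\omega\in D(\varepsilon)$ for which there is a sequence $(u^{(n)})\subset\mathcal D_\omega$ with $\|u^{(n)}\|_{L^2}=1$, $u^{(n)}\rightharpoonup0$ weakly in $L^2(\mathbb R^N)^3$, and $\|L(\omega)u^{(n)}\|_{L^2}\to0$. *)

theory Defs
  imports "HOL-Analysis.Analysis"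
begin

section \<open>Test functions\<close>

definition dir_deriv :: "'a::euclidean_space \<Rightarrow> ('a \<Rightarrow> real) \<Rightarrow> 'a \<Rightarrow> real" where
  "dir_deriv b \<phi> = (\<lambda>x. frechet_derivative \<phi> (at x) b)"

primrec C_k :: "nat \<Rightarrow> ('a::euclidean_space \<Rightarrow> real) \<Rightarrow> bool" where
  "C_k 0 \<phi> \<longleftrightarrow> continuous_on UNIV \<phi>"
| "C_k (Suc k) \<phi> \<longleftrightarrow> (\<forall>x. \<phi> differentiable (at x)) \<and> (\<forall>b\<in>Basis. C_k k (dir_deriv b \<phi>))"

definition test_fun :: "'a::euclidean_space set \<Rightarrow> ('a \<Rightarrow> real) set" where
  "test_fun U = {\<phi>. (\<forall>k. C_k k \<phi>) \<and>
     compact (closure {x. \<phi> x \<noteq> 0}) \<and> closure {x. \<phi> x \<noteq> 0} \<subseteq> U}"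


section \<open>Sobolev spaces on an open subset of the line, and the permittivity\<close>

text \<open>Functions are used in place of equivalence classes modulo null sets; the
  definitions below are invariant under changing \<open>\<epsilon>\<close> and the fields on null sets.\<close>

definition L_infty :: "real set \<Rightarrow> (real \<Rightarrow> complex) set" where
  "L_infty S = {f. f \<in> borel_measurable (lebesgue_on S) \<and>
     (\<exists>C. AE x in lebesgue_on S. norm (f x) \<le> C)}"

definition weak_deriv :: "real set \<Rightarrow> (real \<Rightarrow> complex) \<Rightarrow> (real \<Rightarrow> complex) \<Rightarrow> bool" where
  "weak_deriv S f g \<longleftrightarrow> (\<forall>\<phi>\<in>test_fun S.
     (\<integral>x. deriv \<phi> x *\<^sub>R f x \<partial>lebesgue_on S) = - (\<integral>x. \<phi> x *\<^sub>R g x \<partial>lebesgue_on S))"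

primrec W_infty :: "nat \<Rightarrow> real set \<Rightarrow> (real \<Rightarrow> complex) set" where
  "W_infty 0 S = L_infty S"
| "W_infty (Suc k) S = {f \<in> L_infty S. \<exists>g\<in>W_infty k S. weak_deriv S f g}"

definition D_eps :: "(real \<Rightarrow> complex \<Rightarrow> complex) \<Rightarrow> (real \<Rightarrow> complex \<Rightarrow> complex) \<Rightarrow> complex set" where
  "D_eps \<epsilon>\<^sub>p \<epsilon>\<^sub>m = {\<omega>. (\<lambda>x. \<epsilon>\<^sub>p x \<omega>) \<in> W_infty 3 {0<..} \<and> (\<lambda>x. \<epsilon>\<^sub>m x \<omega>) \<in> W_infty 3 {..<0}}"

text \<open>The value at the interface \<open>x\<^sub>1 = 0\<close>, a null set, is irrelevant.\<close>

definition permittivity ::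
  "(real \<Rightarrow> complex \<Rightarrow> complex) \<Rightarrow> (real \<Rightarrow> complex \<Rightarrow> complex) \<Rightarrow> real \<Rightarrow> complex \<Rightarrow> complex" where
  "permittivity \<epsilon>\<^sub>p \<epsilon>\<^sub>m x\<^sub>1 \<omega> = (if x\<^sub>1 > 0 then \<epsilon>\<^sub>p x\<^sub>1 \<omega> else \<epsilon>\<^sub>m x\<^sub>1 \<omega>)"


section \<open>Fields on \<open>\<real>\<^sup>N\<close> and distributional differential operators\<close>

text \<open>Points of \<open>\<real>\<^sup>N\<close> have type \<open>real ^ 'n\<close> with \<open>CARD('n) = N\<close>. The coordinates are numbered by a
  bijection \<open>c\<close> from \<open>{1..N}\<close> to the index type, so that \<open>x\<^sub>j\<close> is \<open>x $ c j\<close>. Fields always have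
  three components; for \<open>N = 2\<close> the derivative in the third direction is zero.\<close>

definition pd :: "(nat \<Rightarrow> 'n::finite) \<Rightarrow> nat \<Rightarrow> (real^'n \<Rightarrow> real) \<Rightarrow> real^'n \<Rightarrow> real" where
  "pd c j \<phi> = (if j \<le> CARD('n) then dir_deriv (axis (c j) 1) \<phi> else (\<lambda>x. 0))"

definition L2 :: "(real^'n::finite \<Rightarrow> complex^3) set" where
  "L2 = {f. f \<in> borel_measurable lebesgue \<and> integrable lebesgue (\<lambda>x. (norm (f x))\<^sup>2)}"

definition L2_norm :: "(real^'n::finite \<Rightarrow> complex^3) \<Rightarrow> real" where
  "L2_norm f = sqrt (\<integral>x. (norm (f x))\<^sup>2 \<partial>lebesgue)"

definition L2_inner :: "(real^'n::finite \<Rightarrow> complex^3) \<Rightarrow> (real^'n \<Rightarrow> complex^3) \<Rightarrow> complex" where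
  "L2_inner f g = (\<integral>x. (\<Sum>i\<in>UNIV. f x $ i * cnj (g x $ i)) \<partial>lebesgue)"

definition L2_weakly_null :: "(nat \<Rightarrow> real^'n::finite \<Rightarrow> complex^3) \<Rightarrow> bool" where
  "L2_weakly_null u \<longleftrightarrow> (\<forall>v\<in>L2. (\<lambda>n. L2_inner (u n) v) \<longlonglongrightarrow> 0)"

text \<open>A \<open>\<complex>\<^sup>3\<close>-valued distribution is a functional on \<open>test_fun UNIV\<close>; its values on
  other functions are irrelevant.\<close>

type_synonym 'n distribution = "(real^'n \<Rightarrow> real) \<Rightarrow> complex^3"

definition regular_dist :: "(real^'n::finite \<Rightarrow> complex^3) \<Rightarrow> 'n distribution" where
  "regular_dist f \<phi> = (\<integral>x. \<phi> x *\<^sub>R f x \<partial>lebesgue)"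

definition dist_eq :: "'n::finite distribution \<Rightarrow> 'n distribution \<Rightarrow> bool" where
  "dist_eq S T \<longleftrightarrow> (\<forall>\<phi>\<in>test_fun UNIV. S \<phi> = T \<phi>)"

definition dist_in_L2 :: "'n::finite distribution \<Rightarrow> bool" where
  "dist_in_L2 T \<longleftrightarrow> (\<exists>f\<in>L2. dist_eq T (regular_dist f))"

definition dist_pd :: "(nat \<Rightarrow> 'n::finite) \<Rightarrow> nat \<Rightarrow> 'n distribution \<Rightarrow> 'n distribution" where
  "dist_pd c j T \<phi> = - T (pd c j \<phi>)"

definition dist_curl :: "(nat \<Rightarrow> 'n::finite) \<Rightarrow> 'n distribution \<Rightarrow> 'n distribution" where
  "dist_curl c T \<phi> = vector
     [dist_pd c 2 T \<phi> $ 3 - dist_pd c 3 T \<phi> $ 2,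
      dist_pd c 3 T \<phi> $ 1 - dist_pd c 1 T \<phi> $ 3,
      dist_pd c 1 T \<phi> $ 2 - dist_pd c 2 T \<phi> $ 1]"

definition dist_div :: "(nat \<Rightarrow> 'n::finite) \<Rightarrow> 'n distribution \<Rightarrow> (real^'n \<Rightarrow> real) \<Rightarrow> complex" where
  "dist_div c T \<phi> = dist_pd c 1 T \<phi> $ 1 + dist_pd c 2 T \<phi> $ 2 + dist_pd c 3 T \<phi> $ 3"


section \<open>The operator pencil and its Weyl spectrum\<close>

text \<open>In the next two definitions \<open>\<epsilon>\<close> is the permittivity, as a function of \<open>x\<^sub>1\<close>, at the
  frequency under consideration.\<close>

definition pencil_dom :: "(nat \<Rightarrow> 'n::finite) \<Rightarrow> (real \<Rightarrow> complex) \<Rightarrow> (real^'n \<Rightarrow> complex^3) set" where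
  "pencil_dom c \<epsilon> = {E \<in> L2.
     dist_in_L2 (dist_curl c (regular_dist E)) \<and>
     dist_in_L2 (dist_curl c (dist_curl c (regular_dist E))) \<and>
     (\<forall>\<phi>\<in>test_fun UNIV. dist_div c (regular_dist (\<lambda>x. \<epsilon> (x $ c 1) *s E x)) \<phi> = 0)}"

text \<open>The graph of \<open>L(\<omega>)\<close>: the \<open>L\<^sup>2\<close> function \<open>f\<close> is
  \<open>\<nabla> \<times> \<nabla> \<times> E - \<omega>\<^sup>2 \<epsilon> E\<close>, which determines \<open>f\<close> up to a null set. A relation is
  used since functions stand for equivalence classes.\<close>

definition pencil ::
  "(nat \<Rightarrow> 'n::finite) \<Rightarrow> (real \<Rightarrow> complex) \<Rightarrow> complex \<Rightarrow>
   (real^'n \<Rightarrow> complex^3) \<Rightarrow> (real^'n \<Rightarrow> complex^3) \<Rightarrow> bool" where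
  "pencil c \<epsilon> \<omega> E f \<longleftrightarrow> E \<in> pencil_dom c \<epsilon> \<and> f \<in> L2 \<and>
     dist_eq (regular_dist f)
       (\<lambda>\<phi>. dist_curl c (dist_curl c (regular_dist E)) \<phi>
          - \<omega>\<^sup>2 *s regular_dist (\<lambda>x. \<epsilon> (x $ c 1) *s E x) \<phi>)"

definition sigma_Weyl ::
  "(nat \<Rightarrow> 'n::finite) \<Rightarrow> (real \<Rightarrow> complex \<Rightarrow> complex) \<Rightarrow> (real \<Rightarrow> complex \<Rightarrow> complex) \<Rightarrow> complex set" where
  "sigma_Weyl c \<epsilon>\<^sub>p \<epsilon>\<^sub>m = {\<omega> \<in> D_eps \<epsilon>\<^sub>p \<epsilon>\<^sub>m.
     \<exists>u f. (\<forall>n. u n \<in> pencil_dom c (\<lambda>x\<^sub>1. permittivity \<epsilon>\<^sub>p \<epsilon>\<^sub>m x\<^sub>1 \<omega>) \<and> L2_norm (u n) = 1) \<and>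
       L2_weakly_null u \<and>
       (\<forall>n. pencil c (\<lambda>x\<^sub>1. permittivity \<epsilon>\<^sub>p \<epsilon>\<^sub>m x\<^sub>1 \<omega>) \<omega> (u n) (f n)) \<and>
       (\<lambda>n. L2_norm (f n)) \<longlonglongrightarrow> 0}"


section \<open>The case of stability\<close>

text \<open>The coefficients need not be continuous, so \<open>\<Phi>' = A \<Phi>\<close>, \<open>\<Phi>(0) = I\<close> is understood in the
  sense of Caratheodory, i.e. as an integral equation. Only \<open>\<Phi>(a)\<close> is needed, hence the
  restriction to \<open>[0, a]\<close>.\<close>

definition fundamental_matrix ::
  "real \<Rightarrow> (real \<Rightarrow> complex) \<Rightarrow> (real \<Rightarrow> complex) \<Rightarrow> (real \<Rightarrow> complex^2^2) \<Rightarrow> bool" where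
  "fundamental_matrix a P Q \<Phi> \<longleftrightarrow>
     (let A = (\<lambda>t. vector [vector [0, 1 / P t], vector [Q t, 0]] :: complex^2^2)
      in (\<lambda>t. A t ** \<Phi> t) absolutely_integrable_on {0..a} \<and>
         (\<forall>x\<in>{0..a}. \<Phi> x = mat 1 + integral {0..x} (\<lambda>t. A t ** \<Phi> t)))"

definition geom_mult :: "complex^2^2 \<Rightarrow> complex \<Rightarrow> nat" where
  "geom_mult M \<mu> = vec.dim {v. M *v v = \<mu> *s v}"

text \<open>The trace is a complex number; \<open>trace (\<Phi> a) \<in> (-2, 2)\<close> includes that it is real.\<close>

definition stability_case :: "real \<Rightarrow> (real \<Rightarrow> complex) \<Rightarrow> (real \<Rightarrow> complex) \<Rightarrow> bool" where
  "stability_case a P Q \<longleftrightarrow> (\<exists>\<Phi>. fundamental_matrix a P Q \<Phi> \<and>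
     (trace (\<Phi> a) \<in> complex_of_real ` {-2<..<2} \<or>
      trace (\<Phi> a) \<in> {-2, 2} \<and> (\<exists>\<mu>. geom_mult (\<Phi> a) \<mu> = 2)))"

end

theory Submission
  imports Defs "HOL-Computational_Algebra.Polynomial" "HOL-Real_Asymp.Real_Asymp"
begin

text \<open>
A point \<open>\<omega>\<close> belongs to the Weyl spectrum as soon as there are fields \<open>E\<^sub>n\<close> in the domain whose supports
escape to infinity in the \<open>x\<^sub>1\<close> direction and for which \<open>L(\<omega>)E\<^sub>n\<close> is small relative to \<open>E\<^sub>n\<close>; after
normalisation the escaping supports give weak convergence to zero (\<open>weyl_criterion\<close>). Such fields
are built from bounded solutions of the ordinary differential equation in \<open>x\<^sub>1\<close>, multiplied by a plane
wave in \<open>x\<^sub>2\<close> of wave number \<open>\<kappa> = |k\<^sub>0|\<close> and by cutoff functions of length \<open>l \<rightarrow> \<infinity>\<close> in every variable.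
Only \<open>|k\<^sub>0|\<close> enters the two equations, so the plane wave may point in the \<open>x\<^sub>2\<close> direction for \<open>N = 2\<close>
and for \<open>N = 3\<close> alike.

Each derivative that falls on a cutoff costs a factor \<open>1/l\<close>. Hence \<open>L(\<omega>)E\<close> is pointwise \<open>O(1/l)\<close> on a
cube of side \<open>l\<close> and has norm \<open>O(l\<^bsup>N/2 - 1\<^esup>)\<close>, whereas the norm of \<open>E\<close> is at least of order
\<open>l\<^bsup>N/2\<^esup>\<close> provided that the solution does not become small in mean. The constraint
\<open>\<nabla> \<cdot> (\<epsilon>E) = 0\<close> has to hold exactly, and this dictates where the cutoffs are placed: on potentials.
\<^item> In part a) the equation is \<open>w'' = (\<kappa>\<^sup>2 - \<omega>\<^sup>2\<epsilon>)w\<close>, and \<open>E = (0, -\<partial>\<^sub>3\<phi>, \<partial>\<^sub>2\<phi>)\<close> where \<open>\<phi>\<close> is the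
  product of \<open>w\<close>, the plane wave and the cutoffs. As \<open>\<epsilon>\<close> depends on \<open>x\<^sub>1\<close> only, \<open>\<epsilon>E\<close> is
  divergence free (\<open>TE_product_quasimode\<close>).
\<^item> In part b) the equation is the system \<open>v' = (\<kappa>\<^sup>2/\<epsilon> - \<omega>\<^sup>2)h\<close>, \<open>h' = \<epsilon>v\<close> for \<open>v\<close> and its
  quasi-derivative \<open>h\<close>, and \<open>\<epsilon>E\<close> is the curl of \<open>(0, 0, \<psi>)\<close> where \<open>\<psi>\<close> is the product of \<open>h\<close>, the plane
  wave and the cutoffs (\<open>TM_product_quasimode\<close>). Here \<open>1/\<epsilon>\<close> is differentiated twice.

The bounded solutions come from Floquet theory. In the case of stability the monodromy matrix of the
periodic equation has two independent eigenvectors with eigenvalues of modulus one, which gives two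
independent solutions of periodic modulus (\<open>stability_imp_floquet_pairs\<close>). On an interval far from
the interface, where the \<open>L\<^sup>1\<close> norm of the perturbation is small, variation of constants turns one
of them into a solution of the perturbed equation that is uniformly close to it
(\<open>perturbed_solution\<close>). Its mean square over many periods is then bounded below
(\<open>perturbed_floquet_family\<close>).

These arguments need classical coefficients. A function in \<open>W\<^bsup>3,\<infinity>\<^esup>\<close> agrees almost everywhere
with a \<open>C\<^sup>2\<close> function having bounded derivatives (\<open>W_infty_3_classical\<close>), by the lemma of du
Bois-Reymond. Since this function is Lipschitz and the remainder tends to zero along almost every
orbit of the period, the periodic part has a continuous representative to which \<open>\<epsilon>\<close> converges
uniformly at infinity (\<open>continuous_periodic_representative\<close>). In part b) the uniform convergence keeps
\<open>\<epsilon>\<close> away from zero far from the interface, which is where \<open>1/\<epsilon>\<close> is used.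
\<close>

section \<open>Smooth cutoff functions on the line\<close>

lemma dir_deriv_eq:
  fixes \<phi> :: "real \<Rightarrow> real"
  assumes "(\<phi> has_real_derivative d) (at x)"
  shows "dir_deriv 1 \<phi> x = d"
  using frechet_derivative_at[OF assms[unfolded has_field_derivative_def]]
  by (simp add: dir_deriv_def fun_eq_iff) (metis mult.right_neutral)

lemma C_k_SucD:
  fixes \<phi> :: "'a::euclidean_space \<Rightarrow> real"
  shows "C_k (Suc k) \<phi> \<Longrightarrow> C_k k \<phi>"
proof (induction k arbitrary: \<phi>)
  case 0
  then show ?case
    by (auto intro!: differentiable_imp_continuous_on simp: differentiable_on_def
        dest: differentiable_at_withinI)
next
  case (Suc k)
  then show ?case by (metis C_k.simps(2))
qed

lemma C_k_derivI:
  fixes \<phi> :: "real \<Rightarrow> real"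
  assumes "\<And>x. (\<phi> has_real_derivative \<phi>' x) (at x)" "C_k k \<phi>'"
  shows "C_k (Suc k) \<phi>"
proof -
  have "dir_deriv 1 \<phi> = \<phi>'"
    by (rule ext) (rule dir_deriv_eq[OF assms(1)])
  moreover have "\<phi> differentiable (at x)" for x
    using assms(1) real_differentiable_def by blast
  ultimately show ?thesis using assms(2) by simp
qed

lemma C_k_SucE:
  fixes \<phi> :: "real \<Rightarrow> real"
  assumes "C_k (Suc k) \<phi>"
  obtains \<phi>' where "\<And>x. (\<phi> has_real_derivative \<phi>' x) (at x)" "C_k k \<phi>'"
proof
  show "(\<phi> has_real_derivative dir_deriv 1 \<phi> x) (at x)" for x
    using assms dir_deriv_eq[of \<phi> _ x] by (auto simp: real_differentiable_def)
  show "C_k k (dir_deriv 1 \<phi>)" using assms by simp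
qed

lemma C_k_add: "C_k k f \<Longrightarrow> C_k k g \<Longrightarrow> C_k k (\<lambda>x::real. f x + g x)"
proof (induction k arbitrary: f g)
  case 0 then show ?case by (auto intro: continuous_on_add)
next
  case (Suc k)
  obtain f' where f': "\<And>x. (f has_real_derivative f' x) (at x)" "C_k k f'"
    using Suc.prems C_k_SucE by blast
  obtain g' where g': "\<And>x. (g has_real_derivative g' x) (at x)" "C_k k g'"
    using Suc.prems C_k_SucE by blast
  show ?case
    by (rule C_k_derivI[OF DERIV_add[OF f'(1) g'(1)] Suc.IH[OF f'(2) g'(2)]])
qed

lemma C_k_mult: "C_k k f \<Longrightarrow> C_k k g \<Longrightarrow> C_k k (\<lambda>x::real. f x * g x)"
proof (induction k arbitrary: f g)
  case 0 then show ?case by (auto intro: continuous_on_mult)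
next
  case (Suc k)
  obtain f' where f': "\<And>x. (f has_real_derivative f' x) (at x)" "C_k k f'"
    using Suc.prems C_k_SucE by blast
  obtain g' where g': "\<And>x. (g has_real_derivative g' x) (at x)" "C_k k g'"
    using Suc.prems C_k_SucE by blast
  show ?case
    by (rule C_k_derivI[OF DERIV_mult[OF f'(1) g'(1)]
          C_k_add[OF Suc.IH[OF f'(2)] Suc.IH[OF g'(2)]]])
       (rule Suc.prems[THEN C_k_SucD])+
qed

lemma C_k_const: "C_k k (\<lambda>x::real. a)"
proof (induction k arbitrary: a)
  case (Suc k)
  show ?case by (rule C_k_derivI[OF DERIV_const Suc.IH])
qed auto

lemma C_k_affine:
  fixes f :: "real \<Rightarrow> real"
  shows "C_k k f \<Longrightarrow> C_k k (\<lambda>x. f (m * x + b))"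
proof (induction k arbitrary: f)
  case 0 then show ?case
    by (auto intro!: continuous_on_compose2[of UNIV f] continuous_intros)
next
  case (Suc k)
  obtain f' where f': "\<And>x. (f has_real_derivative f' x) (at x)" "C_k k f'"
    using Suc.prems C_k_SucE by blast
  show ?case
  proof (rule C_k_derivI)
    show "((\<lambda>x. f (m * x + b)) has_real_derivative f' (m * x + b) * m) (at x)" for x
      by (rule DERIV_chain2[OF f'(1)]) (auto intro!: derivative_eq_intros)
    show "C_k k (\<lambda>x. f' (m * x + b) * m)"
      using C_k_mult[OF Suc.IH[OF f'(2)] C_k_const] by simp
  qed
qed

text \<open>The functions \<open>q(1/x) exp(-1/x)\<close>, extended by zero, are closed under differentiation when \<open>q\<close>
ranges over all polynomials; this gives smoothness of all orders by one induction.\<close>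

definition flat_step :: "real poly \<Rightarrow> real \<Rightarrow> real" where
  "flat_step q x = (if x > 0 then poly q (1 / x) * exp (- (1 / x)) else 0)"

lemma poly_exp_tendsto_0: "((\<lambda>y. poly q y * exp (- y)) \<longlongrightarrow> (0::real)) at_top"
proof (induction q)
  case 0 then show ?case by simp
next
  case (pCons a q)
  have *: "((\<lambda>y::real. y ^ n * exp (- y)) \<longlongrightarrow> 0) at_top" for n
    using tendsto_power_div_exp_0[of n] by (simp add: exp_minus field_simps)
  have "((\<lambda>y. poly p y * exp (- y)) \<longlongrightarrow> (0::real)) at_top" for p
  proof -
    have "((\<lambda>y. \<Sum>i\<le>degree p. coeff p i * (y ^ i * exp (- y))) \<longlongrightarrow> (\<Sum>i\<le>degree p. coeff p i * 0)) at_top"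
      by (intro tendsto_intros *)
    then show ?thesis by (simp add: poly_altdef sum_distrib_right mult.assoc)
  qed
  then show ?case .
qed

lemma flat_step_deriv:
  "(flat_step q has_real_derivative flat_step ([:0,0,1:] * (q - pderiv q)) x) (at x)"
proof -
  consider "x > 0" | "x < 0" | "x = 0" by linarith
  then show ?thesis
  proof cases
    case 1
    have "((\<lambda>x. poly q (1 / x) * exp (- (1 / x))) has_real_derivative
        flat_step ([:0,0,1:] * (q - pderiv q)) x) (at x)"
      using 1 by (auto intro!: derivative_eq_intros simp: flat_step_def field_simps power2_eq_square)
    then show ?thesis
    proof (rule DERIV_cong_ev[THEN iffD1, rotated -1])
      show "\<forall>\<^sub>F x in nhds x. poly q (1 / x) * exp (- (1 / x)) = flat_step q x"
        using eventually_nhds_in_open[of "{0<..}" x] 1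
        by (auto elim!: eventually_mono simp: flat_step_def)
    qed auto
  next
    case 2
    have "((\<lambda>x. 0) has_real_derivative
        flat_step ([:0,0,1:] * (q - pderiv q)) x) (at x)"
      using 2 by (auto simp: flat_step_def)
    then show ?thesis
    proof (rule DERIV_cong_ev[THEN iffD1, rotated -1])
      show "\<forall>\<^sub>F x in nhds x. 0 = flat_step q x"
        using eventually_nhds_in_open[of "{..<0}" x] 2
        by (auto elim!: eventually_mono simp: flat_step_def)
    qed auto
  next
    case 3
    have "((\<lambda>h. flat_step q h / h) \<longlongrightarrow> 0) (at 0)"
    proof (rule filterlim_split_at)
      show "((\<lambda>h. flat_step q h / h) \<longlongrightarrow> 0) (at_left 0)"
        by (rule tendsto_eventually) (auto simp: eventually_at_filter flat_step_def)
      have "((\<lambda>y. poly (pCons 0 q) y * exp (- y)) \<longlongrightarrow> (0::real)) at_top"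
        by (rule poly_exp_tendsto_0)
      then have "((\<lambda>h. poly (pCons 0 q) (inverse h) * exp (- inverse h)) \<longlongrightarrow> (0::real)) (at_right 0)"
        by (rule filterlim_compose[OF _ filterlim_inverse_at_top_right])
      then show "((\<lambda>h. flat_step q h / h) \<longlongrightarrow> 0) (at_right 0)"
        by (rule Lim_transform_eventually)
           (auto simp: eventually_at_filter flat_step_def field_simps)
    qed
    then show ?thesis using 3 by (simp add: DERIV_def flat_step_def)
  qed
qed

lemma C_k_flat_step: "C_k k (flat_step q)"
proof (induction k arbitrary: q)
  case 0
  show ?case using flat_step_deriv by (auto intro!: continuous_at_imp_continuous_on DERIV_isCont)
next
  case (Suc k) show ?case by (rule C_k_derivI[OF flat_step_deriv Suc.IH])
qed

text \<open>As \<open>k \<rightarrow> \<infinity>\<close> these smooth functions converge to the indicator of the open interval, since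
\<open>exp(-1/y) \<rightarrow> 1\<close> as \<open>y \<rightarrow> \<infinity>\<close>.\<close>

definition plateau :: "real \<Rightarrow> real \<Rightarrow> nat \<Rightarrow> real \<Rightarrow> real" where
  "plateau s t k x = flat_step 1 (real k * x + (- real k * s)) * flat_step 1 (- real k * x + real k * t)"

lemma plateau_range: "0 \<le> plateau s t k x" "plateau s t k x \<le> 1"
  by (auto simp: plateau_def flat_step_def intro!: mult_le_one)

lemma plateau_outside: "x \<notin> {s<..<t} \<Longrightarrow> plateau s t k x = 0"
proof -
  assume "x \<notin> {s<..<t}"
  then have "real k * x \<le> real k * s \<or> real k * t \<le> real k * x"
    by (auto intro: mult_left_mono)
  then show ?thesis by (auto simp: plateau_def flat_step_def)
qed

lemma plateau_tendsto: "(\<lambda>k. plateau s t k x) \<longlonglongrightarrow> indicator {s<..<t} x"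
proof (cases "x \<in> {s<..<t}")
  case True
  have "(\<lambda>k. flat_step 1 (real k * d)) \<longlonglongrightarrow> 1" if "d > 0" for d
  proof -
    have "(\<lambda>k. exp (- (1 / d * inverse (real k)))) \<longlonglongrightarrow> exp (- (1 / d * 0))"
      by (intro tendsto_intros LIMSEQ_inverse_real_of_nat tendsto_exp lim_inverse_n)
    then have "(\<lambda>k. exp (- (1 / d * inverse (real k)))) \<longlonglongrightarrow> 1" by simp
    then show ?thesis
      by (rule Lim_transform_eventually)
         (use that in \<open>auto simp: flat_step_def field_simps intro!: eventually_sequentiallyI[of 1]\<close>)
  qed
  from tendsto_mult[OF this[of "x - s"] this[of "t - x"]] True show ?thesis
    by (simp add: plateau_def algebra_simps)
qed (simp add: plateau_outside)

lemma C_k_plateau: "C_k k (plateau s t n)"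
  unfolding plateau_def[abs_def]
  by (intro C_k_mult C_k_affine C_k_flat_step)

lemma test_funI_real:
  fixes \<phi> :: "real \<Rightarrow> real"
  assumes "\<And>k. C_k k \<phi>" "\<And>x. x \<notin> {l..r} \<Longrightarrow> \<phi> x = 0" "{l..r} \<subseteq> S"
  shows "\<phi> \<in> test_fun S"
proof -
  have "closure {x. \<phi> x \<noteq> 0} \<subseteq> {l..r}"
    by (rule closure_minimal) (use assms(2) in blast)+
  moreover from this have "compact (closure {x. \<phi> x \<noteq> 0})"
    by (meson bounded_closed_interval bounded_subset closed_closure compact_eq_bounded_closed)
  ultimately show ?thesis using assms by (auto simp: test_fun_def)
qed

section \<open>Primitives and the lemma of du Bois-Reymond\<close>

lemma integrable_bounded_Icc:
  fixes f :: "real \<Rightarrow> 'b::{banach, second_countable_topology}"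
  assumes "f \<in> borel_measurable borel" "\<And>x. norm (f x) \<le> B" "\<And>x. x \<notin> {l..r} \<Longrightarrow> f x = 0"
  shows "integrable lborel f"
  by (rule integrableI_bounded_set[where A="{l..r}" and B=B])
     (use assms in \<open>auto simp: emeasure_lborel_Icc_eq\<close>)

text \<open>Intervals generate the Borel sets and are closed under intersection, so all set integrals of \<open>w\<close>
vanish.\<close>

lemma AE_zero_of_interval_integrals:
  fixes w :: "real \<Rightarrow> complex"
  assumes int: "integrable lborel w"
    and zero: "\<And>s t. s \<le> t \<Longrightarrow> (LINT x|lborel. indicat_real {s..t} x *\<^sub>R w x) = 0"
  shows "AE x in lborel. w x = 0"
proof (rule sigma_finite_measure.density_zero[OF sigma_finite_lborel int])
  have total: "(LINT x|lborel. w x) = 0"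
  proof -
    have "(\<lambda>n. LINT x|lborel. indicat_real {-real n..real n} x *\<^sub>R w x) \<longlonglongrightarrow> (LINT x|lborel. w x)"
    proof (rule integral_dominated_convergence)
      show "integrable lborel (\<lambda>x. norm (w x))" using int by simp
      show "AE x in lborel. (\<lambda>n. indicat_real {- real n..real n} x *\<^sub>R w x) \<longlonglongrightarrow> w x"
      proof (rule AE_I2)
        fix x :: real
        obtain N where N: "\<bar>x\<bar> \<le> real N" using real_arch_simple by blast
        show "(\<lambda>n. indicat_real {- real n..real n} x *\<^sub>R w x) \<longlonglongrightarrow> w x"
        proof (rule tendsto_eventually, rule eventually_sequentiallyI[of N])
          fix n assume "N \<le> n"
          then have "x \<in> {- real n..real n}" using N of_nat_mono[of N n] by auto
          then show "indicat_real {- real n..real n} x *\<^sub>R w x = w x" by simp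
        qed
      qed
    qed (use int in \<open>auto simp: indicator_def\<close>)
    moreover have "(LINT x|lborel. indicat_real {-real n..real n} x *\<^sub>R w x) = 0" for n
      by (rule zero) simp
    ultimately show ?thesis by (simp add: LIMSEQ_const_iff)
  qed
  fix A :: "real set" assume "A \<in> sets lborel"
  then have "A \<in> sets borel" by simp
  then show "(LINT x:A|lborel. w x) = 0"
  proof (induction rule: borel_set_induct)
    case empty then show ?case by (simp add: set_lebesgue_integral_def)
  next
    case (interval a b) then show ?case by (simp add: set_lebesgue_integral_def zero)
  next
    case (compl A)
    have "(LINT x:-A|lborel. w x) = (LINT x|lborel. w x - indicat_real A x *\<^sub>R w x)"
      unfolding set_lebesgue_integral_def by (rule Bochner_Integration.integral_cong) (auto simp: indicator_def)
    also have "\<dots> = (LINT x|lborel. w x) - (LINT x|lborel. indicat_real A x *\<^sub>R w x)"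
      using int compl by (intro Bochner_Integration.integral_diff integrable_mult_indicator) auto
    finally show ?case using compl total by (simp add: set_lebesgue_integral_def)
  next
    case (union A)
    have "set_integrable lborel (\<Union>i. A i) w"
      unfolding set_integrable_def by (rule integrable_mult_indicator[OF _ int]) (use union in auto)
    then show ?case using union
      by (subst lebesgue_integral_countable_add) (auto simp: disjoint_family_on_def)
  qed
qed

definition primitive :: "(real \<Rightarrow> complex) \<Rightarrow> (real \<Rightarrow> complex) \<Rightarrow> bool" where
  "primitive F g \<longleftrightarrow> (\<forall>x y. x \<le> y \<longrightarrow> F y - F x = (LINT t|lborel. indicat_real {x..y} t *\<^sub>R g t))"

lemma integral_Icc_split:
  fixes g :: "real \<Rightarrow> complex"
  assumes g: "g \<in> borel_measurable borel" "\<And>x. norm (g x) \<le> B" and xy: "x \<le> y" "y \<le> z"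
  shows "(LINT t|lborel. indicat_real {x..z} t *\<^sub>R g t) =
    (LINT t|lborel. indicat_real {x..y} t *\<^sub>R g t) + (LINT t|lborel. indicat_real {y..z} t *\<^sub>R g t)"
proof -
  have i: "integrable lborel (\<lambda>t. indicat_real {x..y} t *\<^sub>R g t)" for x y
    by (rule integrable_bounded_Icc[where B="B" and l=x and r=y])
       (use g in \<open>auto simp: indicator_def intro: order_trans[OF norm_ge_zero]\<close>)
  have "(LINT t|lborel. indicat_real {x..z} t *\<^sub>R g t) =
      (LINT t|lborel. indicat_real {x..y} t *\<^sub>R g t + indicat_real {y..z} t *\<^sub>R g t)"
  proof (rule integral_cong_AE)
    show "AE t in lborel. indicat_real {x..z} t *\<^sub>R g t = indicat_real {x..y} t *\<^sub>R g t + indicat_real {y..z} t *\<^sub>R g t"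
      using AE_lborel_singleton[of y] by eventually_elim (use xy in \<open>auto simp: indicator_def\<close>)
  qed (use g in auto)
  then show ?thesis using i by simp
qed

lemma primitive_exists:
  assumes g: "g \<in> borel_measurable borel" "\<And>x. norm (g x) \<le> B"
  obtains F where "primitive F g"
proof
  define I where "I x y = (LINT t|lborel. indicat_real {x..y} t *\<^sub>R g t)" for x y
  define F where "F x = (if x \<ge> 0 then I 0 x else - I x 0)" for x
  have split: "x \<le> y \<Longrightarrow> y \<le> z \<Longrightarrow> I x z = I x y + I y z" for x y z
    unfolding I_def by (rule integral_Icc_split[OF g])
  show "primitive F g"
    unfolding primitive_def
  proof (intro allI impI)
    fix x y :: real assume "x \<le> y"
    then show "F y - F x = (LINT t|lborel. indicat_real {x..y} t *\<^sub>R g t)"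
      unfolding I_def[symmetric] F_def
      using split[of 0 x y] split[of x 0 y] split[of x y 0] by auto
  qed
qed

lemma primitive_lipschitz:
  assumes g: "g \<in> borel_measurable borel" "\<And>x. norm (g x) \<le> B" and F: "primitive F g"
  shows "norm (F x - F y) \<le> B * \<bar>x - y\<bar>"
proof -
  have *: "norm (F y - F x) \<le> B * (y - x)" if "x \<le> y" for x y
  proof -
    have "norm (LINT t|lborel. indicat_real {x..y} t *\<^sub>R g t) \<le> (LINT t|lborel. indicat_real {x..y} t * B)"
    proof (rule Bochner_Integration.integral_norm_bound_integral)
      show "integrable lborel (\<lambda>t. indicat_real {x..y} t *\<^sub>R g t)"
        by (rule integrable_bounded_Icc[where B="B" and l=x and r=y])
           (use g in \<open>auto simp: indicator_def intro: order_trans[OF norm_ge_zero]\<close>)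
      show "integrable lborel (\<lambda>t. indicat_real {x..y} t * B)"
        by (intro integrable_mult_left) (simp add: emeasure_lborel_Icc_eq)
    qed (use g in \<open>auto simp: indicator_def\<close>)
    also have "\<dots> = B * (y - x)" using that by simp
    finally show ?thesis using F that by (simp add: primitive_def)
  qed
  show ?thesis
    using *[of x y] *[of y x] by (cases "x \<le> y") (auto simp: norm_minus_commute abs_if)
qed

lemma has_real_derivative_zero_outside:
  fixes \<phi> :: "real \<Rightarrow> real"
  assumes d: "\<And>x. (\<phi> has_real_derivative \<phi>' x) (at x)" and z: "\<And>x. x \<notin> {l..r} \<Longrightarrow> \<phi> x = 0"
    and x: "x \<notin> {l..r}"
  shows "\<phi>' x = 0"
proof -
  have "((\<lambda>_. 0) has_real_derivative \<phi>' x) (at x)"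
    using d[of x]
  proof (rule DERIV_cong_ev[THEN iffD1, rotated -1])
    show "\<forall>\<^sub>F x in nhds x. \<phi> x = 0"
      using eventually_nhds_in_open[of "- {l..r}" x] x
      by (auto elim!: eventually_mono simp: z open_Compl)
  qed auto
  then show ?thesis using DERIV_unique DERIV_const by blast
qed

text \<open>Only \<open>\<phi>\<close> is differentiated classically; \<open>F\<close> is merely Lipschitz. The identity is Fubini for
\<open>\<phi>'(x) g(y)\<close> on the triangle \<open>l \<le> y \<le> x \<le> r\<close>.\<close>

lemma integral_by_parts_primitive:
  fixes \<phi> :: "real \<Rightarrow> real"
  assumes g: "g \<in> borel_measurable borel" "\<And>x. norm (g x) \<le> B" and F: "primitive F g"
    and d: "\<And>x. (\<phi> has_real_derivative \<phi>' x) (at x)" and c: "continuous_on UNIV \<phi>'"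
    and z: "\<And>x. x \<notin> {l<..<r} \<Longrightarrow> \<phi> x = 0" and lr: "l \<le> r"
  shows "(LINT x|lborel. \<phi>' x *\<^sub>R F x) = - (LINT x|lborel. \<phi> x *\<^sub>R g x)"
proof -
  have z': "x \<notin> {l..r} \<Longrightarrow> \<phi>' x = 0" for x
    by (rule has_real_derivative_zero_outside[OF d, where l=l and r=r]) (use z in auto)
  have "compact (\<phi>' ` {l..r})"
    by (rule compact_continuous_image) (use c in \<open>auto intro: continuous_on_subset\<close>)
  then obtain D where D: "\<And>x. x \<in> {l..r} \<Longrightarrow> norm (\<phi>' x) \<le> D" "D > 0"
    by (fastforce dest!: compact_imp_bounded simp: bounded_pos)
  have D0: "0 \<le> D" using D(2) by simp
  have D: "norm (\<phi>' x) \<le> D" for x using D z' by (cases "x \<in> {l..r}") auto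
  have B0: "0 \<le> B" using g(2)[of 0] norm_ge_zero order_trans by blast
  have [measurable]: "\<phi>' \<in> borel_measurable borel" using c by (rule borel_measurable_continuous_onI)
  have [measurable]: "g \<in> borel_measurable borel" by fact
  define h where "h x y = (if l \<le> y \<and> y \<le> x \<and> x \<le> r then \<phi>' x *\<^sub>R g y else 0)" for x y
  have int_phi': "integrable lborel (\<lambda>x. \<phi>' x *\<^sub>R a)" for a :: complex
    by (rule integrable_bounded_Icc[where B="D * norm a" and l=l and r=r])
       (use D z' in \<open>auto intro!: mult_right_mono\<close>)
  have FTC: "(LINT x|lborel. indicat_real {y..r} x *\<^sub>R \<phi>' x) = - \<phi> y" if "y \<le> r" for y
  proof -
    have "(LINT x|lborel. indicat_real {y..r} x *\<^sub>R \<phi>' x) = \<phi> r - \<phi> y"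
      by (rule integral_FTC_Icc[OF that])
         (use d c in \<open>auto simp: has_real_derivative_iff_has_vector_derivative
            intro: continuous_on_subset has_vector_derivative_at_within\<close>)
    then show ?thesis using z[of r] by simp
  qed
  have inth: "integrable (lborel \<Otimes>\<^sub>M lborel) (case_prod h)"
  proof (rule integrableI_bounded_set[where A="{l..r} \<times> {l..r}" and B="D * B"])
    show "emeasure (lborel \<Otimes>\<^sub>M lborel) ({l..r} \<times> {l..r}) < \<infinity>"
      by (subst lborel.emeasure_pair_measure_Times) (auto simp: emeasure_lborel_Icc_eq ennreal_mult_less_top)
    show "(\<lambda>(x, y). h x y) \<in> borel_measurable (lborel \<Otimes>\<^sub>M lborel)"
      unfolding h_def by measurable
    show "AE x in lborel \<Otimes>\<^sub>M lborel. x \<in> {l..r} \<times> {l..r} \<longrightarrow> norm (case_prod h x) \<le> D * B"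
      using D D0 g(2) B0 by (auto simp: h_def intro!: AE_I2 mult_mono)
    show "AE x in lborel \<Otimes>\<^sub>M lborel. x \<notin> {l..r} \<times> {l..r} \<longrightarrow> case_prod h x = 0"
      by (rule AE_I2) (auto simp: h_def split: prod.splits)
  qed simp
  have 1: "(LINT y|lborel. h x y) = \<phi>' x *\<^sub>R (F x - F l)" for x
  proof (cases "x \<in> {l..r}")
    case True
    have "(LINT y|lborel. h x y) = (LINT y|lborel. \<phi>' x *\<^sub>R (indicat_real {l..x} y *\<^sub>R g y))"
      using True by (intro Bochner_Integration.integral_cong) (auto simp: h_def indicator_def)
    also have "\<dots> = \<phi>' x *\<^sub>R (F x - F l)"
      using F True by (simp add: primitive_def del: scaleR_scaleR)
    finally show ?thesis .
  next
    case False
    then have "h x = (\<lambda>_. 0)" by (auto simp: h_def fun_eq_iff)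
    then show ?thesis using z'[OF False] by simp
  qed
  have 2: "(LINT x|lborel. h x y) = - (\<phi> y *\<^sub>R g y)" for y
  proof (cases "y \<in> {l..r}")
    case True
    have "(LINT x|lborel. h x y) = (LINT x|lborel. (indicat_real {y..r} x *\<^sub>R \<phi>' x) *\<^sub>R g y)"
      using True by (intro Bochner_Integration.integral_cong) (auto simp: h_def indicator_def)
    also have "\<dots> = (LINT x|lborel. (indicat_real {y..r} x *\<^sub>R \<phi>' x)) *\<^sub>R g y"
      by (intro integral_scaleR_left impI
          integrable_bounded_Icc[where B=D and l=y and r=r])
         (use D D0 in \<open>auto simp: indicator_def\<close>)
    finally show ?thesis using FTC[of y] True by simp
  next
    case False
    then have "(\<lambda>x. h x y) = (\<lambda>_. 0)" by (auto simp: h_def fun_eq_iff)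
    then show ?thesis using z[of y] False by auto
  qed
  have FTCl: "(LINT x|lborel. \<phi>' x *\<^sub>R F l) = 0"
  proof -
    have "(LINT x|lborel. \<phi>' x) = (LINT x|lborel. indicat_real {l..r} x *\<^sub>R \<phi>' x)"
      using z' by (intro Bochner_Integration.integral_cong) (auto simp: indicator_def)
    also have "\<dots> = 0" using FTC[of l] lr z[of l] by simp
    finally have "(LINT x|lborel. \<phi>' x) = 0" .
    moreover have "integrable lborel \<phi>'"
      by (rule integrable_bounded_Icc[where B=D and l=l and r=r]) (use D z' in auto)
    ultimately show ?thesis by simp
  qed
  have "integrable lborel (\<lambda>x. \<phi>' x *\<^sub>R (F x - F l))"
    using lborel_pair.integrable_fst[OF inth] by (simp add: 1)
  then have "(LINT x|lborel. \<phi>' x *\<^sub>R F x) = (LINT x|lborel. \<phi>' x *\<^sub>R (F x - F l)) + (LINT x|lborel. \<phi>' x *\<^sub>R F l)"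
    using int_phi' by (subst Bochner_Integration.integral_add[symmetric]) (auto simp: algebra_simps)
  also have "\<dots> = (LINT x|lborel. LINT y|lborel. h x y)" by (simp add: 1 FTCl)
  also have "\<dots> = (LINT y|lborel. LINT x|lborel. h x y)"
    using lborel_pair.Fubini_integral[OF inth] by simp
  also have "\<dots> = - (LINT y|lborel. \<phi> y *\<^sub>R g y)" by (simp add: 2)
  finally show ?thesis .
qed

lemma test_fun_primitive:
  fixes \<theta> :: "real \<Rightarrow> real"
  assumes C: "\<And>k. C_k k \<theta>" and z: "\<And>x. x \<notin> {l<..<r} \<Longrightarrow> \<theta> x = 0"
    and total: "(LINT x|lborel. \<theta> x) = 0" and lr: "l \<le> r" and S: "{l..r} \<subseteq> S"
  obtains \<phi> where "\<phi> \<in> test_fun S" "\<And>x. (\<phi> has_real_derivative \<theta> x) (at x)"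
    "\<And>x. x \<notin> {l<..<r} \<Longrightarrow> \<phi> x = 0"
proof
  define \<phi> where "\<phi> x = integral {l-1..x} \<theta>" for x
  have cont: "continuous_on A \<theta>" for A
    using C[of 0] by (auto intro: continuous_on_subset)
  have io: "\<theta> integrable_on {a..b}" for a b
    by (intro integrable_continuous_interval cont)
  have 0: "\<phi> x = 0" if "x \<le> l" for x
    unfolding \<phi>_def by (rule integral_unique[OF has_integral_is_0]) (use that z in auto)
  have r: "\<phi> x = 0" if "x \<ge> r" for x
  proof -
    have eq1: "(\<lambda>t. indicat_real {l-1..x} t *\<^sub>R \<theta> t) = \<theta>"
    proof
      fix y show "indicat_real {l-1..x} y *\<^sub>R \<theta> y = \<theta> y"
        using that lr z[of y] by (cases "y \<in> {l<..<r}") auto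
    qed
    have eq2: "(\<lambda>t. if t \<in> {l-1..x} then \<theta> t else 0) = \<theta>"
    proof
      fix y show "(if y \<in> {l-1..x} then \<theta> y else 0) = \<theta> y"
        using that lr z[of y] by (cases "y \<in> {l<..<r}") auto
    qed
    have "integrable lborel \<theta>"
      using borel_integrable_compact[of "{l-1..x}" \<theta>] cont unfolding eq1 by simp
    from has_integral_integral_lborel[OF this]
    have "(\<theta> has_integral 0) {l-1..x}"
      using has_integral_restrict_UNIV[of "{l-1..x}" \<theta> 0] total unfolding eq2 by simp
    then show ?thesis by (simp add: \<phi>_def integral_unique)
  qed
  show d: "(\<phi> has_real_derivative \<theta> x) (at x)" for x
  proof (cases "x < l")
    case True
    have "((\<lambda>x. 0) has_real_derivative 0) (at x)" by simp
    then have "(\<phi> has_real_derivative 0) (at x)"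
    proof (rule DERIV_cong_ev[THEN iffD1, rotated -1])
      show "\<forall>\<^sub>F x in nhds x. 0 = \<phi> x"
        using eventually_nhds_in_open[of "{..<l}" x] True
        by (auto elim!: eventually_mono simp: 0)
    qed auto
    then show ?thesis using z[of x] True by auto
  next
    case False
    have "(\<phi> has_real_derivative \<theta> x) (at x within {l-1..x+1})"
      unfolding \<phi>_def by (rule integral_has_real_derivative) (use cont False in auto)
    then show ?thesis
      using False at_within_interior[of x "{l-1..x+1}"] by simp
  qed
  show out: "\<phi> x = 0" if "x \<notin> {l<..<r}" for x using that 0 r by fastforce
  show "\<phi> \<in> test_fun S"
  proof (rule test_funI_real[OF _ _ S])
    fix k show "C_k k \<phi>"
      using C_k_derivI[OF d C[of k]] by (rule C_k_SucD)
  qed (use out in auto)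
qed

lemma plateau_abs: "\<bar>plateau s t k x\<bar> \<le> 1"
  using plateau_range[where s=s and t=t and k=k and x=x] by simp

lemma plateau_integrable: "integrable lborel (plateau s t k)"
proof (rule integrable_bounded_Icc[where l=s and r=t and B=1])
  show "plateau s t k \<in> borel_measurable borel"
    by (rule borel_measurable_continuous_onI) (use C_k_plateau[of 0] in simp)
qed (auto simp: plateau_range plateau_outside)

lemma C_k_continuous: "C_k k (f::real\<Rightarrow>real) \<Longrightarrow> continuous_on UNIV f"
  by (induction k arbitrary: f) (auto dest: C_k_SucD simp del: C_k.simps(2))

text \<open>Lemma of du Bois-Reymond. Every smooth \<open>\<theta>\<close> supported in \<open>[l, r]\<close> with mean zero is the derivative
of a test function. Subtracting from a plateau on a subinterval the right multiple of the plateau on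
the whole interval therefore gives an admissible \<open>\<theta>\<close>; so \<open>u - c\<close> has integral zero against all
plateaus, and in the limit over all subintervals.\<close>

lemma weak_deriv_zero_local:
  fixes u :: "real \<Rightarrow> complex"
  assumes S: "{l..r} \<subseteq> S" and lr: "l < r"
    and u: "u \<in> borel_measurable borel" "\<And>x. x \<in> {l..r} \<Longrightarrow> norm (u x) \<le> B"
    and weak: "\<And>\<phi> \<phi>'. \<phi> \<in> test_fun S \<Longrightarrow> (\<And>x. (\<phi> has_real_derivative \<phi>' x) (at x)) \<Longrightarrow> continuous_on UNIV \<phi>' \<Longrightarrow>
       (\<And>x. x \<notin> {l<..<r} \<Longrightarrow> \<phi> x = 0) \<Longrightarrow> (LINT x|lborel. \<phi>' x *\<^sub>R u x) = 0"
  obtains c where "AE x in lborel. x \<in> {l<..<r} \<longrightarrow> u x = c"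
proof -
  have B0: "0 \<le> B" using order_trans[OF norm_ge_zero u(2)[of l]] lr by simp
  have iu: "integrable lborel (\<lambda>x. f x *\<^sub>R u x)"
    if f: "f \<in> borel_measurable borel" "\<And>x. x \<notin> {l<..<r} \<Longrightarrow> f x = 0" "\<And>x. \<bar>f x\<bar> \<le> C" for f :: "real \<Rightarrow> real" and C
  proof (rule integrable_bounded_Icc[where B="C * B" and l=l and r=r])
    have C0: "0 \<le> C" using f(3)[of 0] by linarith
    show "norm (f x *\<^sub>R u x) \<le> C * B" for x
      using f(2)[of x] f(3)[of x] u(2)[of x] B0 C0
      by (cases "x \<in> {l<..<r}") (auto intro!: mult_mono)
  qed (use f u in auto)
  have pm: "plateau s t j \<in> borel_measurable borel" for s t j
    using borel_measurable_integrable[OF plateau_integrable] by simp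
  have "(\<lambda>k. LINT x|lborel. plateau l r k x) \<longlonglongrightarrow> (LINT x|lborel. indicat_real {l<..<r} x)"
  proof (rule integral_dominated_convergence[where w="indicat_real {l..r}"])
    show "AE x in lborel. (\<lambda>k. plateau l r k x) \<longlonglongrightarrow> indicat_real {l<..<r} x"
      by (intro AE_I2 plateau_tendsto)
    show "AE x in lborel. norm (plateau l r k x) \<le> indicat_real {l..r} x" for k
      using plateau_range plateau_outside by (auto simp: indicator_def)
  qed (use pm in \<open>auto simp: emeasure_lborel_Icc_eq\<close>)
  moreover have "(LINT x|lborel. indicat_real {l<..<r} x) = r - l"
    using lr by simp
  ultimately have "eventually (\<lambda>k. (LINT x|lborel. plateau l r k x) > 0) sequentially"
    using lr by (intro order_tendstoD) auto
  then obtain k where k: "(LINT x|lborel. plateau l r k x) > 0"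
    by (auto simp: eventually_sequentially)
  \<comment> \<open>The constant is the mean of \<open>u\<close> weighted by the plateau on the whole interval.\<close>
  define m where "m = (LINT x|lborel. plateau l r k x)"
  define c where "c = (LINT x|lborel. plateau l r k x *\<^sub>R u x) /\<^sub>R m"
  have m: "m > 0" using k by (simp add: m_def)
  have test: "(LINT x|lborel. plateau s t j x *\<^sub>R (u x - c)) = 0" if "l \<le> s" "t \<le> r" for s t j
  proof -
    define q where "q = (LINT x|lborel. plateau s t j x) / m"
    define \<theta> where "\<theta> x = plateau s t j x + (- q) * plateau l r k x" for x
    have "C_k i \<theta>" for i
      unfolding \<theta>_def[abs_def] by (intro C_k_add C_k_mult C_k_const C_k_plateau)
    moreover have "\<theta> x = 0" if "x \<notin> {l<..<r}" for x
      using that \<open>l \<le> s\<close> \<open>t \<le> r\<close> plateau_outside[of x s t] plateau_outside[of x l r] by (auto simp: \<theta>_def)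
    moreover have "(LINT x|lborel. \<theta> x) = 0"
      using m plateau_integrable by (simp add: \<theta>_def q_def m_def[symmetric])
    ultimately obtain \<phi> where \<phi>: "\<phi> \<in> test_fun S" "\<And>x. (\<phi> has_real_derivative \<theta> x) (at x)"
      "\<And>x. x \<notin> {l<..<r} \<Longrightarrow> \<phi> x = 0"
      using test_fun_primitive[of \<theta> l r S] S lr by auto
    have "(LINT x|lborel. \<theta> x *\<^sub>R u x) = 0"
      by (rule weak[OF \<phi>(1,2) _ \<phi>(3)]) (use \<open>\<And>i. C_k i \<theta>\<close> C_k_continuous in blast)+
    moreover have i1: "integrable lborel (\<lambda>x. plateau s t j x *\<^sub>R u x)"
      by (rule iu[where C=1]) (use pm plateau_abs plateau_outside that in auto)
    moreover have i2: "integrable lborel (\<lambda>x. plateau l r k x *\<^sub>R u x)"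
      by (rule iu[where C=1]) (use pm plateau_abs plateau_outside in auto)
    ultimately have "(LINT x|lborel. plateau s t j x *\<^sub>R u x) = q *\<^sub>R (LINT x|lborel. plateau l r k x *\<^sub>R u x)"
      by (simp add: \<theta>_def scaleR_add_left scaleR_diff_left flip: scaleR_scaleR)
    also have "\<dots> = (LINT x|lborel. plateau s t j x *\<^sub>R c)"
      using m plateau_integrable by (simp add: c_def q_def divide_inverse mult.commute)
    finally show ?thesis
      using i1 plateau_integrable by (simp add: scaleR_diff_right)
  qed
  define w where "w x = indicat_real {l<..<r} x *\<^sub>R (u x - c)" for x
  have int_w: "integrable lborel w"
    unfolding w_def
    by (rule integrable_bounded_Icc[where B="B + norm c" and l=l and r=r])
       (use u B0 in \<open>auto simp: indicator_def intro!: order_trans[OF norm_triangle_ineq4] add_mono\<close>)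
  have "AE x in lborel. w x = 0"
  proof (rule AE_zero_of_interval_integrals[OF int_w])
    fix s t :: real assume "s \<le> t"
    define s' t' where "s' = max s l" and "t' = min t r"
    have "(\<lambda>j. LINT x|lborel. plateau s' t' j x *\<^sub>R (u x - c)) \<longlonglongrightarrow> (LINT x|lborel. indicat_real {s'<..<t'} x *\<^sub>R (u x - c))"
    proof (rule integral_dominated_convergence[where w="\<lambda>x. norm (w x)"])
      show "AE x in lborel. norm (plateau s' t' j x *\<^sub>R (u x - c)) \<le> norm (w x)" for j
      proof (rule AE_I2)
        fix x
        show "norm (plateau s' t' j x *\<^sub>R (u x - c)) \<le> norm (w x)"
          using plateau_range[of s' t' j x] plateau_outside[of x s' t' j]
          by (cases "x \<in> {s'<..<t'}")
             (auto simp: w_def s'_def t'_def mult_left_le_one_le)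
      qed
      show "AE x in lborel. (\<lambda>j. plateau s' t' j x *\<^sub>R (u x - c)) \<longlonglongrightarrow> indicat_real {s'<..<t'} x *\<^sub>R (u x - c)"
        by (intro AE_I2 tendsto_intros plateau_tendsto)
    qed (use int_w u pm in \<open>auto simp: borel_measurable_indicator\<close>)
    moreover have "(LINT x|lborel. plateau s' t' j x *\<^sub>R (u x - c)) = 0" for j
      by (rule test) (auto simp: s'_def t'_def)
    ultimately have 0: "(LINT x|lborel. indicat_real {s'<..<t'} x *\<^sub>R (u x - c)) = 0"
      by (simp add: LIMSEQ_const_iff)
    have "(LINT x|lborel. indicat_real {s..t} x *\<^sub>R w x) = (LINT x|lborel. indicat_real {s'<..<t'} x *\<^sub>R (u x - c))"
    proof (rule integral_cong_AE)
      show "AE x in lborel. indicat_real {s..t} x *\<^sub>R w x = indicat_real {s'<..<t'} x *\<^sub>R (u x - c)"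
        using AE_lborel_singleton[of s] AE_lborel_singleton[of t]
        by eventually_elim (auto simp: w_def indicator_def s'_def t'_def)
    qed (use u int_w in auto)
    then show "(LINT x|lborel. indicat_real {s..t} x *\<^sub>R w x) = 0" using 0 by simp
  qed
  then have "AE x in lborel. x \<in> {l<..<r} \<longrightarrow> u x = c"
    by eventually_elim (auto simp: w_def)
  then show ?thesis by (rule that)
qed

section \<open>Classical representatives of Sobolev functions\<close>

text \<open>Members of \<open>L_infty S\<close> are Lebesgue measurable and only essentially bounded. The representative is
taken Borel measurable, bounded everywhere and zero off \<open>S\<close>, so that integrals over \<open>S\<close> become
integrals over the line.\<close>

lemma borel_representative:
  fixes f :: "real \<Rightarrow> complex"
  assumes f: "f \<in> L_infty S" and S: "S \<in> sets borel"
  obtains f' B where "f' \<in> borel_measurable borel" "\<And>x. norm (f' x) \<le> B"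
    "\<And>x. x \<notin> S \<Longrightarrow> f' x = 0" "AE x in lebesgue. x \<in> S \<longrightarrow> f x = f' x"
proof -
  obtain C where C: "AE x in lebesgue_on S. norm (f x) \<le> C" and m: "f \<in> borel_measurable (lebesgue_on S)"
    using f by (auto simp: L_infty_def)
  have SL: "S \<in> sets lebesgue" using S by (simp add: sets_completionI_sets)
  define h where "h x = indicat_real S x *\<^sub>R f x" for x
  have mh: "h \<in> borel_measurable lebesgue"
    using m SL unfolding h_def by (subst (asm) borel_measurable_restrict_space_iff) auto
  have "(\<lambda>x. Re (h x)) \<in> borel_measurable lebesgue" "(\<lambda>x. Im (h x)) \<in> borel_measurable lebesgue"
    using mh by measurable
  then obtain p q where p: "p \<in> borel_measurable lborel" "AE x in lborel. Re (h x) = p x"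
    and q: "q \<in> borel_measurable lborel" "AE x in lborel. Im (h x) = q x"
    using completion_ex_borel_measurable_real by metis
  define k where "k x = Complex (p x) (q x)" for x
  have k: "k \<in> borel_measurable borel"
    using p(1) q(1) unfolding k_def by (simp add: borel_measurable_complex_iff)
  have hk: "AE x in lebesgue. h x = k x"
    using p(2) q(2) unfolding AE_completion_iff by eventually_elim (auto simp: k_def complex_eq_iff)
  define f' where "f' x = (if x \<in> S \<and> norm (k x) \<le> \<bar>C\<bar> then k x else 0)" for x
  show ?thesis
  proof
    show "f' \<in> borel_measurable borel" unfolding f'_def using k S by measurable
    show "norm (f' x) \<le> \<bar>C\<bar>" for x by (auto simp: f'_def)
    show "x \<notin> S \<Longrightarrow> f' x = 0" for x by (auto simp: f'_def)
    have "AE x in lebesgue. x \<in> S \<longrightarrow> norm (f x) \<le> C"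
      using C SL by (subst (asm) AE_restrict_space_iff) auto
    then show "AE x in lebesgue. x \<in> S \<longrightarrow> f x = f' x"
      using hk by eventually_elim (auto simp: f'_def h_def)
  qed
qed

lemma integral_lebesgue_on_eq_lborel:
  fixes f f' :: "real \<Rightarrow> complex"
  assumes S: "S \<in> sets borel" and f': "f' \<in> borel_measurable borel" and z: "\<And>x. x \<notin> S \<Longrightarrow> f' x = 0"
    and ae: "AE x in lebesgue. x \<in> S \<longrightarrow> f x = f' x"
  shows "(\<integral>x. f x \<partial>lebesgue_on S) = (\<integral>x. f' x \<partial>lborel)"
proof -
  have SL: "S \<in> sets lebesgue" using S by (simp add: sets_completionI_sets)
  have "(\<integral>x. f x \<partial>lebesgue_on S) = (\<integral>x. indicat_real S x *\<^sub>R f x \<partial>lebesgue)"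
    using SL by (subst integral_restrict_space) auto
  also have "\<dots> = (\<integral>x. f' x \<partial>lebesgue)"
  proof (rule integral_cong_AE)
    have ae': "AE x in lebesgue. f' x = indicat_real S x *\<^sub>R f x"
      using ae by eventually_elim (auto simp: indicator_def z)
    show f'm: "f' \<in> borel_measurable lebesgue" using f' by (intro measurable_completion) simp
    show "(\<lambda>x. indicat_real S x *\<^sub>R f x) \<in> borel_measurable lebesgue"
      by (rule borel_measurable_AE[OF f'm ae'])
    show "AE x in lebesgue. indicat_real S x *\<^sub>R f x = f' x"
      using ae' by eventually_elim simp
  qed
  also have "\<dots> = (\<integral>x. f' x \<partial>lborel)" using f' by (intro integral_completion) simp
  finally show ?thesis .
qed

lemma interval_rat_hull:
  fixes S :: "real set"
  assumes "open S" "x \<in> S"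
  obtains p q where "p \<in> \<rat>" "q \<in> \<rat>" "p \<in> S" "q \<in> S" "p < x" "x < q"
proof -
  obtain d where d: "d > 0" "\<And>y. \<bar>y - x\<bar> < d \<Longrightarrow> y \<in> S"
    using assms by (auto simp: open_real)
  obtain p where "p \<in> \<rat>" "x - d < p" "p < x" using Rats_dense_in_real[of "x - d" x] d by auto
  moreover obtain q where "q \<in> \<rat>" "x < q" "q < x + d" using Rats_dense_in_real[of x "x + d"] d by auto
  ultimately show ?thesis using that d(2)[of p] d(2)[of q] by auto
qed

text \<open>The difference of \<open>f\<close> and a primitive of \<open>g\<close> has weak derivative zero, hence is constant on every
compact subinterval of \<open>S\<close>. These constants agree because any two subintervals lie in a third one,
and countably many subintervals with rational endpoints cover \<open>S\<close>.\<close>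

lemma weak_deriv_imp_primitive:
  fixes f g :: "real \<Rightarrow> complex"
  assumes S: "open S" "is_interval S" and f: "f \<in> L_infty S" and g: "g \<in> L_infty S"
    and weak: "weak_deriv S f g"
  obtains F g' B where "g' \<in> borel_measurable borel" "\<And>x. norm (g' x) \<le> B"
    "AE x in lebesgue. x \<in> S \<longrightarrow> g x = g' x" "primitive F g'" "AE x in lebesgue. x \<in> S \<longrightarrow> f x = F x"
proof -
  have Sb: "S \<in> sets borel" using S by simp
  obtain f' A where f': "f' \<in> borel_measurable borel" "\<And>x. norm (f' x) \<le> A"
    "\<And>x. x \<notin> S \<Longrightarrow> f' x = 0" "AE x in lebesgue. x \<in> S \<longrightarrow> f x = f' x"
    using borel_representative[OF f Sb] by blast
  obtain g' B where g': "g' \<in> borel_measurable borel" "\<And>x. norm (g' x) \<le> B"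
    "\<And>x. x \<notin> S \<Longrightarrow> g' x = 0" "AE x in lebesgue. x \<in> S \<longrightarrow> g x = g' x"
    using borel_representative[OF g Sb] by blast
  obtain F where F: "primitive F g'" using primitive_exists[OF g'(1,2)] by blast
  note Flip = primitive_lipschitz[OF g'(1,2) F]
  have Fcont: "continuous_on UNIV F"
  proof (rule lipschitz_on_continuous_on)
    show "\<bar>B\<bar>-lipschitz_on UNIV F"
      using Flip by (intro lipschitz_onI)
        (auto simp: dist_norm intro: order_trans[OF _ mult_right_mono[OF abs_ge_self]])
  qed
  have Fm: "F \<in> borel_measurable borel" using Fcont by (rule borel_measurable_continuous_onI)
  define u where "u x = f' x - F x" for x
  have local: "\<exists>c. AE x in lborel. x \<in> {l<..<r} \<longrightarrow> u x = c" if "l < r" "{l..r} \<subseteq> S" for l r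
  proof -
    have "compact (F ` {l..r})"
      by (rule compact_continuous_image) (use Fcont in \<open>auto intro: continuous_on_subset\<close>)
    then obtain D where D: "\<And>x. x \<in> {l..r} \<Longrightarrow> norm (F x) \<le> D"
      by (fastforce dest!: compact_imp_bounded simp: bounded_pos)
    have "norm (u x) \<le> A + D" if "x \<in> {l..r}" for x
      using f'(2)[of x] D[OF that] norm_triangle_ineq4[of "f' x" "F x"] by (simp add: u_def)
    moreover have "(LINT x|lborel. \<phi>' x *\<^sub>R u x) = 0"
      if \<phi>: "\<phi> \<in> test_fun S" "\<And>x. (\<phi> has_real_derivative \<phi>' x) (at x)" "continuous_on UNIV \<phi>'"
        "\<And>x. x \<notin> {l<..<r} \<Longrightarrow> \<phi> x = 0" for \<phi> \<phi>'
    proof -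
      have z': "x \<notin> {l..r} \<Longrightarrow> \<phi>' x = 0" for x
        by (rule has_real_derivative_zero_outside[OF \<phi>(2), where l=l and r=r]) (use \<phi>(4) in auto)
      have "compact (\<phi>' ` {l..r})"
        by (rule compact_continuous_image) (use \<phi>(3) in \<open>auto intro: continuous_on_subset\<close>)
      then obtain E where E: "\<And>x. x \<in> {l..r} \<Longrightarrow> \<bar>\<phi>' x\<bar> \<le> E" "E > 0"
        by (fastforce dest!: compact_imp_bounded simp: bounded_pos)
      have [measurable]: "\<phi>' \<in> borel_measurable borel" "\<phi> \<in> borel_measurable borel"
        "f' \<in> borel_measurable borel" "g' \<in> borel_measurable borel" "F \<in> borel_measurable borel"
        using \<phi>(3) f'(1) g'(1) Fm \<phi>(2)
        by (auto intro!: borel_measurable_continuous_onI continuous_at_imp_continuous_on DERIV_isCont)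
      have d: "deriv \<phi> = \<phi>'" using \<phi>(2) by (auto simp: fun_eq_iff intro: DERIV_imp_deriv)
      have "(LINT x|lborel. \<phi>' x *\<^sub>R f' x) = (\<integral>x. deriv \<phi> x *\<^sub>R f x \<partial>lebesgue_on S)"
        unfolding d by (rule integral_lebesgue_on_eq_lborel[symmetric, OF Sb])
           (use f' in \<open>auto elim!: eventually_mono\<close>)
      also have "\<dots> = - (\<integral>x. \<phi> x *\<^sub>R g x \<partial>lebesgue_on S)"
        using weak \<phi>(1) by (auto simp: weak_deriv_def)
      also have "(\<integral>x. \<phi> x *\<^sub>R g x \<partial>lebesgue_on S) = (LINT x|lborel. \<phi> x *\<^sub>R g' x)"
        by (rule integral_lebesgue_on_eq_lborel[OF Sb])
           (use g' in \<open>auto elim!: eventually_mono\<close>)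
      also have "- \<dots> = (LINT x|lborel. \<phi>' x *\<^sub>R F x)"
        using integral_by_parts_primitive[OF g'(1,2) F \<phi>(2,3,4)] \<open>l < r\<close> by simp
      finally have eq: "(LINT x|lborel. \<phi>' x *\<^sub>R f' x) = (LINT x|lborel. \<phi>' x *\<^sub>R F x)" .
      have bd: "norm (\<phi>' x *\<^sub>R h x) \<le> E * M" if "\<And>x. x \<in> {l..r} \<Longrightarrow> norm (h x) \<le> M" for h :: "real \<Rightarrow> complex" and M x
      proof (cases "x \<in> {l..r}")
        case True then show ?thesis using E that by (auto intro!: mult_mono)
      next
        case False
        have "0 \<le> M" using order_trans[OF norm_ge_zero that[of l]] \<open>l < r\<close> by simp
        then show ?thesis using z'[OF False] E by simp
      qed
      have "integrable lborel (\<lambda>x. \<phi>' x *\<^sub>R f' x)"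
        by (rule integrable_bounded_Icc[where l=l and r=r, OF _ bd]) (use f' z' in auto)
      moreover have "integrable lborel (\<lambda>x. \<phi>' x *\<^sub>R F x)"
        by (rule integrable_bounded_Icc[where l=l and r=r, OF _ bd]) (use D z' in auto)
      ultimately show ?thesis using eq by (simp add: u_def scaleR_diff_right)
    qed
    moreover have "u \<in> borel_measurable borel" unfolding u_def using f'(1) Fm by measurable
    ultimately show ?thesis
      using weak_deriv_zero_local[of l r S u "A + D"] that by metis
  qed
  have "\<exists>c. AE x in lborel. x \<in> S \<longrightarrow> u x = c"
  proof (cases "S = {}")
    case False
    then obtain x0 where "x0 \<in> S" by auto
    then obtain l0 r0 where l0: "l0 \<in> S" "r0 \<in> S" "l0 < x0" "x0 < r0"
      using interval_rat_hull[OF S(1)] by metis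
    have sub: "{l..r} \<subseteq> S" if "l \<in> S" "r \<in> S" for l r
      using mem_is_interval_1_I[OF S(2) that] by auto
    obtain c where c: "AE x in lborel. x \<in> {l0<..<r0} \<longrightarrow> u x = c"
      using local[of l0 r0] sub l0 by auto
    have ext: "AE x in lborel. x \<in> {l<..<r} \<longrightarrow> u x = c" if "l \<in> S" "r \<in> S" for l r
    proof -
      define l' r' where "l' = min l l0" and "r' = max r r0"
      have "l' \<in> S" "r' \<in> S" "l' < r'" using that l0 by (auto simp: l'_def r'_def min_def max_def)
      then obtain c' where c': "AE x in lborel. x \<in> {l'<..<r'} \<longrightarrow> u x = c'"
        using local[of l' r'] sub by auto
      have "c' = c"
      proof (rule ccontr)
        assume ne: "c' \<noteq> c"
        have "AE x in lborel. x \<notin> {l0<..<r0}"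
          using c c' by eventually_elim (use ne in \<open>auto simp: l'_def r'_def\<close>)
        then have "{l0<..<r0} \<in> null_sets lborel" by (simp add: AE_iff_null_sets)
        then show False using l0 by (simp add: null_sets_def)
      qed
      show ?thesis using c' unfolding \<open>c' = c\<close> by eventually_elim (auto simp: l'_def r'_def)
    qed
    have "AE x in lborel. \<forall>p\<in>\<rat> \<inter> S. \<forall>q\<in>\<rat> \<inter> S. x \<in> {p<..<q} \<longrightarrow> u x = c"
      using ext by (intro AE_ball_countable' countable_Int1 countable_rat) auto
    then have "AE x in lborel. x \<in> S \<longrightarrow> u x = c"
    proof eventually_elim
      case (elim x)
      then show ?case using interval_rat_hull[OF S(1), of x] by (metis IntI greaterThanLessThan_iff)
    qed
    then show ?thesis by blast
  qed auto
  then obtain c where c: "AE x in lborel. x \<in> S \<longrightarrow> u x = c" by blast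
  show ?thesis
  proof
    show "primitive (\<lambda>x. F x + c) g'" using F by (simp add: primitive_def)
    show "AE x in lebesgue. x \<in> S \<longrightarrow> f x = F x + c"
      using AE_completion[OF c] f'(4)
      by eventually_elim (auto simp: u_def)
  qed (use g' in auto)
qed

text \<open>A nonempty open set has positive measure.\<close>

lemma AE_closed_imp_everywhere:
  fixes F :: "real \<Rightarrow> 'b::topological_space"
  assumes "open S" "continuous_on S F" "closed K" "AE x in lebesgue. x \<in> S \<longrightarrow> F x \<in> K" "x \<in> S"
  shows "F x \<in> K"
proof (rule ccontr)
  assume "F x \<notin> K"
  define U where "U = S \<inter> F -` (- K)"
  have "open U" unfolding U_def using assms by (auto intro: continuous_open_preimage)
  moreover have "negligible U"
    unfolding negligible_iff_null_sets
    using assms(4) by (rule AE_iff_null_sets[THEN iffD2, rotated, OF eventually_mono])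
       (use \<open>open U\<close> in \<open>auto simp: U_def sets_completionI_sets\<close>)
  moreover have "x \<in> U" using assms \<open>F x \<notin> K\<close> by (simp add: U_def)
  ultimately show False using open_not_negligible by blast
qed

lemma primitive_has_vector_derivative:
  assumes g: "g \<in> borel_measurable borel" and F: "primitive F g"
    and S: "open S" and G: "continuous_on S G" and ae: "AE x in lebesgue. x \<in> S \<longrightarrow> g x = G x" and x: "x \<in> S"
  shows "(F has_vector_derivative G x) (at x)"
proof -
  obtain d where d: "d > 0" "\<And>y. \<bar>y - x\<bar> < d \<Longrightarrow> y \<in> S"
    using S x by (auto simp: open_real)
  define l r where "l = x - d/2" and "r = x + d/2"
  have lr: "l < x" "x < r" "{l..r} \<subseteq> S"
    using d by (auto simp: l_def r_def abs_if intro!: d(2))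
  have eq: "F y = F l + integral {l..y} G" if "y \<in> {l..r}" for y
  proof -
    have cG: "continuous_on {l..y} G"
      using that lr(3) by (intro continuous_on_subset[OF G]) auto
    have "F y - F l = (LINT t|lborel. indicat_real {l..y} t *\<^sub>R g t)"
      using F that by (auto simp: primitive_def)
    also have "\<dots> = (LINT t|lborel. indicat_real {l..y} t *\<^sub>R G t)"
    proof (rule integral_cong_AE)
      show "AE t in lborel. indicat_real {l..y} t *\<^sub>R g t = indicat_real {l..y} t *\<^sub>R G t"
        using ae[unfolded AE_completion_iff]
      proof eventually_elim
        case (elim t)
        show ?case
        proof (cases "t \<in> {l..y}")
          case True
          then have "t \<in> {l..r}" using that by auto
          then have "t \<in> S" using lr(3) by blast
          then show ?thesis using elim by simp
        qed simp
      qed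
      show "(\<lambda>t. indicat_real {l..y} t *\<^sub>R G t) \<in> borel_measurable lborel"
        using borel_measurable_continuous_on_indicator[OF _ cG] by simp
    qed (use g in auto)
    also have "\<dots> = integral {l..y} G"
      using borel_integrable_compact[of "{l..y}" G] cG
      by (subst set_borel_integral_eq_integral(2)[symmetric])
         (auto simp: set_integrable_def set_lebesgue_integral_def)
    finally show ?thesis by (simp add: algebra_simps)
  qed
  have "((\<lambda>y. F l + integral {l..y} G) has_vector_derivative 0 + G x) (at x within {l..r})"
    by (intro has_vector_derivative_add has_vector_derivative_const integral_has_vector_derivative)
       (use lr G in \<open>auto intro: continuous_on_subset\<close>)
  then have h: "((\<lambda>y. F l + integral {l..y} G) has_vector_derivative G x) (at x within {l..r})"
    by simp
  have "(F has_vector_derivative G x) (at x within {l..r})"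
    by (rule has_vector_derivative_transform[OF _ eq h]) (use lr in auto)
  then show ?thesis using lr at_within_interior[of x "{l..r}"] by simp
qed

text \<open>Three weak derivatives give a chain of three primitives, of which the first one is Lipschitz; hence
two classical derivatives, the second one continuous.\<close>

lemma W_infty_3_classical:
  fixes f :: "real \<Rightarrow> complex"
  assumes S: "open S" "is_interval S" and f: "f \<in> W_infty 3 S"
  obtains e e1 e2 C where "AE x in lebesgue. x \<in> S \<longrightarrow> f x = e x"
    "\<And>x. x \<in> S \<Longrightarrow> (e has_vector_derivative e1 x) (at x)"
    "\<And>x. x \<in> S \<Longrightarrow> (e1 has_vector_derivative e2 x) (at x)"
    "continuous_on S e2"
    "\<And>x. x \<in> S \<Longrightarrow> norm (e x) \<le> C" "\<And>x. x \<in> S \<Longrightarrow> norm (e1 x) \<le> C" "\<And>x. x \<in> S \<Longrightarrow> norm (e2 x) \<le> C"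
proof -
  have bound: "\<exists>C. \<forall>x\<in>S. norm (F x) \<le> C"
    if h: "h \<in> L_infty S" "continuous_on S F" "AE x in lebesgue. x \<in> S \<longrightarrow> h x = F x"
    for h F :: "real \<Rightarrow> complex"
  proof -
    have SL: "S \<in> sets lebesgue" using S(1) by (simp add: sets_completionI_sets)
    obtain C where C: "AE x in lebesgue_on S. norm (h x) \<le> C" using h(1) unfolding L_infty_def by blast
    then have "AE x in lebesgue. x \<in> S \<longrightarrow> norm (h x) \<le> C"
      using SL by (subst (asm) AE_restrict_space_iff) auto
    then have "AE x in lebesgue. x \<in> S \<longrightarrow> F x \<in> cball 0 C"
      using h(3) by eventually_elim auto
    then show ?thesis
      using AE_closed_imp_everywhere[OF S(1) h(2), of "cball 0 C"] by auto
  qed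
  obtain g1 g2 g3 where g: "f \<in> L_infty S" "g1 \<in> L_infty S" "g2 \<in> L_infty S" "g3 \<in> L_infty S"
    "weak_deriv S f g1" "weak_deriv S g1 g2" "weak_deriv S g2 g3"
    using f by (auto simp: numeral_3_eq_3)
  obtain e2 h3 B3 where 2: "h3 \<in> borel_measurable borel" "\<And>x. norm (h3 x) \<le> B3"
     "AE x in lebesgue. x \<in> S \<longrightarrow> g3 x = h3 x" "primitive e2 h3" "AE x in lebesgue. x \<in> S \<longrightarrow> g2 x = e2 x"
    by (rule weak_deriv_imp_primitive[OF S g(3,4,7)]) (rule that)
  have c2: "continuous_on S e2"
  proof (rule lipschitz_on_continuous_on)
    show "\<bar>B3\<bar>-lipschitz_on S e2"
      using primitive_lipschitz[OF 2(1,2,4)] by (intro lipschitz_onI)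
        (auto simp: dist_norm intro: order_trans[OF _ mult_right_mono[OF abs_ge_self]])
  qed
  obtain e1 h2 B2 where 1: "h2 \<in> borel_measurable borel" "\<And>x. norm (h2 x) \<le> B2"
     "AE x in lebesgue. x \<in> S \<longrightarrow> g2 x = h2 x" "primitive e1 h2" "AE x in lebesgue. x \<in> S \<longrightarrow> g1 x = e1 x"
    by (rule weak_deriv_imp_primitive[OF S g(2,3,6)]) (rule that)
  have "AE x in lebesgue. x \<in> S \<longrightarrow> h2 x = e2 x" using 1(3) 2(5) by eventually_elim simp
  then have d1: "(e1 has_vector_derivative e2 x) (at x)" if "x \<in> S" for x
    using primitive_has_vector_derivative[OF 1(1,4) S(1) c2 _ that] by simp
  have c1: "continuous_on S e1"
    using d1 by (auto intro!: continuous_at_imp_continuous_on has_vector_derivative_continuous)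
  obtain e h1 B1 where 0: "h1 \<in> borel_measurable borel" "\<And>x. norm (h1 x) \<le> B1"
     "AE x in lebesgue. x \<in> S \<longrightarrow> g1 x = h1 x" "primitive e h1" "AE x in lebesgue. x \<in> S \<longrightarrow> f x = e x"
    by (rule weak_deriv_imp_primitive[OF S g(1,2,5)]) (rule that)
  have "AE x in lebesgue. x \<in> S \<longrightarrow> h1 x = e1 x" using 0(3) 1(5) by eventually_elim simp
  then have d0: "(e has_vector_derivative e1 x) (at x)" if "x \<in> S" for x
    using primitive_has_vector_derivative[OF 0(1,4) S(1) c1 _ that] by simp
  have c0: "continuous_on S e"
    using d0 by (auto intro!: continuous_at_imp_continuous_on has_vector_derivative_continuous)
  obtain C0 where C0: "\<And>x. x \<in> S \<Longrightarrow> norm (e x) \<le> C0" using bound[OF g(1) c0 0(5)] by auto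
  obtain C1 where C1: "\<And>x. x \<in> S \<Longrightarrow> norm (e1 x) \<le> C1" using bound[OF g(2) c1 1(5)] by auto
  obtain C2 where C2: "\<And>x. x \<in> S \<Longrightarrow> norm (e2 x) \<le> C2" using bound[OF g(3) c2 2(5)] by auto
  show ?thesis
    by (rule that[of e e1 e2 "max C0 (max C1 C2)"])
       (use 0(5) d0 d1 c2 C0 C1 C2 in \<open>auto simp: le_max_iff_disj\<close>)
qed

section \<open>Periodic functions up to an integrable remainder\<close>

lemma AE_shift:
  fixes t :: real
  assumes "AE x in lborel. P x"
  shows "AE x in lborel. P (x + t)"
proof -
  obtain N where N: "N \<in> null_sets lborel" "{x \<in> space lborel. \<not> P x} \<subseteq> N"
    using assms by (auto simp: eventually_ae_filter)
  have Nb: "N \<in> sets borel" using N(1) by auto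
  have "AE x in lborel. x \<notin> N" using N(1) by (rule AE_not_in)
  then have "AE x in lborel. t + 1 * x \<notin> N"
    using Nb by (intro AE_borel_affine) auto
  then show ?thesis
    by eventually_elim (use N(2) in \<open>auto simp: add.commute\<close>)
qed

text \<open>The translates of one period cell by multiples of \<open>\<tau>\<close> are disjoint. So the sum over \<open>k\<close> of the
integrals of \<open>|h(x + k\<tau>)|\<close> over the cell is at most the integral of \<open>|h|\<close>, and the series converges
almost everywhere.\<close>

lemma AE_translates_tendsto_0:
  fixes h :: "real \<Rightarrow> real"
  assumes h: "h \<in> borel_measurable borel" and fin: "(\<integral>\<^sup>+x. ennreal \<bar>h x\<bar> \<partial>lborel) < \<infinity>"
    and a: "a > 0" "\<bar>\<tau>\<bar> = a"
  shows "AE x in lborel. (\<lambda>k. h (x + real k * \<tau>)) \<longlonglongrightarrow> 0"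
proof -
  have [measurable]: "h \<in> borel_measurable borel" by fact
  have loc: "AE x in lborel. x \<in> {of_int m * a..<of_int m * a + a} \<longrightarrow> (\<lambda>k. h (x + real k * \<tau>)) \<longlonglongrightarrow> 0" for m :: int
  proof -
    define J where "J = {of_int m * a..<of_int m * a + a}"
    have [measurable]: "J \<in> sets borel" by (simp add: J_def)
    define A where "A k = {y. y - real k * \<tau> \<in> J}" for k :: nat
    have [measurable]: "A k \<in> sets borel" for k unfolding A_def by measurable
    have dis: "disjoint_family A"
      unfolding disjoint_family_on_def
    proof (intro ballI impI, rule ccontr)
      fix i j :: nat assume "i \<noteq> j" "A i \<inter> A j \<noteq> {}"
      then obtain y where "y - real i * \<tau> \<in> J" "y - real j * \<tau> \<in> J" by (auto simp: A_def)
      then have "\<bar>(real i - real j) * \<tau>\<bar> < a" by (auto simp: J_def algebra_simps abs_if)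
      moreover have "\<bar>(real i - real j) * \<tau>\<bar> \<ge> 1 * a"
        unfolding abs_mult a(2) using \<open>i \<noteq> j\<close> a(1) by (intro mult_right_mono) auto
      ultimately show False by simp
    qed
    have "(\<integral>\<^sup>+x. (\<Sum>k. ennreal \<bar>h (x + real k * \<tau>)\<bar> * indicator J x) \<partial>lborel)
        = (\<Sum>k. \<integral>\<^sup>+x. ennreal \<bar>h (x + real k * \<tau>)\<bar> * indicator J x \<partial>lborel)"
      by (rule nn_integral_suminf) measurable
    also have "\<dots> = (\<Sum>k. \<integral>\<^sup>+y. ennreal \<bar>h y\<bar> * indicator (A k) y \<partial>lborel)"
    proof (rule suminf_cong)
      fix k
      have "(\<integral>\<^sup>+y. ennreal \<bar>h y\<bar> * indicator (A k) y \<partial>lborel) =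
          ennreal \<bar>1\<bar> * (\<integral>\<^sup>+x. ennreal \<bar>h (real k * \<tau> + 1 * x)\<bar> * indicator (A k) (real k * \<tau> + 1 * x) \<partial>lborel)"
        by (rule nn_integral_real_affine) auto
      then show "(\<integral>\<^sup>+x. ennreal \<bar>h (x + real k * \<tau>)\<bar> * indicator J x \<partial>lborel) = (\<integral>\<^sup>+y. ennreal \<bar>h y\<bar> * indicator (A k) y \<partial>lborel)"
        by (simp add: A_def indicator_def add.commute)
    qed
    also have "\<dots> = (\<integral>\<^sup>+y. (\<Sum>k. ennreal \<bar>h y\<bar> * indicator (A k) y) \<partial>lborel)"
      by (rule nn_integral_suminf[symmetric]) measurable
    also have "\<dots> \<le> (\<integral>\<^sup>+y. ennreal \<bar>h y\<bar> \<partial>lborel)"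
    proof (rule nn_integral_mono)
      fix y
      have "(\<Sum>k. ennreal \<bar>h y\<bar> * indicator (A k) y) = ennreal \<bar>h y\<bar> * (\<Sum>k. indicator (A k) y)"
        by (rule ennreal_suminf_cmult)
      also have "\<dots> = ennreal \<bar>h y\<bar> * indicator (\<Union>k. A k) y"
        using suminf_indicator[OF dis] by simp
      also have "\<dots> \<le> ennreal \<bar>h y\<bar>" by (simp add: indicator_def)
      finally show "(\<Sum>k. ennreal \<bar>h y\<bar> * indicator (A k) y) \<le> ennreal \<bar>h y\<bar>" .
    qed
    finally have "(\<integral>\<^sup>+x. (\<Sum>k. ennreal \<bar>h (x + real k * \<tau>)\<bar> * indicator J x) \<partial>lborel) \<noteq> \<infinity>"
      using fin by (auto simp: top_unique)
    then have "AE x in lborel. (\<Sum>k. ennreal \<bar>h (x + real k * \<tau>)\<bar> * indicator J x) \<noteq> \<infinity>"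
      by (intro nn_integral_PInf_AE) measurable
    then show ?thesis
    proof eventually_elim
      case (elim x)
      show ?case
      proof
        assume "x \<in> {of_int m * a..<of_int m * a + a}"
        then have "(\<Sum>k. ennreal \<bar>h (x + real k * \<tau>)\<bar>) \<noteq> top" using elim by (simp add: J_def)
        then have "summable (\<lambda>k. \<bar>h (x + real k * \<tau>)\<bar>)"
          by (intro summable_suminf_not_top) auto
        then show "(\<lambda>k. h (x + real k * \<tau>)) \<longlonglongrightarrow> 0"
          using summable_LIMSEQ_zero tendsto_rabs_zero_iff by blast
      qed
    qed
  qed
  have "AE x in lborel. \<forall>m::int. x \<in> {of_int m * a..<of_int m * a + a} \<longrightarrow> (\<lambda>k. h (x + real k * \<tau>)) \<longlonglongrightarrow> 0"
    using loc by (subst AE_all_countable) auto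
  then show ?thesis
  proof eventually_elim
    case (elim x)
    have "of_int \<lfloor>x / a\<rfloor> * a \<le> x"
      using of_int_floor_le[of "x / a"] a(1) by (simp only: pos_le_divide_eq)
    moreover have "x < of_int \<lfloor>x / a\<rfloor> * a + a"
      using floor_correct[of "x / a"] a(1) by (simp add: field_simps)
    ultimately have "of_int \<lfloor>x / a\<rfloor> * a \<le> x" "x < of_int \<lfloor>x / a\<rfloor> * a + a" .
    then show ?case using elim by auto
  qed
qed

lemma dense_if_AE:
  assumes "AE x in lborel. P (x::real)" "d > 0"
  obtains y where "\<bar>y - x\<bar> < d" "P y"
proof -
  have "\<exists>y\<in>ball x d. P y"
  proof (rule ccontr)
    assume no: "\<not> ?thesis"
    have "AE y in lborel. y \<notin> ball x d" using assms(1) by eventually_elim (use no in auto)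
    then have "ball x d \<in> null_sets lborel" by (simp add: AE_iff_null_sets)
    then have "negligible (ball x d)" by (simp add: negligible_iff_null_sets null_sets_completionI)
    then show False using assms(2) open_not_negligible[of "ball x d"] by auto
  qed
  then show ?thesis using that by (auto simp: dist_real_def abs_minus_commute)
qed

text \<open>The representative is \<open>p(x) = lim e(x + k\<tau>)\<close>, where \<open>\<tau>\<close> is the period directed into the half-line.
For almost every \<open>x\<close> the limit exists and equals \<open>q x\<close>, because the integrable remainder tends to zero
along the orbit; as \<open>e\<close> is Lipschitz, existence extends to all \<open>x\<close> and \<open>p\<close> inherits the Lipschitz
constant. Convergence is uniform on a period by a finite net, hence \<open>e - p\<close> tends to zero at infinity.\<close>

lemma continuous_periodic_representative:
  fixes e q as :: "real \<Rightarrow> complex"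
  assumes a: "a > 0" and S: "S = {0<..} \<and> \<tau> = a \<or> S = {..<0} \<and> \<tau> = - a"
    and dec: "AE x in lebesgue. x \<in> S \<longrightarrow> q x + as x = e x"
    and lip: "\<And>x y. x \<in> S \<Longrightarrow> y \<in> S \<Longrightarrow> norm (e x - e y) \<le> L * \<bar>x - y\<bar>"
    and per: "\<And>x. q (x + a) = q x"
    and as: "as absolutely_integrable_on S"
  obtains p where "continuous_on UNIV p" "\<And>x. p (x + a) = p x" "AE x in lebesgue. q x = p x"
    "(\<lambda>x. e x - p x) absolutely_integrable_on S"
    "\<And>\<eta>. \<eta> > 0 \<Longrightarrow> \<exists>R. \<forall>x\<in>S. \<bar>x\<bar> \<ge> R \<longrightarrow> norm (e x - p x) < \<eta>"
proof -
  have absT: "\<bar>\<tau>\<bar> = a" using S a by auto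
  have L0: "L \<ge> 0"
  proof -
    obtain x y where "x \<in> S" "y \<in> S" "x \<noteq> y"
      using S by (elim disjE) (auto intro: that[of 1 2] that[of "-1" "-2"])
    then have "0 \<le> L * \<bar>x - y\<bar>" using order_trans[OF norm_ge_zero lip] by blast
    then show ?thesis using \<open>x \<noteq> y\<close> by (simp add: zero_le_mult_iff)
  qed
  have evS: "\<exists>K. \<forall>k\<ge>K. x + real k * \<tau> \<in> S" for x
  proof -
    obtain K where K: "\<bar>x\<bar> < real K * a" using ex_less_of_nat_mult[OF a] by blast
    have "x + real k * \<tau> \<in> S" if "k \<ge> K" for k
    proof -
      have "real K * a \<le> real k * a" using that a by (intro mult_right_mono) auto
      then show ?thesis using S K by auto
    qed
    then show ?thesis by blast
  qed
  have perT: "q (x + real k * \<tau>) = q x" for x k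
  proof (induction k)
    case (Suc k)
    have "q (y + \<tau>) = q y" for y using S per[of y] per[of "y - a"] by auto
    from this[of "x + real k * \<tau>"] Suc show ?case by (simp add: algebra_simps)
  qed simp
  define as' where "as' x = indicat_real S x *\<^sub>R as x" for x
  have iS: "integrable lebesgue as'" using as unfolding set_integrable_def as'_def .
  have "(\<lambda>x. norm (as' x)) \<in> borel_measurable lebesgue" using iS by auto
  then obtain h where h: "h \<in> borel_measurable borel" "AE x in lborel. norm (as' x) = h x"
    using completion_ex_borel_measurable_real[of "\<lambda>x. norm (as' x)" lborel] by auto
  have "(\<integral>\<^sup>+x. ennreal \<bar>h x\<bar> \<partial>lborel) = (\<integral>\<^sup>+x. ennreal (norm (as' x)) \<partial>lebesgue)"
    unfolding nn_integral_completion
  proof (rule nn_integral_cong_AE)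
    show "AE x in lborel. ennreal \<bar>h x\<bar> = ennreal (norm (as' x))"
      using h(2) by eventually_elim (metis abs_norm_cancel)
  qed
  also have "\<dots> < \<infinity>" using iS by (simp add: integrable_iff_bounded)
  finally have fin: "(\<integral>\<^sup>+x. ennreal \<bar>h x\<bar> \<partial>lborel) < \<infinity>" .
  have dec': "AE x in lborel. x \<in> S \<longrightarrow> q x + as x = e x" using dec by (simp add: AE_completion_iff)
  have "AE x in lborel. \<forall>k. norm (as' (x + real k * \<tau>)) = h (x + real k * \<tau>)"
    by (subst AE_all_countable) (intro allI AE_shift h(2))
  moreover have "AE x in lborel. \<forall>k. x + real k * \<tau> \<in> S \<longrightarrow> q (x + real k * \<tau>) + as (x + real k * \<tau>) = e (x + real k * \<tau>)"
    by (subst AE_all_countable) (intro allI AE_shift[OF dec'])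
  moreover note AE_translates_tendsto_0[OF h(1) fin a absT]
  ultimately have good: "AE x in lborel. (\<lambda>k. e (x + real k * \<tau>)) \<longlonglongrightarrow> q x"
  proof eventually_elim
    case (elim x)
    obtain K where K: "\<And>k. k \<ge> K \<Longrightarrow> x + real k * \<tau> \<in> S" using evS by blast
    have "(\<lambda>k. as' (x + real k * \<tau>)) \<longlonglongrightarrow> 0"
      using elim by (subst tendsto_norm_zero_iff[symmetric]) simp
    then have "(\<lambda>k. q x + as' (x + real k * \<tau>)) \<longlonglongrightarrow> q x + 0" by (intro tendsto_intros)
    then have "(\<lambda>k. q x + as' (x + real k * \<tau>)) \<longlonglongrightarrow> q x" by simp
    then show ?case
    proof (rule Lim_transform_eventually[OF _ eventually_sequentiallyI[of K]])
      fix k assume "K \<le> k"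
      then show "q x + as' (x + real k * \<tau>) = e (x + real k * \<tau>)"
        using K[of k] elim(2) by (auto simp: as'_def perT)
    qed
  qed
  \<comment> \<open>The sequences at nearby points stay uniformly close, so convergence at a dense set of points suffices.\<close>
  have conv: "convergent (\<lambda>k. e (x + real k * \<tau>))" for x
    unfolding Cauchy_convergent_iff[symmetric]
  proof (rule metric_CauchyI)
    fix \<eta> :: real assume "\<eta> > 0"
    define d where "d = \<eta> / (4 * (L + 1))"
    have d: "d > 0" "L * d < \<eta> / 3" using \<open>\<eta> > 0\<close> L0 mult_nonneg_nonneg[of L \<eta>]
      by (auto simp: d_def field_simps intro!: add_nonneg_pos)
    obtain y where y: "\<bar>y - x\<bar> < d" "(\<lambda>k. e (y + real k * \<tau>)) \<longlonglongrightarrow> q y"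
      using dense_if_AE[OF good d(1)] by blast
    have "Cauchy (\<lambda>k. e (y + real k * \<tau>))" using y(2) by (rule LIMSEQ_imp_Cauchy)
    then obtain M where M: "\<And>m n. m \<ge> M \<Longrightarrow> n \<ge> M \<Longrightarrow> dist (e (y + real m * \<tau>)) (e (y + real n * \<tau>)) < \<eta> / 3"
      using \<open>\<eta> > 0\<close> metric_CauchyD[of _ "\<eta> / 3"] by (metis zero_less_divide_iff zero_less_numeral)
    obtain K1 K2 where K: "\<And>k. k \<ge> K1 \<Longrightarrow> x + real k * \<tau> \<in> S" "\<And>k. k \<ge> K2 \<Longrightarrow> y + real k * \<tau> \<in> S"
      using evS by metis
    have near: "dist (e (x + real k * \<tau>)) (e (y + real k * \<tau>)) < \<eta> / 3" if "k \<ge> K1" "k \<ge> K2" for k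
    proof -
      have "dist (e (x + real k * \<tau>)) (e (y + real k * \<tau>)) \<le> L * \<bar>x - y\<bar>"
        using lip[OF K(1)[OF that(1)] K(2)[OF that(2)]] by (simp add: dist_norm)
      also have "\<dots> \<le> L * d" using y(1) L0 by (intro mult_left_mono) auto
      finally show ?thesis using d(2) by simp
    qed
    show "\<exists>M. \<forall>m\<ge>M. \<forall>n\<ge>M. dist (e (x + real m * \<tau>)) (e (x + real n * \<tau>)) < \<eta>"
    proof (intro exI allI impI)
      fix m n assume "max M (max K1 K2) \<le> m" "max M (max K1 K2) \<le> n"
      then have "dist (e (x + real m * \<tau>)) (e (y + real m * \<tau>)) < \<eta> / 3"
        "dist (e (x + real n * \<tau>)) (e (y + real n * \<tau>)) < \<eta> / 3"
        "dist (e (y + real m * \<tau>)) (e (y + real n * \<tau>)) < \<eta> / 3"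
        using near M by auto
      then show "dist (e (x + real m * \<tau>)) (e (x + real n * \<tau>)) < \<eta>"
        using dist_triangle_third[of "e (x + real m * \<tau>)" "e (y + real m * \<tau>)" \<eta> "e (y + real n * \<tau>)" "e (x + real n * \<tau>)"]
        by (simp add: dist_commute)
    qed
  qed
  define p where "p x = lim (\<lambda>k. e (x + real k * \<tau>))" for x
  have lim: "(\<lambda>k. e (x + real k * \<tau>)) \<longlonglongrightarrow> p x" for x
    unfolding p_def using conv convergent_LIMSEQ_iff by blast
  have plip: "norm (p x - p y) \<le> L * \<bar>x - y\<bar>" for x y
  proof (rule tendsto_upperbound)
    show "(\<lambda>k. norm (e (x + real k * \<tau>) - e (y + real k * \<tau>))) \<longlonglongrightarrow> norm (p x - p y)"
      by (intro tendsto_intros lim)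
    obtain K1 K2 where K: "\<And>k. k \<ge> K1 \<Longrightarrow> x + real k * \<tau> \<in> S" "\<And>k. k \<ge> K2 \<Longrightarrow> y + real k * \<tau> \<in> S"
      using evS by metis
    show "\<forall>\<^sub>F k in sequentially. norm (e (x + real k * \<tau>) - e (y + real k * \<tau>)) \<le> L * \<bar>x - y\<bar>"
    proof (rule eventually_sequentiallyI)
      fix k assume "max K1 K2 \<le> k"
      then have "norm (e (x + real k * \<tau>) - e (y + real k * \<tau>)) \<le> L * \<bar>(x + real k * \<tau>) - (y + real k * \<tau>)\<bar>"
        using K by (intro lip) auto
      then show "norm (e (x + real k * \<tau>) - e (y + real k * \<tau>)) \<le> L * \<bar>x - y\<bar>" by simp
    qed
  qed simp
  have pT: "p (x + \<tau>) = p x" for x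
  proof -
    have "(\<lambda>k. e (x + real (Suc k) * \<tau>)) \<longlonglongrightarrow> p x" by (rule LIMSEQ_Suc[OF lim])
    moreover have "(\<lambda>k. e (x + real (Suc k) * \<tau>)) = (\<lambda>k. e (x + \<tau> + real k * \<tau>))"
      by (simp add: algebra_simps)
    ultimately show ?thesis using LIMSEQ_unique[OF lim[of "x + \<tau>"]] by simp
  qed
  have pTk: "p (x + real k * \<tau>) = p x" for x k
  proof (induction k)
    case (Suc k)
    from pT[of "x + real k * \<tau>"] Suc show ?case by (simp add: algebra_simps)
  qed simp
  have qp: "AE x in lborel. q x = p x"
    using good by eventually_elim (use lim LIMSEQ_unique in blast)
  show ?thesis
  proof
    show "continuous_on UNIV p"
      by (rule lipschitz_on_continuous_on[of L]) (use plip L0 in \<open>auto intro!: lipschitz_onI simp: dist_norm\<close>)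
    show "p (x + a) = p x" for x using S pT[of x] pT[of "x + a"] by auto
    show "AE x in lebesgue. q x = p x" using qp by (simp add: AE_completion_iff)
    have "AE x in lebesgue. x \<in> S \<longrightarrow> as x = e x - p x"
      using AE_completion[OF dec'] AE_completion[OF qp]
      by eventually_elim (auto simp: eq_diff_eq add.commute)
    then obtain N where N: "N \<in> null_sets lebesgue" "{x. \<not> (x \<in> S \<longrightarrow> as x = e x - p x)} \<subseteq> N"
      by (auto simp: eventually_ae_filter)
    show "(\<lambda>x. e x - p x) absolutely_integrable_on S"
      by (rule absolutely_integrable_spike[OF as]) (use N in \<open>auto simp: negligible_iff_null_sets\<close>)
  next
    fix \<eta> :: real assume "\<eta> > 0"
    define d where "d = \<eta> / (4 * (L + 1))"
    have d: "d > 0" "L * d < \<eta> / 3" using \<open>\<eta> > 0\<close> L0 mult_nonneg_nonneg[of L \<eta>]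
      by (auto simp: d_def field_simps intro!: add_nonneg_pos)
    have "{0..a} \<subseteq> (\<Union>x\<in>{0..a}. ball x d)" using d(1) by auto
    then obtain D where D: "D \<subseteq> {0..a}" "finite D" "{0..a} \<subseteq> (\<Union>x\<in>D. ball x d)"
      by (rule compactE_image[OF compact_Icc open_ball])
    have "\<forall>\<^sub>F k in sequentially. \<forall>y\<in>D. dist (e (y + real k * \<tau>)) (p y) < \<eta> / 3"
    proof (intro eventually_ball_finite D(2) ballI)
      fix y show "\<forall>\<^sub>F k in sequentially. dist (e (y + real k * \<tau>)) (p y) < \<eta> / 3"
        by (rule tendstoD[OF lim]) (use \<open>\<eta> > 0\<close> in simp)
    qed
    then obtain M where M: "\<And>k y. k \<ge> M \<Longrightarrow> y \<in> D \<Longrightarrow> dist (e (y + real k * \<tau>)) (p y) < \<eta> / 3"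
      by (auto simp: eventually_sequentially)
    have main: "norm (e (y + real k * \<tau>) - p y) < \<eta>" if yk: "y \<in> {0..a}" "k \<ge> M" "k \<ge> 2" for y k
    proof -
      obtain z where z: "z \<in> D" "\<bar>z - y\<bar> < d" using D(3) yk(1) by (auto simp: dist_real_def)
      have inS: "w + real k * \<tau> \<in> S" if "w \<in> {0..a}" for w
      proof -
        have "2 * a \<le> real k * a" using \<open>k \<ge> 2\<close> a by (intro mult_right_mono) auto
        then show ?thesis using S that a
          by (elim disjE conjE) (simp_all only: greaterThan_iff lessThan_iff atLeastAtMost_iff, linarith+)
      qed
      have "z \<in> {0..a}" using z D by auto
      then have "norm (e (y + real k * \<tau>) - e (z + real k * \<tau>)) \<le> L * \<bar>(y + real k * \<tau>) - (z + real k * \<tau>)\<bar>"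
        using that by (intro lip inS) auto
      also have "\<dots> \<le> L * d" using z(2) L0 by (intro mult_left_mono) auto
      finally have 1: "norm (e (y + real k * \<tau>) - e (z + real k * \<tau>)) < \<eta> / 3" using d(2) by simp
      have "norm (p z - p y) \<le> L * d" using plip[of z y] z(2) L0 mult_left_mono[of "\<bar>z - y\<bar>" d L] by simp
      then have 2: "norm (p z - p y) < \<eta> / 3" using d(2) by simp
      have 3: "norm (e (z + real k * \<tau>) - p z) < \<eta> / 3" using M[OF that(2) z(1)] by (simp add: dist_norm)
      have "norm (e (y + real k * \<tau>) - p y) \<le> norm (e (y + real k * \<tau>) - e (z + real k * \<tau>)) + norm (e (z + real k * \<tau>) - p z) + norm (p z - p y)"
        using norm_triangle_ineq[of "e (y + real k * \<tau>) - e (z + real k * \<tau>)" "e (z + real k * \<tau>) - p z"]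
          norm_triangle_ineq[of "e (y + real k * \<tau>) - p z" "p z - p y"] by simp
      then show ?thesis using 1 2 3 by simp
    qed
    show "\<exists>R. \<forall>x\<in>S. \<bar>x\<bar> \<ge> R \<longrightarrow> norm (e x - p x) < \<eta>"
    proof (intro exI ballI impI)
      fix x assume x: "x \<in> S" "\<bar>x\<bar> \<ge> real (M + 3) * a"
      \<comment> \<open>The number of steps \<open>\<tau>\<close> from the cell \<open>[0, a]\<close> to \<open>x\<close>; on the negative side the floor rounds the wrong way.\<close>
      define k where "k = (if \<tau> = a then nat \<lfloor>x / a\<rfloor> else nat \<lfloor>- x / a\<rfloor> + 1)"
      have "real (nat \<lfloor>\<bar>x\<bar> / a\<rfloor>) = of_int \<lfloor>\<bar>x\<bar> / a\<rfloor>" using a by simp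
      moreover have "of_int \<lfloor>\<bar>x\<bar> / a\<rfloor> * a \<le> \<bar>x\<bar>"
        using of_int_floor_le[of "\<bar>x\<bar> / a"] a by (simp only: pos_le_divide_eq)
      moreover have "\<bar>x\<bar> < of_int \<lfloor>\<bar>x\<bar> / a\<rfloor> * a + a"
        using floor_correct[of "\<bar>x\<bar> / a"] a by (simp add: field_simps)
      ultimately have fl: "real (nat \<lfloor>\<bar>x\<bar> / a\<rfloor>) * a \<le> \<bar>x\<bar>" "\<bar>x\<bar> < real (nat \<lfloor>\<bar>x\<bar> / a\<rfloor>) * a + a"
        by simp_all
      have "M + 3 \<le> nat \<lfloor>\<bar>x\<bar> / a\<rfloor>"
        using x(2) a by (simp add: le_nat_iff le_floor_iff field_simps)
      moreover have "k = nat \<lfloor>\<bar>x\<bar> / a\<rfloor> \<and> \<tau> = a \<and> x > 0 \<or> k = nat \<lfloor>\<bar>x\<bar> / a\<rfloor> + 1 \<and> \<tau> = - a \<and> x < 0"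
        using S x(1) a by (auto simp: k_def)
      moreover obtain j where j: "j = nat \<lfloor>\<bar>x\<bar> / a\<rfloor>" by simp
      ultimately have k: "k \<ge> M" "k \<ge> 2" "x - real k * \<tau> \<in> {0..a}"
        using fl unfolding j[symmetric] by (auto simp: algebra_simps)
      show "norm (e x - p x) < \<eta>"
        using main[OF k(3,1,2)] pTk[of "x - real k * \<tau>" k] by simp
    qed
  qed
qed

section \<open>Floquet solutions in the case of stability\<close>

lemma has_vector_derivative_within_Un:
  assumes "(f has_vector_derivative d) (at x within A)" "(f has_vector_derivative d) (at x within B)"
  shows "(f has_vector_derivative d) (at x within A \<union> B)"
  using assms unfolding has_vector_derivative_def has_derivative_within
  by (simp add: at_within_union filterlim_sup Lim_within_Un)

lemma has_vector_derivative_shift_within: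
  fixes f :: "real \<Rightarrow> 'b::real_normed_vector"
  assumes "(f has_vector_derivative d) (at (x - c) within {l..r})"
  shows "((\<lambda>x. f (x - c)) has_vector_derivative d) (at x within {l + c..r + c})"
proof -
  have eq: "(\<lambda>x. x - c) ` {l + c..r + c} = {l..r}"
    by (simp add: image_diff_atLeastAtMost)
  have "((f \<circ> (\<lambda>x. x - c)) has_vector_derivative 1 *\<^sub>R d) (at x within {l + c..r + c})"
    by (rule vector_diff_chain_within) (use assms eq in \<open>auto intro!: derivative_eq_intros simp: has_vector_derivative_def\<close>)
  then show ?thesis by (simp add: o_def)
qed

text \<open>The extension multiplies by \<open>\<mu>\<close> in each further period. The boundary relation makes the two
one-sided derivatives agree at multiples of the period, and \<open>|\<mu>| = 1\<close> makes the modulus periodic.\<close>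

lemma floquet_extension:
  fixes \<alpha> \<beta> v h :: "real \<Rightarrow> complex"
  assumes a: "a > 0" and per: "\<And>t. \<alpha> (t + a) = \<alpha> t" "\<And>t. \<beta> (t + a) = \<beta> t"
    and v: "\<And>t. t \<in> {0..a} \<Longrightarrow> (v has_vector_derivative \<alpha> t * h t) (at t within {0..a})"
    and h: "\<And>t. t \<in> {0..a} \<Longrightarrow> (h has_vector_derivative \<beta> t * v t) (at t within {0..a})"
    and bd: "v a = \<mu> * v 0" "h a = \<mu> * h 0" and \<mu>: "norm \<mu> = 1"
  obtains V H where "\<And>t. (V has_vector_derivative \<alpha> t * H t) (at t)" "\<And>t. (H has_vector_derivative \<beta> t * V t) (at t)"
    "\<And>t. norm (V (t + a)) = norm (V t)" "\<And>t. norm (H (t + a)) = norm (H t)"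
    "\<And>t. t \<in> {0..a} \<Longrightarrow> V t = v t" "\<And>t. t \<in> {0..a} \<Longrightarrow> H t = h t"
proof -
  have \<mu>0: "\<mu> \<noteq> 0" using \<mu> by auto
  define E where "E f t = \<mu> powi \<lfloor>t / a\<rfloor> * f (t - of_int \<lfloor>t / a\<rfloor> * a)" for f :: "real \<Rightarrow> complex" and t
  have perm: "f (t - of_int m * a) = f t" if f: "\<And>t. f (t + a) = f t" for f :: "real \<Rightarrow> complex" and m :: int and t
  proof (induction m rule: int_induct[where k=0])
    case (step1 i) then show ?case using f[of "t - of_int (i + 1) * a"] by (simp add: algebra_simps)
  next
    case (step2 i) then show ?case using f[of "t - of_int i * a"] by (simp add: algebra_simps)
  qed simp
  \<comment> \<open>At the right endpoint of a cell both neighbouring formulas are valid, by the boundary relation.\<close>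
  have E: "E f t = \<mu> powi m * f (t - of_int m * a)" if f: "f a = \<mu> * f 0" and t: "t \<in> {of_int m * a..of_int m * a + a}" for f m t
  proof (cases "t = of_int m * a + a")
    case True
    then have "\<lfloor>t / a\<rfloor> = m + 1" using a by (simp add: add_divide_distrib)
    then show ?thesis using True f \<mu>0 by (simp add: E_def algebra_simps power_int_add)
  next
    case False
    then have "\<lfloor>t / a\<rfloor> = m" using t a by (intro floor_unique) (auto simp: field_simps)
    then show ?thesis by (simp add: E_def)
  qed
  have D: "(E f has_vector_derivative \<gamma> t * E g t) (at t)"
    if f: "f a = \<mu> * f 0" and g: "g a = \<mu> * g 0" and \<gamma>: "\<And>t. \<gamma> (t + a) = \<gamma> t"
      and d: "\<And>t. t \<in> {0..a} \<Longrightarrow> (f has_vector_derivative \<gamma> t * g t) (at t within {0..a})" for f g \<gamma> t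
  proof -
    have W: "(E f has_vector_derivative \<gamma> t * E g t) (at t within {of_int m * a..of_int m * a + a})"
      if t: "t \<in> {of_int m * a..of_int m * a + a}" for m t
    proof -
      have "(f has_vector_derivative \<gamma> (t - of_int m * a) * g (t - of_int m * a)) (at (t - of_int m * a) within {0..a})"
        using t by (intro d) auto
      from has_vector_derivative_shift_within[OF this]
      have "((\<lambda>t. \<mu> powi m * f (t - of_int m * a)) has_vector_derivative \<mu> powi m * (\<gamma> (t - of_int m * a) * g (t - of_int m * a))) (at t within {of_int m * a..of_int m * a + a})"
        by (intro has_vector_derivative_mult_right) (simp add: add.commute)
      from has_vector_derivative_transform[OF t E[OF f] this] show ?thesis
        using E[OF g t] perm[of \<gamma> t m, OF \<gamma>] by (simp add: algebra_simps)
    qed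
    define m where "m = \<lfloor>t / a\<rfloor>"
    have m1: "of_int m * a \<le> t"
      using of_int_floor_le[of "t / a"] a unfolding m_def by (simp only: pos_le_divide_eq)
    have m2: "t < of_int m * a + a"
      using floor_correct[of "t / a"] a unfolding m_def by (simp add: field_simps)
    note m = m1 m2
    have "(E f has_vector_derivative \<gamma> t * E g t) (at t within {of_int m * a - a..of_int m * a + a})"
    proof (cases "t = of_int m * a")
      case True
      have "(E f has_vector_derivative \<gamma> t * E g t) (at t within {of_int (m - 1) * a..of_int (m - 1) * a + a} \<union> {of_int m * a..of_int m * a + a})"
        by (intro has_vector_derivative_within_Un W) (use True a in \<open>auto simp: algebra_simps\<close>)
      moreover have "{of_int (m - 1) * a..of_int (m - 1) * a + a} \<union> {of_int m * a..of_int m * a + a} = {of_int m * a - a..of_int m * a + a}"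
        using a by (auto simp: algebra_simps)
      ultimately show ?thesis by simp
    next
      case False
      then have "(E f has_vector_derivative \<gamma> t * E g t) (at t)"
        using W[of t m] m at_within_interior[of t "{of_int m * a..of_int m * a + a}"] by simp
      then show ?thesis by (rule has_vector_derivative_at_within)
    qed
    then show ?thesis
      using m a at_within_interior[of t "{of_int m * a - a..of_int m * a + a}"] by simp
  qed
  have N: "norm (E f (t + a)) = norm (E f t)" for f t
  proof -
    have "\<lfloor>(t + a) / a\<rfloor> = \<lfloor>t / a\<rfloor> + 1" using a by (simp add: add_divide_distrib)
    then show ?thesis by (simp add: E_def norm_mult norm_power_int \<mu> algebra_simps)
  qed
  have 0: "E f t = f t" if "f a = \<mu> * f 0" "t \<in> {0..a}" for f t
    using E[OF that(1), of t 0] that(2) by simp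
  show ?thesis
    by (rule that[of "E v" "E h"]) (use D[OF bd per(1) v] D[OF bd(2,1) per(2) h] N 0 bd in auto)
qed

lemma geom_mult_2_imp_scalar:
  fixes M :: "complex^2^2"
  assumes "geom_mult M \<mu> = 2"
  shows "M $ 1 $ 1 = \<mu>" "M $ 2 $ 2 = \<mu>" "M $ 1 $ 2 = 0" "M $ 2 $ 1 = 0"
proof -
  define E where "E = {v. M *v v = \<mu> *s v}"
  have "vec.subspace E"
    unfolding vec.subspace_def E_def
    by (auto simp: matrix_vector_right_distrib vec.scale_right_distrib matrix_vector_mult_scaleR
        vector_scalar_commute vec.scale_left_commute)
  moreover have "vec.dim E = vec.dim (UNIV :: (complex^2) set)"
    using assms by (simp add: geom_mult_def E_def vec.dim_UNIV card_cart_basis)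
  ultimately have "E = UNIV"
    using vec.subspace_dim_equal[of E UNIV] by simp
  then have *: "M *v v = \<mu> *s v" for v unfolding E_def by blast
  have "(M *v axis 1 1) $ i = (\<mu> *s axis 1 1) $ i" "(M *v axis 2 1) $ i = (\<mu> *s axis 2 1) $ i" for i
    using * by simp_all
  from this[of 1] this[of 2] show "M $ 1 $ 1 = \<mu>" "M $ 2 $ 2 = \<mu>" "M $ 1 $ 2 = 0" "M $ 2 $ 1 = 0"
    by (simp_all add: matrix_vector_mult_def sum_2 axis_def)
qed

text \<open>With determinant one and trace \<open>D\<close> in \<open>(-2, 2)\<close> the eigenvalues are \<open>D/2 \<plusminus> \<i> sqrt (1 - D\<^sup>2/4)\<close>: distinct
and of modulus one. In the degenerate case the matrix is \<open>\<mu>I\<close> with \<open>\<mu>\<^sup>2 = 1\<close>. The statement is written in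
entries because the eigenvectors serve as initial values.\<close>

lemma unimodular_eigenbasis:
  fixes M :: "complex^2^2"
  defines "p \<equiv> M $ 1 $ 1" and "q \<equiv> M $ 1 $ 2" and "r \<equiv> M $ 2 $ 1" and "s \<equiv> M $ 2 $ 2"
  assumes det: "p * s - q * r = 1"
    and stab: "trace M \<in> complex_of_real ` {-2<..<2} \<or> (\<exists>\<mu>. geom_mult M \<mu> = 2)"
  obtains \<mu>1 \<mu>2 x1 y1 x2 y2 where "norm \<mu>1 = 1" "norm \<mu>2 = 1" "x1 * y2 - x2 * y1 \<noteq> 0"
    "p * x1 + q * y1 = \<mu>1 * x1" "r * x1 + s * y1 = \<mu>1 * y1"
    "p * x2 + q * y2 = \<mu>2 * x2" "r * x2 + s * y2 = \<mu>2 * y2"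
  using stab
proof
  assume "\<exists>\<mu>. geom_mult M \<mu> = 2"
  then obtain \<mu> where "geom_mult M \<mu> = 2" by blast
  note sc = geom_mult_2_imp_scalar[OF this]
  have "\<mu> ^ 2 = 1" using det sc by (simp add: p_def q_def r_def s_def power2_eq_square)
  then have "norm \<mu> = 1" by (metis norm_one norm_power one_power2 power2_eq_iff_nonneg norm_ge_zero zero_le_one)
  then show ?thesis
    using that[of \<mu> \<mu> 1 1 0 0] sc by (simp add: p_def q_def r_def s_def)
next
  assume "trace M \<in> complex_of_real ` {-2<..<2}"
  then obtain D where D: "p + s = of_real D" "-2 < D" "D < 2"
    by (auto simp: trace_def sum_2 p_def s_def)
  define \<sigma> where "\<sigma> = sqrt (1 - (D / 2)\<^sup>2)"
  have "(D / 2)\<^sup>2 < 1" using D by (simp add: abs_square_less_1)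
  then have \<sigma>: "\<sigma> > 0" "\<sigma>\<^sup>2 = 1 - (D / 2)\<^sup>2" by (auto simp: \<sigma>_def)
  define \<mu>1 \<mu>2 where "\<mu>1 = Complex (D / 2) \<sigma>" and "\<mu>2 = Complex (D / 2) (- \<sigma>)"
  have n: "norm \<mu>1 = 1" "norm \<mu>2 = 1" using \<sigma> by (auto simp: \<mu>1_def \<mu>2_def cmod_def)
  have sum: "\<mu>1 + \<mu>2 = p + s" using D by (simp add: \<mu>1_def \<mu>2_def complex_eq_iff)
  have prod: "\<mu>1 * \<mu>2 = 1" using \<sigma> by (simp add: \<mu>1_def \<mu>2_def complex_eq_iff power2_eq_square)
  have ne: "\<mu>1 \<noteq> \<mu>2" using \<sigma> by (simp add: \<mu>1_def \<mu>2_def)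
  have ch: "\<mu> * \<mu> - (p + s) * \<mu> + (p * s - q * r) = 0" if "\<mu> = \<mu>1 \<or> \<mu> = \<mu>2" for \<mu>
    using that det prod sum[symmetric] by (auto simp: algebra_simps)
  consider "q \<noteq> 0" | "q = 0" "r \<noteq> 0" | "q = 0" "r = 0" by blast
  then show ?thesis
  proof cases
    case 1
    show ?thesis
    proof (rule that[OF n, of q "\<mu>2 - p" q "\<mu>1 - p"])
      show "q * (\<mu>2 - p) - q * (\<mu>1 - p) \<noteq> 0" using 1 ne by (simp add: algebra_simps)
      show "r * q + s * (\<mu>1 - p) = \<mu>1 * (\<mu>1 - p)" using ch[of \<mu>1] by (simp add: algebra_simps)
      show "r * q + s * (\<mu>2 - p) = \<mu>2 * (\<mu>2 - p)" using ch[of \<mu>2] by (simp add: algebra_simps)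
    qed (simp_all add: algebra_simps)
  next
    case 2
    show ?thesis
    proof (rule that[OF n, of "\<mu>1 - s" r "\<mu>2 - s" r])
      show "(\<mu>1 - s) * r - (\<mu>2 - s) * r \<noteq> 0" using 2 ne by (simp add: algebra_simps)
      show "p * (\<mu>1 - s) + q * r = \<mu>1 * (\<mu>1 - s)" using ch[of \<mu>1] 2 by (simp add: algebra_simps)
      show "p * (\<mu>2 - s) + q * r = \<mu>2 * (\<mu>2 - s)" using ch[of \<mu>2] 2 by (simp add: algebra_simps)
    qed (simp_all add: algebra_simps)
  next
    case 3
    have "(p - \<mu>1) * (p - \<mu>2) = p * p - (\<mu>1 + \<mu>2) * p + \<mu>1 * \<mu>2" by (simp add: algebra_simps)
    also have "\<dots> = 0" unfolding sum prod using det 3 by (simp add: algebra_simps)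
    finally have "p = \<mu>1 \<or> p = \<mu>2" by auto
    then have "p = \<mu>1 \<and> s = \<mu>2 \<or> p = \<mu>2 \<and> s = \<mu>1" using sum by (auto simp: algebra_simps)
    then have "norm p = 1" "norm s = 1" using n by auto
    then show ?thesis using that[of p s 1 1 0 0] 3 by simp
  qed
qed

text \<open>The Caratheodory solution satisfies an integral equation whose integrand agrees almost everywhere
with a continuous function once \<open>1/P\<close> and \<open>Q\<close> are replaced by continuous representatives.\<close>

lemma fundamental_matrix_classical:
  fixes \<Phi> :: "real \<Rightarrow> complex^2^2" and \<alpha> \<beta> :: "real \<Rightarrow> complex"
  assumes a: "a > 0" and \<Phi>: "fundamental_matrix a P Q \<Phi>"
    and c: "continuous_on UNIV \<alpha>" "continuous_on UNIV \<beta>"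
    and ae: "AE x in lebesgue. 1 / P x = \<alpha> x" "AE x in lebesgue. Q x = \<beta> x"
  shows "\<And>t j. t \<in> {0..a} \<Longrightarrow> ((\<lambda>t. \<Phi> t $ 1 $ j) has_vector_derivative \<alpha> t * \<Phi> t $ 2 $ j) (at t within {0..a})"
    and "\<And>t j. t \<in> {0..a} \<Longrightarrow> ((\<lambda>t. \<Phi> t $ 2 $ j) has_vector_derivative \<beta> t * \<Phi> t $ 1 $ j) (at t within {0..a})"
    and "\<Phi> 0 = mat 1"
proof -
  define A where "A = (\<lambda>t. vector [vector [0, 1 / P t], vector [Q t, 0]] :: complex^2^2)"
  have int: "(\<lambda>t. A t ** \<Phi> t) integrable_on {0..a}"
    and eq: "\<And>x. x \<in> {0..a} \<Longrightarrow> \<Phi> x = mat 1 + integral {0..x} (\<lambda>t. A t ** \<Phi> t)"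
    using \<Phi> unfolding fundamental_matrix_def Let_def A_def
    by (auto intro: set_lebesgue_integral_eq_integral(1))
  show "\<Phi> 0 = mat 1" using eq[of 0] a by simp
  have "continuous_on {0..a} (\<lambda>x. mat 1 + integral {0..x} (\<lambda>t. A t ** \<Phi> t))"
    by (intro continuous_intros indefinite_integral_continuous_1 int)
  then have cont: "continuous_on {0..a} \<Phi>"
    by (subst continuous_on_cong[OF refl eq]) auto
  have cc: "continuous_on {0..a} (\<lambda>t. \<Phi> t $ i $ j)" for i j
    using cont by (intro continuous_on_component)
  have comp: "\<Phi> x $ i $ j = (mat 1 :: complex^2^2) $ i $ j + integral {0..x} (\<lambda>t. (A t ** \<Phi> t) $ i $ j)" if x: "x \<in> {0..a}" for x i j
  proof -
    have "(\<lambda>t. A t ** \<Phi> t) integrable_on {0..x}" using int x by (auto intro: integrable_on_subinterval)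
    moreover have "bounded_linear (\<lambda>M :: complex^2^2. M $ i $ j)"
      by (rule bounded_linear_compose[OF bounded_linear_vec_nth bounded_linear_vec_nth])
    ultimately have "integral {0..x} ((\<lambda>M. M $ i $ j) \<circ> (\<lambda>t. A t ** \<Phi> t)) = integral {0..x} (\<lambda>t. A t ** \<Phi> t) $ i $ j"
      by (rule integral_linear)
    then show ?thesis using eq[OF x] by (simp add: o_def)
  qed
  have gen: "((\<lambda>t. \<Phi> t $ i $ j) has_vector_derivative \<gamma> t * \<Phi> t $ i' $ j) (at t within {0..a})"
    if ae: "AE x in lebesgue. g x = \<gamma> x" and cg: "continuous_on UNIV \<gamma>"
      and A: "\<And>t. (A t ** \<Phi> t) $ i $ j = g t * \<Phi> t $ i' $ j" and t: "t \<in> {0..a}" for g \<gamma> :: "real \<Rightarrow> complex" and i i' j t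
  proof -
    obtain N where N: "negligible N" "\<And>x. x \<notin> N \<Longrightarrow> g x = \<gamma> x"
      using ae by (auto simp: eventually_ae_filter negligible_iff_null_sets)
    have e: "\<Phi> x $ i $ j = (mat 1 :: complex^2^2) $ i $ j + integral {0..x} (\<lambda>t. \<gamma> t * \<Phi> t $ i' $ j)" if "x \<in> {0..a}" for x
    proof -
      have "integral {0..x} (\<lambda>t. (A t ** \<Phi> t) $ i $ j) = integral {0..x} (\<lambda>t. \<gamma> t * \<Phi> t $ i' $ j)"
        by (rule integral_spike[OF N(1)]) (use N(2) A in auto)
      then show ?thesis using comp[OF that] by simp
    qed
    have "((\<lambda>x. (mat 1 :: complex^2^2) $ i $ j + integral {0..x} (\<lambda>t. \<gamma> t * \<Phi> t $ i' $ j)) has_vector_derivative 0 + \<gamma> t * \<Phi> t $ i' $ j) (at t within {0..a})"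
      by (intro has_vector_derivative_add has_vector_derivative_const integral_has_vector_derivative t
          continuous_intros cc continuous_on_subset[OF cg]) auto
    from has_vector_derivative_transform[OF t e this] show ?thesis by simp
  qed
  show "((\<lambda>t. \<Phi> t $ 1 $ j) has_vector_derivative \<alpha> t * \<Phi> t $ 2 $ j) (at t within {0..a})" if "t \<in> {0..a}" for t j
    by (rule gen[OF ae(1) c(1) _ that]) (simp add: A_def matrix_matrix_mult_def sum_2)
  show "((\<lambda>t. \<Phi> t $ 2 $ j) has_vector_derivative \<beta> t * \<Phi> t $ 1 $ j) (at t within {0..a})" if "t \<in> {0..a}" for t j
    by (rule gen[OF ae(2) c(2) _ that]) (simp add: A_def matrix_matrix_mult_def sum_2)
qed

lemma wronskian_constant:
  fixes v1 h1 v2 h2 :: "real \<Rightarrow> complex"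
  assumes S: "convex S" and
    d: "\<And>t. t \<in> S \<Longrightarrow> (v1 has_vector_derivative \<alpha> t * h1 t) (at t within S)"
     "\<And>t. t \<in> S \<Longrightarrow> (h1 has_vector_derivative \<beta> t * v1 t) (at t within S)"
     "\<And>t. t \<in> S \<Longrightarrow> (v2 has_vector_derivative \<alpha> t * h2 t) (at t within S)"
     "\<And>t. t \<in> S \<Longrightarrow> (h2 has_vector_derivative \<beta> t * v2 t) (at t within S)"
  shows "\<exists>W. \<forall>t\<in>S. v1 t * h2 t - v2 t * h1 t = W"
proof -
  have d0: "((\<lambda>t. v1 t * h2 t - v2 t * h1 t) has_vector_derivative 0) (at t within S)" if "t \<in> S" for t
    by (rule has_vector_derivative_eq_rhs)
       (auto intro!: derivative_eq_intros d that simp: algebra_simps)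
  show ?thesis by (rule has_vector_derivative_zero_constant[OF S d0]) blast+
qed

text \<open>A solution of the first order system on the whole line, with periodic moduli.\<close>

definition floquet_pair where
  "floquet_pair a \<alpha> \<beta> v h \<longleftrightarrow> (\<forall>t. (v has_vector_derivative \<alpha> t * h t) (at t)) \<and>
     (\<forall>t. (h has_vector_derivative \<beta> t * v t) (at t)) \<and>
     (\<forall>t. norm (v (t + a)) = norm (v t)) \<and> (\<forall>t. norm (h (t + a)) = norm (h t))"
  for a :: real and \<alpha> \<beta> v h :: "real \<Rightarrow> complex"

text \<open>The Wronskian of the columns of the fundamental matrix is constant, so the monodromy matrix has
determinant one. Its eigenvectors are the initial values of the two solutions.\<close>

lemma stability_imp_floquet_pairs:
  fixes \<alpha> \<beta> :: "real \<Rightarrow> complex"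
  assumes a: "a > 0" and stab: "stability_case a P Q"
    and c: "continuous_on UNIV \<alpha>" "continuous_on UNIV \<beta>"
    and per: "\<And>t. \<alpha> (t + a) = \<alpha> t" "\<And>t. \<beta> (t + a) = \<beta> t"
    and ae: "AE x in lebesgue. 1 / P x = \<alpha> x" "AE x in lebesgue. Q x = \<beta> x"
  obtains v1 h1 v2 h2 W where "floquet_pair a \<alpha> \<beta> v1 h1" "floquet_pair a \<alpha> \<beta> v2 h2"
    "\<And>t. v1 t * h2 t - v2 t * h1 t = W" "W \<noteq> 0"
proof -
  obtain \<Phi> where \<Phi>: "fundamental_matrix a P Q \<Phi>"
    and st: "trace (\<Phi> a) \<in> complex_of_real ` {-2<..<2} \<or> (\<exists>\<mu>. geom_mult (\<Phi> a) \<mu> = 2)"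
    using stab by (auto simp: stability_case_def)
  note d = fundamental_matrix_classical[OF a \<Phi> c ae]
  have "\<exists>w. \<forall>t\<in>{0..a}. \<Phi> t $ 1 $ 1 * \<Phi> t $ 2 $ 2 - \<Phi> t $ 1 $ 2 * \<Phi> t $ 2 $ 1 = w"
    by (rule wronskian_constant[where \<alpha>=\<alpha> and \<beta>=\<beta>]) (auto intro: d(1,2))
  then obtain w where w: "\<And>t. t \<in> {0..a} \<Longrightarrow> \<Phi> t $ 1 $ 1 * \<Phi> t $ 2 $ 2 - \<Phi> t $ 1 $ 2 * \<Phi> t $ 2 $ 1 = w"
    by blast
  have "w = 1" using w[of 0] a by (simp add: d(3) mat_def)
  then have det: "\<Phi> a $ 1 $ 1 * \<Phi> a $ 2 $ 2 - \<Phi> a $ 1 $ 2 * \<Phi> a $ 2 $ 1 = 1"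
    using w[of a] a by simp
  obtain \<mu>1 \<mu>2 x1 y1 x2 y2 where e: "norm \<mu>1 = 1" "norm \<mu>2 = 1" "x1 * y2 - x2 * y1 \<noteq> 0"
    "\<Phi> a $ 1 $ 1 * x1 + \<Phi> a $ 1 $ 2 * y1 = \<mu>1 * x1" "\<Phi> a $ 2 $ 1 * x1 + \<Phi> a $ 2 $ 2 * y1 = \<mu>1 * y1"
    "\<Phi> a $ 1 $ 1 * x2 + \<Phi> a $ 1 $ 2 * y2 = \<mu>2 * x2" "\<Phi> a $ 2 $ 1 * x2 + \<Phi> a $ 2 $ 2 * y2 = \<mu>2 * y2"
    by (rule unimodular_eigenbasis[OF det st]) (rule that)
  have sol: "\<exists>v h. floquet_pair a \<alpha> \<beta> v h \<and> v 0 = x \<and> h 0 = y"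
    if \<mu>: "norm \<mu> = 1" and xy: "\<Phi> a $ 1 $ 1 * x + \<Phi> a $ 1 $ 2 * y = \<mu> * x" "\<Phi> a $ 2 $ 1 * x + \<Phi> a $ 2 $ 2 * y = \<mu> * y"
    for \<mu> x y
  proof -
    define v h where "v t = \<Phi> t $ 1 $ 1 * x + \<Phi> t $ 1 $ 2 * y" and "h t = \<Phi> t $ 2 $ 1 * x + \<Phi> t $ 2 $ 2 * y" for t
    have 0: "v 0 = x" "h 0 = y" by (simp_all add: v_def h_def d(3) mat_def)
    have dv: "(v has_vector_derivative \<alpha> t * h t) (at t within {0..a})" if "t \<in> {0..a}" for t
      unfolding v_def h_def
      by (rule has_vector_derivative_eq_rhs) (auto intro!: derivative_eq_intros d that simp: algebra_simps)
    have dh: "(h has_vector_derivative \<beta> t * v t) (at t within {0..a})" if "t \<in> {0..a}" for t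
      unfolding v_def h_def
      by (rule has_vector_derivative_eq_rhs) (auto intro!: derivative_eq_intros d that simp: algebra_simps)
    have bd: "v a = \<mu> * v 0" "h a = \<mu> * h 0" using xy unfolding 0 by (simp_all add: v_def h_def)
    show ?thesis
    proof (rule floquet_extension[OF a per dv dh bd \<mu>])
      fix V H
      assume VH: "\<And>t. (V has_vector_derivative \<alpha> t * H t) (at t)" "\<And>t. (H has_vector_derivative \<beta> t * V t) (at t)"
        "\<And>t. norm (V (t + a)) = norm (V t)" "\<And>t. norm (H (t + a)) = norm (H t)"
        "\<And>t. t \<in> {0..a} \<Longrightarrow> V t = v t" "\<And>t. t \<in> {0..a} \<Longrightarrow> H t = h t"
      show ?thesis
        using VH 0 a by (intro exI[of _ V] exI[of _ H]) (simp add: floquet_pair_def)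
    qed
  qed
  obtain v1 h1 where 1: "floquet_pair a \<alpha> \<beta> v1 h1" "v1 0 = x1" "h1 0 = y1" using sol[OF e(1,4,5)] by blast
  obtain v2 h2 where 2: "floquet_pair a \<alpha> \<beta> v2 h2" "v2 0 = x2" "h2 0 = y2" using sol[OF e(2,6,7)] by blast
  have "\<exists>W. \<forall>t\<in>UNIV. v1 t * h2 t - v2 t * h1 t = W"
    by (rule wronskian_constant[where \<alpha>=\<alpha> and \<beta>=\<beta>])
       (use 1(1) 2(1) in \<open>simp_all add: floquet_pair_def\<close>)
  then obtain W where W: "\<And>t. v1 t * h2 t - v2 t * h1 t = W" by blast
  show ?thesis
  proof (rule that[OF 1(1) 2(1) W])
    have "W = x1 * y2 - x2 * y1" using W[of 0] 1(2,3) 2(2,3) by simp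
    then show "W \<noteq> 0" using e(3) by simp
  qed
qed

lemma periodic_continuous_bounded:
  fixes f :: "real \<Rightarrow> complex"
  assumes a: "a > 0" and c: "continuous_on UNIV f" and per: "\<And>t. norm (f (t + a)) = norm (f t)"
  obtains C where "C > 0" "\<And>t. norm (f t) \<le> C"
proof -
  have "compact (f ` {0..a})"
    by (rule compact_continuous_image) (use c in \<open>auto intro: continuous_on_subset\<close>)
  then obtain C where C: "C > 0" "\<And>t. t \<in> {0..a} \<Longrightarrow> norm (f t) \<le> C"
    by (fastforce dest!: compact_imp_bounded simp: bounded_pos)
  have perm: "norm (f (t - of_int m * a)) = norm (f t)" for m :: int and t
  proof (induction m rule: int_induct[where k=0])
    case (step1 i) then show ?case using per[of "t - of_int (i + 1) * a"] by (simp add: algebra_simps)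
  next
    case (step2 i) then show ?case using per[of "t - of_int i * a"] by (simp add: algebra_simps)
  qed simp
  have "norm (f t) \<le> C" for t
  proof -
    have 1: "of_int \<lfloor>t / a\<rfloor> * a \<le> t"
      using of_int_floor_le[of "t / a"] a by (simp only: pos_le_divide_eq)
    have 2: "t < of_int \<lfloor>t / a\<rfloor> * a + a"
      using floor_correct[of "t / a"] a by (simp add: field_simps)
    have "t - of_int \<lfloor>t / a\<rfloor> * a \<in> {0..a}" using 1 2 by auto
    from C(2)[OF this] show ?thesis by (simp add: perm)
  qed
  then show ?thesis using C(1) that by blast
qed

section \<open>Integrable perturbations of a stable equation\<close>

lemma floquet_pair_continuous:
  assumes "floquet_pair a \<alpha> \<beta> v h"
  shows "continuous_on A v" "continuous_on A h"
proof -
  have "isCont v t" "isCont h t" for t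
    using assms has_vector_derivative_continuous unfolding floquet_pair_def by blast+
  then show "continuous_on A v" "continuous_on A h"
    by (auto intro: continuous_at_imp_continuous_on)
qed

text \<open>Banach fixed point theorem for \<open>z(t) = z\<^sub>0 + \<integral> F(s, z(s)) ds\<close> in the space of bounded continuous functions:
the contraction constant is the integral of the Lipschitz constants. The functions live on the whole
line and are frozen outside the interval.\<close>

lemma volterra_small_kernel:
  fixes F :: "real \<Rightarrow> 'b::euclidean_space \<Rightarrow> 'b"
  assumes bc: "b \<le> c"
    and lip: "\<And>t x y. t \<in> {b..c} \<Longrightarrow> norm (F t x - F t y) \<le> k t * norm (x - y)"
    and zero: "\<And>t. F t 0 = 0"
    and cont: "\<And>z. continuous_on {b..c} z \<Longrightarrow> continuous_on {b..c} (\<lambda>t. F t (z t))"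
    and k: "continuous_on {b..c} k" "\<And>t. t \<in> {b..c} \<Longrightarrow> 0 \<le> k t" and small: "integral {b..c} k \<le> 1 / 2"
  obtains z where "continuous_on {b..c} z"
    "\<And>t. t \<in> {b..c} \<Longrightarrow> (z has_vector_derivative F t (z t)) (at t within {b..c})"
    "\<And>t. t \<in> {b..c} \<Longrightarrow> norm (z t - z0) \<le> 2 * norm z0 * integral {b..c} k"
proof -
  have "\<exists>g :: real \<Rightarrow>\<^sub>C 'b. \<forall>t. g t = z0 + integral {b..clamp b c t} (\<lambda>s. F s (z s))" for z :: "real \<Rightarrow>\<^sub>C 'b"
  proof -
    have "continuous_on {b..c} (\<lambda>s. F s (z s))" by (rule cont) simp
    then have "(\<lambda>s. F s (z s)) integrable_on {b..c}" by (rule integrable_continuous_interval)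
    then have "continuous_on (cbox b c) (\<lambda>t. z0 + integral {b..t} (\<lambda>s. F s (z s)))"
      by (auto intro!: continuous_intros indefinite_integral_continuous_1)
    then show ?thesis by (rule continuous_on_cbox_bcontfunE) blast
  qed
  then have "\<forall>z :: real \<Rightarrow>\<^sub>C 'b. \<exists>g :: real \<Rightarrow>\<^sub>C 'b. \<forall>t. g t = z0 + integral {b..clamp b c t} (\<lambda>s. F s (z s))"
    by blast
  from choice[OF this] obtain T :: "(real \<Rightarrow>\<^sub>C 'b) \<Rightarrow> (real \<Rightarrow>\<^sub>C 'b)"
    where T: "\<And>z t. apply_bcontfun (T z) t = z0 + integral {b..clamp b c t} (\<lambda>s. F s (z s))"
    by blast
  have cl: "clamp b c t \<in> {b..c}" for t
    using clamp_in_interval[of b c t] bc by simp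
  have cl': "t \<in> {b..c} \<Longrightarrow> clamp b c t = t" for t
    using clamp_cancel_cbox[of t b c] by simp
  have intF: "(\<lambda>s. F s (apply_bcontfun z s)) integrable_on {b..t}" if "t \<in> {b..c}" for z t
    using that cont[of "apply_bcontfun z"]
    by (intro integrable_continuous_interval) (auto intro: continuous_on_subset)
  have intk: "integral {b..t} k \<le> integral {b..c} k" "k integrable_on {b..t}" if "t \<in> {b..c}" for t
  proof -
    show "k integrable_on {b..t}"
      using that k(1) by (intro integrable_continuous_interval) (auto intro: continuous_on_subset)
    then show "integral {b..t} k \<le> integral {b..c} k"
      using that k by (intro integral_subset_le) (auto intro: integrable_continuous_interval)
  qed
  have main: "norm (integral {b..t} (\<lambda>s. F s (apply_bcontfun x s)) - integral {b..t} (\<lambda>s. F s (apply_bcontfun y s)))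
      \<le> integral {b..c} k * dist x y" if t: "t \<in> {b..c}" for x y t
  proof -
    have "norm (integral {b..t} (\<lambda>s. F s (apply_bcontfun x s) - F s (apply_bcontfun y s)))
        \<le> integral {b..t} (\<lambda>s. k s * dist x y)"
    proof (rule Henstock_Kurzweil_Integration.integral_norm_bound_integral)
      show "(\<lambda>s. F s (apply_bcontfun x s) - F s (apply_bcontfun y s)) integrable_on {b..t}"
        by (intro Henstock_Kurzweil_Integration.integrable_diff intF t)
      show "(\<lambda>s. k s * dist x y) integrable_on {b..t}"
        by (intro integrable_on_mult_left intk t)
      fix s assume "s \<in> {b..t}"
      then have s: "s \<in> {b..c}" using t by auto
      have "norm (F s (apply_bcontfun x s) - F s (apply_bcontfun y s)) \<le> k s * norm (apply_bcontfun x s - apply_bcontfun y s)"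
        by (rule lip[OF s])
      also have "\<dots> \<le> k s * dist x y"
        using k(2)[OF s] dist_bounded[of x s y] by (intro mult_left_mono) (auto simp: dist_norm)
      finally show "norm (F s (apply_bcontfun x s) - F s (apply_bcontfun y s)) \<le> k s * dist x y" .
    qed
    also have "\<dots> = integral {b..t} k * dist x y" by simp
    also have "\<dots> \<le> integral {b..c} k * dist x y" using intk(1)[OF t] by (intro mult_right_mono) auto
    finally show ?thesis
      using intF[OF t] by (simp add: Henstock_Kurzweil_Integration.integral_diff)
  qed
  have "\<exists>!z. T z = z"
  proof (rule banach_fix_type[of "1/2"])
    show "\<forall>x y. dist (T x) (T y) \<le> 1 / 2 * dist x y"
    proof (intro allI dist_bound)
      fix x y t
      have "dist (apply_bcontfun (T x) t) (apply_bcontfun (T y) t) \<le> integral {b..c} k * dist x y"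
        using main[OF cl] by (simp add: T dist_norm)
      also have "\<dots> \<le> 1 / 2 * dist x y" using small by (intro mult_right_mono) auto
      finally show "dist (apply_bcontfun (T x) t) (apply_bcontfun (T y) t) \<le> 1 / 2 * dist x y" .
    qed
  qed auto
  then obtain z where z: "T z = z" by blast
  have zeq: "apply_bcontfun z t = z0 + integral {b..t} (\<lambda>s. F s (apply_bcontfun z s))" if "t \<in> {b..c}" for t
    using T[of z t] cl'[OF that] by (simp add: z)
  have diff: "norm (apply_bcontfun z t - z0) \<le> integral {b..c} k * norm z" for t
  proof -
    have "apply_bcontfun z t - z0 = integral {b..clamp b c t} (\<lambda>s. F s (apply_bcontfun z s))"
      using T[of z t] by (simp add: z)
    then show ?thesis using main[OF cl[of t], of z 0] by (simp add: zero dist_norm)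
  qed
  have "norm z \<le> norm z0 + 1 / 2 * norm z"
  proof (rule norm_bound)
    fix t
    have "norm (apply_bcontfun z t) \<le> norm z0 + norm (apply_bcontfun z t - z0)"
      using norm_triangle_ineq[of z0 "apply_bcontfun z t - z0"] by simp
    also have "norm (apply_bcontfun z t - z0) \<le> 1 / 2 * norm z"
      using diff[of t] mult_right_mono[OF small, of "norm z"] by simp
    finally show "norm (apply_bcontfun z t) \<le> norm z0 + 1 / 2 * norm z" by simp
  qed
  then have nz: "norm z \<le> 2 * norm z0" by simp
  show ?thesis
  proof
    show "continuous_on {b..c} (apply_bcontfun z)" by simp
    have k0: "0 \<le> integral {b..c} k" using k by (intro Henstock_Kurzweil_Integration.integral_nonneg) (auto intro: integrable_continuous_interval)
    fix t assume t: "t \<in> {b..c}"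
    have h: "((\<lambda>t. z0 + integral {b..t} (\<lambda>s. F s (apply_bcontfun z s))) has_vector_derivative 0 + F t (apply_bcontfun z t)) (at t within {b..c})"
      by (intro has_vector_derivative_add has_vector_derivative_const integral_has_vector_derivative cont t) simp
    show "(apply_bcontfun z has_vector_derivative F t (apply_bcontfun z t)) (at t within {b..c})"
      using has_vector_derivative_transform[OF t zeq h] by simp
    show "norm (apply_bcontfun z t - z0) \<le> 2 * norm z0 * integral {b..c} k"
      using diff[of t] mult_left_mono[OF nz k0] by (simp add: mult.commute)
  qed
qed

text \<open>Variation of constants: with \<open>v = z\<^sub>1v\<^sub>1 + z\<^sub>2v\<^sub>2\<close> and \<open>h = z\<^sub>1h\<^sub>1 + z\<^sub>2h\<^sub>2\<close> the perturbed system becomes a linear system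
for \<open>z\<close> whose coefficients are products of the perturbation with bounded functions. Its solution with
\<open>z(b) = (1, 0)\<close> stays near \<open>(1, 0)\<close>, so \<open>v\<close> and \<open>h\<close> stay near \<open>v\<^sub>1\<close> and \<open>h\<^sub>1\<close>.\<close>

lemma perturbed_solution:
  fixes \<alpha> \<beta> \<alpha>' \<beta>' :: "real \<Rightarrow> complex"
  assumes fp: "floquet_pair a \<alpha> \<beta> v1 h1" "floquet_pair a \<alpha> \<beta> v2 h2"
    and W: "\<And>t. v1 t * h2 t - v2 t * h1 t = W" "W \<noteq> 0"
    and C: "\<And>t. norm (v1 t) \<le> C" "\<And>t. norm (h1 t) \<le> C" "\<And>t. norm (v2 t) \<le> C" "\<And>t. norm (h2 t) \<le> C"
    and bc: "b \<le> c" and cont: "continuous_on {b..c} \<alpha>" "continuous_on {b..c} \<beta>"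
    "continuous_on {b..c} \<alpha>'" "continuous_on {b..c} \<beta>'"
  defines "\<kappa> \<equiv> integral {b..c} (\<lambda>t. norm (\<alpha>' t - \<alpha> t) + norm (\<beta>' t - \<beta> t))"
  assumes small: "4 * C\<^sup>2 / norm W * \<kappa> \<le> 1 / 2"
  obtains v h where "\<And>t. t \<in> {b..c} \<Longrightarrow> (v has_vector_derivative \<alpha>' t * h t) (at t within {b..c})"
    "\<And>t. t \<in> {b..c} \<Longrightarrow> (h has_vector_derivative \<beta>' t * v t) (at t within {b..c})"
    "\<And>t. t \<in> {b..c} \<Longrightarrow> norm (v t - v1 t) \<le> 2 * C * (8 * C\<^sup>2 / norm W * \<kappa>)"
    "\<And>t. t \<in> {b..c} \<Longrightarrow> norm (h t - h1 t) \<le> 2 * C * (8 * C\<^sup>2 / norm W * \<kappa>)"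
proof -
  have C0: "C \<ge> 0" using order_trans[OF norm_ge_zero C(1)] by blast
  define k where "k t = 4 * C\<^sup>2 / norm W * (norm (\<alpha>' t - \<alpha> t) + norm (\<beta>' t - \<beta> t))" for t
  define V where "V t z = fst z * v1 t + snd z * v2 t" for t and z :: "complex \<times> complex"
  define H where "H t z = fst z * h1 t + snd z * h2 t" for t and z :: "complex \<times> complex"
  \<comment> \<open>\<open>z' = F t z\<close> solves \<open>z\<^sub>1'v\<^sub>1 + z\<^sub>2'v\<^sub>2 = (\<alpha>' - \<alpha>)h\<close> and \<open>z\<^sub>1'h\<^sub>1 + z\<^sub>2'h\<^sub>2 = (\<beta>' - \<beta>)v\<close> by Cramer's rule.\<close>
  define F where "F t z = (((\<alpha>' t - \<alpha> t) * H t z * h2 t - v2 t * ((\<beta>' t - \<beta> t) * V t z)) / W,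
      (v1 t * ((\<beta>' t - \<beta> t) * V t z) - h1 t * ((\<alpha>' t - \<alpha> t) * H t z)) / W)" for t z
  have VH: "norm (V t z) \<le> 2 * C * norm z" "norm (H t z) \<le> 2 * C * norm z" for t z
  proof -
    have z: "norm (fst z) \<le> norm z" "norm (snd z) \<le> norm z"
      by (metis norm_fst_le prod.collapse) (metis norm_snd_le prod.collapse)
    have *: "norm (fst z * x + snd z * y) \<le> 2 * C * norm z" if "norm x \<le> C" "norm y \<le> C" for x y
    proof -
      have "norm (fst z * x + snd z * y) \<le> norm (fst z) * norm x + norm (snd z) * norm y"
        by (metis norm_mult norm_triangle_ineq)
      also have "\<dots> \<le> norm z * C + norm z * C" using z that by (intro add_mono mult_mono) auto
      finally show ?thesis by simp
    qed
    show "norm (V t z) \<le> 2 * C * norm z" "norm (H t z) \<le> 2 * C * norm z"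
      unfolding V_def H_def by (intro * C)+
  qed
  have linV: "V t x - V t y = V t (x - y)" "H t x - H t y = H t (x - y)" for t x y
    by (simp_all add: V_def H_def algebra_simps)
  have linF: "F t x - F t y = F t (x - y)" for t x y
    by (simp add: F_def linV[symmetric] diff_divide_distrib[symmetric] algebra_simps)
  have Fbound: "norm (F t z) \<le> k t * norm z" for t z
  proof -
    let ?A = "norm (\<alpha>' t - \<alpha> t)" and ?B = "norm (\<beta>' t - \<beta> t)"
    have t1: "norm (p * (q * r)) \<le> C * (norm q * (2 * C * norm z))"
      if "norm p \<le> C" "norm r \<le> 2 * C * norm z" for p q r :: complex
      unfolding norm_mult using that C0 by (intro mult_mono) auto
    have e1: "norm ((\<alpha>' t - \<alpha> t) * H t z * h2 t - v2 t * ((\<beta>' t - \<beta> t) * V t z)) \<le> C * (?A * (2 * C * norm z)) + C * (?B * (2 * C * norm z))"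
      using norm_triangle_ineq4[of "h2 t * ((\<alpha>' t - \<alpha> t) * H t z)" "v2 t * ((\<beta>' t - \<beta> t) * V t z)"]
        t1[where p="h2 t" and r="H t z" and q="\<alpha>' t - \<alpha> t", OF C(4) VH(2)]
        t1[where p="v2 t" and r="V t z" and q="\<beta>' t - \<beta> t", OF C(3) VH(1)] by (simp add: mult.commute mult.left_commute)
    have e2: "norm (v1 t * ((\<beta>' t - \<beta> t) * V t z) - h1 t * ((\<alpha>' t - \<alpha> t) * H t z)) \<le> C * (?A * (2 * C * norm z)) + C * (?B * (2 * C * norm z))"
      using norm_triangle_ineq4[of "v1 t * ((\<beta>' t - \<beta> t) * V t z)" "h1 t * ((\<alpha>' t - \<alpha> t) * H t z)"]
        t1[where p="h1 t" and r="H t z" and q="\<alpha>' t - \<alpha> t", OF C(2) VH(2)]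
        t1[where p="v1 t" and r="V t z" and q="\<beta>' t - \<beta> t", OF C(1) VH(1)] by simp
    have "norm (F t z) \<le> norm (fst (F t z)) + norm (snd (F t z))"
      using norm_Pair_le[of "fst (F t z)" "snd (F t z)"] by simp
    also have "\<dots> \<le> (C * (?A * (2 * C * norm z)) + C * (?B * (2 * C * norm z))) / norm W + (C * (?A * (2 * C * norm z)) + C * (?B * (2 * C * norm z))) / norm W"
      unfolding F_def fst_conv snd_conv norm_divide by (intro add_mono divide_right_mono e1 e2) auto
    also have "\<dots> = k t * norm z" by (simp add: k_def field_simps power2_eq_square)
    finally show ?thesis .
  qed
  have cvh: "continuous_on {b..c} v1" "continuous_on {b..c} h1" "continuous_on {b..c} v2" "continuous_on {b..c} h2"
    using floquet_pair_continuous fp by blast+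
  have intk: "integral {b..c} k = 4 * C\<^sup>2 / norm W * \<kappa>" unfolding k_def \<kappa>_def by simp
  obtain z where z: "continuous_on {b..c} z"
    "\<And>t. t \<in> {b..c} \<Longrightarrow> (z has_vector_derivative F t (z t)) (at t within {b..c})"
    "\<And>t. t \<in> {b..c} \<Longrightarrow> norm (z t - (1, 0)) \<le> 2 * norm ((1, 0) :: complex \<times> complex) * integral {b..c} k"
  proof (rule volterra_small_kernel[OF bc, of F k "(1, 0)"])
    show "norm (F t x - F t y) \<le> k t * norm (x - y)" for t x y
      unfolding linF by (rule Fbound)
    show "F t 0 = 0" for t by (simp add: F_def V_def H_def zero_prod_def)
    show "continuous_on {b..c} (\<lambda>t. F t (z t))" if "continuous_on {b..c} z" for z
      unfolding F_def V_def H_def using W(2) by (intro continuous_intros that cont cvh) auto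
    show "continuous_on {b..c} k" unfolding k_def by (intro continuous_intros cont)
    show "0 \<le> k t" for t by (simp add: k_def)
    show "integral {b..c} k \<le> 1 / 2" using small intk by simp
  qed (rule that)
  have zd: "norm (z t - (1, 0)) \<le> 8 * C\<^sup>2 / norm W * \<kappa>" if "t \<in> {b..c}" for t
    using z(3)[OF that] by (simp add: intk norm_Pair)
  have dz1: "((\<lambda>t. fst (z t)) has_vector_derivative fst (F t (z t))) (at t within {b..c})"
    and dz2: "((\<lambda>t. snd (z t)) has_vector_derivative snd (F t (z t))) (at t within {b..c})" if "t \<in> {b..c}" for t
    using bounded_linear.has_vector_derivative[OF bounded_linear_fst z(2)[OF that]]
      bounded_linear.has_vector_derivative[OF bounded_linear_snd z(2)[OF that]] by simp_all
  have d: "(v1 has_vector_derivative \<alpha> t * h1 t) (at t within {b..c})" "(h1 has_vector_derivative \<beta> t * v1 t) (at t within {b..c})"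
     "(v2 has_vector_derivative \<alpha> t * h2 t) (at t within {b..c})" "(h2 has_vector_derivative \<beta> t * v2 t) (at t within {b..c})" for t
    using fp unfolding floquet_pair_def by (auto intro: has_vector_derivative_at_within)
  have cramer: "((x * h2 t - v2 t * y) / W) * v1 t + ((v1 t * y - h1 t * x) / W) * v2 t = x"
    "((x * h2 t - v2 t * y) / W) * h1 t + ((v1 t * y - h1 t * x) / W) * h2 t = y" for x y t
  proof -
    have "(x * h2 t - v2 t * y) * v1 t + (v1 t * y - h1 t * x) * v2 t = x * (v1 t * h2 t - v2 t * h1 t)"
      "(x * h2 t - v2 t * y) * h1 t + (v1 t * y - h1 t * x) * h2 t = y * (v1 t * h2 t - v2 t * h1 t)"
      by (simp_all add: algebra_simps)
    then have "(x * h2 t - v2 t * y) * v1 t + (v1 t * y - h1 t * x) * v2 t = x * W"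
      "(x * h2 t - v2 t * y) * h1 t + (v1 t * y - h1 t * x) * h2 t = y * W" by (simp_all only: W(1))
    then show "((x * h2 t - v2 t * y) / W) * v1 t + ((v1 t * y - h1 t * x) / W) * v2 t = x"
      "((x * h2 t - v2 t * y) / W) * h1 t + ((v1 t * y - h1 t * x) / W) * h2 t = y"
      using W(2) by (simp_all add: add_divide_distrib[symmetric])
  qed
  show ?thesis
  proof (rule that[of "\<lambda>t. V t (z t)" "\<lambda>t. H t (z t)"])
    fix t assume t: "t \<in> {b..c}"
    have "((\<lambda>t. V t (z t)) has_vector_derivative
        (fst (z t) * (\<alpha> t * h1 t) + fst (F t (z t)) * v1 t) + (snd (z t) * (\<alpha> t * h2 t) + snd (F t (z t)) * v2 t)) (at t within {b..c})"
      unfolding V_def by (intro has_vector_derivative_add has_vector_derivative_mult dz1 dz2 d t)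
    moreover have "fst (F t (z t)) * v1 t + snd (F t (z t)) * v2 t = (\<alpha>' t - \<alpha> t) * H t (z t)"
      unfolding F_def fst_conv snd_conv by (rule cramer(1))
    then have "(fst (z t) * (\<alpha> t * h1 t) + fst (F t (z t)) * v1 t) + (snd (z t) * (\<alpha> t * h2 t) + snd (F t (z t)) * v2 t) = \<alpha>' t * H t (z t)"
      by (simp add: H_def algebra_simps)
    ultimately show "((\<lambda>t. V t (z t)) has_vector_derivative \<alpha>' t * H t (z t)) (at t within {b..c})" by simp
    have "((\<lambda>t. H t (z t)) has_vector_derivative
        (fst (z t) * (\<beta> t * v1 t) + fst (F t (z t)) * h1 t) + (snd (z t) * (\<beta> t * v2 t) + snd (F t (z t)) * h2 t)) (at t within {b..c})"
      unfolding H_def by (intro has_vector_derivative_add has_vector_derivative_mult dz1 dz2 d t)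
    moreover have "fst (F t (z t)) * h1 t + snd (F t (z t)) * h2 t = (\<beta>' t - \<beta> t) * V t (z t)"
      unfolding F_def fst_conv snd_conv by (rule cramer(2))
    then have "(fst (z t) * (\<beta> t * v1 t) + fst (F t (z t)) * h1 t) + (snd (z t) * (\<beta> t * v2 t) + snd (F t (z t)) * h2 t) = \<beta>' t * V t (z t)"
      by (simp add: V_def algebra_simps)
    ultimately show "((\<lambda>t. H t (z t)) has_vector_derivative \<beta>' t * V t (z t)) (at t within {b..c})" by simp
    have "V t (z t) - v1 t = V t (z t - (1, 0))" "H t (z t) - h1 t = H t (z t - (1, 0))"
      by (simp_all add: V_def H_def algebra_simps)
    then show "norm (V t (z t) - v1 t) \<le> 2 * C * (8 * C\<^sup>2 / norm W * \<kappa>)" "norm (H t (z t) - h1 t) \<le> 2 * C * (8 * C\<^sup>2 / norm W * \<kappa>)"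
      using VH[of t "z t - (1, 0)"] mult_left_mono[OF zd[OF t], of "2 * C"] C0 by simp_all
  qed
qed

lemma integral_periods:
  fixes f :: "real \<Rightarrow> real"
  assumes a: "a > 0" and c: "continuous_on UNIV f" and per: "\<And>t. f (t + a) = f t"
  shows "integral {of_int m * a..of_int m * a + real k * a} f = real k * integral {0..a} f"
proof -
  have io: "f integrable_on {x..y}" for x y
    using c by (auto intro: integrable_continuous_interval continuous_on_subset)
  have perm: "f (t + of_int m * a) = f t" for m :: int and t
  proof (induction m rule: int_induct[where k=0])
    case (step1 i) then show ?case using per[of "t + of_int i * a"] by (simp add: algebra_simps)
  next
    case (step2 i) then show ?case using per[of "t + of_int (i - 1) * a"] by (simp add: algebra_simps)
  qed simp
  have one: "integral {of_int m * a..of_int m * a + a} f = integral {0..a} f" for m :: int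
    using integral_shift_real_ivl[of "of_int m * a" "of_int m * a" "of_int m * a + a" f]
    by (simp add: perm)
  show ?thesis
  proof (induction k)
    case (Suc k)
    have "integral {of_int m * a..of_int m * a + real (Suc k) * a} f =
        integral {of_int m * a..of_int m * a + real k * a} f + integral {of_int m * a + real k * a..of_int m * a + real (Suc k) * a} f"
      using a by (intro Henstock_Kurzweil_Integration.integral_combine[symmetric] io) (auto simp: algebra_simps)
    moreover have "integral {of_int m * a + real k * a..of_int m * a + real (Suc k) * a} f = integral {0..a} f"
      using one[of "m + int k"] by (simp add: algebra_simps)
    ultimately show ?case using Suc by (simp add: algebra_simps)
  qed simp
qed

text \<open>The integrals are dominated by those over \<open>{x. |x| \<ge> na}\<close>, which tend to zero by dominated
convergence.\<close>

lemma integral_escaping_tendsto_0: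
  fixes f :: "real \<Rightarrow> complex" and b c :: "nat \<Rightarrow> real"
  assumes f: "f absolutely_integrable_on T" and sub: "\<And>n. n \<ge> n0 \<Longrightarrow> {b n..c n} \<subseteq> T"
    and esc: "\<And>n x. n \<ge> n0 \<Longrightarrow> x \<in> {b n..c n} \<Longrightarrow> \<bar>x\<bar> \<ge> real n * a" and a: "a > 0"
    and cont: "continuous_on T f"
  shows "(\<lambda>n. integral {b n..c n} (\<lambda>x. norm (f x))) \<longlonglongrightarrow> 0"
proof -
  define g where "g x = indicat_real T x *\<^sub>R f x" for x
  have g: "integrable lebesgue g" using f unfolding set_integrable_def g_def .
  have "(\<lambda>n. LINT x|lebesgue. indicat_real {b n..c n} x * (norm (g x) * of_bool (n \<ge> n0))) \<longlonglongrightarrow> (LINT x::real|lebesgue. (0::real))"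
  proof (rule Bochner_Integration.integral_dominated_convergence[where w="\<lambda>x. norm (g x)"])
    show "integrable lebesgue (\<lambda>x. norm (g x))" using g by simp
    show "(\<lambda>x. indicat_real {b n..c n} x * (norm (g x) * of_bool (n \<ge> n0))) \<in> borel_measurable lebesgue" for n
      using g by (intro borel_measurable_times borel_measurable_indicator) auto
    show "AE x in lebesgue. (\<lambda>n. indicat_real {b n..c n} x * (norm (g x) * of_bool (n \<ge> n0))) \<longlonglongrightarrow> 0"
    proof (rule AE_I2)
      fix x
      obtain N where N: "\<bar>x\<bar> < real N * a" using ex_less_of_nat_mult[OF a] by blast
      show "(\<lambda>n. indicat_real {b n..c n} x * (norm (g x) * of_bool (n \<ge> n0))) \<longlonglongrightarrow> 0"
      proof (rule tendsto_eventually, rule eventually_sequentiallyI)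
        fix n assume n: "max N n0 \<le> n"
        have "real N * a \<le> real n * a" using n a by (intro mult_right_mono) auto
        then have "x \<notin> {b n..c n}" using esc[of n x] n N by fastforce
        then show "indicat_real {b n..c n} x * (norm (g x) * of_bool (n \<ge> n0)) = 0" by simp
      qed
    qed
    show "AE x in lebesgue. norm (indicat_real {b n..c n} x * (norm (g x) * of_bool (n \<ge> n0))) \<le> norm (g x)" for n
      by (auto simp: indicator_def)
  qed simp
  then have "(\<lambda>n. LINT x|lebesgue. indicat_real {b n..c n} x * (norm (g x) * of_bool (n \<ge> n0))) \<longlonglongrightarrow> 0" by simp
  then show ?thesis
  proof (rule Lim_transform_eventually[OF _ eventually_sequentiallyI[of n0]])
    fix n assume n: "n0 \<le> n"
    have "(\<lambda>x. norm (f x)) absolutely_integrable_on {b n..c n}"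
      using sub[OF n] by (intro absolutely_integrable_continuous_real continuous_on_norm continuous_on_subset[OF cont])
    then have "integral {b n..c n} (\<lambda>x. norm (f x)) = (LINT x:{b n..c n}|lebesgue. norm (f x))"
      by (simp add: set_lebesgue_integral_eq_integral(2))
    also have "\<dots> = (LINT x|lebesgue. indicat_real {b n..c n} x * (norm (g x) * of_bool (n \<ge> n0)))"
      unfolding set_lebesgue_integral_def
      by (rule Bochner_Integration.integral_cong) (use sub[OF n] n in \<open>auto simp: indicator_def g_def\<close>)
    finally show "(LINT x|lebesgue. indicat_real {b n..c n} x * (norm (g x) * of_bool (n \<ge> n0))) = integral {b n..c n} (\<lambda>x. norm (f x))" by simp
  qed
qed

text \<open>The second order equation \<open>(v'/\<alpha>)' = \<beta>v\<close> as a first order system for \<open>v\<close> and its quasi-derivative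
\<open>h = v'/\<alpha>\<close>.\<close>

definition bounded_solution ::
  "(real \<Rightarrow> complex) \<Rightarrow> (real \<Rightarrow> complex) \<Rightarrow> real \<Rightarrow> real set \<Rightarrow> (real \<Rightarrow> complex) \<Rightarrow> (real \<Rightarrow> complex) \<Rightarrow> bool" where
  "bounded_solution \<alpha> \<beta> C I v h \<longleftrightarrow> (\<forall>t\<in>I. (v has_vector_derivative \<alpha> t * h t) (at t within I) \<and>
     (h has_vector_derivative \<beta> t * v t) (at t within I) \<and> norm (v t) \<le> C \<and> norm (h t) \<le> C)"

text \<open>The intervals consist of \<open>4n\<close> periods and lie at distance at least \<open>na\<close> from the origin, so the \<open>L\<^sup>1\<close>
norm of the perturbation on them tends to zero and the perturbed solutions approach a Floquet
solution uniformly. The mean square is measured over the middle half, where cutoffs of the interval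
are not small. The left endpoint is a multiple of the period so that whole periods are counted.\<close>

lemma perturbed_floquet_family:
  fixes \<alpha> \<beta> \<alpha>' \<beta>' :: "real \<Rightarrow> complex" and m :: "nat \<Rightarrow> int"
  assumes a: "a > 0" and stab: "stability_case a P Q"
    and c: "continuous_on UNIV \<alpha>" "continuous_on UNIV \<beta>"
    and per: "\<And>t. \<alpha> (t + a) = \<alpha> t" "\<And>t. \<beta> (t + a) = \<beta> t"
    and ae: "AE x in lebesgue. 1 / P x = \<alpha> x" "AE x in lebesgue. Q x = \<beta> x"
    and nz: "\<And>t. \<alpha> t \<noteq> 0"
    and c': "continuous_on T \<alpha>'" "continuous_on T \<beta>'"
    and L1: "(\<lambda>t. \<alpha>' t - \<alpha> t) absolutely_integrable_on T" "(\<lambda>t. \<beta>' t - \<beta> t) absolutely_integrable_on T"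
  defines "b \<equiv> \<lambda>n. of_int (m n) * a"
  assumes sub: "\<And>n. n \<ge> n0 \<Longrightarrow> {b n..b n + 4 * (real n * a)} \<subseteq> T"
    and esc: "\<And>n x. n \<ge> n0 \<Longrightarrow> x \<in> {b n..b n + 4 * (real n * a)} \<Longrightarrow> \<bar>x\<bar> \<ge> real n * a"
  obtains \<gamma> C where "\<gamma> > 0" "C > 0" "\<forall>\<^sub>F n in sequentially. \<exists>v h.
       bounded_solution \<alpha>' \<beta>' C {b n..b n + 4 * (real n * a)} v h \<and>
     \<gamma> * real n \<le> integral {b n + real n * a..b n + 3 * (real n * a)} (\<lambda>t. (norm (v t))\<^sup>2)"
proof -
  obtain v1 h1 v2 h2 W where fp: "floquet_pair a \<alpha> \<beta> v1 h1" "floquet_pair a \<alpha> \<beta> v2 h2"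
    and W: "\<And>t. v1 t * h2 t - v2 t * h1 t = W" "W \<noteq> 0"
    by (rule stability_imp_floquet_pairs[OF a stab c per ae]) (rule that)
  have cb: "continuous_on UNIV f \<and> (\<exists>C>0. \<forall>t. norm (f t) \<le> C)" if "f \<in> {v1, h1, v2, h2}" for f
  proof
    show cf: "continuous_on UNIV f"
      using that floquet_pair_continuous[OF fp(1)] floquet_pair_continuous[OF fp(2)] by auto
    have "norm (f (t + a)) = norm (f t)" for t
      using that fp unfolding floquet_pair_def by auto
    from periodic_continuous_bounded[OF a cf this] show "\<exists>C>0. \<forall>t. norm (f t) \<le> C" by metis
  qed
  obtain C1 C2 C3 C4 where Cs: "\<And>t. norm (v1 t) \<le> C1" "\<And>t. norm (h1 t) \<le> C2" "\<And>t. norm (v2 t) \<le> C3" "\<And>t. norm (h2 t) \<le> C4" "C1 > 0"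
    using cb[of v1] cb[of h1] cb[of v2] cb[of h2] by auto
  define C where "C = max (max C1 C2) (max C3 C4)"
  have C: "\<And>t. norm (v1 t) \<le> C" "\<And>t. norm (h1 t) \<le> C" "\<And>t. norm (v2 t) \<le> C" "\<And>t. norm (h2 t) \<le> C" "C > 0"
    using Cs unfolding C_def by (auto simp: le_max_iff_disj less_max_iff_disj)
  have cv1: "continuous_on UNIV v1" using cb by simp
  define M where "M = integral {0..a} (\<lambda>t. (norm (v1 t))\<^sup>2)"
  have cn: "continuous_on A (\<lambda>t. (norm (v1 t))\<^sup>2)" for A
    by (intro continuous_intros continuous_on_subset[OF cv1]) auto
  have M0: "M \<ge> 0" unfolding M_def by (intro Henstock_Kurzweil_Integration.integral_nonneg integrable_continuous_interval cn) auto
  \<comment> \<open>If \<open>v\<^sub>1\<close> vanished on a period then so would \<open>h\<^sub>1 = v\<^sub>1'/\<alpha>\<close>, contradicting the Wronskian.\<close>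
  have "M \<noteq> 0"
  proof
    assume "M = 0"
    then have "integral (cbox 0 a) (\<lambda>t. (norm (v1 t))\<^sup>2) = 0" by (simp add: M_def)
    then have 0: "v1 t = 0" if "t \<in> {0..a}" for t
      using integral_eq_0_iff[of 0 a "\<lambda>t. (norm (v1 t))\<^sup>2"] cn a that by auto
    have "(v1 has_vector_derivative 0) (at (a/2))"
    proof -
      have "((\<lambda>_. 0) has_vector_derivative 0) (at (a/2))" by simp
      then show ?thesis
        by (rule has_vector_derivative_transform_within_open[of _ _ _ "{0<..<a}"]) (use a 0 in auto)
    qed
    moreover have "(v1 has_vector_derivative \<alpha> (a/2) * h1 (a/2)) (at (a/2))"
      using fp(1) by (simp add: floquet_pair_def)
    ultimately have "\<alpha> (a/2) * h1 (a/2) = 0" by (rule vector_derivative_unique_at[symmetric])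
    then have "h1 (a/2) = 0" using nz by simp
    then show False using W(1)[of "a/2"] W(2) 0[of "a/2"] a by simp
  qed
  then have Mpos: "M > 0" using M0 by simp
  define \<kappa> where "\<kappa> n = integral {b n..b n + 4 * (real n * a)} (\<lambda>t. norm (\<alpha>' t - \<alpha> t) + norm (\<beta>' t - \<beta> t))" for n
  have sp: "continuous_on T (\<lambda>t. \<alpha>' t - \<alpha> t)" "continuous_on T (\<lambda>t. \<beta>' t - \<beta> t)"
    using c by (auto intro!: continuous_intros c' intro: continuous_on_subset)
  have k1: "(\<lambda>n. integral {b n..b n + 4 * (real n * a)} (\<lambda>t. norm (\<alpha>' t - \<alpha> t))) \<longlonglongrightarrow> 0"
    by (rule integral_escaping_tendsto_0[OF L1(1) sub esc a sp(1)])
  have k2: "(\<lambda>n. integral {b n..b n + 4 * (real n * a)} (\<lambda>t. norm (\<beta>' t - \<beta> t))) \<longlonglongrightarrow> 0"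
    by (rule integral_escaping_tendsto_0[OF L1(2) sub esc a sp(2)])
  have \<kappa>: "\<kappa> \<longlonglongrightarrow> 0"
  proof (rule Lim_transform_eventually[OF _ eventually_sequentiallyI[of n0]])
    show "(\<lambda>n. integral {b n..b n + 4 * (real n * a)} (\<lambda>t. norm (\<alpha>' t - \<alpha> t)) + integral {b n..b n + 4 * (real n * a)} (\<lambda>t. norm (\<beta>' t - \<beta> t))) \<longlonglongrightarrow> 0"
      using tendsto_add[OF k1 k2] by simp
    fix n assume n: "n0 \<le> n"
    have "(\<lambda>t. norm (\<alpha>' t - \<alpha> t)) integrable_on {b n..b n + 4 * (real n * a)}" "(\<lambda>t. norm (\<beta>' t - \<beta> t)) integrable_on {b n..b n + 4 * (real n * a)}"
      by (intro integrable_continuous_interval continuous_on_norm continuous_on_subset[OF sp(1) sub[OF n]] continuous_on_subset[OF sp(2) sub[OF n]])+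
    then show "integral {b n..b n + 4 * (real n * a)} (\<lambda>t. norm (\<alpha>' t - \<alpha> t)) + integral {b n..b n + 4 * (real n * a)} (\<lambda>t. norm (\<beta>' t - \<beta> t)) = \<kappa> n"
      unfolding \<kappa>_def by (simp add: Henstock_Kurzweil_Integration.integral_add)
  qed
  define \<delta> where "\<delta> n = 2 * C * (8 * C\<^sup>2 / norm W * \<kappa> n)" for n
  have "(\<lambda>n. 4 * C\<^sup>2 / norm W * \<kappa> n) \<longlonglongrightarrow> 4 * C\<^sup>2 / norm W * 0" by (intro tendsto_intros \<kappa>)
  then have "\<forall>\<^sub>F n in sequentially. 4 * C\<^sup>2 / norm W * \<kappa> n < 1 / 2" by (rule order_tendstoD) simp
  moreover have "(\<lambda>n. 2 * a * (\<delta> n)\<^sup>2) \<longlonglongrightarrow> 2 * a * (2 * C * (8 * C\<^sup>2 / norm W * 0))\<^sup>2"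
    unfolding \<delta>_def by (intro tendsto_intros \<kappa>)
  then have "\<forall>\<^sub>F n in sequentially. 2 * a * (\<delta> n)\<^sup>2 < M / 2" by (rule order_tendstoD) (use Mpos in simp)
  moreover have "\<delta> \<longlonglongrightarrow> 2 * C * (8 * C\<^sup>2 / norm W * 0)"
    unfolding \<delta>_def by (intro tendsto_intros \<kappa>)
  then have "\<forall>\<^sub>F n in sequentially. \<delta> n < 1" by (rule order_tendstoD) simp
  ultimately have ev: "\<forall>\<^sub>F n in sequentially. n \<ge> n0 \<and> 4 * C\<^sup>2 / norm W * \<kappa> n \<le> 1 / 2 \<and> 2 * a * (\<delta> n)\<^sup>2 < M / 2 \<and> \<delta> n < 1"
    using eventually_ge_at_top[of n0] by eventually_elim auto
  show ?thesis
  proof (rule that[of "M / 2" "C + 1"])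
    show "M / 2 > 0" "C + 1 > 0" using Mpos C(5) by auto
    show "\<forall>\<^sub>F n in sequentially. \<exists>v h.
       bounded_solution \<alpha>' \<beta>' (C + 1) {b n..b n + 4 * (real n * a)} v h \<and>
     M / 2 * real n \<le> integral {b n + real n * a..b n + 3 * (real n * a)} (\<lambda>t. (norm (v t))\<^sup>2)"
      using ev
    proof eventually_elim
      case (elim n)
      let ?I = "{b n..b n + 4 * (real n * a)}" and ?J = "{b n + real n * a..b n + 3 * (real n * a)}"
      have na: "0 \<le> real n * a" using a by simp
      have cI: "continuous_on ?I \<alpha>" "continuous_on ?I \<beta>" "continuous_on ?I \<alpha>'" "continuous_on ?I \<beta>'"
        using c c' sub[of n] elim by (auto intro: continuous_on_subset)
      have le: "b n \<le> b n + 4 * (real n * a)" using na by simp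
      obtain v h where vh: "\<And>t. t \<in> ?I \<Longrightarrow> (v has_vector_derivative \<alpha>' t * h t) (at t within ?I)"
        "\<And>t. t \<in> ?I \<Longrightarrow> (h has_vector_derivative \<beta>' t * v t) (at t within ?I)"
        "\<And>t. t \<in> ?I \<Longrightarrow> norm (v t - v1 t) \<le> \<delta> n" "\<And>t. t \<in> ?I \<Longrightarrow> norm (h t - h1 t) \<le> \<delta> n"
        unfolding \<delta>_def \<kappa>_def
        by (rule perturbed_solution[OF fp W C(1-4) le cI]) (use elim in \<open>auto simp: \<kappa>_def\<close>)
      have nb: "norm (v t) \<le> C + 1 \<and> norm (h t) \<le> C + 1" if "t \<in> ?I" for t
        using vh(3,4)[OF that] C(1,2)[of t] elim norm_triangle_sub[of "v t" "v1 t"] norm_triangle_sub[of "h t" "h1 t"] by linarith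
      have JI: "?J \<subseteq> ?I" using na by auto
      have cv: "continuous_on ?J v"
      proof -
        have "continuous_on ?I v"
          unfolding continuous_on_eq_continuous_within
          using has_vector_derivative_continuous[OF vh(1)] by blast
        then show ?thesis using JI by (rule continuous_on_subset)
      qed
      have "real (2 * n) * M = integral ?J (\<lambda>t. (norm (v1 t))\<^sup>2)"
      proof -
        have "(norm (v1 (t + a)))\<^sup>2 = (norm (v1 t))\<^sup>2" for t using fp(1) by (simp add: floquet_pair_def)
        from integral_periods[OF a cn this, of "m n + int n" "2 * n"] show ?thesis
          by (simp add: M_def b_def algebra_simps)
      qed
      also have "\<dots> \<le> integral ?J (\<lambda>t. 2 * (norm (v t))\<^sup>2 + 2 * (\<delta> n)\<^sup>2)"
      proof (rule integral_le)
        show "(\<lambda>t. (norm (v1 t))\<^sup>2) integrable_on ?J" by (intro integrable_continuous_interval cn)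
        show "(\<lambda>t. 2 * (norm (v t))\<^sup>2 + 2 * (\<delta> n)\<^sup>2) integrable_on ?J"
          by (intro integrable_continuous_interval continuous_intros cv)
        fix t assume "t \<in> ?J"
        then have d: "norm (v t - v1 t) \<le> \<delta> n" using vh(3) JI by blast
        have "norm (v1 t) \<le> norm (v t) + \<delta> n"
          using d norm_triangle_sub[of "v1 t" "v t"] by (simp add: norm_minus_commute)
        then have "(norm (v1 t))\<^sup>2 \<le> (norm (v t) + \<delta> n)\<^sup>2" by (intro power_mono) auto
        also have "\<dots> \<le> 2 * (norm (v t))\<^sup>2 + 2 * (\<delta> n)\<^sup>2"
          using zero_le_power2[of "norm (v t) - \<delta> n"] by (simp add: power2_eq_square algebra_simps)
        finally show "(norm (v1 t))\<^sup>2 \<le> 2 * (norm (v t))\<^sup>2 + 2 * (\<delta> n)\<^sup>2" .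
      qed
      also have "\<dots> = 2 * integral ?J (\<lambda>t. (norm (v t))\<^sup>2) + 2 * (real n * (2 * a * (\<delta> n)\<^sup>2))"
      proof -
        have "(\<lambda>t. 2 * (norm (v t))\<^sup>2) integrable_on ?J" "(\<lambda>t. 2 * (\<delta> n)\<^sup>2) integrable_on ?J"
          by (intro integrable_continuous_interval continuous_intros cv)+
        then have "integral ?J (\<lambda>t. 2 * (norm (v t))\<^sup>2 + 2 * (\<delta> n)\<^sup>2) = integral ?J (\<lambda>t. 2 * (norm (v t))\<^sup>2) + integral ?J (\<lambda>t. 2 * (\<delta> n)\<^sup>2)"
          by (rule Henstock_Kurzweil_Integration.integral_add)
        then show ?thesis using na by (simp add: algebra_simps)
      qed
      also have "real n * (2 * a * (\<delta> n)\<^sup>2) \<le> real n * (M / 2)" using elim by (intro mult_left_mono) auto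
      finally have "M / 2 * real n \<le> integral ?J (\<lambda>t. (norm (v t))\<^sup>2)" by (simp add: algebra_simps)
      then show ?case using vh(1,2) nb by (intro exI[of _ v] exI[of _ h]) (auto simp: bounded_solution_def)
    qed
  qed
qed

section \<open>Distributional derivatives of compactly supported fields\<close>

text \<open>Continuous with compact support; the support bound is stated by norm so that it applies to every
Euclidean space.\<close>

definition cc :: "('a::euclidean_space \<Rightarrow> 'b::real_normed_vector) \<Rightarrow> bool" where
  "cc f \<longleftrightarrow> continuous_on UNIV f \<and> (\<exists>K. \<forall>x. norm x > K \<longrightarrow> f x = 0)"

lemma ccD: "cc f \<Longrightarrow> continuous_on A f"
  unfolding cc_def by (auto intro: continuous_on_subset)

lemma cc_add: "cc f \<Longrightarrow> cc g \<Longrightarrow> cc (\<lambda>x. f x + g x)"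
proof -
  assume f: "cc f" and g: "cc g"
  then obtain K L where "\<And>x. norm x > K \<Longrightarrow> f x = 0" "\<And>x. norm x > L \<Longrightarrow> g x = 0"
    unfolding cc_def by auto
  then have "\<forall>x. norm x > max K L \<longrightarrow> f x + g x = 0" by auto
  then show ?thesis using ccD[OF f] ccD[OF g] unfolding cc_def by (blast intro: continuous_on_add)
qed

lemma cc_bounded_linear:
  assumes "bounded_linear T" "cc f"
  shows "cc (\<lambda>x. T (f x))"
proof -
  obtain K where K: "\<And>x. norm x > K \<Longrightarrow> f x = 0" using assms(2) unfolding cc_def by auto
  have "T (f x) = 0" if "norm x > K" for x
    using K[OF that] linear_0[OF bounded_linear.linear[OF assms(1)]] by simp
  then show ?thesis using ccD[OF assms(2), of UNIV] bounded_linear.continuous_on[OF assms(1)]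
    unfolding cc_def by blast
qed

lemma cc_uminus: "cc f \<Longrightarrow> cc (\<lambda>x. - f x)"
  by (rule cc_bounded_linear[OF bounded_linear_minus[OF bounded_linear_ident]])

lemma cc_diff: "cc f \<Longrightarrow> cc g \<Longrightarrow> cc (\<lambda>x. f x - g x)"
  using cc_add[OF _ cc_uminus, of f g] by simp

lemma cc_zero: "cc (\<lambda>x. 0)" by (simp add: cc_def)

lemma cc_scaleR:
  assumes "continuous_on UNIV \<phi>" "cc f"
  shows "cc (\<lambda>x. \<phi> x *\<^sub>R f x)"
  using assms unfolding cc_def by (auto intro!: continuous_on_scaleR)

lemma cc_bounded:
  assumes "cc f"
  obtains B where "B \<ge> 0" "\<And>x. norm (f x) \<le> B"
proof -
  obtain K where K: "\<And>x. norm x > K \<Longrightarrow> f x = 0" using assms unfolding cc_def by auto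
  have "compact (f ` cball 0 K)"
    by (rule compact_continuous_image) (use ccD[OF assms] in auto)
  then obtain B where B: "B > 0" "\<And>y. y \<in> f ` cball 0 K \<Longrightarrow> norm y \<le> B"
    using compact_imp_bounded bounded_pos by metis
  have "norm (f x) \<le> B" for x
    using K[of x] B(1) B(2)[of "f x"] by (cases "norm x > K") auto
  then show ?thesis using that B(1) by (meson less_imp_le)
qed

lemma cc_integrable:
  fixes f :: "'a::euclidean_space \<Rightarrow> 'b::{banach, second_countable_topology}"
  assumes "cc f"
  shows "integrable lborel f"
proof -
  obtain K where K: "\<And>x. norm x > K \<Longrightarrow> f x = 0" using assms unfolding cc_def by auto
  obtain B where B: "\<And>x. norm (f x) \<le> B" using cc_bounded[OF assms] by blast
  show ?thesis
  proof (rule integrableI_bounded_set[where A="cball 0 K" and B=B])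
    show "f \<in> borel_measurable lborel" using ccD[OF assms, of UNIV] by (simp add: borel_measurable_continuous_onI)
    show "emeasure lborel (cball 0 K :: 'a set) < \<infinity>" by (rule emeasure_bounded_finite) simp
    show "AE x in lborel. x \<notin> cball 0 K \<longrightarrow> f x = 0" using K by auto
  qed (use B in auto)
qed

lemma integral_translation:
  fixes f :: "'a::euclidean_space \<Rightarrow> 'b::{banach, second_countable_topology}"
  assumes "f \<in> borel_measurable borel"
  shows "(LINT x|lborel. f (x + c)) = (LINT x|lborel. f x)"
proof -
  have "(LINT x|lborel. f x) = (LINT x|distr lborel borel ((+) c). f x)"
    by (simp add: lborel_distr_plus)
  also have "\<dots> = (LINT x|lborel. f (c + x))" using assms by (intro integral_distr) auto
  finally show ?thesis by (simp add: add.commute)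
qed

text \<open>The integral of a difference quotient vanishes by translation invariance, and the quotients converge
to the derivative, under a uniform bound on a common compact set.\<close>

lemma integral_directional_derivative_zero:
  fixes \<psi> \<psi>' :: "'a::euclidean_space \<Rightarrow> 'b::{banach, second_countable_topology}"
  assumes d: "\<And>x. ((\<lambda>t. \<psi> (x + t *\<^sub>R b)) has_vector_derivative \<psi>' x) (at 0)"
    and cc: "cc \<psi>" "cc \<psi>'"
  shows "(LINT x|lborel. \<psi>' x) = 0"
proof -
  obtain K where K: "\<And>x. norm x > K \<Longrightarrow> \<psi> x = 0" using cc(1) unfolding cc_def by auto
  obtain B where B: "B \<ge> 0" "\<And>x. norm (\<psi>' x) \<le> B" using cc_bounded[OF cc(2)] by blast
  have m: "\<psi> \<in> borel_measurable borel" "\<psi>' \<in> borel_measurable borel"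
    using ccD[OF cc(1), of UNIV] ccD[OF cc(2), of UNIV] by (simp_all add: borel_measurable_continuous_onI)
  have dt: "((\<lambda>t. \<psi> (x + t *\<^sub>R b)) has_vector_derivative \<psi>' (x + s *\<^sub>R b)) (at s)" for x s
  proof -
    have "((\<lambda>t. t - s) has_vector_derivative 1) (at s)"
      by (auto intro!: derivative_eq_intros)
    moreover have "((\<lambda>t. \<psi> ((x + s *\<^sub>R b) + t *\<^sub>R b)) has_vector_derivative \<psi>' (x + s *\<^sub>R b)) (at (s - s))"
      using d[of "x + s *\<^sub>R b"] by simp
    ultimately have "((\<lambda>t. \<psi> ((x + s *\<^sub>R b) + t *\<^sub>R b)) \<circ> (\<lambda>t. t - s) has_vector_derivative 1 *\<^sub>R \<psi>' (x + s *\<^sub>R b)) (at s)"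
      by (rule vector_diff_chain_at)
    then show ?thesis by (simp add: o_def algebra_simps)
  qed
  define t where "t n = inverse (real (Suc n))" for n
  have t: "t n > 0" "t n \<le> 1" for n by (auto simp: t_def field_simps)
  have t0: "t \<longlonglongrightarrow> 0" unfolding t_def[abs_def] by (rule LIMSEQ_inverse_real_of_nat)
  define q where "q n x = (\<psi> (x + t n *\<^sub>R b) - \<psi> x) /\<^sub>R t n" for n x
  have "(\<lambda>n. LINT x|lborel. q n x) \<longlonglongrightarrow> (LINT x|lborel. \<psi>' x)"
  proof (rule Bochner_Integration.integral_dominated_convergence[where w="\<lambda>x. indicat_real (cball 0 (\<bar>K\<bar> + norm b)) x * B"])
    show "integrable lborel (\<lambda>x. indicat_real (cball 0 (\<bar>K\<bar> + norm b)) x * B)"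
      by (intro integrable_mult_left integrable_real_indicator emeasure_bounded_finite) auto
    show "q n \<in> borel_measurable lborel" for n
      unfolding q_def using m(1) by measurable
    show "AE x in lborel. (\<lambda>n. q n x) \<longlonglongrightarrow> \<psi>' x"
    proof (rule AE_I2)
      fix x
      have "((\<lambda>s. (\<psi> (x + s *\<^sub>R b) - \<psi> x - s *\<^sub>R \<psi>' x) /\<^sub>R \<bar>s\<bar>) \<longlongrightarrow> 0) (at 0)"
        using d[of x] by (simp add: has_vector_derivative_def has_derivative_at_within has_derivative_def)
      then have "(\<lambda>n. (\<psi> (x + t n *\<^sub>R b) - \<psi> x - t n *\<^sub>R \<psi>' x) /\<^sub>R \<bar>t n\<bar>) \<longlonglongrightarrow> 0"
        by (rule filterlim_compose) (use t t0 in \<open>auto simp: filterlim_at intro!: always_eventually less_imp_neq[THEN not_sym]\<close>)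
      moreover have "(\<psi> (x + t n *\<^sub>R b) - \<psi> x - t n *\<^sub>R \<psi>' x) /\<^sub>R \<bar>t n\<bar> = q n x - \<psi>' x" for n
        using t(1)[of n] by (simp add: q_def algebra_simps)
      ultimately have "(\<lambda>n. q n x - \<psi>' x) \<longlonglongrightarrow> 0" by simp
      then show "(\<lambda>n. q n x) \<longlonglongrightarrow> \<psi>' x" by (simp add: LIM_zero_iff)
    qed
    show "AE x in lborel. norm (q n x) \<le> indicat_real (cball 0 (\<bar>K\<bar> + norm b)) x * B" for n
    proof (rule AE_I2)
      fix x
      show "norm (q n x) \<le> indicat_real (cball 0 (\<bar>K\<bar> + norm b)) x * B"
      proof (cases "norm x \<le> \<bar>K\<bar> + norm b")
        case True
        have "norm (\<psi> (x + t n *\<^sub>R b) - \<psi> (x + 0 *\<^sub>R b)) \<le> B * norm (t n - 0)"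
        proof (rule differentiable_bound[of UNIV "\<lambda>s. \<psi> (x + s *\<^sub>R b)" "\<lambda>s h. h *\<^sub>R \<psi>' (x + s *\<^sub>R b)"])
          show "((\<lambda>s. \<psi> (x + s *\<^sub>R b)) has_derivative (\<lambda>h. h *\<^sub>R \<psi>' (x + s *\<^sub>R b))) (at s within UNIV)" for s
            using dt[of x s] by (simp add: has_vector_derivative_def)
          show "onorm (\<lambda>h. h *\<^sub>R \<psi>' (x + s *\<^sub>R b)) \<le> B" for s
          proof (rule onorm_le)
            fix h :: real
            show "norm (h *\<^sub>R \<psi>' (x + s *\<^sub>R b)) \<le> B * norm h"
              using mult_left_mono[OF B(2)[of "x + s *\<^sub>R b"] abs_ge_zero[of h]] by (simp add: mult.commute)
          qed
        qed auto
        then show ?thesis using True t(1)[of n] by (simp add: q_def divide_simps mult.commute)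
      next
        case False
        have "norm (t n *\<^sub>R b) \<le> norm b" using t[of n] by (simp add: mult_left_le_one_le)
        then have "norm (x + t n *\<^sub>R b) > \<bar>K\<bar>"
          using False norm_triangle_ineq4[of "x + t n *\<^sub>R b" "t n *\<^sub>R b"] by simp
        then have "\<psi> (x + t n *\<^sub>R b) = 0" using K abs_ge_self order_le_less_trans by blast
        moreover have "\<psi> x = 0" using K[of x] False norm_ge_zero[of b] by linarith
        ultimately show ?thesis using B(1) by (simp add: q_def)
      qed
    qed
  qed (use m in auto)
  moreover have "(LINT x|lborel. q n x) = 0" for n
  proof -
    have i: "integrable lborel \<psi>" using cc_integrable[OF cc(1)] .
    have "cc (\<lambda>x. \<psi> (x + t n *\<^sub>R b))"
      unfolding cc_def
    proof
      show "continuous_on UNIV (\<lambda>x. \<psi> (x + t n *\<^sub>R b))"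
        by (rule continuous_on_compose2[OF ccD[OF cc(1), of UNIV]]) (auto intro!: continuous_intros)
      have "\<psi> (x + t n *\<^sub>R b) = 0" if "norm x > K + norm (t n *\<^sub>R b)" for x
        by (rule K) (use that norm_triangle_ineq4[of "x + t n *\<^sub>R b" "t n *\<^sub>R b"] in simp)
      then show "\<exists>K. \<forall>x. norm x > K \<longrightarrow> \<psi> (x + t n *\<^sub>R b) = 0" by blast
    qed
    then have "integrable lborel (\<lambda>x. \<psi> (x + t n *\<^sub>R b))" by (rule cc_integrable)
    then show ?thesis
      unfolding q_def using i integral_translation[OF m(1), of "t n *\<^sub>R b"] by simp
  qed
  ultimately show ?thesis by (simp add: LIMSEQ_const_iff)
qed

text \<open>Partial differentiation with the convention of \<open>pd\<close>: the derivative in the third direction is zero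
for \<open>N = 2\<close>.\<close>

definition has_pd :: "(nat \<Rightarrow> 'n::finite) \<Rightarrow> nat \<Rightarrow> (real^'n \<Rightarrow> complex) \<Rightarrow> (real^'n \<Rightarrow> complex) \<Rightarrow> bool" where
  "has_pd c j f g \<longleftrightarrow> cc f \<and> cc g \<and>
    (if j \<le> CARD('n) then \<forall>x. ((\<lambda>t. f (x + t *\<^sub>R axis (c j) 1)) has_vector_derivative g x) (at 0)
     else \<forall>x. g x = 0)"

lemma has_pd_cc: "has_pd c j f g \<Longrightarrow> cc f" "has_pd c j f g \<Longrightarrow> cc g"
  by (simp_all add: has_pd_def)

lemma has_pd_uminus: "has_pd c j f g \<Longrightarrow> has_pd c j (\<lambda>x. - f x) (\<lambda>x. - g x)"
  unfolding has_pd_def by (auto intro!: cc_uminus has_vector_derivative_minus cc_zero split: if_splits)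

lemma has_pd_diff: "has_pd c j f g \<Longrightarrow> has_pd c j f' g' \<Longrightarrow> has_pd c j (\<lambda>x. f x - f' x) (\<lambda>x. g x - g' x)"
  unfolding has_pd_def by (auto intro!: cc_diff has_vector_derivative_diff cc_zero split: if_splits)

lemma has_pd_zero: "has_pd c j (\<lambda>x. 0) (\<lambda>x. 0)"
  unfolding has_pd_def by (simp add: cc_zero)

lemma test_fun_continuous: "\<phi> \<in> test_fun U \<Longrightarrow> continuous_on A \<phi>"
  unfolding test_fun_def using C_k.simps(1) continuous_on_subset by blast

lemma test_fun_dir_deriv:
  assumes "\<phi> \<in> test_fun UNIV" "b \<in> Basis"
  shows "dir_deriv b \<phi> \<in> test_fun UNIV"
proof -
  have C: "C_k k \<phi>" for k using assms by (simp add: test_fun_def)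
  have cpt: "compact (closure {x. \<phi> x \<noteq> 0})" using assms by (simp add: test_fun_def)
  have "C_k k (dir_deriv b \<phi>)" for k using C[of "Suc k"] assms(2) by simp
  moreover have "{x. dir_deriv b \<phi> x \<noteq> 0} \<subseteq> closure {x. \<phi> x \<noteq> 0}"
  proof (rule ccontr)
    assume "\<not> ?thesis"
    then obtain x where x: "dir_deriv b \<phi> x \<noteq> 0" "x \<in> - closure {x. \<phi> x \<noteq> 0}" by auto
    define Z where "Z = closure {x. \<phi> x \<noteq> 0}"
    have out: "0 = \<phi> y" if "y \<in> - Z" for y
    proof (rule ccontr)
      assume "0 \<noteq> \<phi> y"
      then have "y \<in> {x. \<phi> x \<noteq> 0}" by simp
      then have "y \<in> Z" unfolding Z_def by (rule subsetD[OF closure_subset])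
      then show False using that by simp
    qed
    have "open (- Z)" "x \<in> - Z" using x(2) by (simp_all add: Z_def open_Compl)
    then have "(\<phi> has_derivative (\<lambda>_. 0)) (at x)"
      using has_derivative_transform_within_open[of "\<lambda>_. 0" "\<lambda>_. 0" x UNIV "- Z" \<phi>] out by simp
    then have "frechet_derivative \<phi> (at x) = (\<lambda>_. 0)" by (rule frechet_derivative_at[symmetric])
    then show False using x(1) by (simp add: dir_deriv_def)
  qed
  then have "closure {x. dir_deriv b \<phi> x \<noteq> 0} \<subseteq> closure {x. \<phi> x \<noteq> 0}" by (simp add: closure_minimal)
  then have "compact (closure {x. dir_deriv b \<phi> x \<noteq> 0})"
    using cpt bounded_subset unfolding compact_eq_bounded_closed by blast
  ultimately show ?thesis by (simp add: test_fun_def)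
qed

lemma test_fun_zero: "(\<lambda>x. 0) \<in> test_fun UNIV"
proof -
  have "C_k k (\<lambda>x :: 'a. 0)" for k
  proof (induction k)
    case (Suc k)
    have "dir_deriv b (\<lambda>x :: 'a. 0) = (\<lambda>x. 0)" for b by (simp add: dir_deriv_def frechet_derivative_const)
    then show ?case using Suc by simp
  qed simp
  then show ?thesis by (simp add: test_fun_def)
qed

lemma test_fun_pd:
  fixes c :: "nat \<Rightarrow> 'n::finite"
  shows "\<phi> \<in> test_fun UNIV \<Longrightarrow> pd c j \<phi> \<in> test_fun UNIV"
  by (auto simp: pd_def test_fun_zero intro!: test_fun_dir_deriv)

text \<open>The integral of the derivative of the product \<open>\<phi> f\<close> vanishes.\<close>

lemma integral_by_parts_pd:
  fixes c :: "nat \<Rightarrow> 'n::finite"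
  assumes \<phi>: "\<phi> \<in> test_fun UNIV" and f: "has_pd c j f g"
  shows "(LINT x|lborel. pd c j \<phi> x *\<^sub>R f x) = - (LINT x|lborel. \<phi> x *\<^sub>R g x)"
proof (cases "j \<le> CARD('n)")
  case True
  define b where "b = (axis (c j) 1 :: real^'n)"
  have bB: "b \<in> Basis" by (simp add: b_def)
  have pd: "pd c j \<phi> = dir_deriv b \<phi>" using True by (simp add: pd_def b_def)
  have cf: "cc f" "cc g" using f by (auto simp: has_pd_def)
  have c1: "continuous_on UNIV \<phi>" "continuous_on UNIV (dir_deriv b \<phi>)"
    using test_fun_continuous[OF \<phi>] test_fun_continuous[OF test_fun_dir_deriv[OF \<phi> bB]] by auto
  have "(LINT x|lborel. dir_deriv b \<phi> x *\<^sub>R f x + \<phi> x *\<^sub>R g x) = 0"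
  proof (rule integral_directional_derivative_zero[of "\<lambda>x. \<phi> x *\<^sub>R f x" b])
    fix x
    have "C_k (Suc 0) \<phi>" using \<phi> by (simp only: test_fun_def mem_Collect_eq)
    then have "\<phi> differentiable (at (x + 0 *\<^sub>R b))" by simp
    then have "(\<phi> has_derivative frechet_derivative \<phi> (at (x + 0 *\<^sub>R b))) (at (x + 0 *\<^sub>R b))"
      by (simp add: frechet_derivative_works)
    moreover have "((\<lambda>t. x + t *\<^sub>R b) has_vector_derivative b) (at 0)"
      by (auto intro!: derivative_eq_intros)
    ultimately have "((\<phi> \<circ> (\<lambda>t. x + t *\<^sub>R b)) has_vector_derivative frechet_derivative \<phi> (at (x + 0 *\<^sub>R b)) b) (at 0)"
      by (intro vector_derivative_diff_chain_within[where f="\<lambda>t. x + t *\<^sub>R b" and x="0::real" and S=UNIV])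
         (auto intro: has_derivative_at_withinI)
    then have "((\<lambda>t. \<phi> (x + t *\<^sub>R b)) has_real_derivative dir_deriv b \<phi> x) (at 0)"
      by (simp add: o_def dir_deriv_def has_real_derivative_iff_has_vector_derivative)
    moreover have "((\<lambda>t. f (x + t *\<^sub>R b)) has_vector_derivative g x) (at 0)"
      using f True by (simp add: has_pd_def b_def)
    ultimately have "((\<lambda>t. \<phi> (x + t *\<^sub>R b) *\<^sub>R f (x + t *\<^sub>R b)) has_vector_derivative
        \<phi> (x + 0 *\<^sub>R b) *\<^sub>R g x + dir_deriv b \<phi> x *\<^sub>R f (x + 0 *\<^sub>R b)) (at 0)"
      by (rule has_vector_derivative_scaleR)
    then show "((\<lambda>t. \<phi> (x + t *\<^sub>R b) *\<^sub>R f (x + t *\<^sub>R b)) has_vector_derivative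
        dir_deriv b \<phi> x *\<^sub>R f x + \<phi> x *\<^sub>R g x) (at 0)" by (simp add: add.commute)
  qed (intro cc_add cc_scaleR cf c1)+
  then have "(LINT x|lborel. dir_deriv b \<phi> x *\<^sub>R f x) + (LINT x|lborel. \<phi> x *\<^sub>R g x) = 0"
    using cf c1 by (subst Bochner_Integration.integral_add[symmetric]) (auto intro!: cc_integrable cc_scaleR)
  then show ?thesis by (simp add: pd eq_neg_iff_add_eq_0)
next
  case False
  then show ?thesis using f by (simp add: pd_def has_pd_def)
qed

definition field3 :: "('a \<Rightarrow> complex) \<Rightarrow> ('a \<Rightarrow> complex) \<Rightarrow> ('a \<Rightarrow> complex) \<Rightarrow> 'a \<Rightarrow> complex^3" where
  "field3 f1 f2 f3 x = vector [f1 x, f2 x, f3 x]"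

lemma field3_nth [simp]: "field3 f1 f2 f3 x $ 1 = f1 x" "field3 f1 f2 f3 x $ 2 = f2 x" "field3 f1 f2 f3 x $ 3 = f3 x"
  by (simp_all add: field3_def)

lemma cc_field3:
  assumes "cc f1" "cc f2" "cc f3"
  shows "cc (field3 f1 f2 f3)"
proof -
  obtain K1 K2 K3 where K: "\<And>x. norm x > K1 \<Longrightarrow> f1 x = 0" "\<And>x. norm x > K2 \<Longrightarrow> f2 x = 0" "\<And>x. norm x > K3 \<Longrightarrow> f3 x = 0"
    using assms unfolding cc_def by metis
  have "field3 f1 f2 f3 x = 0" if "norm x > max K1 (max K2 K3)" for x
    using K[of x] that by (simp add: vec_eq_iff forall_3)
  moreover have "continuous_on UNIV (field3 f1 f2 f3)"
  proof -
    have "field3 f1 f2 f3 = (\<lambda>x. \<chi> i. if i = 1 then f1 x else if i = 2 then f2 x else f3 x)"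
      by (rule ext) (simp add: vec_eq_iff forall_3)
    moreover have "continuous_on UNIV (\<lambda>x. if i = 1 then f1 x else if i = 2 then f2 x else f3 x)" for i :: 3
      using assms[THEN ccD, of UNIV] by (cases "i = 1"; cases "i = 2") simp_all
    then have "continuous_on UNIV (\<lambda>x. (\<chi> i. if i = (1::3) then f1 x else if i = 2 then f2 x else f3 x) :: complex^3)"
      by (rule continuous_on_vec_lambda)
    ultimately show ?thesis by simp
  qed
  ultimately show ?thesis unfolding cc_def by blast
qed

lemma cc_measurable: "cc f \<Longrightarrow> f \<in> borel_measurable borel"
  using ccD[of f UNIV] by (simp add: borel_measurable_continuous_onI)

lemma cc_L2:
  fixes F :: "real^'n::finite \<Rightarrow> complex^3"
  assumes "cc F"
  shows "F \<in> L2"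
proof -
  have m: "F \<in> borel_measurable borel" using assms by (rule cc_measurable)
  have "cc (\<lambda>x. (norm (F x))\<^sup>2)"
    using assms unfolding cc_def by (auto intro!: continuous_intros)
  then have "integrable lborel (\<lambda>x. (norm (F x))\<^sup>2)" by (rule cc_integrable)
  then have "integrable lebesgue (\<lambda>x. (norm (F x))\<^sup>2)"
    using m by (subst integrable_completion) auto
  then show ?thesis using m unfolding L2_def by (simp add: measurable_completion)
qed

lemma regular_dist_nth:
  fixes F :: "real^'n::finite \<Rightarrow> complex^3"
  assumes "cc F" "continuous_on UNIV \<phi>"
  shows "regular_dist F \<phi> $ i = (LINT x|lborel. \<phi> x *\<^sub>R F x $ i)"
proof -
  have c: "cc (\<lambda>x. \<phi> x *\<^sub>R F x)" by (rule cc_scaleR[OF assms(2,1)])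
  have "regular_dist F \<phi> = (LINT x|lborel. \<phi> x *\<^sub>R F x)"
    unfolding regular_dist_def using cc_measurable[OF c] by (intro integral_completion) simp
  also have "\<dots> $ i = (LINT x|lborel. (\<phi> x *\<^sub>R F x) $ i)"
    by (rule integral_bounded_linear[OF bounded_linear_vec_nth cc_integrable[OF c], symmetric])
  finally show ?thesis by simp
qed

lemma dist_pd_field3:
  fixes c :: "nat \<Rightarrow> 'n::finite" and F :: "real^'n \<Rightarrow> complex^3"
  assumes "cc F" "has_pd c j (\<lambda>x. F x $ i) g" "\<phi> \<in> test_fun UNIV"
  shows "dist_pd c j (regular_dist F) \<phi> $ i = (LINT x|lborel. \<phi> x *\<^sub>R g x)"
  unfolding dist_pd_def
  using regular_dist_nth[OF assms(1) test_fun_continuous[OF test_fun_pd[OF assms(3)]]]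
    integral_by_parts_pd[OF assms(3,2)] by simp

lemma dist_curl_field3:
  fixes c :: "nat \<Rightarrow> 'n::finite"
  assumes cc: "cc f1" "cc f2" "cc f3"
    and d: "has_pd c 2 f3 d23" "has_pd c 3 f2 d32" "has_pd c 3 f1 d31" "has_pd c 1 f3 d13" "has_pd c 1 f2 d12" "has_pd c 2 f1 d21"
    and \<phi>: "\<phi> \<in> test_fun UNIV"
  shows "dist_curl c (regular_dist (field3 f1 f2 f3)) \<phi> =
    regular_dist (field3 (\<lambda>x. d23 x - d32 x) (\<lambda>x. d31 x - d13 x) (\<lambda>x. d12 x - d21 x)) \<phi>"
proof -
  have F: "cc (field3 f1 f2 f3)" by (rule cc_field3[OF cc])
  note ccs = d[THEN has_pd_cc(2)]
  have G: "cc (field3 (\<lambda>x. d23 x - d32 x) (\<lambda>x. d31 x - d13 x) (\<lambda>x. d12 x - d21 x))"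
    by (intro cc_field3 cc_diff ccs)
  have c\<phi>: "continuous_on UNIV \<phi>" by (rule test_fun_continuous[OF \<phi>])
  have i: "integrable lborel (\<lambda>x. \<phi> x *\<^sub>R g x)" if "cc g" for g :: "real^'n \<Rightarrow> complex"
    by (rule cc_integrable[OF cc_scaleR[OF c\<phi> that]])
  have D: "dist_pd c j (regular_dist (field3 f1 f2 f3)) \<phi> $ i = (LINT x|lborel. \<phi> x *\<^sub>R g x)"
    if "has_pd c j (\<lambda>x. field3 f1 f2 f3 x $ i) g" for j i g by (rule dist_pd_field3[OF F that \<phi>])
  show ?thesis
    unfolding vec_eq_iff forall_3 dist_curl_def
    using D[of 2 3] D[of 3 2] D[of 3 1] D[of 1 3] D[of 1 2] D[of 2 1] d ccs i
    by (simp add: regular_dist_nth[OF G c\<phi>] scaleR_diff_right)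
qed

lemma regular_dist_cong_AE:
  fixes F G :: "real^'n::finite \<Rightarrow> complex^3"
  assumes "G \<in> borel_measurable lebesgue" "AE x in lebesgue. G x = F x" "continuous_on UNIV \<phi>"
  shows "regular_dist F \<phi> = regular_dist G \<phi>"
  unfolding regular_dist_def
proof (rule integral_cong_AE)
  have "F \<in> borel_measurable lebesgue" by (rule borel_measurable_AE[OF assms(1,2)])
  moreover have "\<phi> \<in> borel_measurable lebesgue"
    using assms(3) by (intro measurable_completion) (simp add: borel_measurable_continuous_onI)
  ultimately show "(\<lambda>x. \<phi> x *\<^sub>R F x) \<in> borel_measurable lebesgue" "(\<lambda>x. \<phi> x *\<^sub>R G x) \<in> borel_measurable lebesgue"
    using assms(1) by simp_all
  show "AE x in lebesgue. \<phi> x *\<^sub>R F x = \<phi> x *\<^sub>R G x" using assms(2) by eventually_elim simp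
qed

lemma dist_curl_cong:
  fixes c :: "nat \<Rightarrow> 'n::finite"
  assumes "\<And>\<phi>. \<phi> \<in> test_fun UNIV \<Longrightarrow> S \<phi> = T \<phi>" "\<phi> \<in> test_fun UNIV"
  shows "dist_curl c S \<phi> = dist_curl c T \<phi>"
  unfolding dist_curl_def dist_pd_def using assms(1)[OF test_fun_pd[OF assms(2)]] by simp

text \<open>If all partial derivatives involved exist classically, curls may be computed componentwise, and the
distributional definition of the pencil is satisfied. The displacement \<open>D = \<epsilon>E\<close> is a separate datum
since \<open>\<epsilon>\<close> is only known almost everywhere, while \<open>D\<close> has a divergence in the classical sense.\<close>

lemma pencil_of_classical_field:
  fixes c :: "nat \<Rightarrow> 'n::finite" and \<epsilon> :: "real \<Rightarrow> complex"
  assumes cc: "cc f1" "cc f2" "cc f3"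
    and d: "has_pd c 2 f3 d23" "has_pd c 3 f2 d32" "has_pd c 3 f1 d31" "has_pd c 1 f3 d13" "has_pd c 1 f2 d12" "has_pd c 2 f1 d21"
    and K: "K1 = (\<lambda>x. d23 x - d32 x)" "K2 = (\<lambda>x. d31 x - d13 x)" "K3 = (\<lambda>x. d12 x - d21 x)"
    and e: "has_pd c 2 K3 e23" "has_pd c 3 K2 e32" "has_pd c 3 K1 e31" "has_pd c 1 K3 e13" "has_pd c 1 K2 e12" "has_pd c 2 K1 e21"
    and D: "has_pd c 1 D1 q1" "has_pd c 2 D2 q2" "has_pd c 3 D3 q3" "\<And>x. q1 x + q2 x + q3 x = 0"
    and ae: "AE x in lebesgue. field3 D1 D2 D3 x = \<epsilon> (x $ c 1) *s field3 f1 f2 f3 x"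
  shows "pencil c \<epsilon> \<omega> (field3 f1 f2 f3)
    (field3 (\<lambda>x. (e23 x - e32 x) - \<omega>\<^sup>2 * D1 x) (\<lambda>x. (e31 x - e13 x) - \<omega>\<^sup>2 * D2 x) (\<lambda>x. (e12 x - e21 x) - \<omega>\<^sup>2 * D3 x))"
proof -
  let ?E = "field3 f1 f2 f3" and ?K = "field3 K1 K2 K3" and ?D = "field3 D1 D2 D3"
  let ?KK = "field3 (\<lambda>x. e23 x - e32 x) (\<lambda>x. e31 x - e13 x) (\<lambda>x. e12 x - e21 x)"
  let ?f = "field3 (\<lambda>x. (e23 x - e32 x) - \<omega>\<^sup>2 * D1 x) (\<lambda>x. (e31 x - e13 x) - \<omega>\<^sup>2 * D2 x) (\<lambda>x. (e12 x - e21 x) - \<omega>\<^sup>2 * D3 x)"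
  note ccd = d[THEN has_pd_cc(2)] and cce = e[THEN has_pd_cc(2)] and ccD' = D(1-3)[THEN has_pd_cc(1)]
  have ccK: "cc K1" "cc K2" "cc K3" unfolding K by (intro cc_diff ccd)+
  have E: "cc ?E" and KF: "cc ?K" and DF: "cc ?D" by (intro cc_field3 cc ccK ccD')+
  have KKF: "cc ?KK" by (intro cc_field3 cc_diff cce)
  have om: "cc (\<lambda>x. \<omega>\<^sup>2 * g x)" if "cc g" for g :: "real^'n \<Rightarrow> complex"
    by (rule cc_bounded_linear[OF bounded_linear_mult_right that])
  have fF: "cc ?f" by (intro cc_field3 cc_diff cce om ccD')
  have curl: "dist_curl c (regular_dist ?E) \<phi> = regular_dist ?K \<phi>" if "\<phi> \<in> test_fun UNIV" for \<phi>
    using dist_curl_field3[OF cc d that] by (simp add: K)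
  have curl2: "dist_curl c (dist_curl c (regular_dist ?E)) \<phi> = regular_dist ?KK \<phi>" if \<phi>: "\<phi> \<in> test_fun UNIV" for \<phi>
    using dist_curl_cong[OF curl \<phi>] dist_curl_field3[OF ccK e \<phi>] by simp
  have mD: "?D \<in> borel_measurable lebesgue" using cc_measurable[OF DF] by (intro measurable_completion) simp
  have epsE: "regular_dist (\<lambda>x. \<epsilon> (x $ c 1) *s ?E x) \<phi> = regular_dist ?D \<phi>" if "continuous_on UNIV \<phi>" for \<phi>
    by (rule regular_dist_cong_AE[OF mD ae that])
  have "dist_div c (regular_dist (\<lambda>x. \<epsilon> (x $ c 1) *s ?E x)) \<phi> = 0" if \<phi>: "\<phi> \<in> test_fun UNIV" for \<phi>
  proof -
    have c\<phi>: "continuous_on UNIV \<phi>" by (rule test_fun_continuous[OF \<phi>])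
    have "dist_pd c j (regular_dist (\<lambda>x. \<epsilon> (x $ c 1) *s ?E x)) \<phi> = dist_pd c j (regular_dist ?D) \<phi>" for j
      unfolding dist_pd_def using epsE[OF test_fun_continuous[OF test_fun_pd[OF \<phi>]]] by simp
    then have "dist_div c (regular_dist (\<lambda>x. \<epsilon> (x $ c 1) *s ?E x)) \<phi> =
        (LINT x|lborel. \<phi> x *\<^sub>R q1 x) + (LINT x|lborel. \<phi> x *\<^sub>R q2 x) + (LINT x|lborel. \<phi> x *\<^sub>R q3 x)"
      using dist_pd_field3[OF DF _ \<phi>, of c 1 1 q1] dist_pd_field3[OF DF _ \<phi>, of c 2 2 q2] dist_pd_field3[OF DF _ \<phi>, of c 3 3 q3] D(1-3)
      by (simp add: dist_div_def)
    also have "\<dots> = (LINT x|lborel. \<phi> x *\<^sub>R q1 x + \<phi> x *\<^sub>R q2 x + \<phi> x *\<^sub>R q3 x)"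
      using D(1-3)[THEN has_pd_cc(2)] c\<phi> by (simp add: cc_integrable cc_scaleR)
    also have "\<dots> = 0" using D(4) by (simp add: scaleR_add_right[symmetric])
    finally show ?thesis .
  qed
  then have "?E \<in> pencil_dom c \<epsilon>"
    unfolding pencil_dom_def dist_in_L2_def dist_eq_def
    using cc_L2[OF E] cc_L2[OF KF] cc_L2[OF KKF] curl curl2 by blast
  moreover have "regular_dist ?f \<phi> = dist_curl c (dist_curl c (regular_dist ?E)) \<phi> - \<omega>\<^sup>2 *s regular_dist (\<lambda>x. \<epsilon> (x $ c 1) *s ?E x) \<phi>"
    if \<phi>: "\<phi> \<in> test_fun UNIV" for \<phi>
  proof -
    have c\<phi>: "continuous_on UNIV \<phi>" by (rule test_fun_continuous[OF \<phi>])
    have i: "integrable lborel (\<lambda>x. \<phi> x *\<^sub>R g x)" if "cc g" for g :: "real^'n \<Rightarrow> complex"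
      by (rule cc_integrable[OF cc_scaleR[OF c\<phi> that]])
    have *: "(LINT x|lborel. \<phi> x *\<^sub>R ((a x - b x) - \<omega>\<^sup>2 * g x)) = (LINT x|lborel. \<phi> x *\<^sub>R (a x - b x)) - \<omega>\<^sup>2 * (LINT x|lborel. \<phi> x *\<^sub>R g x)"
      if "cc a" "cc b" "cc g" for a b g :: "real^'n \<Rightarrow> complex"
    proof -
      have "(LINT x|lborel. \<phi> x *\<^sub>R ((a x - b x) - \<omega>\<^sup>2 * g x)) = (LINT x|lborel. \<phi> x *\<^sub>R (a x - b x) - \<omega>\<^sup>2 * (\<phi> x *\<^sub>R g x))"
        by (simp add: scaleR_diff_right)
      also have "\<dots> = (LINT x|lborel. \<phi> x *\<^sub>R (a x - b x)) - (LINT x|lborel. \<omega>\<^sup>2 * (\<phi> x *\<^sub>R g x))"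
        by (intro Bochner_Integration.integral_diff i cc_diff that integrable_mult_right)
      also have "(LINT x|lborel. \<omega>\<^sup>2 * (\<phi> x *\<^sub>R g x)) = \<omega>\<^sup>2 * (LINT x|lborel. \<phi> x *\<^sub>R g x)"
        by (rule integral_mult_right_zero)
      finally show ?thesis .
    qed
    show ?thesis
      unfolding curl2[OF \<phi>] epsE[OF c\<phi>] vec_eq_iff forall_3
      by (simp add: regular_dist_nth[OF fF c\<phi>] regular_dist_nth[OF KKF c\<phi>] regular_dist_nth[OF DF c\<phi>] * cce ccD')
  qed
  ultimately show ?thesis
    unfolding pencil_def dist_eq_def using cc_L2[OF fF] by blast
qed

lemma regular_dist_scaleR: "regular_dist (\<lambda>x. r *\<^sub>R F x) \<phi> = r *\<^sub>R regular_dist F \<phi>"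
proof -
  have "(\<lambda>x. \<phi> x *\<^sub>R r *\<^sub>R F x) = (\<lambda>x. r *\<^sub>R (\<phi> x *\<^sub>R F x))" by (simp add: mult.commute)
  then show ?thesis unfolding regular_dist_def by (simp only: integral_scaleR_right)
qed

lemma dist_curl_scaleR:
  "dist_curl c (\<lambda>\<phi>. r *\<^sub>R T \<phi>) \<phi> = r *\<^sub>R dist_curl c T \<phi>"
  unfolding dist_curl_def dist_pd_def vec_eq_iff forall_3 by (simp add: scaleR_diff_right)

lemma L2_scaleR: "F \<in> L2 \<Longrightarrow> (\<lambda>x. r *\<^sub>R F x) \<in> L2"
  unfolding L2_def by (auto simp: power_mult_distrib)

lemma L2_norm_scaleR: "L2_norm (\<lambda>x. r *\<^sub>R F x) = \<bar>r\<bar> * L2_norm F"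
  unfolding L2_norm_def by (simp add: power_mult_distrib real_sqrt_mult)

lemma pencil_scaleR:
  fixes c :: "nat \<Rightarrow> 'n::finite"
  assumes "pencil c \<epsilon> \<omega> E f"
  shows "pencil c \<epsilon> \<omega> (\<lambda>x. r *\<^sub>R E x) (\<lambda>x. r *\<^sub>R f x)"
proof -
  have R: "regular_dist (\<lambda>x. r *\<^sub>R F x) = (\<lambda>\<phi>. r *\<^sub>R regular_dist F \<phi>)" for F :: "real^'n \<Rightarrow> complex^3"
    by (rule ext) (rule regular_dist_scaleR)
  have C: "dist_curl c (\<lambda>\<phi>. r *\<^sub>R T \<phi>) = (\<lambda>\<phi>. r *\<^sub>R dist_curl c T \<phi>)" for T :: "'n distribution"
    by (rule ext) (rule dist_curl_scaleR)
  have S: "dist_in_L2 (\<lambda>\<phi>. r *\<^sub>R T \<phi>)" if "dist_in_L2 T" for T :: "'n distribution"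
  proof -
    obtain g where "g \<in> L2" "dist_eq T (regular_dist g)" using \<open>dist_in_L2 T\<close> unfolding dist_in_L2_def by blast
    then show ?thesis unfolding dist_in_L2_def dist_eq_def
      by (intro bexI[of _ "\<lambda>x. r *\<^sub>R g x"]) (auto simp: R intro: L2_scaleR)
  qed
  have M: "(\<lambda>x. \<epsilon> (x $ i) *s (r *\<^sub>R E x)) = (\<lambda>x. r *\<^sub>R (\<epsilon> (x $ i) *s E x))" for i
    by (simp add: fun_eq_iff vec_eq_iff)
  have V: "dist_div c (\<lambda>\<phi>. r *\<^sub>R T \<phi>) \<phi> = r *\<^sub>R dist_div c T \<phi>" for T :: "'n distribution" and \<phi>
    unfolding dist_div_def dist_pd_def by (simp add: scaleR_add_right scaleR_diff_right)
  have "(\<lambda>x. r *\<^sub>R E x) \<in> pencil_dom c \<epsilon>"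
    using assms unfolding pencil_def pencil_dom_def by (auto simp: M R C V intro!: L2_scaleR S)
  moreover have "(\<lambda>x. r *\<^sub>R f x) \<in> L2" using assms by (auto simp: pencil_def intro: L2_scaleR)
  moreover have "\<omega>\<^sup>2 *s (r *\<^sub>R v) = r *\<^sub>R (\<omega>\<^sup>2 *s v)" for v :: "complex^3" by (simp add: vec_eq_iff)
  ultimately show ?thesis
    using assms unfolding pencil_def dist_eq_def by (simp add: M R C scaleR_diff_right)
qed

section \<open>Fields of product form and singular sequences\<close>

lemma nn_integral_prod_coords:
  fixes g :: "'n::finite \<Rightarrow> real \<Rightarrow> ennreal"
  assumes "\<And>i. g i \<in> borel_measurable borel"
  shows "(\<integral>\<^sup>+x. (\<Prod>i\<in>UNIV. g i (x $ i)) \<partial>(lborel :: (real^'n) measure)) = (\<Prod>i\<in>UNIV. \<integral>\<^sup>+t. g i t \<partial>lborel)"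
proof -
  have B: "(Basis :: (real^'n) set) = (\<lambda>i. axis i 1) ` UNIV" by (auto simp: Basis_vec_def)
  have inj: "inj (\<lambda>i :: 'n. axis i (1::real))" by (auto simp: inj_def axis_eq_axis)
  define f where "f b = g (axis_index b)" for b :: "real^'n"
  have "(\<integral>\<^sup>+x. (\<Prod>b\<in>Basis. f b (x \<bullet> b)) \<partial>lborel) = (\<Prod>b\<in>Basis. \<integral>\<^sup>+t. f b t \<partial>lborel)"
    by (rule nn_integral_lborel_prod) (auto simp: f_def assms)
  then show ?thesis
    unfolding B by (simp add: prod.reindex[OF inj] f_def o_def inner_axis axis_index_axis)
qed

text \<open>A null set of the line has as preimage a null cylinder.\<close>

lemma AE_coordinate:
  assumes "AE t in lborel. P t"
  shows "AE x in (lborel :: (real^'n::finite) measure). P (x $ i)"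
proof -
  obtain N where N: "N \<in> null_sets lborel" "{t \<in> space lborel. \<not> P t} \<subseteq> N"
    using assms by (auto simp: eventually_ae_filter)
  have Nb: "N \<in> sets borel" using N(1) by auto
  define M where "M = {x :: real^'n. x $ i \<in> N}"
  have "M = (\<lambda>x. x $ i) -` N \<inter> space borel" by (auto simp: M_def)
  also have "\<dots> \<in> sets borel" using Nb by (intro measurable_sets[OF borel_measurable_continuous_onI]) (auto intro: continuous_intros)
  finally have Mb: "M \<in> sets borel" .
  have "emeasure lborel M = (\<integral>\<^sup>+x. indicator M x \<partial>lborel)" using Mb by simp
  also have "\<dots> = (\<integral>\<^sup>+x. (\<Prod>j\<in>UNIV. (if j = i then indicator N (x $ j) else 1)) \<partial>lborel)"
    by (intro nn_integral_cong) (auto simp: M_def prod.delta indicator_def)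
  also have "\<dots> = (\<Prod>j\<in>(UNIV :: 'n set). \<integral>\<^sup>+t. (if j = i then indicator N t else 1) \<partial>lborel)"
    by (rule nn_integral_prod_coords[of "\<lambda>j t. if j = i then indicator N t else 1"]) (use Nb in auto)
  also have "\<dots> = 0"
  proof (rule prod_zero)
    show "\<exists>j\<in>UNIV. (\<integral>\<^sup>+t. (if j = i then indicator N t else 1) \<partial>lborel) = 0"
      by (rule bexI[of _ i]) (use N(1) Nb in auto)
  qed simp
  finally have "M \<in> null_sets lborel" using Mb by (simp add: null_sets_def)
  then have "AE x in lborel. x \<notin> M" by (rule AE_not_in)
  then show ?thesis by eventually_elim (use N(2) in \<open>auto simp: M_def\<close>)
qed

definition tensor :: "(nat \<Rightarrow> 'n) \<Rightarrow> (real \<Rightarrow> 'b) \<Rightarrow> (real \<Rightarrow> 'b) \<Rightarrow> (real \<Rightarrow> 'b) \<Rightarrow> real^'n \<Rightarrow> 'b::comm_ring_1" where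
  "tensor c f1 f2 f3 x = f1 (x $ c 1) * f2 (x $ c 2) * f3 (x $ c 3)"

text \<open>The admissible factors in the variable \<open>x\<^sub>3\<close>: for \<open>N = 2\<close> there is no such variable, and \<open>c 3\<close>
is an arbitrary index, so the factor must be constant.\<close>

definition transverse :: "nat \<Rightarrow> (real \<Rightarrow> complex) \<Rightarrow> bool" where
  "transverse N f \<longleftrightarrow> (if N = 3 then cc f else \<exists>z. f = (\<lambda>_. z))"

lemma tensor_cc:
  fixes c :: "nat \<Rightarrow> 'n::finite"
  assumes N: "N \<in> {2, 3}" and c: "bij_betw c {1..N} (UNIV :: 'n set)"
    and f: "cc f1" "cc f2" "transverse N f3"
  shows "cc (tensor c f1 f2 f3)"
proof -
  have c3: "continuous_on UNIV f3" using f(3) by (auto simp: transverse_def split: if_splits intro: ccD)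
  have cont: "continuous_on UNIV (\<lambda>x :: real^'n. f (x $ i))" if "continuous_on UNIV f" for f :: "real \<Rightarrow> complex" and i
    by (rule continuous_on_compose2[OF that]) (auto intro!: continuous_intros)
  have "continuous_on UNIV (tensor c f1 f2 f3)"
    unfolding tensor_def[abs_def] using f c3 by (intro continuous_intros cont) (auto intro: ccD)
  moreover obtain K1 K2 where K: "\<And>t. \<bar>t\<bar> > K1 \<Longrightarrow> f1 t = 0" "\<And>t. \<bar>t\<bar> > K2 \<Longrightarrow> f2 t = 0"
    using f(1,2) unfolding cc_def real_norm_def by metis
  obtain K3 where K3: "\<And>t. N = 3 \<Longrightarrow> \<bar>t\<bar> > K3 \<Longrightarrow> f3 t = 0"
    using f(3) unfolding transverse_def cc_def real_norm_def by metis
  define K where "K = max \<bar>K1\<bar> (max \<bar>K2\<bar> \<bar>K3\<bar>)"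
  have "tensor c f1 f2 f3 x = 0" if x: "norm x > real CARD('n) * K" for x
  proof (rule ccontr)
    assume nz: "tensor c f1 f2 f3 x \<noteq> 0"
    have 1: "\<bar>x $ c 1\<bar> \<le> K" "\<bar>x $ c 2\<bar> \<le> K" "N = 3 \<Longrightarrow> \<bar>x $ c 3\<bar> \<le> K"
      using nz K(1)[of "x $ c 1"] K(2)[of "x $ c 2"] K3[of "x $ c 3"] unfolding tensor_def K_def by fastforce+
    have "\<bar>x $ i\<bar> \<le> K" for i
    proof -
      obtain j where j: "j \<in> {1..N}" "i = c j" using c by (metis UNIV_I bij_betw_imp_surj_on imageE)
      then have "j = 1 \<or> j = 2 \<or> (j = 3 \<and> N = 3)" using N by auto
      then show ?thesis using 1 j(2) by auto
    qed
    then have "(\<Sum>i\<in>UNIV. \<bar>x $ i\<bar>) \<le> real CARD('n) * K" using sum_bounded_above[of UNIV "\<lambda>i. \<bar>x $ i\<bar>" K] by simp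
    then show False using x norm_le_l1_cart[of x] by linarith
  qed
  ultimately show ?thesis unfolding cc_def by blast
qed

text \<open>The variables \<open>x $ c j\<close> are independent, so differentiating in one of them differentiates one factor.
For \<open>N = 2\<close> the third factor is constant, hence its derivative is zero, as it should be.\<close>

lemma has_pd_tensor:
  fixes c :: "nat \<Rightarrow> 'n::finite"
  assumes N: "N \<in> {2, 3}" and c: "bij_betw c {1..N} (UNIV :: 'n set)"
    and f: "cc f1" "cc f2" "transverse N f3"
  shows has_pd_tensor1: "cc f1' \<Longrightarrow> (\<And>t. (f1 has_vector_derivative f1' t) (at t)) \<Longrightarrow> has_pd c 1 (tensor c f1 f2 f3) (tensor c f1' f2 f3)"
    and has_pd_tensor2: "cc f2' \<Longrightarrow> (\<And>t. (f2 has_vector_derivative f2' t) (at t)) \<Longrightarrow> has_pd c 2 (tensor c f1 f2 f3) (tensor c f1 f2' f3)"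
    and has_pd_tensor3: "transverse N f3' \<Longrightarrow> (\<And>t. (f3 has_vector_derivative f3' t) (at t)) \<Longrightarrow> has_pd c 3 (tensor c f1 f2 f3) (tensor c f1 f2 f3')"
proof -
  have card: "CARD('n) = N" using bij_betw_same_card[OF c] by simp
  have inj: "i \<in> {1..N} \<Longrightarrow> j \<in> {1..N} \<Longrightarrow> c i = c j \<longleftrightarrow> i = j" for i j
    using inj_on_eq_iff[OF bij_betw_imp_inj_on[OF c]] by blast
  have coord: "(x + t *\<^sub>R axis (c i) 1) $ c j = (if i = j then x $ c j + t else x $ c j)"
    if "i \<in> {1..N}" "j \<in> {1..N}" for x :: "real^'n" and t i j
    using inj[OF that] by (auto simp: axis_def)
  have sh: "((\<lambda>t. g (s + t)) has_vector_derivative g' s) (at 0)" if "\<And>t. (g has_vector_derivative g' t) (at t)" for g g' :: "real \<Rightarrow> complex" and s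
  proof -
    have "((g \<circ> (\<lambda>t. s + t)) has_vector_derivative 1 *\<^sub>R g' s) (at 0)"
      by (rule vector_diff_chain_at) (use that[of s] in \<open>auto intro!: derivative_eq_intros\<close>)
    then show ?thesis by (simp add: o_def)
  qed
  have third: "f3 ((x + t *\<^sub>R axis (c i) 1) $ c 3) = f3 (x $ c 3)" if "i \<in> {1, 2}" for x :: "real^'n" and t i
  proof (cases "N = 3")
    case True then show ?thesis using coord[of i 3 x t] that by auto
  next
    case False then show ?thesis using f(3) by (auto simp: transverse_def)
  qed
  note cct = tensor_cc[OF N c]
  show "has_pd c 1 (tensor c f1 f2 f3) (tensor c f1' f2 f3)" if "cc f1'" "\<And>t. (f1 has_vector_derivative f1' t) (at t)"
  proof -
    have eq: "tensor c f1 f2 f3 (x + t *\<^sub>R axis (c 1) 1) = f1 (x $ c 1 + t) * (f2 (x $ c 2) * f3 (x $ c 3))" for x t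
      using coord[of 1 1 x t] coord[of 1 2 x t] third[of 1 x t] N by (auto simp: tensor_def)
    have "((\<lambda>t. tensor c f1 f2 f3 (x + t *\<^sub>R axis (c 1) 1)) has_vector_derivative tensor c f1' f2 f3 x) (at 0)" for x
      unfolding eq using has_vector_derivative_mult_left[OF sh[of f1 f1' "x $ c 1", OF that(2)], of "f2 (x $ c 2) * f3 (x $ c 3)"]
      by (simp add: tensor_def mult.assoc)
    then show ?thesis unfolding has_pd_def using cct f that card N by auto
  qed
  show "has_pd c 2 (tensor c f1 f2 f3) (tensor c f1 f2' f3)" if "cc f2'" "\<And>t. (f2 has_vector_derivative f2' t) (at t)"
  proof -
    have eq: "tensor c f1 f2 f3 (x + t *\<^sub>R axis (c 2) 1) = f2 (x $ c 2 + t) * (f1 (x $ c 1) * f3 (x $ c 3))" for x t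
      using coord[of 2 1 x t] coord[of 2 2 x t] third[of 2 x t] N by (auto simp: tensor_def)
    have "((\<lambda>t. tensor c f1 f2 f3 (x + t *\<^sub>R axis (c 2) 1)) has_vector_derivative tensor c f1 f2' f3 x) (at 0)" for x
      unfolding eq using has_vector_derivative_mult_left[OF sh[of f2 f2' "x $ c 2", OF that(2)], of "f1 (x $ c 1) * f3 (x $ c 3)"]
      by (simp add: tensor_def mult_ac)
    then show ?thesis unfolding has_pd_def using cct f that card N by auto
  qed
  show "has_pd c 3 (tensor c f1 f2 f3) (tensor c f1 f2 f3')" if f3': "transverse N f3'" "\<And>t. (f3 has_vector_derivative f3' t) (at t)"
  proof (cases "N = 3")
    case True
    have eq: "tensor c f1 f2 f3 (x + t *\<^sub>R axis (c 3) 1) = f3 (x $ c 3 + t) * (f1 (x $ c 1) * f2 (x $ c 2))" for x t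
      using coord[of 3 1 x t] coord[of 3 2 x t] coord[of 3 3 x t] True by (auto simp: tensor_def)
    have "((\<lambda>t. tensor c f1 f2 f3 (x + t *\<^sub>R axis (c 3) 1)) has_vector_derivative tensor c f1 f2 f3' x) (at 0)" for x
      unfolding eq using has_vector_derivative_mult_left[OF sh[of f3 f3' "x $ c 3", OF f3'(2)], of "f1 (x $ c 1) * f2 (x $ c 2)"]
      by (simp add: tensor_def mult_ac)
    then show ?thesis unfolding has_pd_def using cct f f3' card True by auto
  next
    case False
    then obtain z where "f3 = (\<lambda>_. z)" using f(3) by (auto simp: transverse_def)
    then have "f3' t = 0" for t
      using f3'(2)[of t] has_vector_derivative_const[of z "at t"] vector_derivative_unique_at by metis
    then have "tensor c f1 f2 f3' x = 0" for x by (simp add: tensor_def)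
    then show ?thesis unfolding has_pd_def using cct f f3' card False N by auto
  qed
qed

lemma nn_integral_tensor:
  fixes c :: "nat \<Rightarrow> 'n::finite"
  assumes N: "N \<in> {2, 3}" and c: "bij_betw c {1..N} (UNIV :: 'n set)"
    and g: "g1 \<in> borel_measurable borel" "g2 \<in> borel_measurable borel" "g3 \<in> borel_measurable borel"
    and g3: "N = 2 \<Longrightarrow> g3 = (\<lambda>_. 1)"
  shows "(\<integral>\<^sup>+x. g1 (x $ c 1) * g2 (x $ c 2) * g3 (x $ c 3) \<partial>(lborel :: (real^'n) measure)) =
    (\<integral>\<^sup>+t. g1 t \<partial>lborel) * (\<integral>\<^sup>+t. g2 t \<partial>lborel) * (if N = 3 then \<integral>\<^sup>+t. g3 t \<partial>lborel else 1)"
proof -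
  define G where "G j = (if j = 1 then g1 else if j = (2::nat) then g2 else g3)" for j
  define h where "h i = G (inv_into {1..N} c i)" for i
  have hc: "h (c j) = G j" if "j \<in> {1..N}" for j
    using that c by (simp add: h_def bij_betw_def inv_into_f_f)
  have re: "(\<Prod>i\<in>UNIV. F i) = (\<Prod>j\<in>{1..N}. F (c j))" for F :: "'n \<Rightarrow> ennreal"
    using prod.reindex_bij_betw[OF c, of F] by simp
  have s: "{1..N} = (if N = 3 then {1, 2, 3} else {1, 2})" using N by auto
  have 1: "(\<Prod>i\<in>UNIV. h i (x $ i)) = g1 (x $ c 1) * g2 (x $ c 2) * g3 (x $ c 3)" for x
  proof -
    have "(\<Prod>i\<in>UNIV. h i (x $ i)) = (\<Prod>j\<in>{1..N}. G j (x $ c j))"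
      unfolding re by (rule prod.cong) (auto simp: hc)
    then show ?thesis unfolding s using N g3 by (auto simp: G_def mult.assoc)
  qed
  have 2: "(\<Prod>i\<in>UNIV. \<integral>\<^sup>+t. h i t \<partial>lborel) = (\<integral>\<^sup>+t. g1 t \<partial>lborel) * (\<integral>\<^sup>+t. g2 t \<partial>lborel) * (if N = 3 then \<integral>\<^sup>+t. g3 t \<partial>lborel else 1)"
  proof -
    have "(\<Prod>i\<in>UNIV. \<integral>\<^sup>+t. h i t \<partial>lborel) = (\<Prod>j\<in>{1..N}. \<integral>\<^sup>+t. G j t \<partial>lborel)"
      unfolding re by (rule prod.cong) (auto simp: hc)
    then show ?thesis unfolding s using N by (auto simp: G_def mult.assoc)
  qed
  show ?thesis
    using nn_integral_prod_coords[of h] g unfolding 1 2 by (auto simp: h_def G_def)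
qed

lemma L2_norm_upper:
  fixes F :: "real^'n::finite \<Rightarrow> complex^3"
  assumes F: "cc F" and A: "A \<ge> 0" "\<And>x. norm (F x) \<le> A" and l: "l \<ge> 0"
    and supp: "\<And>x. F x \<noteq> 0 \<Longrightarrow> x \<in> cbox p (p + (\<chi> i. l))"
  shows "(L2_norm F)\<^sup>2 \<le> A\<^sup>2 * l ^ CARD('n)"
proof -
  have m: "F \<in> borel_measurable borel" using F by (rule cc_measurable)
  have "cc (\<lambda>x. (norm (F x))\<^sup>2)"
    using F unfolding cc_def by (auto intro!: continuous_intros)
  then have i: "integrable lborel (\<lambda>x. (norm (F x))\<^sup>2)" by (rule cc_integrable)
  have "(L2_norm F)\<^sup>2 = (LINT x|lebesgue. (norm (F x))\<^sup>2)"
    unfolding L2_norm_def by (simp add: integral_nonneg_AE)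
  also have "\<dots> = (LINT x|lborel. (norm (F x))\<^sup>2)" using m by (intro integral_completion) auto
  also have "\<dots> \<le> (LINT x|lborel. indicat_real (cbox p (p + (\<chi> i. l))) x * A\<^sup>2)"
  proof (rule integral_mono[OF i])
    show "integrable lborel (\<lambda>x. indicat_real (cbox p (p + (\<chi> i. l))) x * A\<^sup>2)"
      by (intro integrable_mult_left integrable_real_indicator emeasure_bounded_finite) auto
    fix x show "(norm (F x))\<^sup>2 \<le> indicat_real (cbox p (p + (\<chi> i. l))) x * A\<^sup>2"
      using supp[of x] A(2)[of x] by (cases "F x = 0") (auto intro: power_mono)
  qed
  also have "\<dots> = measure lborel (cbox p (p + (\<chi> i. l))) * A\<^sup>2" by simp
  also have "measure lborel (cbox p (p + (\<chi> i. l))) = l ^ CARD('n)"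
    using l by (subst content_cbox_cart) (auto simp: interval_ne_empty_cart)
  finally show ?thesis by (simp add: mult.commute)
qed

text \<open>By Fubini the norm of a product field is the product of the norms of its factors.\<close>

lemma L2_norm_lower:
  fixes c :: "nat \<Rightarrow> 'n::finite" and F :: "real^'n \<Rightarrow> complex^3"
  assumes N: "N \<in> {2, 3}" and c: "bij_betw c {1..N} (UNIV :: 'n set)" and F: "cc F"
    and comp: "\<And>x. norm (tensor c f1 f2 f3 x) \<le> norm (F x)"
    and f: "cc f1" "cc f2" "transverse N f3" "N = 2 \<Longrightarrow> f3 = (\<lambda>_. 1)"
    and low: "\<gamma> * l \<le> (LINT t|lborel. (norm (f1 t))\<^sup>2)" "\<gamma> * l \<le> (LINT t|lborel. (norm (f2 t))\<^sup>2)"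
      "N = 3 \<Longrightarrow> \<gamma> * l \<le> (LINT t|lborel. (norm (f3 t))\<^sup>2)"
    and nn: "\<gamma> \<ge> 0" "l \<ge> 0"
  shows "(\<gamma> * l) ^ CARD('n) \<le> (L2_norm F)\<^sup>2"
proof -
  have card: "CARD('n) = N" using bij_betw_same_card[OF c] by simp
  have m: "F \<in> borel_measurable borel" using F by (rule cc_measurable)
  have sq: "cc (\<lambda>x. (norm (G x))\<^sup>2)" if "cc G" for G :: "'a::euclidean_space \<Rightarrow> 'b::real_normed_vector"
    using that unfolding cc_def by (auto intro!: continuous_intros)
  have nni: "(\<integral>\<^sup>+t. ennreal ((norm (g t))\<^sup>2) \<partial>lborel) = ennreal (LINT t|lborel. (norm (g t))\<^sup>2)" if "cc g" for g :: "real \<Rightarrow> complex"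
    by (rule nn_integral_eq_integral[OF cc_integrable[OF sq[OF that]]]) simp
  have f3m: "f3 \<in> borel_measurable borel"
    using f(3) by (cases "N = 3") (auto simp: transverse_def intro: cc_measurable)
  have "ennreal ((\<gamma> * l) ^ CARD('n)) \<le> (\<integral>\<^sup>+t. ennreal ((norm (f1 t))\<^sup>2) \<partial>lborel) * (\<integral>\<^sup>+t. ennreal ((norm (f2 t))\<^sup>2) \<partial>lborel) * (if N = 3 then \<integral>\<^sup>+t. ennreal ((norm (f3 t))\<^sup>2) \<partial>lborel else 1)"
  proof -
    have l1: "ennreal (\<gamma> * l) \<le> (\<integral>\<^sup>+t. ennreal ((norm (f1 t))\<^sup>2) \<partial>lborel)" "ennreal (\<gamma> * l) \<le> (\<integral>\<^sup>+t. ennreal ((norm (f2 t))\<^sup>2) \<partial>lborel)"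
      unfolding nni[OF f(1)] nni[OF f(2)] using low by (auto intro: ennreal_leI)
    have l3: "ennreal (\<gamma> * l) \<le> (\<integral>\<^sup>+t. ennreal ((norm (f3 t))\<^sup>2) \<partial>lborel)" if "N = 3"
    proof -
      have "cc f3" using f(3) that by (simp add: transverse_def)
      then show ?thesis unfolding nni[OF \<open>cc f3\<close>] using low(3)[OF that] by (auto intro: ennreal_leI)
    qed
    have g0: "0 \<le> \<gamma> * l" using nn by simp
    show ?thesis
    proof (cases "N = 3")
      case True
      have "ennreal ((\<gamma> * l) ^ CARD('n)) = ennreal (\<gamma> * l) * ennreal (\<gamma> * l) * ennreal (\<gamma> * l)"
        using g0 by (simp add: card True ennreal_mult[symmetric] power3_eq_cube del: mult_nonneg_nonneg)
      then show ?thesis using True l1 l3 by (auto intro!: mult_mono)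
    next
      case False
      then have "N = 2" using N by simp
      have "ennreal ((\<gamma> * l) ^ CARD('n)) = ennreal (\<gamma> * l) * ennreal (\<gamma> * l)"
        using g0 by (simp add: card \<open>N = 2\<close> ennreal_mult[symmetric] power2_eq_square)
      then show ?thesis using \<open>N = 2\<close> l1 by (auto intro!: mult_mono)
    qed
  qed
  also have "\<dots> = (\<integral>\<^sup>+x. ennreal ((norm (f1 (x $ c 1)))\<^sup>2) * ennreal ((norm (f2 (x $ c 2)))\<^sup>2) * ennreal ((norm (f3 (x $ c 3)))\<^sup>2) \<partial>(lborel :: (real^'n) measure))"
    by (rule nn_integral_tensor[OF N c, symmetric]) (use f(4) f3m cc_measurable[OF f(1)] cc_measurable[OF f(2)] in auto)
  also have "\<dots> = (\<integral>\<^sup>+x. ennreal ((norm (tensor c f1 f2 f3 x))\<^sup>2) \<partial>lborel)"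
    by (intro nn_integral_cong) (simp add: tensor_def norm_mult power_mult_distrib ennreal_mult)
  also have "\<dots> \<le> (\<integral>\<^sup>+x. ennreal ((norm (F x))\<^sup>2) \<partial>lborel)"
    by (intro nn_integral_mono ennreal_leI power_mono comp) auto
  also have "\<dots> = ennreal (LINT x|lborel. (norm (F x))\<^sup>2)"
    by (rule nn_integral_eq_integral[OF cc_integrable[OF sq[OF F]]]) simp
  finally have "(\<gamma> * l) ^ CARD('n) \<le> (LINT x|lborel. (norm (F x))\<^sup>2)" by (simp add: integral_nonneg_AE)
  also have "\<dots> = (LINT x|lebesgue. (norm (F x))\<^sup>2)" using m by (intro integral_completion[symmetric]) auto
  also have "\<dots> = (L2_norm F)\<^sup>2" unfolding L2_norm_def by (simp add: integral_nonneg_AE)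
  finally show ?thesis .
qed

text \<open>By Cauchy-Schwarz the inner product with \<open>v\<close> is bounded by the norm of \<open>v\<close> on the set
\<open>{x. |x\<^sub>i| \<ge> r\<^sub>n}\<close>, which tends to zero.\<close>

lemma escaping_weakly_null:
  fixes u :: "nat \<Rightarrow> real^'n::finite \<Rightarrow> complex^3"
  assumes u: "\<And>n. u n \<in> L2" "\<And>n. L2_norm (u n) = 1"
    and esc: "\<And>n x. u n x \<noteq> 0 \<Longrightarrow> r n \<le> \<bar>x $ i\<bar>" and r: "filterlim r at_top sequentially"
  shows "L2_weakly_null u"
  unfolding L2_weakly_null_def
proof
  fix v :: "real^'n \<Rightarrow> complex^3" assume v: "v \<in> L2"
  have um: "u n \<in> borel_measurable lebesgue" "integrable lebesgue (\<lambda>x. (norm (u n x))\<^sup>2)" for n using u(1) by (auto simp: L2_def)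
  have vm: "v \<in> borel_measurable lebesgue" "integrable lebesgue (\<lambda>x. (norm (v x))\<^sup>2)" using v by (auto simp: L2_def)
  have u1: "(LINT x|lebesgue. (norm (u n x))\<^sup>2) = 1" for n using u(2)[of n] by (simp add: L2_norm_def)
  define w where "w n x = of_bool (r n \<le> \<bar>x $ i\<bar>) * (norm (v x))\<^sup>2" for n and x :: "real^'n"
  have "(\<lambda>x :: real^'n. x $ i) \<in> borel_measurable borel"
    by (rule borel_measurable_continuous_onI) (auto intro: continuous_intros)
  then have xm: "(\<lambda>x :: real^'n. x $ i) \<in> borel_measurable lebesgue" by (intro measurable_completion) simp
  have wm: "w n \<in> borel_measurable lebesgue" for n
    unfolding w_def using xm vm by measurable
  have wi: "integrable lebesgue (w n)" for n
    by (rule Bochner_Integration.integrable_bound[OF vm(2) wm]) (auto simp: w_def)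
  have "(\<lambda>n. LINT x|lebesgue. w n x) \<longlonglongrightarrow> (LINT x::real^'n|lebesgue. (0::real))"
  proof (rule Bochner_Integration.integral_dominated_convergence[where w="\<lambda>x. (norm (v x))\<^sup>2"])
    show "AE x in lebesgue. (\<lambda>n. w n x) \<longlonglongrightarrow> 0"
    proof (rule AE_I2)
      fix x :: "real^'n"
      have "\<forall>\<^sub>F n in sequentially. \<bar>x $ i\<bar> < r n" using r by (simp add: filterlim_at_top_dense)
      then have "\<forall>\<^sub>F n in sequentially. w n x = 0" by eventually_elim (simp add: w_def)
      then show "(\<lambda>n. w n x) \<longlonglongrightarrow> 0" by (rule tendsto_eventually)
    qed
    show "AE x in lebesgue. norm (w n x) \<le> (norm (v x))\<^sup>2" for n by (simp add: w_def)
  qed (use vm wm in simp_all)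
  then have tau: "(\<lambda>n. LINT x|lebesgue. w n x) \<longlonglongrightarrow> 0" by simp
  \<comment> \<open>Cauchy-Schwarz in the form \<open>xy \<le> dx\<^sup>2/2 + y\<^sup>2/(2d)\<close>; the factor \<open>3\<close> bounds the sum over components.\<close>
  have bound: "norm (L2_inner (u n) v) \<le> 3 * (d / 2 + (LINT x|lebesgue. w n x) / (2 * d))" if d: "d > 0" for n d
  proof -
    have pt: "norm (\<Sum>j\<in>UNIV. u n x $ j * cnj (v x $ j)) \<le> 3 * (d / 2 * (norm (u n x))\<^sup>2 + w n x / (2 * d))" for x
    proof (cases "u n x = 0")
      case True then show ?thesis using d by (simp add: w_def)
    next
      case False
      then have w: "w n x = (norm (v x))\<^sup>2" using esc by (simp add: w_def)
      have "norm (\<Sum>j\<in>UNIV. u n x $ j * cnj (v x $ j)) \<le> (\<Sum>j\<in>(UNIV::3 set). norm (u n x) * norm (v x))"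
        by (intro sum_norm_le) (auto simp: norm_mult intro!: mult_mono Finite_Cartesian_Product.norm_nth_le)
      also have "\<dots> = 3 * (norm (u n x) * norm (v x))" by simp
      also have "norm (u n x) * norm (v x) \<le> d / 2 * (norm (u n x))\<^sup>2 + (norm (v x))\<^sup>2 / (2 * d)"
      proof -
        have "0 \<le> (d * norm (u n x) - norm (v x))\<^sup>2 / (2 * d)" using d by simp
        also have "\<dots> = d / 2 * (norm (u n x))\<^sup>2 + (norm (v x))\<^sup>2 / (2 * d) - norm (u n x) * norm (v x)"
          using d by (simp add: power2_eq_square field_simps)
        finally show ?thesis by simp
      qed
      finally show ?thesis using w by simp
    qed
    have "norm (L2_inner (u n) v) \<le> (LINT x|lebesgue. 3 * (d / 2 * (norm (u n x))\<^sup>2 + w n x / (2 * d)))"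
      unfolding L2_inner_def
    proof (rule Bochner_Integration.integral_norm_bound_integral)
      show i: "integrable lebesgue (\<lambda>x. 3 * (d / 2 * (norm (u n x))\<^sup>2 + w n x / (2 * d)))"
        using um(2) wi by simp
      have c1: "(\<lambda>w :: complex^3. w $ j) \<in> borel_measurable borel" for j
        by (rule borel_measurable_continuous_onI) (auto intro: continuous_intros)
      have c2: "(\<lambda>w :: complex^3. cnj (w $ j)) \<in> borel_measurable borel" for j
        by (rule borel_measurable_continuous_onI) (auto intro!: continuous_intros)
      have "(\<lambda>x. \<Sum>j\<in>UNIV. u n x $ j * cnj (v x $ j)) \<in> borel_measurable lebesgue"
        by (intro borel_measurable_sum borel_measurable_times
            measurable_compose[OF um(1) c1] measurable_compose[OF vm(1) c2])
      then show "integrable lebesgue (\<lambda>x. \<Sum>j\<in>UNIV. u n x $ j * cnj (v x $ j))"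
        by (rule Bochner_Integration.integrable_bound[OF i]) (use pt in \<open>auto intro!: AE_I2 intro: order_trans[OF _ abs_ge_self]\<close>)
    qed (use pt in auto)
    also have "\<dots> = 3 * (d / 2 * 1 + (LINT x|lebesgue. w n x) / (2 * d))"
      using um(2) wi u1[of n] by simp
    finally show ?thesis by simp
  qed
  show "(\<lambda>n. L2_inner (u n) v) \<longlonglongrightarrow> 0"
  proof (rule LIMSEQ_I)
    fix \<eta> :: real assume "\<eta> > 0"
    define d where "d = \<eta> / 3"
    have d: "d > 0" using \<open>\<eta> > 0\<close> by (simp add: d_def)
    have "\<forall>\<^sub>F n in sequentially. (LINT x|lebesgue. w n x) < d * d"
      by (rule order_tendstoD[OF tau]) (use d in simp)
    then obtain M where M: "\<And>n. n \<ge> M \<Longrightarrow> (LINT x|lebesgue. w n x) < d * d" by (auto simp: eventually_sequentially)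
    have "norm (L2_inner (u n) v - 0) < \<eta>" if "n \<ge> M" for n
    proof -
      have "(LINT x|lebesgue. w n x) / (2 * d) < d / 2" using M[OF that] d by (simp add: field_simps)
      then show ?thesis using bound[OF d, of n] by (simp add: d_def)
    qed
    then show "\<exists>M. \<forall>n\<ge>M. norm (L2_inner (u n) v - 0) < \<eta>" by blast
  qed
qed

text \<open>An approximate solution of \<open>L(\<omega>)E = 0\<close> with relative error \<open>\<delta>\<close>, supported in the slab \<open>x\<^sub>1 \<in> I\<close>.\<close>

definition has_quasimode ::
  "(nat \<Rightarrow> 'n::finite) \<Rightarrow> (real \<Rightarrow> complex) \<Rightarrow> complex \<Rightarrow> real \<Rightarrow> real set \<Rightarrow> bool" where
  "has_quasimode c \<epsilon> \<omega> \<delta> I \<longleftrightarrow> (\<exists>E F. pencil c \<epsilon> \<omega> E F \<and> L2_norm E > 0 \<and>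
     L2_norm F \<le> \<delta> * L2_norm E \<and> (\<forall>x. E x \<noteq> 0 \<longrightarrow> x $ c 1 \<in> I))"

lemma has_quasimode_mono: "has_quasimode c \<epsilon> \<omega> \<delta> I \<Longrightarrow> I \<subseteq> J \<Longrightarrow> has_quasimode c \<epsilon> \<omega> \<delta> J"
  unfolding has_quasimode_def by blast

text \<open>Normalise the quasimodes: errors and supports are unaffected, and escaping supports give weak
convergence to zero.\<close>

lemma weyl_criterion:
  fixes c :: "nat \<Rightarrow> 'n::finite"
  assumes omega: "\<omega> \<in> D_eps \<epsilon>\<^sub>p \<epsilon>\<^sub>m"
    and ev: "\<forall>\<^sub>F n in sequentially.
      has_quasimode c (\<lambda>x. permittivity \<epsilon>\<^sub>p \<epsilon>\<^sub>m x \<omega>) \<omega> (\<delta> n) {t. r n \<le> \<bar>t\<bar>}"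
    and \<delta>: "\<delta> \<longlonglongrightarrow> 0" and r: "filterlim r at_top sequentially"
  shows "\<omega> \<in> sigma_Weyl c \<epsilon>\<^sub>p \<epsilon>\<^sub>m"
proof -
  let ?\<epsilon> = "\<lambda>x. permittivity \<epsilon>\<^sub>p \<epsilon>\<^sub>m x \<omega>"
  obtain n0 where n0: "\<And>n. n \<ge> n0 \<Longrightarrow> \<exists>E f. pencil c ?\<epsilon> \<omega> E f \<and>
      L2_norm E > 0 \<and> L2_norm f \<le> \<delta> n * L2_norm E \<and> (\<forall>x. E x \<noteq> 0 \<longrightarrow> r n \<le> \<bar>x $ c 1\<bar>)"
    using ev unfolding eventually_sequentially has_quasimode_def mem_Collect_eq by blast
  have "\<forall>n. \<exists>Ef. pencil c ?\<epsilon> \<omega> (fst Ef) (snd Ef) \<and> L2_norm (fst Ef) > 0 \<and>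
      L2_norm (snd Ef) \<le> \<delta> (n + n0) * L2_norm (fst Ef) \<and> (\<forall>x. fst Ef x \<noteq> 0 \<longrightarrow> r (n + n0) \<le> \<bar>x $ c 1\<bar>)"
    using n0 by simp
  from choice[OF this] obtain Ef where Ef: "\<And>n. pencil c ?\<epsilon> \<omega> (fst (Ef n)) (snd (Ef n))" "\<And>n. L2_norm (fst (Ef n)) > 0"
      "\<And>n. L2_norm (snd (Ef n)) \<le> \<delta> (n + n0) * L2_norm (fst (Ef n))" "\<And>n x. fst (Ef n) x \<noteq> 0 \<Longrightarrow> r (n + n0) \<le> \<bar>x $ c 1\<bar>"
    by blast
  define s where "s n = 1 / L2_norm (fst (Ef n))" for n
  define u where "u n = (\<lambda>x. s n *\<^sub>R fst (Ef n) x)" for n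
  define f where "f n = (\<lambda>x. s n *\<^sub>R snd (Ef n) x)" for n
  have p: "pencil c ?\<epsilon> \<omega> (u n) (f n)" for n unfolding u_def f_def by (rule pencil_scaleR[OF Ef(1)])
  have nu: "L2_norm (u n) = 1" for n using Ef(2)[of n] by (simp add: u_def L2_norm_scaleR s_def)
  have dom: "u n \<in> pencil_dom c ?\<epsilon>" for n using p[of n] by (simp add: pencil_def)
  have "filterlim (\<lambda>n. r (n + n0)) at_top sequentially" by (rule filterlim_compose[OF r filterlim_add_const_nat_at_top])
  then have "L2_weakly_null u"
    by (rule escaping_weakly_null[where i="c 1", rotated 3]) (use dom nu Ef(4) in \<open>auto simp: pencil_dom_def u_def\<close>)
  moreover have "(\<lambda>n. L2_norm (f n)) \<longlonglongrightarrow> 0"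
  proof (rule tendsto_sandwich[of "\<lambda>_. 0" _ _ "\<lambda>n. \<delta> (n + n0)"])
    show "\<forall>\<^sub>F n in sequentially. L2_norm (f n) \<le> \<delta> (n + n0)"
    proof (rule always_eventually, rule allI)
      fix n
      have "L2_norm (f n) = L2_norm (snd (Ef n)) / L2_norm (fst (Ef n))"
        using Ef(2)[of n] by (simp add: f_def L2_norm_scaleR s_def)
      then show "L2_norm (f n) \<le> \<delta> (n + n0)" using Ef(2,3)[of n] by (simp add: divide_le_eq)
    qed
    show "(\<lambda>n. \<delta> (n + n0)) \<longlonglongrightarrow> 0" by (rule LIMSEQ_ignore_initial_segment[OF \<delta>])
    show "\<forall>\<^sub>F n in sequentially. 0 \<le> L2_norm (f n)" by (simp add: L2_norm_def)
  qed simp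
  ultimately show ?thesis
    unfolding sigma_Weyl_def using omega dom nu p by blast
qed

section \<open>Cutoffs and transverse profiles\<close>

definition zext :: "real \<Rightarrow> real \<Rightarrow> (real \<Rightarrow> complex) \<Rightarrow> real \<Rightarrow> complex" where
  "zext l r f t = (if t \<in> {l..r} then f t else 0)"

text \<open>Gluing with zero is differentiable at the endpoints because the function and its derivative vanish
there.\<close>

lemma zext_deriv:
  assumes lr: "l < r" and d: "\<And>t. t \<in> {l..r} \<Longrightarrow> (f has_vector_derivative f' t) (at t within {l..r})"
    and z: "f l = 0" "f r = 0" "f' l = 0" "f' r = 0"
  shows "(zext l r f has_vector_derivative zext l r f' t) (at t)"
proof -
  have zero: "((\<lambda>_. 0 :: complex) has_vector_derivative 0) (at t within A)" for A by simp
  have inn: "(zext l r f has_vector_derivative f' t) (at t within {l..r})" if t: "t \<in> {l..r}"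
    by (rule has_vector_derivative_transform[OF t _ d[OF t]]) (simp add: zext_def)
  consider "t < l" | "t = l" | "t \<in> {l<..<r}" | "t = r" | "t > r" using lr by fastforce
  then show ?thesis
  proof cases
    case 1
    have "(zext l r f has_vector_derivative 0) (at t)"
      by (rule has_vector_derivative_transform_within_open[OF zero, where S="{..<l}"]) (use 1 in \<open>auto simp: zext_def\<close>)
    then show ?thesis using 1 by (simp add: zext_def)
  next
    case 5
    have "(zext l r f has_vector_derivative 0) (at t)"
      by (rule has_vector_derivative_transform_within_open[OF zero, where S="{r<..}"]) (use 5 lr in \<open>auto simp: zext_def\<close>)
    then show ?thesis using 5 by (simp add: zext_def)
  next
    case 3
    then have "(zext l r f has_vector_derivative f' t) (at t)"
      using inn at_within_interior[of t "{l..r}"] by simp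
    then show ?thesis using 3 by (simp add: zext_def)
  next
    case 2
    have "(zext l r f has_vector_derivative 0) (at t within {..l})"
      by (rule has_vector_derivative_transform[OF _ _ zero]) (use 2 lr z in \<open>auto simp: zext_def\<close>)
    moreover have "(zext l r f has_vector_derivative 0) (at t within {l..r})" using inn 2 lr z by simp
    ultimately have "(zext l r f has_vector_derivative 0) (at t within {..l} \<union> {l..r})"
      by (rule has_vector_derivative_within_Un)
    moreover have "{..l} \<union> {l..r} = {..r}" using lr by auto
    then have "at t within {..l} \<union> {l..r} = at t"
      using 2 lr by (intro at_within_interior) simp
    ultimately show ?thesis using 2 lr z by (simp add: zext_def)
  next
    case 4
    have "(zext l r f has_vector_derivative 0) (at t within {r..})"
      by (rule has_vector_derivative_transform[OF _ _ zero]) (use 4 lr z in \<open>auto simp: zext_def\<close>)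
    moreover have "(zext l r f has_vector_derivative 0) (at t within {l..r})" using inn 4 lr z by simp
    ultimately have "(zext l r f has_vector_derivative 0) (at t within {l..r} \<union> {r..})"
      by (intro has_vector_derivative_within_Un)
    moreover have "{l..r} \<union> {r..} = {l..}" using lr by auto
    then have "at t within {l..r} \<union> {r..} = at t"
      using 4 lr by (intro at_within_interior) simp
    ultimately show ?thesis using 4 lr z by (simp add: zext_def)
  qed
qed

lemma zext_cc:
  assumes lr: "l < r" and c: "continuous_on {l..r} f" and z: "f l = 0" "f r = 0"
  shows "cc (zext l r f)"
proof -
  have "continuous_on ({..l} \<union> {l..r} \<union> {r..}) (zext l r f)"
  proof (intro continuous_on_closed_Un closed_Un)
    show "continuous_on {l..r} (zext l r f)"
      using c by (rule continuous_on_eq) (simp add: zext_def)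
    show "continuous_on {..l} (zext l r f)"
      by (rule continuous_on_eq[OF continuous_on_const[of _ 0]]) (use z lr in \<open>auto simp: zext_def\<close>)
    show "continuous_on {r..} (zext l r f)"
      by (rule continuous_on_eq[OF continuous_on_const[of _ 0]]) (use z lr in \<open>auto simp: zext_def\<close>)
  qed auto
  moreover have "{..l} \<union> {l..r} \<union> {r..} = UNIV" using lr by auto
  ultimately have "continuous_on UNIV (zext l r f)" by simp
  moreover have "zext l r f t = 0" if "norm t > max \<bar>l\<bar> \<bar>r\<bar>" for t
    using that by (auto simp: zext_def)
  ultimately show ?thesis unfolding cc_def by blast
qed

text \<open>The function \<open>(t - t\<^sup>2)\<^sup>4\<close> and its first three derivatives. The fourth power makes all of them vanish at
\<open>0\<close> and \<open>1\<close>; three derivatives occur when \<open>L(\<omega>)\<close> is applied to a field that is itself a first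
derivative of a potential.\<close>

definition cut :: "nat \<Rightarrow> real \<Rightarrow> real" where
  "cut k t = (if k = 0 then t^4 - 4*t^5 + 6*t^6 - 4*t^7 + t^8
    else if k = 1 then 4*t^3 - 20*t^4 + 36*t^5 - 28*t^6 + 8*t^7
    else if k = 2 then 12*t^2 - 80*t^3 + 180*t^4 - 168*t^5 + 56*t^6
    else 24*t - 240*t^2 + 720*t^3 - 840*t^4 + 336*t^5)"

lemma cut_deriv: "k \<le> 2 \<Longrightarrow> (cut k has_real_derivative cut (Suc k) t) (at t)"
proof -
  assume "k \<le> 2"
  then consider "k = 0" | "k = 1" | "k = 2" by linarith
  then show ?thesis
    by cases (auto simp: cut_def[abs_def] intro!: derivative_eq_intros)
qed

lemma cut_zero: "cut k 0 = 0" "cut k 1 = 0"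
  by (simp_all add: cut_def)

text \<open>\<open>2160\<close> is the sum of the absolute values of the coefficients of the third derivative.\<close>

lemma cut_bound: "t \<in> {0..1} \<Longrightarrow> \<bar>cut k t\<bar> \<le> 2160"
proof -
  assume t: "t \<in> {0..1}"
  have p: "0 \<le> t ^ j" "t ^ j \<le> 1" for j using t by (auto simp: power_le_one)
  note pp = p[of 1, simplified power_one_right] p[of 2] p[of 3] p[of 4] p[of 5] p[of 6] p[of 7] p[of 8]
  consider "k = 0" | "k = 1" | "k = 2" | "k > 2" by linarith
  then show ?thesis
  proof cases
    case 1
    have "cut k t = t^4 - 4*t^5 + 6*t^6 - 4*t^7 + t^8" using 1 by (simp add: cut_def)
    then show ?thesis using pp by linarith
  next
    case 2
    have "cut k t = 4*t^3 - 20*t^4 + 36*t^5 - 28*t^6 + 8*t^7" using 2 by (simp add: cut_def)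
    then show ?thesis using pp by linarith
  next
    case 3
    have "cut k t = 12*t^2 - 80*t^3 + 180*t^4 - 168*t^5 + 56*t^6" using 3 by (simp add: cut_def)
    then show ?thesis using pp by linarith
  next
    case 4
    have "cut k t = 24*t - 240*t^2 + 720*t^3 - 840*t^4 + 336*t^5" using 4 by (simp add: cut_def)
    then show ?thesis using pp by linarith
  qed
qed

lemma cut_0_eq: "cut 0 t = (t * (1 - t)) ^ 4" and cut_1_eq: "cut 1 t = 4 * (t * (1 - t)) ^ 3 * (1 - 2 * t)"
  by (simp_all add: cut_def power4_eq_xxxx eval_nat_numeral algebra_simps)

lemma cut_lower:
  shows "t \<in> {1/4..3/4} \<Longrightarrow> 1/1000 \<le> cut 0 t" and "t \<in> {1/8..1/4} \<Longrightarrow> 1/1000 \<le> cut 1 t"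
proof -
  assume t: "t \<in> {1/4..3/4}"
  have "0 \<le> (t - 1/4) * (3/4 - t)" using t by simp
  moreover have "(t - 1/4) * (3/4 - t) = t * (1 - t) - 3/16" by (simp add: field_simps)
  ultimately have "3/16 \<le> t * (1 - t)" by linarith
  then have "(3/16) ^ 4 \<le> (t * (1 - t)) ^ 4" by (intro power_mono) auto
  then show "1/1000 \<le> cut 0 t" unfolding cut_0_eq by (simp add: power_divide)
next
  assume t: "t \<in> {1/8..1/4}"
  have "0 \<le> (t - 1/8) * (7/8 - t)" using t by simp
  moreover have "(t - 1/8) * (7/8 - t) = t * (1 - t) - 7/64" by (simp add: field_simps)
  ultimately have "7/64 \<le> t * (1 - t)" by linarith
  then have "(7/64) ^ 3 \<le> (t * (1 - t)) ^ 3" by (intro power_mono) auto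
  then have "4 * (7/64) ^ 3 * (1/2) \<le> 4 * (t * (1 - t)) ^ 3 * (1 - 2 * t)" using t by (intro mult_mono) auto
  then show "1/1000 \<le> cut 1 t" unfolding cut_1_eq by (simp add: power_divide)
qed

text \<open>The cutoff of the interval \<open>[b, b + l]\<close> and its derivatives: \<open>cutoff b l k\<close> is the \<open>k\<close>-th derivative of
\<open>cut 0 ((t - b)/l)\<close>.\<close>

definition cutoff :: "real \<Rightarrow> real \<Rightarrow> nat \<Rightarrow> real \<Rightarrow> complex" where
  "cutoff b l k t = of_real (cut k ((t - b) / l) / l ^ k)"

lemma cutoff_deriv:
  assumes "l > 0" "k \<le> 2"
  shows "(cutoff b l k has_vector_derivative cutoff b l (Suc k) t) (at t within A)"
proof -
  have "((\<lambda>t. (t - b) / l) has_real_derivative 1 / l) (at t)"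
    using assms by (auto intro!: derivative_eq_intros)
  from DERIV_chain2[OF cut_deriv[OF assms(2)] this]
  have "((\<lambda>t. cut k ((t - b) / l) / l ^ k) has_real_derivative cut (Suc k) ((t - b) / l) * (1 / l) / l ^ k) (at t)"
    by (rule DERIV_cdivide)
  then have "((\<lambda>t. cut k ((t - b) / l) / l ^ k) has_vector_derivative cut (Suc k) ((t - b) / l) / l ^ Suc k) (at t)"
    by (simp add: has_real_derivative_iff_has_vector_derivative field_simps)
  then have "((\<lambda>t. complex_of_real (cut k ((t - b) / l) / l ^ k)) has_vector_derivative of_real (cut (Suc k) ((t - b) / l) / l ^ Suc k)) (at t)"
    by (rule bounded_linear.has_vector_derivative[OF bounded_linear_of_real])
  then show ?thesis unfolding cutoff_def[abs_def] by (rule has_vector_derivative_at_within)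
qed

lemma cut_cont: "continuous_on A (cut k)"
  unfolding cut_def[abs_def]
  by (cases "k = 0"; cases "k = 1"; cases "k = 2") (auto intro!: continuous_intros)

lemma cutoff_cont: "l > 0 \<Longrightarrow> continuous_on A (cutoff b l k)"
  unfolding cutoff_def[abs_def]
  by (auto intro!: continuous_intros continuous_on_compose2[OF cut_cont[of UNIV]])

lemma cutoff_zero: "l > 0 \<Longrightarrow> cutoff b l k b = 0" "l > 0 \<Longrightarrow> cutoff b l k (b + l) = 0"
  by (simp_all add: cutoff_def cut_zero)

lemma cutoff_bound:
  assumes "l > 0" "t \<in> {b..b + l}"
  shows "norm (cutoff b l k t) \<le> 2160 / l ^ k"
proof -
  have "(t - b) / l \<in> {0..1}" using assms by (auto simp: field_simps)
  from cut_bound[OF this] show ?thesis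
    using assms(1) by (simp add: cutoff_def norm_divide norm_power divide_right_mono)
qed

lemma cutoff_lower:
  assumes "l > 0"
  shows "t \<in> {b + l/4..b + 3 * l/4} \<Longrightarrow> 1/1000 \<le> norm (cutoff b l 0 t)"
    and "t \<in> {b + l/8..b + l/4} \<Longrightarrow> 1/1000 / l \<le> norm (cutoff b l 1 t)"
proof -
  assume "t \<in> {b + l/4..b + 3 * l/4}"
  then have "(t - b) / l \<in> {1/4..3/4}" using assms by (auto simp: field_simps)
  from cut_lower(1)[OF this] show "1/1000 \<le> norm (cutoff b l 0 t)" by (simp add: cutoff_def)
next
  assume "t \<in> {b + l/8..b + l/4}"
  then have "(t - b) / l \<in> {1/8..1/4}" using assms by (auto simp: field_simps)
  from cut_lower(2)[OF this] have "1/1000 / l \<le> cut 1 ((t - b) / l) / l"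
    using assms by (intro divide_right_mono) auto
  also have "\<dots> \<le> norm (cutoff b l 1 t)" unfolding cutoff_def norm_of_real
    by (rule order_trans[OF _ abs_ge_self]) simp
  finally show "1/1000 / l \<le> norm (cutoff b l 1 t)" .
qed

lemma integral_sq_lower:
  fixes f :: "real \<Rightarrow> complex"
  assumes f: "cc f" and h: "continuous_on {l..r} h" "\<And>t. t \<in> {l..r} \<Longrightarrow> h t \<le> (norm (f t))\<^sup>2"
  shows "integral {l..r} h \<le> (LINT t|lborel. (norm (f t))\<^sup>2)"
proof -
  have c: "continuous_on A (\<lambda>t. (norm (f t))\<^sup>2)" for A by (intro continuous_intros ccD[OF f])
  have "cc (\<lambda>t. (norm (f t))\<^sup>2)" using f unfolding cc_def by (auto intro!: continuous_intros)
  then have i: "integrable lborel (\<lambda>t. (norm (f t))\<^sup>2)" by (rule cc_integrable)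
  have "integral {l..r} h \<le> integral {l..r} (\<lambda>t. (norm (f t))\<^sup>2)"
    by (intro integral_le integrable_continuous_interval c h)
  also have "\<dots> = (LINT t:{l..r}|lborel. (norm (f t))\<^sup>2)"
    using borel_integrable_compact[of "{l..r}" "\<lambda>t. (norm (f t))\<^sup>2"] c
    by (intro set_borel_integral_eq_integral(2)[symmetric]) (simp add: set_integrable_def)
  also have "\<dots> \<le> (LINT t|lborel. (norm (f t))\<^sup>2)"
    unfolding set_lebesgue_integral_def
    by (rule integral_mono[OF integrable_mult_indicator i]) (use i in \<open>auto simp: indicator_def\<close>)
  finally show ?thesis .
qed

lemma integral_sq_lower_const:
  fixes f :: "real \<Rightarrow> complex"
  assumes f: "cc f" and m: "0 \<le> m" "\<And>t. t \<in> {l..r} \<Longrightarrow> m \<le> norm (f t)" and lr: "l \<le> r"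
  shows "m\<^sup>2 * (r - l) \<le> (LINT t|lborel. (norm (f t))\<^sup>2)"
  using integral_sq_lower[OF f, of l r "\<lambda>_. m\<^sup>2"] m lr by (simp add: power_mono mult.commute)

text \<open>For \<open>N = 3\<close> a cutoff of \<open>[0, l]\<close>, for \<open>N = 2\<close> the constant one with zero derivatives.\<close>

lemma transverse_profile:
  assumes N: "N \<in> {2, 3::nat}"
  obtains f where "\<And>k l. l \<ge> 1 \<Longrightarrow> k \<le> 3 \<Longrightarrow> transverse N (f l k)"
    "\<And>k l t. l \<ge> 1 \<Longrightarrow> k \<le> 2 \<Longrightarrow> (f l k has_vector_derivative f l (Suc k) t) (at t)"
    "\<And>k l t. l \<ge> 1 \<Longrightarrow> k \<le> 3 \<Longrightarrow> norm (f l k t) \<le> 2160 / l ^ k"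
    "\<And>l. N = 2 \<Longrightarrow> f l 0 = (\<lambda>_. 1)"
    "\<And>l. N = 3 \<Longrightarrow> l \<ge> 1 \<Longrightarrow> 1/2000000 * l \<le> (LINT t|lborel. (norm (f l 0 t))\<^sup>2)"
    "\<And>l k t. N = 3 \<Longrightarrow> f l k t \<noteq> 0 \<Longrightarrow> t \<in> {0..l}"
proof (cases "N = 3")
  case True
  have cc: "cc (zext 0 l (cutoff 0 l k))" if "l \<ge> 1" for l :: real and k
    using that by (intro zext_cc cutoff_cont) (use cutoff_zero[of l 0 k] in auto)
  show ?thesis
  proof (rule that[of "\<lambda>l k. zext 0 l (cutoff 0 l k)"])
    fix k :: nat and l t :: real assume l: "l \<ge> 1"
    show "transverse N (zext 0 l (cutoff 0 l k))" using cc[OF l] True by (simp add: transverse_def)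
    show "(zext 0 l (cutoff 0 l k) has_vector_derivative zext 0 l (cutoff 0 l (Suc k)) t) (at t)" if "k \<le> 2"
      by (rule zext_deriv) (use l that cutoff_zero[of l 0] in \<open>auto intro!: cutoff_deriv\<close>)
    show "norm (zext 0 l (cutoff 0 l k) t) \<le> 2160 / l ^ k"
      using cutoff_bound[of l t 0 k] l by (auto simp: zext_def)
    have "(1/1000)\<^sup>2 * (3 * l/4 - l/4) \<le> (LINT t|lborel. (norm (zext 0 l (cutoff 0 l 0) t))\<^sup>2)"
      by (rule integral_sq_lower_const[OF cc[OF l]]) (use l cutoff_lower(1)[of l _ 0] in \<open>auto simp: zext_def\<close>)
    then show "1/2000000 * l \<le> (LINT t|lborel. (norm (zext 0 l (cutoff 0 l 0) t))\<^sup>2)"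
      by (simp add: power2_eq_square)
  qed (use True in \<open>auto simp: zext_def split: if_splits\<close>)
next
  case False
  show ?thesis
    by (rule that[of "\<lambda>l k t. if k = 0 then 1 else 0"]) (use False N in \<open>auto simp: transverse_def\<close>)
qed

text \<open>The plane wave \<open>exp(\<i>\<kappa>t)\<close> times the cutoff of \<open>[0, l]\<close>, and its derivatives by the Leibniz rule.\<close>

definition wave :: "real \<Rightarrow> real \<Rightarrow> nat \<Rightarrow> real \<Rightarrow> complex" where
  "wave \<kappa> l k t = (let z = \<i> * of_real \<kappa>; X = (\<lambda>j. cutoff 0 l j t) in exp (z * of_real t) *
    (if k = 0 then X 0 else if k = 1 then z * X 0 + X 1 else if k = 2 then z * z * X 0 + 2 * z * X 1 + X 2
     else z * z * z * X 0 + 3 * z * z * X 1 + 3 * z * X 2 + X 3))"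

lemma exp_mult_deriv:
  fixes P :: "real \<Rightarrow> complex" and z :: complex
  assumes "(P has_vector_derivative P') (at t within A)"
  shows "((\<lambda>t. exp (z * of_real t) * P t) has_vector_derivative exp (z * of_real t) * (z * P t + P')) (at t within A)"
proof -
  have "((\<lambda>t. z * of_real t) has_vector_derivative z * of_real 1) (at t within A)"
    by (intro has_vector_derivative_mult_right has_vector_derivative_of_real) (rule DERIV_ident)
  from field_vector_diff_chain_within[OF this, of exp "exp (z * of_real t)"]
  have "((\<lambda>t. exp (z * of_real t)) has_vector_derivative z * exp (z * of_real t)) (at t within A)"
    by (simp add: o_def has_field_derivative_at_within)
  from has_vector_derivative_mult[OF this assms] show ?thesis by (simp add: algebra_simps)
qed

lemma wave_deriv:
  assumes l: "l > 0" and k: "k \<le> 2"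
  shows "(wave \<kappa> l k has_vector_derivative wave \<kappa> l (Suc k) t) (at t within A)"
proof -
  define z where "z = \<i> * complex_of_real \<kappa>"
  have d: "(cutoff 0 l 0 has_vector_derivative cutoff 0 l 1 t) (at t within A)"
    "(cutoff 0 l 1 has_vector_derivative cutoff 0 l 2 t) (at t within A)"
    "(cutoff 0 l 2 has_vector_derivative cutoff 0 l 3 t) (at t within A)"
    using cutoff_deriv[OF l, of 0] cutoff_deriv[OF l, of 1] cutoff_deriv[OF l, of 2]
    by (simp_all add: numeral_2_eq_2 numeral_3_eq_3)
  consider "k = 0" | "k = 1" | "k = 2" using k by linarith
  then show ?thesis
  proof cases
    case 1
    show ?thesis using exp_mult_deriv[OF d(1), of z] 1 by (simp add: wave_def[abs_def] Let_def z_def)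
  next
    case 2
    have "((\<lambda>t. z * cutoff 0 l 0 t + cutoff 0 l 1 t) has_vector_derivative z * cutoff 0 l 1 t + cutoff 0 l 2 t) (at t within A)"
      by (intro has_vector_derivative_add has_vector_derivative_mult_right d)
    from exp_mult_deriv[OF this, of z] 2 show ?thesis
      by (simp add: wave_def[abs_def] Let_def z_def algebra_simps)
  next
    case 3
    have "((\<lambda>t. z * z * cutoff 0 l 0 t + 2 * z * cutoff 0 l 1 t + cutoff 0 l 2 t) has_vector_derivative
        z * z * cutoff 0 l 1 t + 2 * z * cutoff 0 l 2 t + cutoff 0 l 3 t) (at t within A)"
      by (intro has_vector_derivative_add has_vector_derivative_mult_right d)
    from exp_mult_deriv[OF this, of z] 3 show ?thesis
      by (simp add: wave_def[abs_def] Let_def z_def algebra_simps)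
  qed
qed

lemma wave_cont: "l > 0 \<Longrightarrow> continuous_on A (wave \<kappa> l k)"
  unfolding wave_def[abs_def] Let_def
  by (cases "k = 0"; cases "k = 1"; cases "k = 2") (auto intro!: continuous_intros cutoff_cont)

lemma wave_zero: "l > 0 \<Longrightarrow> wave \<kappa> l k 0 = 0" "l > 0 \<Longrightarrow> wave \<kappa> l k l = 0"
  using cutoff_zero[of l 0] by (simp_all add: wave_def Let_def)

text \<open>In \<open>f'' + \<kappa>\<^sup>2f\<close> the terms without a derivative of the cutoff cancel, and the others carry a factor \<open>1/l\<close>.\<close>

lemma wave_norm:
  assumes l: "l \<ge> 1" and t: "t \<in> {0..l}"
  shows "norm (wave \<kappa> l k t) \<le> 2160 * (1 + \<bar>\<kappa>\<bar>) ^ 3 * 8"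
    and "norm (wave \<kappa> l 2 t + of_real (\<kappa>\<^sup>2) * wave \<kappa> l 0 t) \<le> 2160 * (1 + \<bar>\<kappa>\<bar>) ^ 3 * 8 / l"
    and "norm (wave \<kappa> l 3 t + of_real (\<kappa>\<^sup>2) * wave \<kappa> l 1 t) \<le> 2160 * (1 + \<bar>\<kappa>\<bar>) ^ 3 * 8 / l"
proof -
  define z where "z = \<i> * complex_of_real \<kappa>"
  define K where "K = (1 + \<bar>\<kappa>\<bar>) ^ 3"
  have nz: "norm z = \<bar>\<kappa>\<bar>" and kk: "complex_of_real (\<kappa>\<^sup>2) = - (z * z)"
    by (simp_all add: z_def norm_mult power2_eq_square algebra_simps)
  have K: "1 \<le> K" "norm z \<le> K" "norm z * norm z \<le> K" "norm z * norm z * norm z \<le> K"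
  proof -
    have "(norm z) ^ j \<le> K" if "j \<le> 3" for j
    proof -
      have "(norm z) ^ j \<le> (1 + \<bar>\<kappa>\<bar>) ^ j" unfolding nz by (intro power_mono) auto
      also have "\<dots> \<le> K" unfolding K_def using that by (intro power_increasing) auto
      finally show ?thesis .
    qed
    from this[of 0] this[of 1] this[of 2] this[of 3] show "1 \<le> K" "norm z \<le> K" "norm z * norm z \<le> K" "norm z * norm z * norm z \<le> K"
      by (simp_all add: power2_eq_square power3_eq_cube)
  qed
  define X where "X j = cutoff 0 l j t" for j
  have lk: "1 / l ^ j \<le> 1" "1 \<le> j \<Longrightarrow> 1 / l ^ j \<le> 1 / l" for j
    using l one_le_power[of l j] power_increasing[of 1 j l] by (auto simp: divide_simps)
  have X: "norm (X j) \<le> 2160" "1 \<le> j \<Longrightarrow> norm (X j) \<le> 2160 / l" for j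
  proof -
    have "norm (X j) \<le> 2160 * (1 / l ^ j)" using cutoff_bound[of l t 0 j] l t by (simp add: X_def)
    then show "norm (X j) \<le> 2160" "1 \<le> j \<Longrightarrow> norm (X j) \<le> 2160 / l"
      using mult_left_mono[OF lk(1)[of j], of 2160] mult_left_mono[OF lk(2)[of j], of 2160] by auto
  qed
  have ex: "norm (exp (z * of_real t)) = 1" by (simp add: z_def norm_exp_eq_Re)
  have w: "wave \<kappa> l 0 t = exp (z * of_real t) * X 0" "wave \<kappa> l 1 t = exp (z * of_real t) * (z * X 0 + X 1)"
    "wave \<kappa> l 2 t = exp (z * of_real t) * (z * z * X 0 + 2 * z * X 1 + X 2)"
    "wave \<kappa> l 3 t = exp (z * of_real t) * (z * z * z * X 0 + 3 * z * z * X 1 + 3 * z * X 2 + X 3)"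
    "k > 3 \<Longrightarrow> wave \<kappa> l k t = exp (z * of_real t) * (z * z * z * X 0 + 3 * z * z * X 1 + 3 * z * X 2 + X 3)"
    by (simp_all add: wave_def Let_def z_def X_def)
  have m: "norm (y * x) \<le> K * M" if "norm y \<le> K" "norm x \<le> M" for y x :: complex and M
    unfolding norm_mult using that order_trans[OF norm_ge_zero that(1)] by (intro mult_mono) auto
  have m1: "norm x \<le> K * M" if "norm x \<le> M" for x :: complex and M
    using m[of 1 x M] K(1) that by simp
  have l0: "l > 0" using l by simp
  have zs: "norm (z * z) \<le> K" "norm (z * z * z) \<le> K" using K by (simp_all add: norm_mult)
  note tri = norm_triangle_le
  have T: "norm (a + 3 * b + 3 * c + d) \<le> norm a + 3 * norm b + 3 * norm c + norm d" for a b c d :: complex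
    using norm_triangle_ineq[of "a + 3 * b + 3 * c" d] norm_triangle_ineq[of "a + 3 * b" "3 * c"] norm_triangle_ineq[of a "3 * b"]
    by (simp add: norm_mult)
  have T2: "norm (a + 2 * b + d) \<le> norm a + 2 * norm b + norm d" for a b d :: complex
    using norm_triangle_ineq[of "a + 2 * b" d] norm_triangle_ineq[of a "2 * b"] by (simp add: norm_mult)
  have KP: "0 \<le> K * 2160" "0 \<le> K * (2160 / l)" using K(1) l by auto
  have b3: "norm (z * z * z * X 0 + 3 * z * z * X 1 + 3 * z * X 2 + X 3) \<le> 2160 * K * 8"
    using T[of "z * z * z * X 0" "z * z * X 1" "z * X 2" "X 3"] m[OF zs(2) X(1)[of 0]] m[OF zs(1) X(1)[of 1]] m[OF K(2) X(1)[of 2]] m1[OF X(1)[of 3]] KP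
    by (simp add: mult.assoc)
  have b2: "norm (z * z * X 0 + 2 * z * X 1 + X 2) \<le> 2160 * K * 8"
    using T2[of "z * z * X 0" "z * X 1" "X 2"] m[OF zs(1) X(1)[of 0]] m[OF K(2) X(1)[of 1]] m1[OF X(1)[of 2]] KP
    by (simp add: mult.assoc)
  have b1: "norm (z * X 0 + X 1) \<le> 2160 * K * 8"
    using norm_triangle_ineq[of "z * X 0" "X 1"] m[OF K(2) X(1)[of 0]] m1[OF X(1)[of 1]] KP by simp
  have b0: "norm (X 0) \<le> 2160 * K * 8" using m1[OF X(1)[of 0]] KP by simp
  consider "k = 0" | "k = 1" | "k = 2" | "k = 3" | "k > 3" by linarith
  then show "norm (wave \<kappa> l k t) \<le> 2160 * (1 + \<bar>\<kappa>\<bar>) ^ 3 * 8"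
    unfolding K_def[symmetric] by cases (simp_all only: w norm_mult ex mult_1_left b0 b1 b2 b3)
  have "wave \<kappa> l 2 t + of_real (\<kappa>\<^sup>2) * wave \<kappa> l 0 t = exp (z * of_real t) * (0 + 2 * (z * X 1) + X 2)"
    unfolding w kk by (simp add: algebra_simps)
  then have "norm (wave \<kappa> l 2 t + of_real (\<kappa>\<^sup>2) * wave \<kappa> l 0 t) = norm (0 + 2 * (z * X 1) + X 2)"
    by (simp only: norm_mult ex mult_1_left)
  also have "\<dots> \<le> 2160 * K * 8 / l"
    using T2[of 0 "z * X 1" "X 2"] m[OF K(2) X(2)[of 1]] m1[OF X(2)[of 2]] KP by simp
  finally show "norm (wave \<kappa> l 2 t + of_real (\<kappa>\<^sup>2) * wave \<kappa> l 0 t) \<le> 2160 * (1 + \<bar>\<kappa>\<bar>) ^ 3 * 8 / l" unfolding K_def .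
  have "wave \<kappa> l 3 t + of_real (\<kappa>\<^sup>2) * wave \<kappa> l 1 t = exp (z * of_real t) * (0 + 2 * (z * z * X 1) + (3 * (z * X 2) + X 3))"
    unfolding w kk by (simp add: algebra_simps)
  then have "norm (wave \<kappa> l 3 t + of_real (\<kappa>\<^sup>2) * wave \<kappa> l 1 t) = norm (0 + 2 * (z * z * X 1) + (3 * (z * X 2) + X 3))"
    by (simp only: norm_mult ex mult_1_left)
  also have "\<dots> \<le> 2160 * K * 8 / l"
    using T2[of 0 "z * z * X 1" "3 * (z * X 2) + X 3"] norm_triangle_ineq[of "3 * (z * X 2)" "X 3"]
      m[OF zs(1) X(2)[of 1]] m[OF K(2) X(2)[of 2]] m1[OF X(2)[of 3]] KP by (simp add: norm_mult)
  finally show "norm (wave \<kappa> l 3 t + of_real (\<kappa>\<^sup>2) * wave \<kappa> l 1 t) \<le> 2160 * (1 + \<bar>\<kappa>\<bar>) ^ 3 * 8 / l" unfolding K_def .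
qed

lemma zext_nz: "zext l r f t \<noteq> 0 \<Longrightarrow> t \<in> {l..r}"
  by (auto simp: zext_def split: if_splits)

lemma zext_norm: "(\<And>t. t \<in> {l..r} \<Longrightarrow> norm (f t) \<le> B) \<Longrightarrow> 0 \<le> B \<Longrightarrow> norm (zext l r f t) \<le> B"
  by (auto simp: zext_def)

lemma wave_zext:
  assumes "l \<ge> 1"
  shows "cc (zext 0 l (wave \<kappa> l k))"
    and "k \<le> 2 \<Longrightarrow> (zext 0 l (wave \<kappa> l k) has_vector_derivative zext 0 l (wave \<kappa> l (Suc k)) t) (at t)"
proof -
  have l: "l > 0" using assms by simp
  show "cc (zext 0 l (wave \<kappa> l k))" by (intro zext_cc l wave_cont wave_zero)
  show "(zext 0 l (wave \<kappa> l k) has_vector_derivative zext 0 l (wave \<kappa> l (Suc k)) t) (at t)" if "k \<le> 2"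
    by (intro zext_deriv l wave_deriv wave_zero that)
qed

text \<open>The entries \<open>f 0, \<dots>, f 3\<close> are a function on \<open>[0, l]\<close>, extended by zero, and its derivatives.\<close>

definition C3_profile :: "real \<Rightarrow> (nat \<Rightarrow> real \<Rightarrow> complex) \<Rightarrow> bool" where
  "C3_profile l f \<longleftrightarrow> (\<forall>k\<le>3. cc (f k)) \<and> (\<forall>k\<le>2. \<forall>t. (f k has_vector_derivative f (Suc k) t) (at t)) \<and>
     (\<forall>k\<le>3. \<forall>t. f k t \<noteq> 0 \<longrightarrow> t \<in> {0..l})"

lemma TM_wave_profile:
  obtains C where "C \<ge> 1" "\<And>l. l \<ge> 1 \<Longrightarrow> \<exists>f :: nat \<Rightarrow> real \<Rightarrow> complex. C3_profile l f \<and> (\<forall>k\<le>1. \<forall>t. norm (f k t) \<le> C) \<and>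
     (\<forall>t. norm (f 2 t + of_real (\<kappa>\<^sup>2) * f 0 t) \<le> C / l) \<and> (\<forall>t. norm (f 3 t + of_real (\<kappa>\<^sup>2) * f 1 t) \<le> C / l) \<and>
     1/2000000 * l \<le> (LINT t|lborel. (norm (f (0::nat) t))\<^sup>2)"
proof -
  define C where "C = 2160 * (1 + \<bar>\<kappa>\<bar>) ^ 3 * 8"
  have "1 \<le> (1 + \<bar>\<kappa>\<bar>) ^ 3" by (rule one_le_power) simp
  then have C: "C \<ge> 1" unfolding C_def by linarith
  show ?thesis
  proof (rule that[OF C])
    fix l :: real assume l: "l \<ge> 1"
    define f where "f k = zext 0 l (wave \<kappa> l k)" for k
    have b: "norm (f 2 t + of_real (\<kappa>\<^sup>2) * f 0 t) \<le> C / l" "norm (f 3 t + of_real (\<kappa>\<^sup>2) * f 1 t) \<le> C / l" for t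
      using wave_norm(2,3)[OF l, of t \<kappa>] C l unfolding C_def[symmetric] by (auto simp: f_def zext_def)
    have "(1/1000)\<^sup>2 * (3 * l/4 - l/4) \<le> (LINT t|lborel. (norm (f 0 t))\<^sup>2)"
    proof (rule integral_sq_lower_const)
      show "cc (f 0)" unfolding f_def by (rule wave_zext(1)[OF l])
      fix t assume t: "t \<in> {l/4..3 * l/4}"
      then have "f 0 t = exp (\<i> * of_real \<kappa> * of_real t) * cutoff 0 l 0 t" using l by (simp add: f_def zext_def wave_def)
      then have "norm (f 0 t) = norm (cutoff 0 l 0 t)" by (simp add: norm_mult)
      then show "1/1000 \<le> norm (f 0 t)" using cutoff_lower(1)[of l t 0] l t by simp
    qed (use l in auto)
    then have "1/2000000 * l \<le> (LINT t|lborel. (norm (f 0 t))\<^sup>2)" by (simp add: power2_eq_square)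
    moreover have "norm (f k t) \<le> C" for k t
      unfolding f_def by (rule zext_norm) (use wave_norm(1)[OF l] C in \<open>auto simp: C_def\<close>)
    ultimately show "\<exists>f :: nat \<Rightarrow> real \<Rightarrow> complex. C3_profile l f \<and> (\<forall>k\<le>1. \<forall>t. norm (f k t) \<le> C) \<and>
     (\<forall>t. norm (f 2 t + of_real (\<kappa>\<^sup>2) * f 0 t) \<le> C / l) \<and> (\<forall>t. norm (f 3 t + of_real (\<kappa>\<^sup>2) * f 1 t) \<le> C / l) \<and>
     1/2000000 * l \<le> (LINT t|lborel. (norm (f (0::nat) t))\<^sup>2)"
      using b wave_zext[OF l] by (intro exI[of _ f]) (auto simp: C3_profile_def f_def dest: zext_nz)
  qed
qed

text \<open>For the field \<open>(0, -\<partial>\<^sub>3\<phi>, \<partial>\<^sub>2\<phi>)\<close> the amplitude is the derivative of the profile. For \<open>\<kappa> \<noteq> 0\<close> it is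
comparable to the profile; for \<open>\<kappa> = 0\<close> the profile is the cutoff multiplied by \<open>l\<close>, whose derivative
is of order one. This is why \<open>f 0\<close> is only bounded by \<open>Cl\<close>.\<close>

lemma TE_wave_profile:
  obtains C \<gamma> where "C \<ge> 1" "\<gamma> > 0" "\<And>l. l \<ge> 1 \<Longrightarrow> \<exists>f :: nat \<Rightarrow> real \<Rightarrow> complex. C3_profile l f \<and> (\<forall>t. norm (f 0 t) \<le> C * l) \<and> (\<forall>t. norm (f 1 t) \<le> C) \<and>
     (\<forall>t. norm (f 2 t + of_real (\<kappa>\<^sup>2) * f 0 t) \<le> C) \<and> (\<forall>t. norm (f 3 t + of_real (\<kappa>\<^sup>2) * f 1 t) \<le> C / l) \<and>
     \<gamma> * l \<le> (LINT t|lborel. (norm (f (1::nat) t))\<^sup>2)"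
proof (cases "\<kappa> = 0")
  case False
  define C where "C = 2160 * (1 + \<bar>\<kappa>\<bar>) ^ 3 * 8"
  have "1 \<le> (1 + \<bar>\<kappa>\<bar>) ^ 3" by (rule one_le_power) simp
  then have C: "C \<ge> 1" unfolding C_def by linarith
  define \<gamma> where "\<gamma> = (\<bar>\<kappa>\<bar>/1000)\<^sup>2 / 2"
  have \<gamma>: "\<gamma> > 0" using False by (simp add: \<gamma>_def)
  show ?thesis
  proof (rule that[OF C \<gamma>])
    fix l :: real assume l: "l \<ge> 1"
    define f where "f k = zext 0 l (wave \<kappa> l k)" for k
    have Cl: "C / l \<le> C" "C \<le> C * l" using C l by (simp_all add: divide_simps)
    have b: "norm (f 2 t + of_real (\<kappa>\<^sup>2) * f 0 t) \<le> C / l" "norm (f 3 t + of_real (\<kappa>\<^sup>2) * f 1 t) \<le> C / l" for t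
      using wave_norm(2,3)[OF l, of t \<kappa>] C l unfolding C_def[symmetric] by (auto simp: f_def zext_def)
    have "(\<bar>\<kappa>\<bar>/1000)\<^sup>2 * (3 * l/4 - l/4) \<le> (LINT t|lborel. (norm (f 1 t))\<^sup>2)"
    proof (rule integral_sq_lower_const)
      show "cc (f 1)" unfolding f_def by (rule wave_zext(1)[OF l])
      fix t assume t: "t \<in> {l/4..3 * l/4}"
      \<comment> \<open>Up to the phase, \<open>f 1\<close> has imaginary part \<open>\<kappa>x\<close> and real part \<open>y\<close>.\<close>
      define x y where "x = cut 0 (t / l)" and "y = cut 1 (t / l) / l"
      have "f 1 t = exp (\<i> * of_real \<kappa> * of_real t) * Complex y (\<kappa> * x)"
        using t l by (simp add: f_def zext_def wave_def Let_def cutoff_def x_def y_def complex_eq_iff)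
      then have "norm (f 1 t) = norm (Complex y (\<kappa> * x))" by (simp add: norm_mult)
      also have "\<dots> \<ge> \<bar>\<kappa> * x\<bar>" using abs_Im_le_cmod[of "Complex y (\<kappa> * x)"] by simp
      finally have "\<bar>\<kappa>\<bar> * \<bar>x\<bar> \<le> norm (f 1 t)" by (simp add: abs_mult)
      moreover have "1/1000 \<le> \<bar>x\<bar>" using cutoff_lower(1)[of l t 0] l t by (simp add: cutoff_def x_def)
      then have "\<bar>\<kappa>\<bar> * (1/1000) \<le> \<bar>\<kappa>\<bar> * \<bar>x\<bar>" by (intro mult_left_mono) auto
      ultimately show "\<bar>\<kappa>\<bar>/1000 \<le> norm (f 1 t)" by simp
    qed (use l in auto)
    then have "\<gamma> * l \<le> (LINT t|lborel. (norm (f 1 t))\<^sup>2)" by (simp add: \<gamma>_def)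
    moreover have fb: "norm (f k t) \<le> C" for k t
      unfolding f_def by (rule zext_norm) (use wave_norm(1)[OF l] C in \<open>auto simp: C_def\<close>)
    ultimately show "\<exists>f :: nat \<Rightarrow> real \<Rightarrow> complex. C3_profile l f \<and> (\<forall>t. norm (f 0 t) \<le> C * l) \<and> (\<forall>t. norm (f 1 t) \<le> C) \<and>
     (\<forall>t. norm (f 2 t + of_real (\<kappa>\<^sup>2) * f 0 t) \<le> C) \<and> (\<forall>t. norm (f 3 t + of_real (\<kappa>\<^sup>2) * f 1 t) \<le> C / l) \<and>
     \<gamma> * l \<le> (LINT t|lborel. (norm (f (1::nat) t))\<^sup>2)"
      using b order_trans[OF b(1) Cl(1)] order_trans[OF fb Cl(2)] wave_zext[OF l]
      by (intro exI[of _ f]) (auto simp: C3_profile_def f_def dest: zext_nz)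
  qed
next
  case True
  show ?thesis
  proof (rule that[of 2160 "1/8000000"])
    fix l :: real assume l: "l \<ge> 1"
    then have l0: "l > 0" by simp
    define w where "w k t = of_real l * cutoff 0 l k t" for k t
    define f where "f k = zext 0 l (w k)" for k
    have wc: "continuous_on A (w k)" for A k unfolding w_def[abs_def] by (intro continuous_intros cutoff_cont l0)
    have wz: "w k 0 = 0" "w k l = 0" for k using cutoff_zero[OF l0, of 0 k] by (simp_all add: w_def)
    have wd: "(w k has_vector_derivative w (Suc k) t) (at t within A)" if "k \<le> 2" for k t A
      unfolding w_def[abs_def] by (intro has_vector_derivative_mult_right cutoff_deriv l0 that)
    have fc: "cc (f k)" for k unfolding f_def by (intro zext_cc l0 wc wz)
    have fd: "(f k has_vector_derivative f (Suc k) t) (at t)" if "k \<le> 2" for k t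
      unfolding f_def by (intro zext_deriv l0 wd wz that)
    have fb: "norm (f k t) \<le> 2160 * l / l ^ k" for k t
      unfolding f_def
    proof (rule zext_norm)
      fix t assume "t \<in> {0..l}"
      then have "norm (cutoff 0 l k t) \<le> 2160 / l ^ k" using cutoff_bound[OF l0, of t 0 k] by simp
      then show "norm (w k t) \<le> 2160 * l / l ^ k"
        using mult_left_mono[of "norm (cutoff 0 l k t)" "2160 / l ^ k" l] l0 by (simp add: w_def norm_mult mult_ac)
    qed (use l in simp)
    have sq: "l \<le> l * l" using l by simp
    have b: "norm (f 0 t) \<le> 2160 * l" "norm (f 1 t) \<le> 2160" "norm (f 2 t) \<le> 2160" "norm (f 3 t) \<le> 2160 / l" for t
    proof -
      show "norm (f 0 t) \<le> 2160 * l" "norm (f 1 t) \<le> 2160" using fb[of 0 t] fb[of 1 t] l0 by simp_all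
      have "2160 * l / l ^ 2 \<le> 2160" "2160 * l / l ^ 3 \<le> 2160 / l"
        using l sq by (simp_all add: divide_simps power2_eq_square power3_eq_cube)
      then show "norm (f 2 t) \<le> 2160" "norm (f 3 t) \<le> 2160 / l" using fb[of 2 t] fb[of 3 t] by linarith+
    qed
    have "(1/1000)\<^sup>2 * (l/4 - l/8) \<le> (LINT t|lborel. (norm (f 1 t))\<^sup>2)"
    proof (rule integral_sq_lower_const[OF fc])
      fix t assume t: "t \<in> {l/8..l/4}"
      then have "1/1000 / l \<le> norm (cutoff 0 l 1 t)" using cutoff_lower(2)[OF l0, of t 0] by simp
      then have "l * (1/1000 / l) \<le> l * norm (cutoff 0 l 1 t)" using l0 by (intro mult_left_mono) auto
      then show "1/1000 \<le> norm (f 1 t)" using t l0 by (simp add: f_def zext_def w_def norm_mult)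
    qed (use l in auto)
    then have "1/8000000 * l \<le> (LINT t|lborel. (norm (f 1 t))\<^sup>2)" by (simp add: power2_eq_square)
    then show "\<exists>f :: nat \<Rightarrow> real \<Rightarrow> complex. C3_profile l f \<and> (\<forall>t. norm (f 0 t) \<le> 2160 * l) \<and> (\<forall>t. norm (f 1 t) \<le> 2160) \<and>
     (\<forall>t. norm (f 2 t + of_real (\<kappa>\<^sup>2) * f 0 t) \<le> 2160) \<and> (\<forall>t. norm (f 3 t + of_real (\<kappa>\<^sup>2) * f 1 t) \<le> 2160 / l) \<and>
     1/8000000 * l \<le> (LINT t|lborel. (norm (f (1::nat) t))\<^sup>2)"
      using fc fd b True by (intro exI[of _ f]) (auto simp: C3_profile_def f_def dest: zext_nz)
  qed auto
qed

section \<open>Quasimodes of the pencil\<close>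

text \<open>The upper bound for \<open>F\<close> is \<open>A/l\<close> times the square root \<open>l\<^bsup>N/2\<^esup>\<close> of the volume of a cube; the lower
bound for \<open>E\<close> is \<open>(\<gamma>l)\<^bsup>N/2\<^esup>\<close> by the product structure of one component.\<close>

lemma quasimode_estimate:
  fixes c :: "nat \<Rightarrow> 'n::finite" and E F :: "real^'n \<Rightarrow> complex^3"
  assumes N: "N \<in> {2, 3}" and c: "bij_betw c {1..N} (UNIV :: 'n set)"
    and cc: "cc E" "cc F" and l: "l \<ge> 1" and A: "A \<ge> 0" and F: "\<And>x. norm (F x) \<le> A / l"
    and supp: "\<And>x. F x \<noteq> 0 \<Longrightarrow> x $ c 1 \<in> {b..b + l} \<and> x $ c 2 \<in> {0..l} \<and> (N = 3 \<longrightarrow> x $ c 3 \<in> {0..l})"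
    and comp: "\<And>x. norm (tensor c f1 f2 f3 x) \<le> norm (E x)"
    and f: "cc f1" "cc f2" "transverse N f3" "N = 2 \<Longrightarrow> f3 = (\<lambda>_. 1)"
    and low: "\<gamma> * l \<le> (LINT t|lborel. (norm (f1 t))\<^sup>2)" "\<gamma> * l \<le> (LINT t|lborel. (norm (f2 t))\<^sup>2)"
      "N = 3 \<Longrightarrow> \<gamma> * l \<le> (LINT t|lborel. (norm (f3 t))\<^sup>2)"
    and \<gamma>: "\<gamma> > 0"
  shows "L2_norm E > 0" and "L2_norm F \<le> A / (sqrt (\<gamma> ^ N) * l) * L2_norm E"
proof -
  have card: "CARD('n) = N" using bij_betw_same_card[OF c] by simp
  have lower: "(\<gamma> * l) ^ N \<le> (L2_norm E)\<^sup>2"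
    using L2_norm_lower[OF N c cc(1) comp f low] \<gamma> l by (simp add: card)
  have "0 < (\<gamma> * l) ^ N" using \<gamma> l by simp
  then have "(L2_norm E)\<^sup>2 > 0" using lower by linarith
  moreover have nE: "L2_norm E \<ge> 0" and nF: "L2_norm F \<ge> 0" by (simp_all add: L2_norm_def)
  ultimately show "L2_norm E > 0" by (simp add: zero_less_power2)
  define p :: "real^'n" where "p = (\<chi> i. if i = c 1 then b else 0)"
  have inj: "j \<in> {1..N} \<Longrightarrow> c j = c 1 \<longleftrightarrow> j = 1" for j
    using inj_on_eq_iff[OF bij_betw_imp_inj_on[OF c], of j 1] N by auto
  have box: "x \<in> cbox p (p + (\<chi> i. l))" if "F x \<noteq> 0" for x
  proof -
    have "p $ i \<le> x $ i \<and> x $ i \<le> p $ i + l" for i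
    proof -
      obtain j where j: "j \<in> {1..N}" "i = c j" using c by (metis UNIV_I bij_betw_imp_surj_on imageE)
      then have "j = 1 \<or> j = 2 \<or> (j = 3 \<and> N = 3)" using N by auto
      then show ?thesis using supp[OF that] j inj[OF j(1)] by (auto simp: p_def)
    qed
    then show ?thesis by (simp add: mem_box_cart)
  qed
  have upper: "(L2_norm F)\<^sup>2 \<le> (A / l)\<^sup>2 * l ^ N"
    using L2_norm_upper[OF cc(2) _ F _ box] A l by (simp add: card)
  have "(L2_norm F)\<^sup>2 \<le> (A / (sqrt (\<gamma> ^ N) * l) * L2_norm E)\<^sup>2"
  proof -
    have "(A / (sqrt (\<gamma> ^ N) * l) * L2_norm E)\<^sup>2 = (A / l)\<^sup>2 / \<gamma> ^ N * (L2_norm E)\<^sup>2"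
      using \<gamma> by (simp add: power_mult_distrib power_divide)
    moreover have "(A / l)\<^sup>2 / \<gamma> ^ N * (\<gamma> * l) ^ N \<le> (A / l)\<^sup>2 / \<gamma> ^ N * (L2_norm E)\<^sup>2"
      using lower \<gamma> by (intro mult_left_mono) auto
    moreover have "(A / l)\<^sup>2 / \<gamma> ^ N * (\<gamma> * l) ^ N = (A / l)\<^sup>2 * l ^ N"
      using \<gamma> by (simp add: power_mult_distrib)
    ultimately show ?thesis using upper by linarith
  qed
  then show "L2_norm F \<le> A / (sqrt (\<gamma> ^ N) * l) * L2_norm E"
    by (rule power2_le_imp_le) (use A \<gamma> l nE in auto)
qed

lemma norm_vec3_le: "norm (v :: complex^3) \<le> norm (v $ 1) + norm (v $ 2) + norm (v $ 3)"
  using L2_set_le_sum[of UNIV "\<lambda>i. norm (v $ i)"] by (simp add: norm_vec_def sum_3)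

lemma norm_triple_le:
  fixes x y z :: complex
  assumes "norm x \<le> p" "norm y \<le> q" "norm z \<le> r"
  shows "norm (x * y * z) \<le> p * q * r"
proof -
  have "norm x * norm y * norm z \<le> p * q * r"
    using assms order_trans[OF norm_ge_zero assms(1)] order_trans[OF norm_ge_zero assms(2)] by (intro mult_mono) auto
  then show ?thesis by (simp add: norm_mult)
qed

text \<open>The field is \<open>E = (0, -\<partial>\<^sub>3\<phi>, \<partial>\<^sub>2\<phi>)\<close> with \<open>\<phi> = f\<^sub>1(x\<^sub>1)f\<^sub>2(x\<^sub>2)f\<^sub>3(x\<^sub>3)\<close>. Both divergences \<open>\<nabla> \<cdot> E\<close> and
\<open>\<nabla> \<cdot> (\<epsilon>E)\<close> vanish, so \<open>L(\<omega>)E = (0, \<partial>\<^sub>3\<rho>, -\<partial>\<^sub>2\<rho>)\<close> with \<open>\<rho> = \<Delta>\<phi> + \<omega>\<^sup>2\<epsilon>\<phi>\<close>. Writing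
\<open>f\<^sub>1'' + \<omega>\<^sup>2\<epsilon>f\<^sub>1 = \<kappa>\<^sup>2f\<^sub>1 + O(1/l)\<close> and \<open>f\<^sub>2'' = -\<kappa>\<^sup>2f\<^sub>2 + q\<close>, the main terms cancel. Here
\<open>q' = O(1/l)\<close>, while \<open>q = O(1)\<close> is enough because \<open>q\<close> itself occurs only together with \<open>f\<^sub>3'\<close>. The function \<open>g\<close>
is a continuous version of \<open>\<epsilon>f\<^sub>1\<close>.\<close>

lemma TE_product_quasimode:
  fixes c :: "nat \<Rightarrow> 'n::finite" and \<epsilon> :: "real \<Rightarrow> complex" and f1 f2 f3 :: "nat \<Rightarrow> real \<Rightarrow> complex"
  assumes N: "N \<in> {2, 3}" and c: "bij_betw c {1..N} (UNIV :: 'n set)" and l: "l \<ge> 1" and C: "C \<ge> 1"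
    and f1: "\<And>k. k \<le> 2 \<Longrightarrow> cc (f1 k)" "\<And>k t. k \<le> 1 \<Longrightarrow> (f1 k has_vector_derivative f1 (Suc k) t) (at t)"
      "\<And>k t. k \<le> 2 \<Longrightarrow> f1 k t \<noteq> 0 \<Longrightarrow> t \<in> {b..b + l}"
    and f2: "\<And>k. k \<le> 3 \<Longrightarrow> cc (f2 k)" "\<And>k t. k \<le> 2 \<Longrightarrow> (f2 k has_vector_derivative f2 (Suc k) t) (at t)"
      "\<And>k t. k \<le> 3 \<Longrightarrow> f2 k t \<noteq> 0 \<Longrightarrow> t \<in> {0..l}"
    and f3: "\<And>k. k \<le> 3 \<Longrightarrow> transverse N (f3 k)" "\<And>k t. k \<le> 2 \<Longrightarrow> (f3 k has_vector_derivative f3 (Suc k) t) (at t)"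
      "\<And>k t. k \<le> 3 \<Longrightarrow> norm (f3 k t) \<le> C / l ^ k" "N = 2 \<Longrightarrow> f3 0 = (\<lambda>_. 1)"
      "\<And>k t. N = 3 \<Longrightarrow> f3 k t \<noteq> 0 \<Longrightarrow> t \<in> {0..l}"
    and g: "cc g" "AE t in lborel. g t = \<epsilon> t * f1 0 t" "\<And>t. g t \<noteq> 0 \<Longrightarrow> t \<in> {b..b + l}"
    and b1: "\<And>t. norm (f1 0 t) \<le> C" "\<And>t. norm (f1 2 t + \<omega>\<^sup>2 * g t - of_real (\<kappa>\<^sup>2) * f1 0 t) \<le> C / l"
    and b2: "\<And>t. norm (f2 0 t) \<le> C * l" "\<And>t. norm (f2 1 t) \<le> C"
      "\<And>t. norm (f2 2 t + of_real (\<kappa>\<^sup>2) * f2 0 t) \<le> C" "\<And>t. norm (f2 3 t + of_real (\<kappa>\<^sup>2) * f2 1 t) \<le> C / l"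
    and low: "\<gamma> * l \<le> (LINT t|lborel. (norm (f1 0 t))\<^sup>2)" "\<gamma> * l \<le> (LINT t|lborel. (norm (f2 1 t))\<^sup>2)"
      "N = 3 \<Longrightarrow> \<gamma> * l \<le> (LINT t|lborel. (norm (f3 0 t))\<^sup>2)" "\<gamma> > 0"
  shows "has_quasimode c \<epsilon> \<omega> (6 * C^3 / (sqrt (\<gamma> ^ N) * l)) {b..b + l}"
proof -
  define T where "T i j k = tensor c (f1 i) (f2 j) (f3 k)" for i j k
  define G where "G j k = tensor c g (f2 j) (f3 k)" for j k
  have ccT: "cc (T i j k)" if "i \<le> 2" "j \<le> 3" "k \<le> 3" for i j k
    unfolding T_def by (rule tensor_cc[OF N c f1(1)[OF that(1)] f2(1)[OF that(2)] f3(1)[OF that(3)]])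
  have T1: "has_pd c 1 (T i j k) (T (Suc i) j k)" if "i \<le> 1" "j \<le> 3" "k \<le> 3" for i j k
    unfolding T_def using that by (intro has_pd_tensor1[OF N c] f1 f2 f3) auto
  have T2: "has_pd c 2 (T i j k) (T i (Suc j) k)" if "i \<le> 2" "j \<le> 2" "k \<le> 3" for i j k
    unfolding T_def using that by (intro has_pd_tensor2[OF N c] f1 f2 f3) auto
  have T3: "has_pd c 3 (T i j k) (T i j (Suc k))" if "i \<le> 2" "j \<le> 3" "k \<le> 2" for i j k
    unfolding T_def using that by (intro has_pd_tensor3[OF N c] f1 f2 f3) auto
  have G2: "has_pd c 2 (G j k) (G (Suc j) k)" if "j \<le> 2" "k \<le> 3" for j k
    unfolding G_def using that by (intro has_pd_tensor2[OF N c] g f2 f3) auto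
  have G3: "has_pd c 3 (G j k) (G j (Suc k))" if "j \<le> 3" "k \<le> 2" for j k
    unfolding G_def using that by (intro has_pd_tensor3[OF N c] g f2 f3) auto
  define E where "E = field3 (\<lambda>_. 0) (\<lambda>x. - T 0 0 1 x) (T 0 1 0)"
  define K1 where "K1 = (\<lambda>x. T 0 2 0 x - - T 0 0 2 x)"
  define K2 where "K2 = (\<lambda>x. 0 - T 1 1 0 x)"
  define K3 where "K3 = (\<lambda>x. - T 1 0 1 x - 0)"
  define F where "F = field3 (\<lambda>x. ((- T 1 1 1 x - 0) - (0 - T 1 1 1 x)) - \<omega>\<^sup>2 * 0)
     (\<lambda>x. ((T 0 2 1 x - - T 0 0 3 x) - (- T 2 0 1 x - 0)) - \<omega>\<^sup>2 * (- G 0 1 x))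
     (\<lambda>x. ((0 - T 2 1 0 x) - (T 0 3 0 x - - T 0 1 2 x)) - \<omega>\<^sup>2 * G 1 0 x)"
  have s: "Suc 0 = 1" "Suc 1 = 2" "Suc 2 = 3" by simp_all
  note T1' = T1[of 0, unfolded s] T1[of 1, unfolded s]
  note T2' = T2[of _ 0, unfolded s] T2[of _ 1, unfolded s] T2[of _ 2, unfolded s]
  note T3' = T3[of _ _ 0, unfolded s] T3[of _ _ 1, unfolded s] T3[of _ _ 2, unfolded s]
  have ae: "AE x in lebesgue. field3 (\<lambda>_. 0) (\<lambda>x. - G 0 1 x) (G 1 0) x = \<epsilon> (x $ c 1) *s E x"
    unfolding AE_completion_iff using AE_coordinate[OF g(2), of "c 1"]
    by eventually_elim (simp add: vec_eq_iff forall_3 E_def G_def T_def tensor_def)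
  have p: "pencil c \<epsilon> \<omega> E F"
    unfolding E_def F_def
  proof (rule pencil_of_classical_field[where ?d23.0 = "T 0 2 0" and ?d32.0 = "\<lambda>x. - T 0 0 2 x" and ?d31.0 = "\<lambda>_. 0"
        and ?d13.0 = "T 1 1 0" and ?d12.0 = "\<lambda>x. - T 1 0 1 x" and ?d21.0 = "\<lambda>_. 0"
        and ?K1.0 = K1 and ?K2.0 = K2 and ?K3.0 = K3
        and ?q1.0 = "\<lambda>_. 0" and ?q2.0 = "\<lambda>x. - G 1 1 x" and ?q3.0 = "G 1 1"])
    show "AE x in lebesgue. field3 (\<lambda>_. 0) (\<lambda>x. - G 0 1 x) (G 1 0) x = \<epsilon> (x $ c 1) *s field3 (\<lambda>_. 0) (\<lambda>x. - T 0 0 1 x) (T 0 1 0) x"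
      using ae unfolding E_def .
    show "has_pd c 2 (\<lambda>x. - G 0 1 x) (\<lambda>x. - G 1 1 x)" using G2[of 0 1] by (intro has_pd_uminus) simp
    show "0 + - G 1 1 x + G 1 1 x = 0" for x by simp
    show "has_pd c 3 (G 1 0) (G 1 1)" using G3[of 1 0] by simp
  qed (unfold K1_def K2_def K3_def, (intro refl cc_zero cc_uminus ccT has_pd_zero has_pd_uminus has_pd_diff T1' T2' T3' ; simp)+)
  have cE: "cc E" unfolding E_def by (intro cc_field3 cc_zero cc_uminus ccT) auto
  have ccG: "cc (G j k)" if "j \<le> 3" "k \<le> 3" for j k
    unfolding G_def by (rule tensor_cc[OF N c g(1) f2(1)[OF that(1)] f3(1)[OF that(2)]])
  have cF: "cc F" unfolding F_def
    by (intro cc_field3 cc_zero cc_uminus cc_diff ccT ccG cc_bounded_linear[OF bounded_linear_mult_right]) auto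
  define r where "r t = f1 2 t + \<omega>\<^sup>2 * g t - of_real (\<kappa>\<^sup>2) * f1 0 t" for t
  define q2 where "q2 t = f2 2 t + of_real (\<kappa>\<^sup>2) * f2 0 t" for t
  define q3 where "q3 t = f2 3 t + of_real (\<kappa>\<^sup>2) * f2 1 t" for t
  have F1: "F x $ 1 = 0" for x by (simp add: F_def)
  have F2: "F x $ 2 = r (x $ c 1) * f2 0 (x $ c 2) * f3 1 (x $ c 3) + f1 0 (x $ c 1) * q2 (x $ c 2) * f3 1 (x $ c 3)
      + f1 0 (x $ c 1) * f2 0 (x $ c 2) * f3 3 (x $ c 3)" for x
    by (simp add: F_def T_def G_def tensor_def r_def q2_def algebra_simps)
  have F3: "F x $ 3 = - (r (x $ c 1) * f2 1 (x $ c 2) * f3 0 (x $ c 3) + f1 0 (x $ c 1) * q3 (x $ c 2) * f3 0 (x $ c 3)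
      + f1 0 (x $ c 1) * f2 1 (x $ c 2) * f3 2 (x $ c 3))" for x
    by (simp add: F_def T_def G_def tensor_def r_def q3_def algebra_simps)
  have tri: "norm (x + y + z) \<le> 3 * B" if "norm x \<le> B" "norm y \<le> B" "norm z \<le> B" for x y z :: complex and B
    using norm_triangle_ineq[of "x + y" z] norm_triangle_ineq[of x y] that by linarith
  have l1: "1 / l ^ j \<le> 1 / l" if "j \<ge> 1" for j
    using that l power_increasing[of 1 j l] by (auto simp: divide_simps)
  have bF: "norm (F x) \<le> 6 * C^3 / l" for x
  proof -
    have l2: "C * C * (C / l ^ 2) \<le> C^3 / l" "C * (C * l) * (C / l ^ 3) \<le> C^3 / l"
    proof -
      have "C ^ 3 * (1 / l ^ 2) \<le> C ^ 3 * (1 / l)" using C l1[of 2] by (intro mult_left_mono) auto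
      then show "C * C * (C / l ^ 2) \<le> C^3 / l" by (simp add: power3_eq_cube)
      then show "C * (C * l) * (C / l ^ 3) \<le> C^3 / l" using l by (simp add: power3_eq_cube power2_eq_square)
    qed
    have e: "C / l * (C * l) * (C / l ^ 1) = C^3 / l" "C * C * (C / l ^ 1) = C^3 / l" "C / l * C * (C / l ^ 0) = C^3 / l" "C * (C / l) * (C / l ^ 0) = C^3 / l"
      using l by (simp_all add: power3_eq_cube)
    have "norm (F x $ 2) \<le> 3 * (C^3 / l)"
      unfolding F2
    proof (rule tri)
      show "norm (r (x $ c 1) * f2 0 (x $ c 2) * f3 1 (x $ c 3)) \<le> C^3 / l"
        using norm_triple_le[OF b1(2) b2(1) f3(3)[of 1]] unfolding e(1) r_def by simp
      show "norm (f1 0 (x $ c 1) * q2 (x $ c 2) * f3 1 (x $ c 3)) \<le> C^3 / l"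
        using norm_triple_le[OF b1(1) b2(3) f3(3)[of 1]] unfolding e(2) q2_def by simp
      show "norm (f1 0 (x $ c 1) * f2 0 (x $ c 2) * f3 3 (x $ c 3)) \<le> C^3 / l"
        using norm_triple_le[OF b1(1) b2(1) f3(3)[of 3]] order_trans[OF _ l2(2)] by simp
    qed
    moreover have "norm (F x $ 3) \<le> 3 * (C^3 / l)"
      unfolding F3 norm_minus_cancel
    proof (rule tri)
      show "norm (r (x $ c 1) * f2 1 (x $ c 2) * f3 0 (x $ c 3)) \<le> C^3 / l"
        using norm_triple_le[OF b1(2) b2(2) f3(3)[of 0]] unfolding e(3) r_def by simp
      show "norm (f1 0 (x $ c 1) * q3 (x $ c 2) * f3 0 (x $ c 3)) \<le> C^3 / l"
        using norm_triple_le[OF b1(1) b2(4) f3(3)[of 0]] unfolding e(4) q3_def by simp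
      show "norm (f1 0 (x $ c 1) * f2 1 (x $ c 2) * f3 2 (x $ c 3)) \<le> C^3 / l"
        using norm_triple_le[OF b1(1) b2(2) f3(3)[of 2]] order_trans[OF _ l2(1)] by simp
    qed
    ultimately show ?thesis using norm_vec3_le[of "F x"] by (simp add: F1)
  qed
  have z: "E x = 0 \<and> F x = 0" if out: "x $ c 1 \<notin> {b..b + l}" for x
  proof -
    have "f1 i (x $ c 1) = 0" if "i \<le> 2" for i using f1(3)[OF that] out by blast
    then have "T i j k x = 0" if "i \<le> 2" for i j k using that by (simp add: T_def tensor_def)
    moreover have "g (x $ c 1) = 0" using g(3) out by blast
    then have "G j k x = 0" for j k by (simp add: G_def tensor_def)
    ultimately show ?thesis by (simp add: E_def F_def vec_eq_iff forall_3)
  qed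
  have z2: "F x = 0" if out: "x $ c 2 \<notin> {0..l}" for x
  proof -
    have 0: "f2 j (x $ c 2) = 0" if "j \<le> 3" for j using f2(3)[OF that] out by blast
    then have "T i j k x = 0" "G j k x = 0" if "j \<le> 3" for i j k using that by (simp_all add: T_def G_def tensor_def)
    then show ?thesis by (simp add: F_def vec_eq_iff forall_3)
  qed
  have z3: "F x = 0" if "N = 3" and out: "x $ c 3 \<notin> {0..l}" for x
  proof -
    have "f3 k (x $ c 3) = 0" for k using f3(5)[OF that(1)] out by blast
    then have "T i j k x = 0" "G j k x = 0" for i j k by (simp_all add: T_def G_def tensor_def)
    then show ?thesis by (simp add: F_def vec_eq_iff forall_3)
  qed
  have comp: "norm (tensor c (f1 0) (f2 1) (f3 0) x) \<le> norm (E x)" for x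
    using Finite_Cartesian_Product.norm_nth_le[of "E x" 3] by (simp add: E_def T_def)
  have supp: "x $ c 1 \<in> {b..b + l} \<and> x $ c 2 \<in> {0..l} \<and> (N = 3 \<longrightarrow> x $ c 3 \<in> {0..l})" if "F x \<noteq> 0" for x
    using z z2 z3 that by blast
  have A: "0 \<le> 6 * C^3" using C by simp
  note q = quasimode_estimate[OF N c cE cF l A bF supp comp f1(1) f2(1) f3(1) f3(4) low]
  show ?thesis
    unfolding has_quasimode_def using p q z by (intro exI[of _ E] exI[of _ F]) auto
qed

text \<open>The displacement is \<open>\<epsilon>E = (\<partial>\<^sub>2\<psi>, -\<partial>\<^sub>1\<psi>, 0)\<close> with \<open>\<psi> = G\<^sub>0(x\<^sub>1)f\<^sub>2(x\<^sub>2)f\<^sub>3(x\<^sub>3)\<close>, which is divergence free.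
With \<open>A = G/\<epsilon>\<close> and \<open>V = G'/\<epsilon>\<close> the field is \<open>E = (A f\<^sub>2'f\<^sub>3, -V f\<^sub>2f\<^sub>3, 0)\<close>. The main terms of \<open>L(\<omega>)E\<close>
contain \<open>V' - \<kappa>\<^sup>2A + \<omega>\<^sup>2G\<close> and its derivative; all terms of the third component contain a
derivative of \<open>f\<^sub>3\<close>. Thus the potential solves \<open>(G'/\<epsilon>)' = (\<kappa>\<^sup>2/\<epsilon> - \<omega>\<^sup>2)G\<close> approximately.\<close>

lemma TM_product_quasimode:
  fixes c :: "nat \<Rightarrow> 'n::finite" and \<epsilon> :: "real \<Rightarrow> complex" and A V G f2 f3 :: "nat \<Rightarrow> real \<Rightarrow> complex"
  assumes N: "N \<in> {2, 3}" and c: "bij_betw c {1..N} (UNIV :: 'n set)" and l: "l \<ge> 1" and C: "C \<ge> 1"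
    and A: "\<And>k. k \<le> 1 \<Longrightarrow> cc (A k)" "\<And>t. (A 0 has_vector_derivative A 1 t) (at t)" "\<And>k t. k \<le> 1 \<Longrightarrow> A k t \<noteq> 0 \<Longrightarrow> t \<in> {b..b + l}"
    and V: "\<And>k. k \<le> 2 \<Longrightarrow> cc (V k)" "\<And>k t. k \<le> 1 \<Longrightarrow> (V k has_vector_derivative V (Suc k) t) (at t)"
      "\<And>k t. k \<le> 2 \<Longrightarrow> V k t \<noteq> 0 \<Longrightarrow> t \<in> {b..b + l}"
    and G: "\<And>k. k \<le> 1 \<Longrightarrow> cc (G k)" "\<And>t. (G 0 has_vector_derivative G 1 t) (at t)" "\<And>k t. k \<le> 1 \<Longrightarrow> G k t \<noteq> 0 \<Longrightarrow> t \<in> {b..b + l}"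
    and f2: "\<And>k. k \<le> 3 \<Longrightarrow> cc (f2 k)" "\<And>k t. k \<le> 2 \<Longrightarrow> (f2 k has_vector_derivative f2 (Suc k) t) (at t)"
      "\<And>k t. k \<le> 3 \<Longrightarrow> f2 k t \<noteq> 0 \<Longrightarrow> t \<in> {0..l}"
    and f3: "\<And>k. k \<le> 3 \<Longrightarrow> transverse N (f3 k)" "\<And>k t. k \<le> 2 \<Longrightarrow> (f3 k has_vector_derivative f3 (Suc k) t) (at t)"
      "\<And>k t. k \<le> 3 \<Longrightarrow> norm (f3 k t) \<le> C / l ^ k" "N = 2 \<Longrightarrow> f3 0 = (\<lambda>_. 1)"
      "\<And>k t. N = 3 \<Longrightarrow> f3 k t \<noteq> 0 \<Longrightarrow> t \<in> {0..l}"
    and ae: "AE t in lborel. G 0 t = \<epsilon> t * A 0 t" "AE t in lborel. G 1 t = \<epsilon> t * V 0 t"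
    and b1: "\<And>k t. k \<le> 1 \<Longrightarrow> norm (A k t) \<le> C" "\<And>t. norm (V 0 t) \<le> C"
      "\<And>k t. k \<le> 1 \<Longrightarrow> norm (V (Suc k) t - of_real (\<kappa>\<^sup>2) * A k t + \<omega>\<^sup>2 * G k t) \<le> C / l"
    and b2: "\<And>k t. k \<le> 1 \<Longrightarrow> norm (f2 k t) \<le> C"
      "\<And>t. norm (f2 2 t + of_real (\<kappa>\<^sup>2) * f2 0 t) \<le> C / l" "\<And>t. norm (f2 3 t + of_real (\<kappa>\<^sup>2) * f2 1 t) \<le> C / l"
    and low: "\<gamma> * l \<le> (LINT t|lborel. (norm (V 0 t))\<^sup>2)" "\<gamma> * l \<le> (LINT t|lborel. (norm (f2 0 t))\<^sup>2)"
      "N = 3 \<Longrightarrow> \<gamma> * l \<le> (LINT t|lborel. (norm (f3 0 t))\<^sup>2)" "\<gamma> > 0"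
  shows "has_quasimode c \<epsilon> \<omega> (9 * C^3 / (sqrt (\<gamma> ^ N) * l)) {b..b + l}"
proof -
  define T where "T f j k = tensor c f (f2 j) (f3 k)" for f j k
  have ccT: "cc (T f j k)" if "cc f" "j \<le> 3" "k \<le> 3" for f j k
    unfolding T_def by (rule tensor_cc[OF N c that(1) f2(1)[OF that(2)] f3(1)[OF that(3)]])
  have T1: "has_pd c 1 (T f j k) (T f' j k)" if "cc f" "cc f'" "\<And>t. (f has_vector_derivative f' t) (at t)" "j \<le> 3" "k \<le> 3" for f f' j k
    unfolding T_def using that by (intro has_pd_tensor1[OF N c] f2 f3) auto
  have T2: "has_pd c 2 (T f j k) (T f (Suc j) k)" if "cc f" "j \<le> 2" "k \<le> 3" for f j k
    unfolding T_def using that by (intro has_pd_tensor2[OF N c] f2 f3) auto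
  have T3: "has_pd c 3 (T f j k) (T f j (Suc k))" if "cc f" "j \<le> 3" "k \<le> 2" for f j k
    unfolding T_def using that by (intro has_pd_tensor3[OF N c] f2 f3) auto
  have s: "Suc 0 = 1" "Suc 1 = 2" "Suc 2 = 3" by simp_all
  have cs: "cc (A 0)" "cc (A 1)" "cc (V 0)" "cc (V 1)" "cc (V 2)" "cc (G 0)" "cc (G 1)"
    using A(1) V(1) G(1) by simp_all
  have VD: "(V 0 has_vector_derivative V 1 t) (at t)" "(V 1 has_vector_derivative V 2 t) (at t)" for t
    using V(2)[of 0 t] V(2)[of 1 t] by (simp_all add: numeral_2_eq_2)
  note T2' = T2[of _ 0, unfolded s] T2[of _ 1, unfolded s] T2[of _ 2, unfolded s]
  note T3' = T3[of _ _ 0, unfolded s] T3[of _ _ 1, unfolded s] T3[of _ _ 2, unfolded s]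
  define E where "E = field3 (T (A 0) 1 0) (\<lambda>x. - T (V 0) 0 0 x) (\<lambda>_. 0)"
  define K1 where "K1 = (\<lambda>x. 0 - - T (V 0) 0 1 x)"
  define K2 where "K2 = (\<lambda>x. T (A 0) 1 1 x - 0)"
  define K3 where "K3 = (\<lambda>x. - T (V 1) 0 0 x - T (A 0) 2 0 x)"
  define F where "F = field3 (\<lambda>x. ((- T (V 1) 1 0 x - T (A 0) 3 0 x) - (T (A 0) 1 2 x - 0)) - \<omega>\<^sup>2 * T (G 0) 1 0 x)
     (\<lambda>x. ((0 - - T (V 0) 0 2 x) - (- T (V 2) 0 0 x - T (A 1) 2 0 x)) - \<omega>\<^sup>2 * (- T (G 1) 0 0 x))
     (\<lambda>x. ((T (A 1) 1 1 x - 0) - (0 - - T (V 0) 1 1 x)) - \<omega>\<^sup>2 * 0)"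
  have aeE: "AE x in lebesgue. field3 (T (G 0) 1 0) (\<lambda>x. - T (G 1) 0 0 x) (\<lambda>_. 0) x = \<epsilon> (x $ c 1) *s E x"
    unfolding AE_completion_iff using AE_coordinate[OF ae(1), of "c 1"] AE_coordinate[OF ae(2), of "c 1"]
    by eventually_elim (simp add: vec_eq_iff forall_3 E_def T_def tensor_def)
  have p: "pencil c \<epsilon> \<omega> E F"
    unfolding E_def F_def
  proof (rule pencil_of_classical_field[where ?d23.0 = "\<lambda>_. 0" and ?d32.0 = "\<lambda>x. - T (V 0) 0 1 x" and ?d31.0 = "T (A 0) 1 1"
        and ?d13.0 = "\<lambda>_. 0" and ?d12.0 = "\<lambda>x. - T (V 1) 0 0 x" and ?d21.0 = "T (A 0) 2 0"
        and ?K1.0 = K1 and ?K2.0 = K2 and ?K3.0 = K3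
        and ?q1.0 = "T (G 1) 1 0" and ?q2.0 = "\<lambda>x. - T (G 1) 1 0 x" and ?q3.0 = "\<lambda>_. 0"])
    show "AE x in lebesgue. field3 (T (G 0) 1 0) (\<lambda>x. - T (G 1) 0 0 x) (\<lambda>_. 0) x = \<epsilon> (x $ c 1) *s field3 (T (A 0) 1 0) (\<lambda>x. - T (V 0) 0 0 x) (\<lambda>_. 0) x"
      using aeE unfolding E_def .
    show "has_pd c 1 (T (G 0) 1 0) (T (G 1) 1 0)" by (rule T1[OF cs(6,7) G(2)]) auto
    show "T (G 1) 1 0 x + - T (G 1) 1 0 x + 0 = 0" for x by simp
    show "has_pd c 1 (\<lambda>x. - T (V 0) 0 0 x) (\<lambda>x. - T (V 1) 0 0 x)" by (rule has_pd_uminus[OF T1[OF cs(3,4) VD(1)]]) auto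
    show "has_pd c 1 K3 (\<lambda>x. - T (V 2) 0 0 x - T (A 1) 2 0 x)"
      unfolding K3_def by (intro has_pd_diff has_pd_uminus T1 cs VD A(2)) auto
    show "has_pd c 1 K2 (\<lambda>x. T (A 1) 1 1 x - 0)"
      unfolding K2_def by (intro has_pd_diff has_pd_zero T1 cs A(2)) auto
  qed (unfold K1_def K2_def K3_def, (intro refl cc_zero cc_uminus ccT has_pd_zero has_pd_uminus has_pd_diff T2' T3' cs ; simp)+)
  have cE: "cc E" unfolding E_def by (intro cc_field3 cc_zero cc_uminus ccT cs) auto
  have cF: "cc F" unfolding F_def
    by (intro cc_field3 cc_zero cc_uminus cc_diff ccT cs cc_bounded_linear[OF bounded_linear_mult_right]) auto
  define r where "r k t = V (Suc k) t - of_real (\<kappa>\<^sup>2) * A k t + \<omega>\<^sup>2 * G k t" for k t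
  define q2 where "q2 t = f2 2 t + of_real (\<kappa>\<^sup>2) * f2 0 t" for t
  define q3 where "q3 t = f2 3 t + of_real (\<kappa>\<^sup>2) * f2 1 t" for t
  have F1: "F x $ 1 = - (r 0 (x $ c 1) * f2 1 (x $ c 2) * f3 0 (x $ c 3) + A 0 (x $ c 1) * q3 (x $ c 2) * f3 0 (x $ c 3)
      + A 0 (x $ c 1) * f2 1 (x $ c 2) * f3 2 (x $ c 3))" for x
    by (simp add: F_def T_def tensor_def r_def q3_def algebra_simps)
  have F2: "F x $ 2 = r 1 (x $ c 1) * f2 0 (x $ c 2) * f3 0 (x $ c 3) + A 1 (x $ c 1) * q2 (x $ c 2) * f3 0 (x $ c 3)
      + V 0 (x $ c 1) * f2 0 (x $ c 2) * f3 2 (x $ c 3)" for x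
    by (simp add: F_def T_def tensor_def r_def q2_def algebra_simps numeral_2_eq_2)
  have F3: "F x $ 3 = A 1 (x $ c 1) * f2 1 (x $ c 2) * f3 1 (x $ c 3) + - V 0 (x $ c 1) * f2 1 (x $ c 2) * f3 1 (x $ c 3) + 0" for x
    by (simp add: F_def T_def tensor_def)
  have tri: "norm (x + y + z) \<le> 3 * B" if "norm x \<le> B" "norm y \<le> B" "norm z \<le> B" for x y z :: complex and B
    using norm_triangle_ineq[of "x + y" z] norm_triangle_ineq[of x y] that by linarith
  have bF: "norm (F x) \<le> 9 * C^3 / l" for x
  proof -
    have "1 / l ^ 2 \<le> 1 / l" using l power_increasing[of 1 2 l] by (auto simp: divide_simps)
    then have "C ^ 3 * (1 / l ^ 2) \<le> C ^ 3 * (1 / l)" using C by (intro mult_left_mono) auto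
    then have l2: "C * C * (C / l ^ 2) \<le> C^3 / l" by (simp add: power3_eq_cube)
    have e: "C * C * (C / l ^ 1) = C^3 / l" "C / l * C * (C / l ^ 0) = C^3 / l" "C * (C / l) * (C / l ^ 0) = C^3 / l"
      using l by (simp_all add: power3_eq_cube)
    have r: "norm (r k t) \<le> C / l" if "k \<le> 1" for k t unfolding r_def by (rule b1(3)[OF that])
    have "norm (F x $ 1) \<le> 3 * (C^3 / l)"
      unfolding F1 norm_minus_cancel
    proof (rule tri)
      show "norm (r 0 (x $ c 1) * f2 1 (x $ c 2) * f3 0 (x $ c 3)) \<le> C^3 / l"
        using norm_triple_le[OF r[of 0] b2(1)[of 1] f3(3)[of 0]] unfolding e(2) by simp
      show "norm (A 0 (x $ c 1) * q3 (x $ c 2) * f3 0 (x $ c 3)) \<le> C^3 / l"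
        using norm_triple_le[OF b1(1)[of 0] b2(3) f3(3)[of 0]] unfolding e(3) q3_def by simp
      show "norm (A 0 (x $ c 1) * f2 1 (x $ c 2) * f3 2 (x $ c 3)) \<le> C^3 / l"
        using norm_triple_le[OF b1(1)[of 0] b2(1)[of 1] f3(3)[of 2]] order_trans[OF _ l2] by simp
    qed
    moreover have "norm (F x $ 2) \<le> 3 * (C^3 / l)"
      unfolding F2
    proof (rule tri)
      show "norm (r 1 (x $ c 1) * f2 0 (x $ c 2) * f3 0 (x $ c 3)) \<le> C^3 / l"
        using norm_triple_le[OF r[of 1] b2(1)[of 0] f3(3)[of 0]] unfolding e(2) by simp
      show "norm (A 1 (x $ c 1) * q2 (x $ c 2) * f3 0 (x $ c 3)) \<le> C^3 / l"
        using norm_triple_le[OF b1(1)[of 1] b2(2) f3(3)[of 0]] unfolding e(3) q2_def by simp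
      show "norm (V 0 (x $ c 1) * f2 0 (x $ c 2) * f3 2 (x $ c 3)) \<le> C^3 / l"
        using norm_triple_le[OF b1(2) b2(1)[of 0] f3(3)[of 2]] order_trans[OF _ l2] by simp
    qed
    moreover have "norm (F x $ 3) \<le> 3 * (C^3 / l)"
      unfolding F3
    proof (rule tri)
      show "norm (A 1 (x $ c 1) * f2 1 (x $ c 2) * f3 1 (x $ c 3)) \<le> C^3 / l"
        using norm_triple_le[OF b1(1)[of 1] b2(1)[of 1] f3(3)[of 1]] unfolding e(1) by simp
      show "norm (- V 0 (x $ c 1) * f2 1 (x $ c 2) * f3 1 (x $ c 3)) \<le> C^3 / l"
        using norm_triple_le[OF b1(2) b2(1)[of 1] f3(3)[of 1]] unfolding e(1) by simp
      show "norm (0 :: complex) \<le> C^3 / l" using C l by simp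
    qed
    ultimately show ?thesis using norm_vec3_le[of "F x"] by simp
  qed
  have z: "E x = 0 \<and> F x = 0" if out: "x $ c 1 \<notin> {b..b + l}" for x
  proof -
    have "A k (x $ c 1) = 0" "G k (x $ c 1) = 0" if "k \<le> 1" for k using A(3)[OF that] G(3)[OF that] out by blast+
    moreover have "V k (x $ c 1) = 0" if "k \<le> 2" for k using V(3)[OF that] out by blast
    ultimately show ?thesis by (simp add: E_def F_def T_def tensor_def vec_eq_iff forall_3)
  qed
  have z2: "F x = 0" if out: "x $ c 2 \<notin> {0..l}" for x
  proof -
    have 0: "f2 j (x $ c 2) = 0" if "j \<le> 3" for j using f2(3)[OF that] out by blast
    then have "T f j k x = 0" if "j \<le> 3" for f j k using that by (simp add: T_def tensor_def)
    then show ?thesis by (simp add: F_def vec_eq_iff forall_3)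
  qed
  have z3: "F x = 0" if "N = 3" and out: "x $ c 3 \<notin> {0..l}" for x
  proof -
    have "f3 k (x $ c 3) = 0" for k using f3(5)[OF that(1)] out by blast
    then have "T f j k x = 0" for f j k by (simp add: T_def tensor_def)
    then show ?thesis by (simp add: F_def vec_eq_iff forall_3)
  qed
  have comp: "norm (tensor c (V 0) (f2 0) (f3 0) x) \<le> norm (E x)" for x
    using Finite_Cartesian_Product.norm_nth_le[of "E x" 2] by (simp add: E_def T_def)
  have supp: "x $ c 1 \<in> {b..b + l} \<and> x $ c 2 \<in> {0..l} \<and> (N = 3 \<longrightarrow> x $ c 3 \<in> {0..l})" if "F x \<noteq> 0" for x
    using z z2 z3 that by blast
  have A0: "0 \<le> 9 * C^3" using C by simp
  note q = quasimode_estimate[OF N c cE cF l A0 bF supp comp V(1) f2(1) f3(1) f3(4) low]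
  show ?thesis
    unfolding has_quasimode_def using p q z by (intro exI[of _ E] exI[of _ F]) auto
qed

text \<open>The profile is the solution times the cutoff of \<open>[b, b + l]\<close>. The constant \<open>K\<close> depends on the bounds
of the solution, but neither on the interval nor on the solution.\<close>

lemma TE_quasimode_of_solution:
  fixes c :: "nat \<Rightarrow> 'n::finite" and \<epsilon> e :: "real \<Rightarrow> complex" and C\<^sub>0 \<gamma>\<^sub>0 \<kappa> :: real
  assumes N: "N \<in> {2, 3}" and c: "bij_betw c {1..N} (UNIV :: 'n set)" and C0: "C\<^sub>0 \<ge> 1" and g0: "\<gamma>\<^sub>0 > 0"
  obtains K where "\<And>b l v h. l \<ge> 1 \<Longrightarrow> continuous_on {b..b + l} e \<Longrightarrow> (AE t in lborel. t \<in> {b..b + l} \<longrightarrow> \<epsilon> t = e t) \<Longrightarrow>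
     bounded_solution (\<lambda>_. 1) (\<lambda>t. of_real (\<kappa>\<^sup>2) - \<omega>\<^sup>2 * e t) C\<^sub>0 {b..b + l} v h \<Longrightarrow>
     \<gamma>\<^sub>0 * l \<le> integral {b + l/4..b + 3 * l/4} (\<lambda>t. (norm (v t))\<^sup>2) \<Longrightarrow>
     has_quasimode c \<epsilon> \<omega> (K / l) {b..b + l}"
proof -
  obtain C2 \<gamma>2 where C2: "C2 \<ge> 1" "\<gamma>2 > 0" and W: "\<And>l. l \<ge> 1 \<Longrightarrow> \<exists>f :: nat \<Rightarrow> real \<Rightarrow> complex. C3_profile l f \<and> (\<forall>t. norm (f 0 t) \<le> C2 * l) \<and> (\<forall>t. norm (f 1 t) \<le> C2) \<and>
     (\<forall>t. norm (f 2 t + of_real (\<kappa>\<^sup>2) * f 0 t) \<le> C2) \<and> (\<forall>t. norm (f 3 t + of_real (\<kappa>\<^sup>2) * f 1 t) \<le> C2 / l) \<and>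
     \<gamma>2 * l \<le> (LINT t|lborel. (norm (f (1::nat) t))\<^sup>2)"
    by (rule TE_wave_profile) (rule that)
  obtain f3 where f3: "\<And>k l. l \<ge> 1 \<Longrightarrow> k \<le> 3 \<Longrightarrow> transverse N (f3 l k)"
    "\<And>k l t. l \<ge> 1 \<Longrightarrow> k \<le> 2 \<Longrightarrow> (f3 l k has_vector_derivative f3 l (Suc k) t) (at t)"
    "\<And>k l t. l \<ge> 1 \<Longrightarrow> k \<le> 3 \<Longrightarrow> norm (f3 l k t) \<le> 2160 / l ^ k"
    "\<And>l. N = 2 \<Longrightarrow> f3 l 0 = (\<lambda>_. 1)"
    "\<And>l. N = 3 \<Longrightarrow> l \<ge> 1 \<Longrightarrow> 1/2000000 * l \<le> (LINT t|lborel. (norm (f3 l 0 t))\<^sup>2)"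
    "\<And>l k t. N = 3 \<Longrightarrow> f3 l k t \<noteq> 0 \<Longrightarrow> t \<in> {0..l}"
    by (rule transverse_profile[OF N]) (rule that)
  define C where "C = 6480 * C\<^sub>0 + C2"
  define \<gamma> where "\<gamma> = min (\<gamma>\<^sub>0 / 1000000) (min \<gamma>2 (1/2000000))"
  have C: "C \<ge> 1" "6480 * C\<^sub>0 \<le> C" "C2 \<le> C" "2160 \<le> C" using C0 C2 by (auto simp: C_def)
  have \<gamma>: "\<gamma> > 0" "\<gamma> \<le> \<gamma>\<^sub>0 / 1000000" "\<gamma> \<le> \<gamma>2" "\<gamma> \<le> 1/2000000" using g0 C2 by (auto simp: \<gamma>_def)
  show ?thesis
  proof (rule that[of "6 * C^3 / sqrt (\<gamma> ^ N)"])
    fix b l :: real and v h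
    assume l: "l \<ge> 1" and ce: "continuous_on {b..b + l} e" and ae: "AE t in lborel. t \<in> {b..b + l} \<longrightarrow> \<epsilon> t = e t"
      and vh: "bounded_solution (\<lambda>_. 1) (\<lambda>t. of_real (\<kappa>\<^sup>2) - \<omega>\<^sup>2 * e t) C\<^sub>0 {b..b + l} v h"
      and low: "\<gamma>\<^sub>0 * l \<le> integral {b + l/4..b + 3 * l/4} (\<lambda>t. (norm (v t))\<^sup>2)"
    let ?I = "{b..b + l}"
    have l0: "l > 0" "b < b + l" using l by auto
    have dv: "(v has_vector_derivative h t) (at t within ?I)" and dh: "(h has_vector_derivative (of_real (\<kappa>\<^sup>2) - \<omega>\<^sup>2 * e t) * v t) (at t within ?I)"
      and bv: "norm (v t) \<le> C\<^sub>0" "norm (h t) \<le> C\<^sub>0" if "t \<in> ?I" for t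
      using vh that by (auto simp: bounded_solution_def)
    have cv: "continuous_on ?I v" "continuous_on ?I h"
      unfolding continuous_on_eq_continuous_within
      using has_vector_derivative_continuous[OF dv] has_vector_derivative_continuous[OF dh] by blast+
    define X where "X k = cutoff b l k" for k
    have dX: "(X 0 has_vector_derivative X 1 t) (at t within ?I)" "(X 1 has_vector_derivative X 2 t) (at t within ?I)" for t
      using cutoff_deriv[OF l0(1), of 0] cutoff_deriv[OF l0(1), of 1] by (simp_all add: X_def numeral_2_eq_2)
    have cX: "continuous_on A (X k)" for A k unfolding X_def by (rule cutoff_cont[OF l0(1)])
    have zX: "X k b = 0" "X k (b + l) = 0" for k unfolding X_def by (rule cutoff_zero[OF l0(1)])+
    have bX: "norm (X k t) \<le> 2160 / l ^ k" if "t \<in> ?I" for k t unfolding X_def by (rule cutoff_bound[OF l0(1) that])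
    define f1 where "f1 k = (if k = 0 then zext b (b + l) (\<lambda>t. v t * X 0 t)
      else if k = 1 then zext b (b + l) (\<lambda>t. v t * X 1 t + h t * X 0 t)
      else zext b (b + l) (\<lambda>t. (v t * X 2 t + h t * X 1 t) + (h t * X 1 t + (of_real (\<kappa>\<^sup>2) - \<omega>\<^sup>2 * e t) * v t * X 0 t)))" for k :: nat
    define g where "g = zext b (b + l) (\<lambda>t. e t * (v t * X 0 t))"
    have f1c: "cc (f1 k)" for k
      unfolding f1_def by (auto intro!: zext_cc l0 continuous_intros cv cX ce simp: zX)
    have gc: "cc g" unfolding g_def by (auto intro!: zext_cc l0 continuous_intros cv cX ce simp: zX)
    have f1eq: "f1 0 = zext b (b + l) (\<lambda>t. v t * X 0 t)" "f1 1 = zext b (b + l) (\<lambda>t. v t * X 1 t + h t * X 0 t)"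
      "f1 2 = zext b (b + l) (\<lambda>t. (v t * X 2 t + h t * X 1 t) + (h t * X 1 t + (of_real (\<kappa>\<^sup>2) - \<omega>\<^sup>2 * e t) * v t * X 0 t))"
      unfolding f1_def by simp_all
    have f1d0: "(f1 0 has_vector_derivative f1 1 t) (at t)" for t
      unfolding f1eq by (rule zext_deriv[OF l0(2) has_vector_derivative_mult[OF dv dX(1)]]) (simp_all add: zX)
    have f1d1: "(f1 1 has_vector_derivative f1 2 t) (at t)" for t
      unfolding f1eq
      by (rule zext_deriv[OF l0(2) has_vector_derivative_add[OF has_vector_derivative_mult[OF dv dX(2)] has_vector_derivative_mult[OF dh dX(1)]]])
         (simp_all add: zX)
    have f1d: "(f1 k has_vector_derivative f1 (Suc k) t) (at t)" if "k \<le> 1" for k t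
    proof -
      have "k = 0 \<or> k = 1" using that by linarith
      then show ?thesis using f1d0 f1d1 by (auto simp: numeral_2_eq_2)
    qed
    have f1z: "f1 k t \<noteq> 0 \<Longrightarrow> t \<in> ?I" for k t unfolding f1_def by (auto split: if_splits dest: zext_nz)
    have gz: "g t \<noteq> 0 \<Longrightarrow> t \<in> ?I" for t unfolding g_def by (rule zext_nz)
    have aeg: "AE t in lborel. g t = \<epsilon> t * f1 0 t"
      using ae by eventually_elim (auto simp: g_def f1_def zext_def)
    have vX: "norm (v t * X 0 t) \<le> C" if "t \<in> ?I" for t
    proof -
      have "norm (v t * X 0 t) \<le> C\<^sub>0 * 2160" unfolding norm_mult using bv(1)[OF that] bX[OF that, of 0] C0 by (intro mult_mono) auto
      then show ?thesis using C C0 by simp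
    qed
    have b10: "norm (f1 0 t) \<le> C" for t
      unfolding f1_def using C vX by (auto intro!: zext_norm)
    have b1r: "norm (f1 2 t + \<omega>\<^sup>2 * g t - of_real (\<kappa>\<^sup>2) * f1 0 t) \<le> C / l" for t
    proof (cases "t \<in> ?I")
      case True
      have "f1 2 t + \<omega>\<^sup>2 * g t - of_real (\<kappa>\<^sup>2) * f1 0 t = v t * X 2 t + 2 * (h t * X 1 t)"
        using True by (simp add: f1_def g_def zext_def algebra_simps)
      moreover have "norm (v t * X 2 t) \<le> C\<^sub>0 * (2160 / l)"
      proof -
        have "1 / l ^ 2 \<le> 1 / l" using l by (simp add: divide_simps power2_eq_square)
        then have "norm (X 2 t) \<le> 2160 / l" using bX[OF True, of 2] by simp
        then show ?thesis unfolding norm_mult using bv(1)[OF True] C0 by (intro mult_mono) auto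
      qed
      moreover have "norm (h t * X 1 t) \<le> C\<^sub>0 * (2160 / l)"
        unfolding norm_mult using bv(2)[OF True] bX[OF True, of 1] C0 by (intro mult_mono) auto
      moreover have "norm (v t * X 2 t + 2 * (h t * X 1 t)) \<le> norm (v t * X 2 t) + 2 * norm (h t * X 1 t)"
        using norm_triangle_ineq[of "v t * X 2 t" "2 * (h t * X 1 t)"] by (simp add: norm_mult)
      ultimately have "norm (f1 2 t + \<omega>\<^sup>2 * g t - of_real (\<kappa>\<^sup>2) * f1 0 t) \<le> 6480 * C\<^sub>0 / l" by simp
      also have "\<dots> \<le> C / l" using C l by (intro divide_right_mono) auto
      finally show ?thesis .
    next
      case False
      then have "f1 k t = 0" "g t = 0" for k using f1z gz by blast+
      then show ?thesis using C(1) l by simp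
    qed
    have low1: "\<gamma> * l \<le> (LINT t|lborel. (norm (f1 0 t))\<^sup>2)"
    proof -
      have J: "{b + l/4..b + 3 * l/4} \<subseteq> ?I" using l by auto
      have "\<gamma> * l \<le> \<gamma>\<^sub>0 / 1000000 * l" using \<gamma> l by (intro mult_right_mono) auto
      also have "\<dots> = 1/1000000 * (\<gamma>\<^sub>0 * l)" by simp
      also have "\<dots> \<le> 1/1000000 * integral {b + l/4..b + 3 * l/4} (\<lambda>t. (norm (v t))\<^sup>2)" by (intro mult_left_mono low) auto
      also have "\<dots> = integral {b + l/4..b + 3 * l/4} (\<lambda>t. 1/1000000 * (norm (v t))\<^sup>2)" by simp
      also have "\<dots> \<le> (LINT t|lborel. (norm (f1 0 t))\<^sup>2)"
      proof (rule integral_sq_lower[OF f1c])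
        show "continuous_on {b + l/4..b + 3 * l/4} (\<lambda>t. 1/1000000 * (norm (v t))\<^sup>2)"
          by (intro continuous_intros continuous_on_subset[OF cv(1) J])
        fix t assume t: "t \<in> {b + l/4..b + 3 * l/4}"
        have "(1/1000)\<^sup>2 \<le> (norm (X 0 t))\<^sup>2" using cutoff_lower(1)[OF l0(1) t] by (intro power_mono) (auto simp: X_def)
        then have "(norm (v t))\<^sup>2 * (1/1000)\<^sup>2 \<le> (norm (v t))\<^sup>2 * (norm (X 0 t))\<^sup>2" by (intro mult_left_mono) auto
        moreover have "f1 0 t = v t * X 0 t" using t J by (auto simp: f1_def zext_def)
        ultimately show "1/1000000 * (norm (v t))\<^sup>2 \<le> (norm (f1 0 t))\<^sup>2"
          by (simp add: norm_mult power_mult_distrib power_divide)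
      qed
      finally show ?thesis .
    qed
    obtain f2 :: "nat \<Rightarrow> real \<Rightarrow> complex" where f2: "\<And>k. k \<le> 3 \<Longrightarrow> cc (f2 k)" "\<And>k t. k \<le> 2 \<Longrightarrow> (f2 k has_vector_derivative f2 (Suc k) t) (at t)"
      "\<And>k t. k \<le> 3 \<Longrightarrow> f2 k t \<noteq> 0 \<Longrightarrow> t \<in> {0..l}" and b2: "\<And>t. norm (f2 0 t) \<le> C2 * l" "\<And>t. norm (f2 1 t) \<le> C2"
      "\<And>t. norm (f2 2 t + of_real (\<kappa>\<^sup>2) * f2 0 t) \<le> C2" "\<And>t. norm (f2 3 t + of_real (\<kappa>\<^sup>2) * f2 1 t) \<le> C2 / l"
      and low2: "\<gamma>2 * l \<le> (LINT t|lborel. (norm (f2 (1::nat) t))\<^sup>2)"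
      using W[OF l] unfolding C3_profile_def by blast
    have CC: "C2 * l \<le> C * l" "C2 / l \<le> C / l" "2160 / l ^ k \<le> C / l ^ k" for k
      using C l by (auto intro!: mult_right_mono divide_right_mono)
    have gg: "\<gamma> * l \<le> \<gamma>2 * l" "\<gamma> * l \<le> 1/2000000 * l" using \<gamma> l by (auto intro!: mult_right_mono)
    have "has_quasimode c \<epsilon> \<omega> (6 * C^3 / (sqrt (\<gamma> ^ N) * l)) {b..b + l}"
    proof (rule TE_product_quasimode[OF N c l C(1), of f1 b f2 "f3 l" g])
      show "norm (f2 0 t) \<le> C * l" "norm (f2 1 t) \<le> C" "norm (f2 2 t + of_real (\<kappa>\<^sup>2) * f2 0 t) \<le> C"
        "norm (f2 3 t + of_real (\<kappa>\<^sup>2) * f2 1 t) \<le> C / l" for t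
        using b2[of t] CC C(3) by (auto intro: order_trans)
      show "norm (f3 l k t) \<le> C / l ^ k" if "k \<le> 3" for k t using order_trans[OF f3(3)[OF l that] CC(3)] .
      show "\<gamma> * l \<le> (LINT t|lborel. (norm (f2 1 t))\<^sup>2)" using gg(1) low2 by linarith
      show "\<gamma> * l \<le> (LINT t|lborel. (norm (f3 l 0 t))\<^sup>2)" if "N = 3" using gg(2) f3(5)[OF that l] by linarith
    qed ((rule f1c f1d f1z f2 f3(1,2)[OF l] f3(4) f3(6) gc aeg gz b10 b1r low1 \<gamma>(1); assumption) | assumption)+
    then show "has_quasimode c \<epsilon> \<omega> (6 * C^3 / sqrt (\<gamma> ^ N) / l) {b..b + l}"
      by simp
  qed
qed

text \<open>Coarse bookkeeping for polynomial expressions in quantities bounded by \<open>B\<close>: a power of \<open>B\<close> bounds each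
expression, and its exponent is found by counting operations.\<close>

lemma power_bound_add:
  fixes x y :: complex
  assumes B: "(2::real) \<le> B" and xy: "norm x \<le> B ^ i" "norm y \<le> B ^ j"
  shows "norm (x + y) \<le> B ^ (i + j + 1)" "norm (x - y) \<le> B ^ (i + j + 1)" "norm (x * y) \<le> B ^ (i + j)"
proof -
  have "B ^ i \<le> B ^ (i + j)" "B ^ j \<le> B ^ (i + j)" using B by (auto intro: power_increasing)
  moreover have "2 * B ^ (i + j) \<le> B * B ^ (i + j)" using B by (intro mult_right_mono) auto
  ultimately have "B ^ i + B ^ j \<le> B ^ (i + j + 1)" by simp
  then show "norm (x + y) \<le> B ^ (i + j + 1)" "norm (x - y) \<le> B ^ (i + j + 1)"
    using norm_triangle_ineq[of x y] norm_triangle_ineq4[of x y] xy by linarith+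
  show "norm (x * y) \<le> B ^ (i + j)" unfolding norm_mult power_add using xy B by (intro mult_mono) auto
qed

lemma power_bound_minus: "norm x \<le> (B::real) ^ i \<Longrightarrow> norm (- x :: complex) \<le> B ^ i"
  by simp

lemma power_bound_weaken:
  assumes "norm x \<le> B ^ i" "i \<le> j" "(2::real) \<le> B"
  shows "norm x \<le> B ^ j"
  using assms power_increasing[of i j B] by linarith

text \<open>The potential is \<open>G = hX\<close> with the cutoff \<open>X\<close> of \<open>[b, b + l]\<close>, since \<open>h\<close> satisfies
\<open>(h'/\<epsilon>)' = v' = (\<kappa>\<^sup>2/\<epsilon> - \<omega>\<^sup>2)h\<close>. Then \<open>V = G'/\<epsilon> = vX + hX'/\<epsilon>\<close>, and its norm is bounded below by the
mean square of \<open>v\<close> up to an error \<open>O(1/l)\<close> in amplitude; this is where \<open>l \<ge> L\<close> is used. The remainder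
\<open>R = V' - \<kappa>\<^sup>2A + \<omega>\<^sup>2G\<close> and its derivative are linear in derivatives of \<open>X\<close>, hence \<open>O(1/l)\<close>; the
derivative of \<open>R\<close> contains the second derivative of \<open>\<epsilon>\<close>.\<close>

lemma TM_quasimode_of_solution:
  fixes c :: "nat \<Rightarrow> 'n::finite" and \<epsilon> e e1 e2 :: "real \<Rightarrow> complex" and C\<^sub>0 \<gamma>\<^sub>0 \<kappa> :: real
  assumes N: "N \<in> {2, 3}" and c: "bij_betw c {1..N} (UNIV :: 'n set)" and C0: "C\<^sub>0 \<ge> 1" and g0: "\<gamma>\<^sub>0 > 0"
  obtains K L where "\<And>b l v h. l \<ge> 1 \<Longrightarrow> l \<ge> L \<Longrightarrow>
     (\<forall>t\<in>{b..b + l}. (e has_vector_derivative e1 t) (at t) \<and> (e1 has_vector_derivative e2 t) (at t) \<and> e t \<noteq> 0 \<and>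
        norm (e t) \<le> C\<^sub>0 \<and> norm (e1 t) \<le> C\<^sub>0 \<and> norm (e2 t) \<le> C\<^sub>0 \<and> norm (1 / e t) \<le> C\<^sub>0) \<Longrightarrow>
     continuous_on {b..b + l} e2 \<Longrightarrow> (AE t in lborel. t \<in> {b..b + l} \<longrightarrow> \<epsilon> t = e t) \<Longrightarrow>
     bounded_solution (\<lambda>t. of_real (\<kappa>\<^sup>2) / e t - \<omega>\<^sup>2) e C\<^sub>0 {b..b + l} v h \<Longrightarrow>
     \<gamma>\<^sub>0 * l \<le> integral {b + l/4..b + 3 * l/4} (\<lambda>t. (norm (v t))\<^sup>2) \<Longrightarrow>
     has_quasimode c \<epsilon> \<omega> (K / l) {b..b + l}"
proof -
  obtain C2 where C2: "C2 \<ge> 1" and W: "\<And>l. l \<ge> 1 \<Longrightarrow> \<exists>f :: nat \<Rightarrow> real \<Rightarrow> complex. C3_profile l f \<and> (\<forall>k\<le>1. \<forall>t. norm (f k t) \<le> C2) \<and>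
     (\<forall>t. norm (f 2 t + of_real (\<kappa>\<^sup>2) * f 0 t) \<le> C2 / l) \<and> (\<forall>t. norm (f 3 t + of_real (\<kappa>\<^sup>2) * f 1 t) \<le> C2 / l) \<and>
     1/2000000 * l \<le> (LINT t|lborel. (norm (f (0::nat) t))\<^sup>2)"
    by (rule TM_wave_profile) (rule that)
  obtain f3 where f3: "\<And>k l. l \<ge> 1 \<Longrightarrow> k \<le> 3 \<Longrightarrow> transverse N (f3 l k)"
    "\<And>k l t. l \<ge> 1 \<Longrightarrow> k \<le> 2 \<Longrightarrow> (f3 l k has_vector_derivative f3 l (Suc k) t) (at t)"
    "\<And>k l t. l \<ge> 1 \<Longrightarrow> k \<le> 3 \<Longrightarrow> norm (f3 l k t) \<le> 2160 / l ^ k"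
    "\<And>l. N = 2 \<Longrightarrow> f3 l 0 = (\<lambda>_. 1)"
    "\<And>l. N = 3 \<Longrightarrow> l \<ge> 1 \<Longrightarrow> 1/2000000 * l \<le> (LINT t|lborel. (norm (f3 l 0 t))\<^sup>2)"
    "\<And>l k t. N = 3 \<Longrightarrow> f3 l k t \<noteq> 0 \<Longrightarrow> t \<in> {0..l}"
    by (rule transverse_profile[OF N]) (rule that)
  define B where "B = 2160 + C\<^sub>0 + \<kappa>\<^sup>2 + (norm \<omega>)\<^sup>2"
  have B: "2 \<le> B" "2160 \<le> B" "C\<^sub>0 \<le> B" "\<kappa>\<^sup>2 \<le> B" "(norm \<omega>)\<^sup>2 \<le> B" using C0 by (simp_all add: B_def add_nonneg_nonneg)
  \<comment> \<open>The exponents that arise below are less than 100.\<close>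
  define C where "C = B ^ 100 + C2"
  define \<gamma> where "\<gamma> = min (\<gamma>\<^sub>0 / 4000000) (1/2000000)"
  \<comment> \<open>For \<open>l \<ge> L\<close> the error \<open>(B\<^sup>3/l)\<^sup>2\<close> is at most \<open>\<gamma>\<^sub>0/2000000\<close>.\<close>
  define L where "L = B ^ 3 * sqrt (2000000 / \<gamma>\<^sub>0)"
  have "B \<le> B ^ 100" using B self_le_power[of B 100] by simp
  then have C: "C \<ge> 1" "B ^ 100 \<le> C" "C2 \<le> C" "2160 \<le> C" using C2 B by (auto simp: C_def)
  have \<gamma>: "\<gamma> > 0" "\<gamma> \<le> \<gamma>\<^sub>0 / 4000000" "\<gamma> \<le> 1/2000000" using g0 by (auto simp: \<gamma>_def)
  show ?thesis
  proof (rule that[where K = "9 * C^3 / sqrt (\<gamma> ^ N)" and L = L])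
    fix b l :: real and v h
    assume l: "l \<ge> 1" "l \<ge> L"
      and ee: "\<forall>t\<in>{b..b + l}. (e has_vector_derivative e1 t) (at t) \<and> (e1 has_vector_derivative e2 t) (at t) \<and> e t \<noteq> 0 \<and>
        norm (e t) \<le> C\<^sub>0 \<and> norm (e1 t) \<le> C\<^sub>0 \<and> norm (e2 t) \<le> C\<^sub>0 \<and> norm (1 / e t) \<le> C\<^sub>0"
      and ce2: "continuous_on {b..b + l} e2" and ae: "AE t in lborel. t \<in> {b..b + l} \<longrightarrow> \<epsilon> t = e t"
      and vh: "bounded_solution (\<lambda>t. of_real (\<kappa>\<^sup>2) / e t - \<omega>\<^sup>2) e C\<^sub>0 {b..b + l} v h"
      and low: "\<gamma>\<^sub>0 * l \<le> integral {b + l/4..b + 3 * l/4} (\<lambda>t. (norm (v t))\<^sup>2)"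
    let ?I = "{b..b + l}"
    have l0: "l > 0" "b < b + l" using l by auto
    define i where "i t = 1 / e t" for t
    define k where "k = complex_of_real (\<kappa>\<^sup>2)"
    define w where "w = \<omega>\<^sup>2"
    define X where "X k = cutoff b l k" for k
    have ei: "e t * i t = 1" if "t \<in> ?I" for t using ee that by (simp add: i_def)
    have dv: "(v has_vector_derivative (k * i t - w) * h t) (at t within ?I)" and dh: "(h has_vector_derivative e t * v t) (at t within ?I)"
      if "t \<in> ?I" for t
      using vh that by (auto simp: bounded_solution_def i_def k_def w_def)
    have de: "(e has_vector_derivative e1 t) (at t within ?I)" "(e1 has_vector_derivative e2 t) (at t within ?I)" if "t \<in> ?I" for t
      using ee that by (auto intro: has_vector_derivative_at_within)
    have di: "(i has_vector_derivative - (e1 t * i t * i t)) (at t within ?I)" if t: "t \<in> ?I" for t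
    proof -
      have "(inverse has_field_derivative - (inverse (e t) * inverse (e t))) (at (e t) within e ` ?I)"
        using ee t DERIV_inverse[of "e t" "e ` ?I"] by (simp add: power2_eq_square)
      from field_vector_diff_chain_within[OF de(1)[OF t] this]
      show ?thesis by (simp add: o_def i_def[abs_def] inverse_eq_divide mult.assoc)
    qed
    have dX: "(X 0 has_vector_derivative X 1 t) (at t within ?I)" "(X 1 has_vector_derivative X 2 t) (at t within ?I)"
      "(X 2 has_vector_derivative X 3 t) (at t within ?I)" for t
      using cutoff_deriv[OF l0(1), of 0] cutoff_deriv[OF l0(1), of 1] cutoff_deriv[OF l0(1), of 2]
      by (simp_all add: X_def numeral_2_eq_2 numeral_3_eq_3)
    have cX: "continuous_on A (X k)" for A k unfolding X_def by (rule cutoff_cont[OF l0(1)])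
    have zX: "X k b = 0" "X k (b + l) = 0" for k unfolding X_def by (rule cutoff_zero[OF l0(1)])+
    have cont: "continuous_on ?I v" "continuous_on ?I h" "continuous_on ?I e" "continuous_on ?I e1" "continuous_on ?I i"
      unfolding continuous_on_eq_continuous_within
      using has_vector_derivative_continuous[OF dv] has_vector_derivative_continuous[OF dh]
        has_vector_derivative_continuous[OF de(1)] has_vector_derivative_continuous[OF de(2)] has_vector_derivative_continuous[OF di] by blast+
    define G0 where "G0 = (\<lambda>t. h t * X 0 t)"
    define G1 where "G1 = (\<lambda>t. h t * X 1 t + e t * v t * X 0 t)"
    define A0 where "A0 = (\<lambda>t. G0 t * i t)"
    define A1 where "A1 = (\<lambda>t. G0 t * - (e1 t * i t * i t) + G1 t * i t)"
    define H0 where "H0 = (\<lambda>t. h t * X 1 t)"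
    define H1 where "H1 = (\<lambda>t. h t * X 2 t + e t * v t * X 1 t)"
    define H2 where "H2 = (\<lambda>t. (h t * X 3 t + e t * v t * X 2 t) +
       ((e t * v t) * X 2 t + (e t * ((k * i t - w) * h t) + e1 t * v t) * X 1 t))"
    define V0 where "V0 = (\<lambda>t. v t * X 0 t + H0 t * i t)"
    define R0 where "R0 = (\<lambda>t. v t * X 1 t + (H0 t * - (e1 t * i t * i t) + H1 t * i t))"
    define R1 where "R1 = (\<lambda>t. (v t * X 2 t + (k * i t - w) * h t * X 1 t) +
       ((H0 t * - (e1 t * i t * - (e1 t * i t * i t) + (e1 t * - (e1 t * i t * i t) + e2 t * i t) * i t) + H1 t * - (e1 t * i t * i t)) +
        (H1 t * - (e1 t * i t * i t) + H2 t * i t)))"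
    define V1 where "V1 = (\<lambda>t. k * A0 t - w * G0 t + R0 t)"
    define V2 where "V2 = (\<lambda>t. k * A1 t - w * G1 t + R1 t)"
    note defs = G0_def G1_def A0_def A1_def H0_def H1_def H2_def V0_def R0_def R1_def V1_def V2_def
    have dG0: "(G0 has_vector_derivative G1 t) (at t within ?I)" if "t \<in> ?I" for t
      unfolding G0_def G1_def by (intro has_vector_derivative_mult dh dX that)
    have dA0: "(A0 has_vector_derivative A1 t) (at t within ?I)" if "t \<in> ?I" for t
      unfolding A0_def A1_def by (intro has_vector_derivative_mult dG0 di that)
    have dH0: "(H0 has_vector_derivative H1 t) (at t within ?I)" if "t \<in> ?I" for t
      unfolding H0_def H1_def by (intro has_vector_derivative_mult dh dX that)
    have dH1: "(H1 has_vector_derivative H2 t) (at t within ?I)" if "t \<in> ?I" for t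
      unfolding H1_def H2_def by (intro has_vector_derivative_add has_vector_derivative_mult dh dv de dX that)
    have dV0: "(V0 has_vector_derivative V1 t) (at t within ?I)" if "t \<in> ?I" for t
    proof -
      have "(V0 has_vector_derivative (v t * X 1 t + (k * i t - w) * h t * X 0 t) + (H0 t * - (e1 t * i t * i t) + H1 t * i t)) (at t within ?I)"
        unfolding V0_def by (intro has_vector_derivative_add has_vector_derivative_mult dv dX dH0 di that)
      moreover have "(v t * X 1 t + (k * i t - w) * h t * X 0 t) + (H0 t * - (e1 t * i t * i t) + H1 t * i t) = V1 t"
        by (simp add: V1_def A0_def G0_def R0_def algebra_simps)
      ultimately show ?thesis by simp
    qed
    have dR0: "(R0 has_vector_derivative R1 t) (at t within ?I)" if "t \<in> ?I" for t
      unfolding R0_def R1_def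
      by (intro has_vector_derivative_add has_vector_derivative_mult has_vector_derivative_minus dv dX dH0 dH1 di de that)
    have dV1: "(V1 has_vector_derivative V2 t) (at t within ?I)" if "t \<in> ?I" for t
      unfolding V1_def V2_def
      by (intro has_vector_derivative_add has_vector_derivative_diff has_vector_derivative_mult_right dA0 dG0 dR0 that)
    have ck: "continuous_on ?I G0" "continuous_on ?I G1" "continuous_on ?I A0" "continuous_on ?I A1" "continuous_on ?I V0"
      "continuous_on ?I V1" "continuous_on ?I V2"
      unfolding defs by (intro continuous_intros cont ce2 cX)+
    have zk: "G0 t = 0" "G1 t = 0" "A0 t = 0" "A1 t = 0" "V0 t = 0" "V1 t = 0" "V2 t = 0" if "t = b \<or> t = b + l" for t
      using that zX unfolding defs by auto
    define Z where "Z f = zext b (b + l) f" for f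
    have ccZ: "cc (Z f)" if "f \<in> {G0, G1, A0, A1, V0, V1, V2}" for f
      unfolding Z_def by (rule zext_cc[OF l0(2)]) (use that ck zk in auto)
    have Zd: "(Z G0 has_vector_derivative Z G1 t) (at t)" "(Z A0 has_vector_derivative Z A1 t) (at t)"
       "(Z V0 has_vector_derivative Z V1 t) (at t)" "(Z V1 has_vector_derivative Z V2 t) (at t)" for t
      unfolding Z_def by (rule zext_deriv[OF l0(2)], auto intro: dG0 dA0 dV0 dV1 simp: zk)+
    have Znz: "Z f t \<noteq> 0 \<Longrightarrow> t \<in> ?I" for f t unfolding Z_def by (rule zext_nz)
    \<comment> \<open>Derivatives of the cutoff multiplied by \<open>l\<close> are bounded, so \<open>lR\<close> is a polynomial in bounded quantities.\<close>
    define Y where "Y j t = of_real l * X j t" for j t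
    have base: "norm (v t) \<le> B ^ 1" "norm (h t) \<le> B ^ 1" "norm (e t) \<le> B ^ 1" "norm (e1 t) \<le> B ^ 1" "norm (e2 t) \<le> B ^ 1"
      "norm (i t) \<le> B ^ 1" "norm k \<le> B ^ 1" "norm w \<le> B ^ 1" "norm (X j t) \<le> B ^ 1" "norm (Y (Suc j) t) \<le> B ^ 1" if t: "t \<in> ?I" for t j
    proof -
      have x: "norm (X j t) \<le> 2160" for j
      proof -
        have "1 / l ^ j \<le> 1" using l(1) by (simp add: divide_simps)
        then have "2160 * (1 / l ^ j) \<le> 2160" by linarith
        then show ?thesis using cutoff_bound[OF l0(1) t, of j] by (simp add: X_def)
      qed
      show "norm (X j t) \<le> B ^ 1" using x[of j] B by simp
      have "norm (Y (Suc j) t) \<le> l * (2160 / l ^ Suc j)"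
        unfolding Y_def X_def norm_mult norm_of_real using cutoff_bound[OF l0(1) t, of "Suc j"] l0 by (intro mult_mono) auto
      also have "\<dots> = 2160 * (1 / l ^ j)" using l0 by simp
      also have "\<dots> \<le> 2160"
      proof -
        have "1 / l ^ j \<le> 1" using l(1) by (simp add: divide_simps)
        then show ?thesis by linarith
      qed
      finally show "norm (Y (Suc j) t) \<le> B ^ 1" using B by simp
      show "norm (v t) \<le> B ^ 1" "norm (h t) \<le> B ^ 1" "norm (e t) \<le> B ^ 1" "norm (e1 t) \<le> B ^ 1" "norm (e2 t) \<le> B ^ 1" "norm (i t) \<le> B ^ 1"
        using vh ee t B by (auto simp: bounded_solution_def i_def intro: order_trans)
      show "norm k \<le> B ^ 1" "norm w \<le> B ^ 1" using B by (simp_all add: k_def w_def norm_power)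
    qed
    note pb = power_bound_add[OF B(1)] power_bound_minus
    have bA: "norm (A0 t) \<le> B ^ 100" "norm (A1 t) \<le> B ^ 100" "norm (V0 t) \<le> B ^ 100" if "t \<in> ?I" for t
      unfolding defs
      by (rule power_bound_weaken[OF _ _ B(1)], (rule pb base[OF that])+, simp)+
    have Y1: "norm (Y 1 t) \<le> B ^ 1" "norm (Y 2 t) \<le> B ^ 1" "norm (Y 3 t) \<le> B ^ 1" if "t \<in> ?I" for t
      using base(10)[OF that, of 0] base(10)[OF that, of 1] base(10)[OF that, of 2] by (simp_all add: numeral_2_eq_2 numeral_3_eq_3)
    have lR: "of_real l * R0 t = v t * Y 1 t + (h t * Y 1 t * - (e1 t * i t * i t) + (h t * Y 2 t + e t * v t * Y 1 t) * i t)"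
      "of_real l * R1 t = (v t * Y 2 t + (k * i t - w) * h t * Y 1 t) +
       ((h t * Y 1 t * - (e1 t * i t * - (e1 t * i t * i t) + (e1 t * - (e1 t * i t * i t) + e2 t * i t) * i t) + (h t * Y 2 t + e t * v t * Y 1 t) * - (e1 t * i t * i t)) +
        ((h t * Y 2 t + e t * v t * Y 1 t) * - (e1 t * i t * i t) + ((h t * Y 3 t + e t * v t * Y 2 t) +
       ((e t * v t) * Y 2 t + (e t * ((k * i t - w) * h t) + e1 t * v t) * Y 1 t)) * i t))" for t
      unfolding R0_def R1_def H0_def H1_def H2_def Y_def by (simp_all only: distrib_left mult.left_commute[of "of_real l"] mult.assoc distrib_right)
    have bR: "norm (R0 t) \<le> C / l" "norm (R1 t) \<le> C / l" if t: "t \<in> ?I" for t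
    proof -
      have "norm (of_real l * R0 t) \<le> B ^ 100" "norm (of_real l * R1 t) \<le> B ^ 100"
        unfolding lR
        by (rule power_bound_weaken[OF _ _ B(1)], (rule pb base(1-9)[OF t] Y1[OF t])+, simp)+
      then show "norm (R0 t) \<le> C / l" "norm (R1 t) \<le> C / l"
        using C(2) l0 by (simp_all add: norm_mult field_simps)
    qed
    have low1: "\<gamma> * l \<le> (LINT t|lborel. (norm (Z V0 t))\<^sup>2)"
    proof -
      have J: "{b + l/4..b + 3 * l/4} \<subseteq> ?I" using l by auto
      let ?J = "{b + l/4..b + 3 * l/4}"
      have cJ: "continuous_on ?J v" by (rule continuous_on_subset[OF cont(1) J])
      have "integral ?J (\<lambda>t. 1/2000000 * (norm (v t))\<^sup>2 - (B ^ 3 / l)\<^sup>2) \<le> (LINT t|lborel. (norm (Z V0 t))\<^sup>2)"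
      proof (rule integral_sq_lower)
        show "cc (Z V0)" by (rule ccZ) simp
        show "continuous_on ?J (\<lambda>t. 1/2000000 * (norm (v t))\<^sup>2 - (B ^ 3 / l)\<^sup>2)" by (intro continuous_intros cJ)
        fix t assume t: "t \<in> ?J"
        then have tI: "t \<in> ?I" using J by blast
        define x y where "x = norm (v t * X 0 t)" and "y = norm (H0 t * i t)"
        have "norm (h t * Y 1 t * i t) \<le> B ^ (1 + 1 + 1)" by (rule pb base(1-9)[OF tI] Y1[OF tI])+
        moreover have "norm (h t * Y 1 t * i t) = l * y" using l0 by (simp add: Y_def H0_def y_def norm_mult)
        ultimately have "l * y \<le> B ^ 3" by (simp add: numeral_3_eq_3)
        then have y: "0 \<le> y" "y \<le> B ^ 3 / l" using l0 by (simp_all add: y_def field_simps)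
        then have y2: "y\<^sup>2 \<le> (B ^ 3 / l)\<^sup>2" by (intro power_mono) auto
        have "(1/1000)\<^sup>2 \<le> (norm (X 0 t))\<^sup>2" using cutoff_lower(1)[OF l0(1) t] by (intro power_mono) (auto simp: X_def)
        then have "(norm (v t))\<^sup>2 * (1/1000)\<^sup>2 \<le> (norm (v t))\<^sup>2 * (norm (X 0 t))\<^sup>2" by (intro mult_left_mono) auto
        then have x2: "1/1000000 * (norm (v t))\<^sup>2 \<le> x\<^sup>2" by (simp add: x_def norm_mult power_mult_distrib power_divide)
        have "x \<le> norm (V0 t) + y"
          using norm_triangle_ineq4[of "V0 t" "H0 t * i t"] by (simp add: V0_def x_def y_def)
        then have "x\<^sup>2 \<le> (norm (V0 t) + y)\<^sup>2" by (intro power_mono) (auto simp: x_def)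
        also have "\<dots> \<le> 2 * (norm (V0 t))\<^sup>2 + 2 * y\<^sup>2"
          using zero_le_power2[of "norm (V0 t) - y"] by (simp add: power2_eq_square algebra_simps)
        finally have "x\<^sup>2 / 2 - y\<^sup>2 \<le> (norm (V0 t))\<^sup>2" by simp
        moreover have "Z V0 t = V0 t" using tI by (simp add: Z_def zext_def)
        ultimately show "1/2000000 * (norm (v t))\<^sup>2 - (B ^ 3 / l)\<^sup>2 \<le> (norm (Z V0 t))\<^sup>2" using x2 y2 by simp
      qed
      moreover have "integral ?J (\<lambda>t. 1/2000000 * (norm (v t))\<^sup>2 - (B ^ 3 / l)\<^sup>2) = 1/2000000 * integral ?J (\<lambda>t. (norm (v t))\<^sup>2) - (B ^ 3 / l)\<^sup>2 * (l / 2)"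
      proof -
        have "(\<lambda>t. 1/2000000 * (norm (v t))\<^sup>2) integrable_on ?J" "(\<lambda>t. (B ^ 3 / l)\<^sup>2) integrable_on ?J"
          by (intro integrable_continuous_interval continuous_intros cJ)+
        then have "integral ?J (\<lambda>t. 1/2000000 * (norm (v t))\<^sup>2 - (B ^ 3 / l)\<^sup>2) = integral ?J (\<lambda>t. 1/2000000 * (norm (v t))\<^sup>2) - integral ?J (\<lambda>t. (B ^ 3 / l)\<^sup>2)"
          by (rule Henstock_Kurzweil_Integration.integral_diff)
        moreover have "integral ?J (\<lambda>t. 1/2000000 * (norm (v t))\<^sup>2) = 1/2000000 * integral ?J (\<lambda>t. (norm (v t))\<^sup>2)"
          by (rule integral_mult_right)
        moreover have "integral ?J (\<lambda>t. (B ^ 3 / l)\<^sup>2) = (B ^ 3 / l)\<^sup>2 * (l / 2)" using l0 by simp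
        ultimately show ?thesis by linarith
      qed
      moreover have "(B ^ 3 / l)\<^sup>2 * (l / 2) \<le> \<gamma>\<^sub>0 / 4000000 * l"
      proof -
        have "L\<^sup>2 \<le> l\<^sup>2" using l(2) g0 B by (intro power_mono) (auto simp: L_def)
        then have "(B ^ 3)\<^sup>2 * (2000000 / \<gamma>\<^sub>0) \<le> l\<^sup>2" using g0 by (simp add: L_def power_mult_distrib)
        then have "(B ^ 3)\<^sup>2 / l\<^sup>2 \<le> \<gamma>\<^sub>0 / 2000000" using g0 l0 by (simp add: field_simps)
        then have "(B ^ 3)\<^sup>2 / l\<^sup>2 * (l / 2) \<le> \<gamma>\<^sub>0 / 2000000 * (l / 2)" using l0 by (intro mult_right_mono) auto
        then show ?thesis by (simp add: power_divide)
      qed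
      moreover have "\<gamma> * l \<le> \<gamma>\<^sub>0 / 4000000 * l" using \<gamma> l0 by (intro mult_right_mono) auto
      ultimately show ?thesis using low by linarith
    qed
    obtain f2 :: "nat \<Rightarrow> real \<Rightarrow> complex" where f2: "\<And>k. k \<le> 3 \<Longrightarrow> cc (f2 k)" "\<And>k t. k \<le> 2 \<Longrightarrow> (f2 k has_vector_derivative f2 (Suc k) t) (at t)"
      "\<And>k t. k \<le> 3 \<Longrightarrow> f2 k t \<noteq> 0 \<Longrightarrow> t \<in> {0..l}" and b2: "\<And>k t. k \<le> 1 \<Longrightarrow> norm (f2 k t) \<le> C2"
      "\<And>t. norm (f2 2 t + of_real (\<kappa>\<^sup>2) * f2 0 t) \<le> C2 / l" "\<And>t. norm (f2 3 t + of_real (\<kappa>\<^sup>2) * f2 1 t) \<le> C2 / l"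
      and low2: "1/2000000 * l \<le> (LINT t|lborel. (norm (f2 (0::nat) t))\<^sup>2)"
      using W[OF l(1)] unfolding C3_profile_def by blast
    have CC: "C2 / l \<le> C / l" "2160 / l ^ k \<le> C / l ^ k" for k
      using C l by (auto intro!: divide_right_mono)
    have gg: "\<gamma> * l \<le> 1/2000000 * l" using \<gamma> l by (auto intro!: mult_right_mono)
    define Af where "Af j = (if j = 0 then Z A0 else Z A1)" for j :: nat
    define Vf where "Vf j = (if j = 0 then Z V0 else if j = 1 then Z V1 else Z V2)" for j :: nat
    define Gf where "Gf j = (if j = 0 then Z G0 else Z G1)" for j :: nat
    have f0: "Af 0 = Z A0" "Af 1 = Z A1" "Vf 0 = Z V0" "Vf 1 = Z V1" "Vf 2 = Z V2" "Vf (Suc 0) = Z V1" "Vf (Suc 1) = Z V2" "Gf 0 = Z G0" "Gf 1 = Z G1"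
      "Af (Suc 0) = Z A1" "Gf (Suc 0) = Z G1" "Vf (Suc (Suc 0)) = Z V2"
      by (simp_all add: Af_def Vf_def Gf_def)
    have j1: "j = 0 \<or> j = 1" if "j \<le> 1" for j :: nat using that by linarith
    have "has_quasimode c \<epsilon> \<omega> (9 * C^3 / (sqrt (\<gamma> ^ N) * l)) {b..b + l}"
    proof (rule TM_product_quasimode[OF N c l(1) C(1), of Af b Vf Gf f2 "f3 l"])
      show "cc (Af j)" "cc (Gf j)" "cc (Vf j)" for j by (auto simp: Af_def Gf_def Vf_def intro!: ccZ)
      show "(Af 0 has_vector_derivative Af 1 t) (at t)" "(Gf 0 has_vector_derivative Gf 1 t) (at t)" for t unfolding f0 by (rule Zd)+
      show "(Vf j has_vector_derivative Vf (Suc j) t) (at t)" if "j \<le> 1" for j t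
        using j1[OF that] Zd(3,4) f0 by (auto simp: numeral_2_eq_2)
      show "Af j t \<noteq> 0 \<Longrightarrow> t \<in> ?I" "Gf j t \<noteq> 0 \<Longrightarrow> t \<in> ?I" "Vf j t \<noteq> 0 \<Longrightarrow> t \<in> ?I" for j t
        by (auto simp: Af_def Gf_def Vf_def split: if_splits dest: Znz)
      show "AE t in lborel. Gf 0 t = \<epsilon> t * Af 0 t"
        using ae by eventually_elim (auto simp: f0 Z_def zext_def A0_def ei algebra_simps)
      show "AE t in lborel. Gf 1 t = \<epsilon> t * Vf 0 t"
        using ae
      proof eventually_elim
        case (elim t)
        show ?case
        proof (cases "t \<in> ?I")
          case True
          have "e t * V0 t = e t * v t * X 0 t + H0 t * (e t * i t)" by (simp add: V0_def algebra_simps)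
          then show ?thesis using elim True ei[OF True] by (simp add: f0 Z_def zext_def G1_def H0_def)
        qed (auto simp: f0 Z_def zext_def)
      qed
      show "norm (Af j t) \<le> C" for j t
        using bA(1,2)[THEN order_trans[OF _ C(2)]] C(1) by (auto simp: Af_def Z_def intro!: zext_norm)
      show "norm (Vf 0 t) \<le> C" for t
        using bA(3)[THEN order_trans[OF _ C(2)]] C(1) by (auto simp: Vf_def Z_def intro!: zext_norm)
      show "norm (Vf (Suc j) t - of_real (\<kappa>\<^sup>2) * Af j t + \<omega>\<^sup>2 * Gf j t) \<le> C / l" if "j \<le> 1" for j t
      proof (cases "t \<in> ?I")
        case True
        have "Vf (Suc 0) t - of_real (\<kappa>\<^sup>2) * Af 0 t + \<omega>\<^sup>2 * Gf 0 t = R0 t" "Vf (Suc 1) t - of_real (\<kappa>\<^sup>2) * Af 1 t + \<omega>\<^sup>2 * Gf 1 t = R1 t"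
          unfolding f0 using True by (simp_all add: Z_def zext_def V1_def V2_def k_def w_def)
        then show ?thesis using j1[OF that] bR[OF True] by auto
      next
        case False
        then have "Z f t = 0" for f using Znz by blast
        then show ?thesis using C(1) l0 by (simp add: Vf_def Af_def Gf_def)
      qed
      show "norm (f2 j t) \<le> C" if "j \<le> 1" for j t using b2(1)[OF that] C(3) by (rule order_trans)
      show "norm (f2 2 t + of_real (\<kappa>\<^sup>2) * f2 0 t) \<le> C / l" "norm (f2 3 t + of_real (\<kappa>\<^sup>2) * f2 1 t) \<le> C / l" for t
        using b2(2,3)[of t] CC(1) by (auto intro: order_trans)
      show "norm (f3 l j t) \<le> C / l ^ j" if "j \<le> 3" for j t using order_trans[OF f3(3)[OF l(1) that] CC(2)] .
      show "\<gamma> * l \<le> (LINT t|lborel. (norm (Vf 0 t))\<^sup>2)" unfolding f0 by (rule low1)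
      show "\<gamma> * l \<le> (LINT t|lborel. (norm (f2 0 t))\<^sup>2)" using gg low2 by linarith
      show "\<gamma> * l \<le> (LINT t|lborel. (norm (f3 l 0 t))\<^sup>2)" if "N = 3" using gg f3(5)[OF that l(1)] by linarith
    qed ((rule f2 f3(1,2)[OF l(1)] f3(4) f3(6) \<gamma>(1); assumption) | assumption)+
    then show "has_quasimode c \<epsilon> \<omega> (9 * C^3 / sqrt (\<gamma> ^ N) / l) {b..b + l}"
      by simp
  qed
qed

section \<open>Membership in the Weyl spectrum\<close>

text \<open>Solutions on the intervals of \<open>4n\<close> periods are converted into quasimodes of length \<open>l = 4na\<close>, with error
\<open>K/l\<close>.\<close>

lemma weyl_of_solution_family:
  fixes c :: "nat \<Rightarrow> 'n::finite" and b :: "nat \<Rightarrow> real" and V :: "nat \<Rightarrow> (real \<Rightarrow> complex) \<Rightarrow> (real \<Rightarrow> complex) \<Rightarrow> bool"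
  assumes omega: "\<omega> \<in> D_eps \<epsilon>\<^sub>p \<epsilon>\<^sub>m" and a: "a > 0"
    and esc: "\<And>n x. n \<ge> n0 \<Longrightarrow> x \<in> {b n..b n + 4 * (real n * a)} \<Longrightarrow> \<bar>x\<bar> \<ge> real n * a"
    and fam: "\<forall>\<^sub>F n in sequentially. \<exists>v h. V n v h \<and>
      \<gamma> * real n \<le> integral {b n + real n * a..b n + 3 * (real n * a)} (\<lambda>t. (norm (v t))\<^sup>2)"
    and quasimode: "\<And>n v h l. n \<ge> n0 \<Longrightarrow> l = 4 * (real n * a) \<Longrightarrow> l \<ge> 1 \<Longrightarrow> l \<ge> L \<Longrightarrow> V n v h \<Longrightarrow>
      \<gamma> / (4 * a) * l \<le> integral {b n + l/4..b n + 3 * l/4} (\<lambda>t. (norm (v t))\<^sup>2) \<Longrightarrow>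
      has_quasimode c (\<lambda>x. permittivity \<epsilon>\<^sub>p \<epsilon>\<^sub>m x \<omega>) \<omega> (K / l) {b n..b n + l}"
  shows "\<omega> \<in> sigma_Weyl c \<epsilon>\<^sub>p \<epsilon>\<^sub>m"
proof (rule weyl_criterion[OF omega])
  have top: "filterlim (\<lambda>n. real n * a) at_top sequentially" "filterlim (\<lambda>n. 4 * (real n * a)) at_top sequentially"
    using a by real_asymp+
  then show "filterlim (\<lambda>n. real n * a) at_top sequentially" by blast
  show "(\<lambda>n. K / (4 * (real n * a))) \<longlonglongrightarrow> 0"
    using tendsto_divide_0[OF tendsto_const filterlim_at_top_imp_at_infinity[OF top(2)]] by simp
  show "\<forall>\<^sub>F n in sequentially.
      has_quasimode c (\<lambda>x. permittivity \<epsilon>\<^sub>p \<epsilon>\<^sub>m x \<omega>) \<omega> (K / (4 * (real n * a))) {t. real n * a \<le> \<bar>t\<bar>}"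
    using fam eventually_ge_at_top[of n0] filterlim_at_top[THEN iffD1, OF top(2), rule_format, of 1]
      filterlim_at_top[THEN iffD1, OF top(2), rule_format, of L]
  proof eventually_elim
    case (elim n)
    then obtain v h where V: "V n v h"
      and low: "\<gamma> * real n \<le> integral {b n + real n * a..b n + 3 * (real n * a)} (\<lambda>t. (norm (v t))\<^sup>2)" by blast
    have "\<gamma> / (4 * a) * (4 * (real n * a)) = \<gamma> * real n" using a by simp
    then have low': "\<gamma> / (4 * a) * (4 * (real n * a)) \<le> integral {b n + 4 * (real n * a) / 4..b n + 3 * (4 * (real n * a)) / 4} (\<lambda>t. (norm (v t))\<^sup>2)"
      using low a by (simp add: mult_ac)
    show ?case
      by (rule has_quasimode_mono[OF quasimode[OF elim(2) refl elim(3) elim(4) V low']]) (use esc[OF elim(2)] in blast)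
  qed
qed

lemma absolutely_integrable_bounded_times:
  fixes f g :: "real \<Rightarrow> complex"
  assumes T: "T \<in> sets borel" and f: "f absolutely_integrable_on T" and g: "continuous_on T g" "\<And>t. t \<in> T \<Longrightarrow> norm (g t) \<le> C"
  shows "(\<lambda>t. g t * f t) absolutely_integrable_on T"
proof (rule measurable_bounded_by_integrable_imp_absolutely_integrable)
  have TL: "T \<in> sets lebesgue" using T by (simp add: sets_completionI_sets)
  show "T \<in> sets lebesgue" by (rule TL)
  have "f \<in> borel_measurable (lebesgue_on T)" "g \<in> borel_measurable (lebesgue_on T)"
    using f g(1) TL by (auto intro: integrable_imp_measurable continuous_imp_measurable_on_sets_lebesgue
        absolutely_integrable_on_def dest: set_lebesgue_integral_eq_integral(1))
  then show "(\<lambda>t. g t * f t) \<in> borel_measurable (lebesgue_on T)" by (rule borel_measurable_times[rotated])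
  show "(\<lambda>t. C * norm (f t)) integrable_on T"
    using f by (simp add: absolutely_integrable_on_def integrable_on_mult_right)
  show "norm (g t * f t) \<le> C * norm (f t)" if "t \<in> T" for t
    using g(2)[OF that] by (simp add: norm_mult mult_right_mono)
qed

theorem lemma4p9:
  fixes N :: nat and c :: "nat \<Rightarrow> 'n::finite"
    and eps_plus eps_minus :: "real \<Rightarrow> complex \<Rightarrow> complex" and \<omega> :: complex
    and S :: "real set" and eps :: "real \<Rightarrow> complex \<Rightarrow> complex"
    and a :: real and eps_per eps_as :: "real \<Rightarrow> complex"
  assumes N: "N \<in> {2, 3}"
    and coords: "bij_betw c {1..N} (UNIV :: 'n set)"
    and dim_k: "CARD('m::finite) = N - 1"
    and omega: "\<omega> \<in> D_eps eps_plus eps_minus"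
    and side: "S = {0<..} \<and> eps = eps_plus \<or> S = {..<0} \<and> eps = eps_minus"
    and a: "a > 0"
    and periodic: "\<forall>x. eps_per (x + a) = eps_per x"
    and decomposition: "\<forall>x\<in>S. eps x \<omega> = eps_per x + eps_as x"
    and as_L1: "eps_as absolutely_integrable_on S"
  shows
    "(\<forall>k0 :: real^'m.
        stability_case a (\<lambda>x. 1) (\<lambda>x. of_real ((norm k0)\<^sup>2) - \<omega>\<^sup>2 * eps_per x)
        \<longrightarrow> \<omega> \<in> sigma_Weyl c eps_plus eps_minus)
   \<and> (\<forall>k0 :: real^'m.
        stability_case a (\<lambda>x. eps_per x / (of_real ((norm k0)\<^sup>2) - \<omega>\<^sup>2 * eps_per x)) eps_per
        \<and> (\<exists>g. weak_deriv S eps_as g \<and> g absolutely_integrable_on S)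
        \<and> setdist ((\<lambda>x. \<omega>\<^sup>2 * eps_per x) ` S) {0, of_real ((norm k0)\<^sup>2)} > 0
        \<longrightarrow> \<omega> \<in> sigma_Weyl c eps_plus eps_minus)"
proof -
  let ?\<epsilon> = "\<lambda>x. permittivity eps_plus eps_minus x \<omega>"
  have S: "open S" "is_interval S" "convex S" "S \<in> sets borel" using side by auto
  have W: "(\<lambda>x. eps x \<omega>) \<in> W_infty 3 S" using omega side by (auto simp: D_eps_def)
  obtain e e1 e2 D where ae: "AE x in lebesgue. x \<in> S \<longrightarrow> eps x \<omega> = e x"
    and de: "\<And>x. x \<in> S \<Longrightarrow> (e has_vector_derivative e1 x) (at x)" "\<And>x. x \<in> S \<Longrightarrow> (e1 has_vector_derivative e2 x) (at x)"
    and ce2: "continuous_on S e2"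
    and be: "\<And>x. x \<in> S \<Longrightarrow> norm (e x) \<le> D" "\<And>x. x \<in> S \<Longrightarrow> norm (e1 x) \<le> D" "\<And>x. x \<in> S \<Longrightarrow> norm (e2 x) \<le> D"
    by (rule W_infty_3_classical[OF S(1,2) W]) (rule that)
  have ce: "continuous_on S e"
    unfolding continuous_on_eq_continuous_within
    using has_vector_derivative_continuous[OF has_vector_derivative_at_within[OF de(1)]] by blast
  have lip: "norm (e x - e y) \<le> D * \<bar>x - y\<bar>" if "x \<in> S" "y \<in> S" for x y
  proof -
    have d: "(e has_derivative (\<lambda>h. h *\<^sub>R e1 t)) (at t within S)" if "t \<in> S" for t
      using has_vector_derivative_at_within[OF de(1)[OF that]] unfolding has_vector_derivative_def .
    have "onorm (\<lambda>h. h *\<^sub>R e1 t) \<le> D" if "t \<in> S" for t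
    proof (rule onorm_bound)
      show "0 \<le> D" using order_trans[OF norm_ge_zero be(2)[OF that]] .
      show "norm (h *\<^sub>R e1 t) \<le> D * norm h" for h
        using mult_left_mono[OF be(2)[OF that], of "\<bar>h\<bar>"] by (simp add: mult.commute)
    qed
    from differentiable_bound[OF S(3) d this that(1,2)] show ?thesis by simp
  qed
  define \<tau> where "\<tau> = (if S = {0<..} then a else - a)"
  have \<tau>: "S = {0<..} \<and> \<tau> = a \<or> S = {..<0} \<and> \<tau> = - a"
  proof (cases "S = {0<..}")
    case False
    then show ?thesis using side by (auto simp: \<tau>_def)
  qed (simp add: \<tau>_def)
  have dec: "AE x in lebesgue. x \<in> S \<longrightarrow> eps_per x + eps_as x = e x"
    using ae decomposition by (auto elim!: eventually_mono)
  obtain p where p: "continuous_on UNIV p" "\<And>x. p (x + a) = p x" "AE x in lebesgue. eps_per x = p x"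
    "(\<lambda>x. e x - p x) absolutely_integrable_on S"
    "\<And>\<eta>. \<eta> > 0 \<Longrightarrow> \<exists>R. \<forall>x\<in>S. \<bar>x\<bar> \<ge> R \<longrightarrow> norm (e x - p x) < \<eta>"
    by (rule continuous_periodic_representative[OF a \<tau> dec lip periodic[rule_format] as_L1]) (assumption, assumption, rule that)
  have aeps: "AE x in lborel. x \<in> S \<longrightarrow> ?\<epsilon> x = e x"
  proof -
    have "?\<epsilon> x = eps x \<omega>" if "x \<in> S" for x using side that by (auto simp: permittivity_def)
    then show ?thesis using ae unfolding AE_completion_iff by (auto elim!: eventually_mono)
  qed
  \<comment> \<open>The intervals are \<open>[4na, 8na]\<close> on the positive and \<open>[-8na, -4na]\<close> on the negative half-line.\<close>
  define m :: "nat \<Rightarrow> int" where "m n = (if S = {0<..} then 4 * int n else - 8 * int n)" for n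
  define b where "b n = of_int (m n) * a" for n
  have I: "{b n..b n + 4 * (real n * a)} \<subseteq> S \<and> (\<forall>x\<in>{b n..b n + 4 * (real n * a)}. real n * a \<le> \<bar>x\<bar>)" if "n \<ge> 1" for n
  proof -
    define r where "r = real n * a"
    have r: "r > 0" using that a by (simp add: r_def)
    have "x \<in> S \<and> r \<le> \<bar>x\<bar>" if x: "b n \<le> x" "x \<le> b n + 4 * r" for x
    proof (cases "S = {0<..}")
      case True
      then have "b n = 4 * r" by (simp add: b_def m_def r_def)
      then have "0 < x" "r \<le> \<bar>x\<bar>" using x r by linarith+
      then show ?thesis using True by simp
    next
      case False
      then have "b n = - 8 * r" by (simp add: b_def m_def r_def)
      then have "x < 0" "r \<le> \<bar>x\<bar>" using x r by linarith+
      then show ?thesis using False \<tau> by simp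
    qed
    then show ?thesis unfolding r_def subset_iff atLeastAtMost_iff Ball_def by blast
  qed
  have aeI: "AE t in lborel. t \<in> {b n..b n + l} \<longrightarrow> ?\<epsilon> t = e t" if "n \<ge> 1" "l = 4 * (real n * a)" for n l
    using aeps I[OF that(1)] that(2) by (auto elim!: eventually_mono)
  have TE: "\<omega> \<in> sigma_Weyl c eps_plus eps_minus"
    if stab: "stability_case a (\<lambda>x. 1) (\<lambda>x. of_real (\<kappa>\<^sup>2) - \<omega>\<^sup>2 * eps_per x)" for \<kappa> :: real
  proof -
    have L1: "(\<lambda>t. (of_real (\<kappa>\<^sup>2) - \<omega>\<^sup>2 * e t) - (of_real (\<kappa>\<^sup>2) - \<omega>\<^sup>2 * p t)) absolutely_integrable_on S"
      using set_integrable_mult_right[of "- \<omega>\<^sup>2" lebesgue S "\<lambda>x. e x - p x"] p(4) by (simp add: algebra_simps)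
    obtain \<gamma> C where gC: "\<gamma> > 0" "C > 0" and fam: "\<forall>\<^sub>F n in sequentially. \<exists>v h.
       bounded_solution (\<lambda>_. 1) (\<lambda>t. of_real (\<kappa>\<^sup>2) - \<omega>\<^sup>2 * e t) C {b n..b n + 4 * (real n * a)} v h \<and>
       \<gamma> * real n \<le> integral {b n + real n * a..b n + 3 * (real n * a)} (\<lambda>t. (norm (v t))\<^sup>2)"
      unfolding b_def
    proof (rule perturbed_floquet_family[OF a stab, of "\<lambda>_. 1" "\<lambda>t. of_real (\<kappa>\<^sup>2) - \<omega>\<^sup>2 * p t" S "\<lambda>_. 1" "\<lambda>t. of_real (\<kappa>\<^sup>2) - \<omega>\<^sup>2 * e t" 1 m])
      show "AE x in lebesgue. of_real (\<kappa>\<^sup>2) - \<omega>\<^sup>2 * eps_per x = of_real (\<kappa>\<^sup>2) - \<omega>\<^sup>2 * p x"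
        using p(3) by eventually_elim simp
      show "{of_int (m n) * a..of_int (m n) * a + 4 * (real n * a)} \<subseteq> S" if "n \<ge> 1" for n
        using I[OF that] by (simp add: b_def)
      show "real n * a \<le> \<bar>x\<bar>" if "n \<ge> 1" "x \<in> {of_int (m n) * a..of_int (m n) * a + 4 * (real n * a)}" for n x
        using I[OF that(1)] that(2) by (simp add: b_def)
      show "continuous_on UNIV (\<lambda>t. of_real (\<kappa>\<^sup>2) - \<omega>\<^sup>2 * p t)" by (intro continuous_intros p(1))
      show "continuous_on S (\<lambda>t. of_real (\<kappa>\<^sup>2) - \<omega>\<^sup>2 * e t)" by (intro continuous_intros ce)
    qed ((rule that; assumption) | rule L1 | simp add: p(2))+
    obtain K where K: "\<And>b l v h. l \<ge> 1 \<Longrightarrow> continuous_on {b..b + l} e \<Longrightarrow> (AE t in lborel. t \<in> {b..b + l} \<longrightarrow> ?\<epsilon> t = e t) \<Longrightarrow>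
     bounded_solution (\<lambda>_. 1) (\<lambda>t. of_real (\<kappa>\<^sup>2) - \<omega>\<^sup>2 * e t) (max 1 C) {b..b + l} v h \<Longrightarrow>
     \<gamma> / (4 * a) * l \<le> integral {b + l/4..b + 3 * l/4} (\<lambda>t. (norm (v t))\<^sup>2) \<Longrightarrow>
     has_quasimode c ?\<epsilon> \<omega> (K / l) {b..b + l}"
      by (rule TE_quasimode_of_solution[OF N coords, of "max 1 C" "\<gamma> / (4 * a)"]) (use gC a in simp, use gC a in simp, rule that)
    show ?thesis
    proof (rule weyl_of_solution_family[OF omega a _ fam, of 1 1])
      show "real n * a \<le> \<bar>x\<bar>" if "n \<ge> 1" "x \<in> {b n..b n + 4 * (real n * a)}" for n x
        using I[OF that(1)] that(2) by blast
      fix n v h l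
      assume n: "1 \<le> n" and l: "l = 4 * (real n * a)" "1 \<le> l"
        and vh: "bounded_solution (\<lambda>_. 1) (\<lambda>t. of_real (\<kappa>\<^sup>2) - \<omega>\<^sup>2 * e t) C {b n..b n + 4 * (real n * a)} v h"
        and low: "\<gamma> / (4 * a) * l \<le> integral {b n + l/4..b n + 3 * l/4} (\<lambda>t. (norm (v t))\<^sup>2)"
      show "has_quasimode c ?\<epsilon> \<omega> (K / l) {b n..b n + l}"
      proof (rule K[OF l(2) _ aeI[OF n l(1)] _ low])
        show "continuous_on {b n..b n + l} e" using continuous_on_subset[OF ce] I[OF n] l(1) by blast
        show "bounded_solution (\<lambda>_. 1) (\<lambda>t. of_real (\<kappa>\<^sup>2) - \<omega>\<^sup>2 * e t) (max 1 C) {b n..b n + l} v h"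
          using vh unfolding l(1) by (auto simp: bounded_solution_def le_max_iff_disj)
      qed
    qed
  qed
  have TM: "\<omega> \<in> sigma_Weyl c eps_plus eps_minus"
    if stab: "stability_case a (\<lambda>x. eps_per x / (of_real (\<kappa>\<^sup>2) - \<omega>\<^sup>2 * eps_per x)) eps_per"
      and dist: "setdist ((\<lambda>x. \<omega>\<^sup>2 * eps_per x) ` S) {0, of_real (\<kappa>\<^sup>2)} > 0" for \<kappa> :: real
  proof -
    define d where "d = setdist ((\<lambda>x. \<omega>\<^sup>2 * eps_per x) ` S) {0, of_real (\<kappa>\<^sup>2)}"
    have d: "d > 0" using dist by (simp add: d_def)
    have dz: "d \<le> norm (\<omega>\<^sup>2 * eps_per x - z)" if "x \<in> S" "z \<in> {0, of_real (\<kappa>\<^sup>2)}" for x z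
      unfolding d_def dist_norm[symmetric] by (rule setdist_le_dist) (use that in auto)
    \<comment> \<open>The distance condition holds for \<open>p\<close> almost everywhere on \<open>S\<close>, by continuity on \<open>S\<close>, by periodicity on the line.\<close>
    have pz: "d \<le> norm (\<omega>\<^sup>2 * p x - z)" if z: "z \<in> {0, of_real (\<kappa>\<^sup>2)}" for x z
    proof -
      have onS: "d \<le> norm (\<omega>\<^sup>2 * p t - z)" if t: "t \<in> S" for t
      proof -
        have "norm (\<omega>\<^sup>2 * p t - z) \<in> {d..}"
        proof (rule AE_closed_imp_everywhere[OF S(1) _ _ _ t])
          show "continuous_on S (\<lambda>x. norm (\<omega>\<^sup>2 * p x - z))"
            by (intro continuous_intros continuous_on_subset[OF p(1)]) simp
          show "AE x in lebesgue. x \<in> S \<longrightarrow> norm (\<omega>\<^sup>2 * p x - z) \<in> {d..}"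
            using p(3)
          proof eventually_elim
            case (elim x)
            show ?case unfolding elim[symmetric] using dz[OF _ z] by blast
          qed
        qed simp
        then show ?thesis by simp
      qed
      have per: "p (x + of_int k * a) = p x" for k x
      proof (induction k rule: int_induct[of _ 0])
        case (step1 i)
        then show ?case using p(2)[of "x + of_int i * a"] by (simp add: algebra_simps)
      next
        case (step2 i)
        then show ?case using p(2)[of "x + of_int (i - 1) * a"] by (simp add: algebra_simps)
      qed simp
      obtain k :: int where "x + of_int k * a \<in> S"
      proof (cases "S = {0<..}")
        case True
        obtain k where "- x / a < of_int k" using ex_less_of_int by blast
        then show ?thesis using a True that[of k] by (simp add: field_simps)
      next
        case False
        obtain k where "of_int k < - x / a" using ex_of_int_less by blast
        then show ?thesis using a \<tau> False that[of k] by (auto simp: field_simps)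
      qed
      from onS[OF this] show ?thesis by (simp add: per)
    qed
    have w: "\<omega> \<noteq> 0" using pz[of 0 0] d by auto
    define \<mu> where "\<mu> = d / (norm \<omega>)\<^sup>2"
    have \<mu>: "\<mu> > 0" using d w by (simp add: \<mu>_def)
    have pm: "\<mu> \<le> norm (p x)" for x
      using pz[of 0 x] w by (simp add: \<mu>_def norm_mult norm_power field_simps)
    have p0: "p x \<noteq> 0" "of_real (\<kappa>\<^sup>2) - \<omega>\<^sup>2 * p x \<noteq> 0" for x
      using pz[of 0 x] pz[of "of_real (\<kappa>\<^sup>2)" x] d by auto
    obtain R where R: "\<And>x. x \<in> S \<Longrightarrow> \<bar>x\<bar> \<ge> R \<Longrightarrow> norm (e x - p x) < \<mu> / 2" using p(5)[of "\<mu> / 2"] \<mu> by auto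
    \<comment> \<open>Only here is \<open>e\<close> known to be bounded away from zero.\<close>
    define T where "T = {x \<in> S. \<bar>x\<bar> \<ge> R}"
    have TS: "T \<subseteq> S" by (auto simp: T_def)
    have Tb: "T \<in> sets borel"
    proof -
      have "T = S \<inter> {x. R \<le> \<bar>x\<bar>}" by (auto simp: T_def)
      moreover have "closed {x::real. R \<le> \<bar>x\<bar>}" by (intro closed_Collect_le continuous_intros)
      ultimately show ?thesis using S(4) by auto
    qed
    have em: "\<mu> / 2 \<le> norm (e x)" if "x \<in> T" for x
      using R[of x] that pm[of x] norm_triangle_ineq2[of "p x" "e x"] by (simp add: T_def norm_minus_commute)
    have e0: "e x \<noteq> 0" if "x \<in> T" for x using em[OF that] \<mu> by auto
    have cT: "continuous_on T e" "continuous_on T p" using continuous_on_subset[OF ce TS] continuous_on_subset[OF p(1)] by auto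
    have epT: "(\<lambda>x. e x - p x) absolutely_integrable_on T"
      using p(4) by (rule set_integrable_subset) (use Tb TS in \<open>auto simp: sets_completionI_sets\<close>)
    \<comment> \<open>The bounded factor in \<open>\<kappa>\<^sup>2/e - \<kappa>\<^sup>2/p = g(e - p)\<close>.\<close>
    define g where "g x = - of_real (\<kappa>\<^sup>2) / (e x * p x)" for x
    have L1: "(\<lambda>t. (of_real (\<kappa>\<^sup>2) / e t - \<omega>\<^sup>2) - (of_real (\<kappa>\<^sup>2) / p t - \<omega>\<^sup>2)) absolutely_integrable_on T"
    proof -
      have "(\<lambda>t. g t * (e t - p t)) absolutely_integrable_on T"
      proof (rule absolutely_integrable_bounded_times[OF Tb epT])
        show "continuous_on T g" unfolding g_def by (intro continuous_intros cT) (use e0 p0 in auto)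
        fix t assume t: "t \<in> T"
        have le: "\<mu> / 2 * \<mu> \<le> norm (e t) * norm (p t)" using em[OF t] pm[of t] \<mu> by (intro mult_mono) auto
        have "norm (g t) = \<kappa>\<^sup>2 / (norm (e t) * norm (p t))" by (simp add: g_def norm_divide norm_mult norm_power)
        also have "\<dots> \<le> \<kappa>\<^sup>2 / (\<mu> / 2 * \<mu>)"
        proof (rule divide_left_mono[OF le])
          show "0 < norm (e t) * norm (p t) * (\<mu> / 2 * \<mu>)" using e0[OF t] p0(1)[of t] \<mu> by simp
        qed simp
        finally show "norm (g t) \<le> \<kappa>\<^sup>2 / (\<mu> / 2 * \<mu>)" .
      qed
      moreover have "g t * (e t - p t) = (of_real (\<kappa>\<^sup>2) / e t - \<omega>\<^sup>2) - (of_real (\<kappa>\<^sup>2) / p t - \<omega>\<^sup>2)" if "t \<in> T" for t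
        using e0[OF that] p0(1)[of t] by (simp add: g_def field_simps)
      ultimately show ?thesis using set_integrable_cong[of lebesgue lebesgue T T] by (metis (no_types, lifting))
    qed
    obtain n1 where n1: "R < real n1 * a" using ex_less_of_nat_mult[OF a] by blast
    define n0 where "n0 = max 1 n1"
    have n0: "n \<ge> 1" "R \<le> real n * a" if "n \<ge> n0" for n
    proof -
      have "real n1 * a \<le> real n * a" using that a by (intro mult_right_mono) (auto simp: n0_def)
      then show "R \<le> real n * a" using n1 by simp
    qed (use that in \<open>simp add: n0_def\<close>)
    have IT: "{b n..b n + 4 * (real n * a)} \<subseteq> T" if "n \<ge> n0" for n
    proof
      fix x assume x: "x \<in> {b n..b n + 4 * (real n * a)}"
      have "x \<in> S" "real n * a \<le> \<bar>x\<bar>" using I[OF n0(1)[OF that]] x by blast+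
      then show "x \<in> T" using n0(2)[OF that] by (simp add: T_def)
    qed
    obtain \<gamma> C where gC: "\<gamma> > 0" "C > 0" and fam: "\<forall>\<^sub>F n in sequentially. \<exists>v h.
       bounded_solution (\<lambda>t. of_real (\<kappa>\<^sup>2) / e t - \<omega>\<^sup>2) e C {b n..b n + 4 * (real n * a)} v h \<and>
       \<gamma> * real n \<le> integral {b n + real n * a..b n + 3 * (real n * a)} (\<lambda>t. (norm (v t))\<^sup>2)"
      unfolding b_def
    proof (rule perturbed_floquet_family[OF a stab, of "\<lambda>t. of_real (\<kappa>\<^sup>2) / p t - \<omega>\<^sup>2" p T "\<lambda>t. of_real (\<kappa>\<^sup>2) / e t - \<omega>\<^sup>2" e n0 m])
      show "AE x in lebesgue. 1 / (eps_per x / (of_real (\<kappa>\<^sup>2) - \<omega>\<^sup>2 * eps_per x)) = of_real (\<kappa>\<^sup>2) / p x - \<omega>\<^sup>2"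
        using p(3) by eventually_elim (use p0 in \<open>simp add: diff_divide_distrib\<close>)
      show "of_real (\<kappa>\<^sup>2) / p t - \<omega>\<^sup>2 \<noteq> 0" for t using p0[of t] by (simp add: field_simps)
      show "continuous_on UNIV (\<lambda>t. of_real (\<kappa>\<^sup>2) / p t - \<omega>\<^sup>2)" by (intro continuous_intros p(1)) (use p0 in auto)
      show "continuous_on T (\<lambda>t. of_real (\<kappa>\<^sup>2) / e t - \<omega>\<^sup>2)" by (intro continuous_intros cT) (use e0 in auto)
      show "{of_int (m n) * a..of_int (m n) * a + 4 * (real n * a)} \<subseteq> T" if "n \<ge> n0" for n
        using IT[OF that] by (simp add: b_def)
      show "real n * a \<le> \<bar>x\<bar>" if "n \<ge> n0" "x \<in> {of_int (m n) * a..of_int (m n) * a + 4 * (real n * a)}" for n x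
        using I[OF n0(1)[OF that(1)]] that(2) by (simp add: b_def)
    qed ((rule that; assumption) | rule p(1,2,3) L1 cT epT | simp add: p(2))+
    define C0 where "C0 = Max {1, C, D, 2 / \<mu>}"
    have C0: "1 \<le> C0" "C \<le> C0" "D \<le> C0" "2 / \<mu> \<le> C0" by (simp_all add: C0_def)
    obtain K L where K: "\<And>b l v h. l \<ge> 1 \<Longrightarrow> l \<ge> L \<Longrightarrow>
     (\<forall>t\<in>{b..b + l}. (e has_vector_derivative e1 t) (at t) \<and> (e1 has_vector_derivative e2 t) (at t) \<and> e t \<noteq> 0 \<and>
        norm (e t) \<le> C0 \<and> norm (e1 t) \<le> C0 \<and> norm (e2 t) \<le> C0 \<and> norm (1 / e t) \<le> C0) \<Longrightarrow>
     continuous_on {b..b + l} e2 \<Longrightarrow> (AE t in lborel. t \<in> {b..b + l} \<longrightarrow> ?\<epsilon> t = e t) \<Longrightarrow>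
     bounded_solution (\<lambda>t. of_real (\<kappa>\<^sup>2) / e t - \<omega>\<^sup>2) e C0 {b..b + l} v h \<Longrightarrow>
     \<gamma> / (4 * a) * l \<le> integral {b + l/4..b + 3 * l/4} (\<lambda>t. (norm (v t))\<^sup>2) \<Longrightarrow>
     has_quasimode c ?\<epsilon> \<omega> (K / l) {b..b + l}"
      by (rule TM_quasimode_of_solution[OF N coords C0(1), of "\<gamma> / (4 * a)"]) (use gC a in simp, rule that)
    show ?thesis
    proof (rule weyl_of_solution_family[OF omega a _ fam, of n0 L])
      show "real n * a \<le> \<bar>x\<bar>" if "n \<ge> n0" "x \<in> {b n..b n + 4 * (real n * a)}" for n x
        using I[OF n0(1)[OF that(1)]] that(2) by blast
      fix n v h l
      assume n: "n0 \<le> n" and l: "l = 4 * (real n * a)" "1 \<le> l" "L \<le> l"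
        and vh: "bounded_solution (\<lambda>t. of_real (\<kappa>\<^sup>2) / e t - \<omega>\<^sup>2) e C {b n..b n + 4 * (real n * a)} v h"
        and low: "\<gamma> / (4 * a) * l \<le> integral {b n + l/4..b n + 3 * l/4} (\<lambda>t. (norm (v t))\<^sup>2)"
      have T: "{b n..b n + l} \<subseteq> T" using IT[OF n] l(1) by simp
      show "has_quasimode c ?\<epsilon> \<omega> (K / l) {b n..b n + l}"
      proof (rule K[OF l(2,3) _ _ aeI[OF n0(1)[OF n] l(1)] _ low])
        show "continuous_on {b n..b n + l} e2" by (rule continuous_on_subset[OF ce2]) (use T TS in blast)
        show "bounded_solution (\<lambda>t. of_real (\<kappa>\<^sup>2) / e t - \<omega>\<^sup>2) e C0 {b n..b n + l} v h"
          using vh C0(2) unfolding l(1) by (auto simp: bounded_solution_def intro: order_trans)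
        show "\<forall>t\<in>{b n..b n + l}. (e has_vector_derivative e1 t) (at t) \<and> (e1 has_vector_derivative e2 t) (at t) \<and> e t \<noteq> 0 \<and>
          norm (e t) \<le> C0 \<and> norm (e1 t) \<le> C0 \<and> norm (e2 t) \<le> C0 \<and> norm (1 / e t) \<le> C0"
        proof
          fix t assume "t \<in> {b n..b n + l}"
          then have t: "t \<in> T" "t \<in> S" using T TS by auto
          have "norm (1 / e t) \<le> 2 / \<mu>"
            using em[OF t(1)] e0[OF t(1)] \<mu> by (simp add: norm_divide field_simps)
          then show "(e has_vector_derivative e1 t) (at t) \<and> (e1 has_vector_derivative e2 t) (at t) \<and> e t \<noteq> 0 \<and>
            norm (e t) \<le> C0 \<and> norm (e1 t) \<le> C0 \<and> norm (e2 t) \<le> C0 \<and> norm (1 / e t) \<le> C0"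
            using de(1,2)[OF t(2)] e0[OF t(1)] order_trans[OF be(1)[OF t(2)] C0(3)] order_trans[OF be(2)[OF t(2)] C0(3)] order_trans[OF be(3)[OF t(2)] C0(3)] C0(4) by auto
        qed
      qed
    qed
  qed
  show ?thesis
  proof (intro conjI allI impI)
    fix k0 :: "real^'m"
    assume "stability_case a (\<lambda>x. 1) (\<lambda>x. of_real ((norm k0)\<^sup>2) - \<omega>\<^sup>2 * eps_per x)"
    then show "\<omega> \<in> sigma_Weyl c eps_plus eps_minus" by (rule TE)
  next
    fix k0 :: "real^'m"
    assume "stability_case a (\<lambda>x. eps_per x / (of_real ((norm k0)\<^sup>2) - \<omega>\<^sup>2 * eps_per x)) eps_per
        \<and> (\<exists>g. weak_deriv S eps_as g \<and> g absolutely_integrable_on S)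
        \<and> setdist ((\<lambda>x. \<omega>\<^sup>2 * eps_per x) ` S) {0, of_real ((norm k0)\<^sup>2)} > 0"
    then show "\<omega> \<in> sigma_Weyl c eps_plus eps_minus" using TM[of "norm k0"] by blast
  qed
qed

end
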